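(* Let $G$ be a compact group with dual object $\Sigma$ and let $R\subset\Sigma$ be a finite set. Then for every $\varepsilon>0$ there exists a central function $f\in L^{\infty}(G)$ such that: (1) $\widehat{f}(\sigma)=I_{d_\sigma}$ (the $d_\sigma\times d_\sigma$ identity matrix) for every $\sigma\in R$; (2) $\|f\|_{1}\leq 1+\varepsilon$; (3) $v(\mathrm{supp}\,\widehat{f})\leq \left(\frac{c}{\varepsilon}\right)^{2v(R)}$, where $c>0$ is an absolute constant.
   Context: $G$ is a compact (not necessarily commutative) group with normalized Haar measure $m$; $L^p(G)=L^p(G,m)$ with norm $\|\cdot\|_p$. $\Sigma$ is the dual object of $G$: the set of equivalence classes of continuous irreducible unitary representations of $G$, with a fixed representative $x\mapsto U_x^{(\sigma)}$ on a Hilbert space $H_\sigma$ of finite dimension $d_\sigma$ for each $\sigma\in\Sigma$. For $f\in L^1(G)$ the Fourier transform at $\sigma$ is $\widehat{f}(\sigma)=\int_G U^{(\sigma)}_{x^{-1}}f(x)\,dm(x)$, an operator on $H_\sigma$ (a $d_\sigma\times d_\sigma$ matrix in a fixed orthonormal basis). $\mathrm{supp}\,\widehat f=\{\sigma\in\Sigma:\widehat f(\sigma)\neq 0\}$. For $S\subset\Sigma$, $v(S):=\sum_{\sigma\in S}d_\sigma^2$. $M(G)$ is the convolution algebra of complex regular Borel measures on $G$; a measure $\mu\in M(G)$ is central if $\mu\ast\nu=\nu\ast\mu$ for all $\nu\in M(G)$, and a function $f\in L^1(G)$ is central if the measure $f\,dm$ is central. "Absolute constant" means that $c$ does not depend on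 $G$, $R$ or $\varepsilon$.
   Formalization: Bound (3) is stated with min(ε,1) in place of ε, since as written it fails for ε>c and nonempty R ((1) forces v(supp f̂)≥1). The constant c is uniform over compact groups within one arbitrary universe; full uniformity follows by placing groups in a disjoint union. *)

theory Defs
  imports
    "HOL-Probability.Probability"
    "HOL-Algebra.Coset"
    "Jordan_Normal_Form.Schur_Decomposition"
begin

unbundle no vec_syntax

section \<open>Compact groups and Haar measure\<close>

text \<open>
  Groups and topologies are explicit objects on a carrier inside a type, so that one
  can quantify over all compact groups within a formula. Topological groups are
  Hausdorff, as usual in harmonic analysis.
\<close>

locale compact_group = group G for G :: "'a monoid" (structure) +
  fixes T :: "'a topology"
  assumes topspace_eq: "topspace T = carrier G"
    and compact: "compact_space T"
    and Hausdorff: "Hausdorff_space T"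
    and continuous_mult: "continuous_map (prod_topology T T) T (\<lambda>(x, y). x \<otimes> y)"
    and continuous_inv: "continuous_map T T (\<lambda>x. inv x)"

definition borel_sets :: "'a topology \<Rightarrow> 'a set set" where
  "borel_sets T = sigma_sets (topspace T) {V. openin T V}"

text \<open>
  For finite measures on a compact Hausdorff space this is inner regularity by compact
  sets together with outer regularity by open sets.
\<close>

definition regular_on :: "'a topology \<Rightarrow> ('a set \<Rightarrow> ennreal) \<Rightarrow> bool" where
  "regular_on T \<phi> \<longleftrightarrow>
    (\<forall>E\<in>borel_sets T. \<forall>e>0. \<exists>K V. compactin T K \<and> openin T V \<and>
       K \<subseteq> E \<and> E \<subseteq> V \<and> \<phi> (V - K) < e)"

definition normalized_haar :: "'a monoid \<Rightarrow> 'a topology \<Rightarrow> 'a measure \<Rightarrow> bool" where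
  "normalized_haar G T m \<longleftrightarrow>
     space m = topspace T \<and> sets m = borel_sets T \<and>
     prob_space m \<and> regular_on T (emeasure m) \<and>
     (\<forall>x\<in>carrier G. \<forall>E\<in>sets m. emeasure m (x <#\<^bsub>G\<^esub> E) = emeasure m E)"

section \<open>The dual object\<close>

definition unitary_mat :: "nat \<Rightarrow> complex mat \<Rightarrow> bool" where
  "unitary_mat n A \<longleftrightarrow> A \<in> carrier_mat n n \<and> mat_adjoint A * A = 1\<^sub>m n"

text \<open>
  Every irreducible unitary representation of a compact group is finite-dimensional; it
  is given by its matrices in an orthonormal basis, and its dimension is read off from
  the matrix at the identity.
\<close>

definition rep_dim :: "'a monoid \<Rightarrow> ('a \<Rightarrow> complex mat) \<Rightarrow> nat" where
  "rep_dim G U = dim_row (U \<one>\<^bsub>G\<^esub>)"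

definition unitary_rep :: "'a monoid \<Rightarrow> 'a topology \<Rightarrow> ('a \<Rightarrow> complex mat) \<Rightarrow> bool" where
  "unitary_rep G T U \<longleftrightarrow>
     (\<forall>x\<in>carrier G. unitary_mat (rep_dim G U) (U x)) \<and>
     (\<forall>x\<in>carrier G. \<forall>y\<in>carrier G. U (x \<otimes>\<^bsub>G\<^esub> y) = U x * U y) \<and>
     (\<forall>i<rep_dim G U. \<forall>j<rep_dim G U. continuous_map T euclidean (\<lambda>x. U x $$ (i, j)))"

definition irreducible_rep :: "'a monoid \<Rightarrow> ('a \<Rightarrow> complex mat) \<Rightarrow> bool" where
  "irreducible_rep G U \<longleftrightarrow>
     rep_dim G U > 0 \<and>
     (\<forall>W. VectorSpace.subspace class_ring W (module_vec TYPE(complex) (rep_dim G U)) \<and>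
          (\<forall>x\<in>carrier G. \<forall>w\<in>W. U x *\<^sub>v w \<in> W) \<longrightarrow>
          W = {0\<^sub>v (rep_dim G U)} \<or> W = carrier_vec (rep_dim G U))"

definition irreps :: "'a monoid \<Rightarrow> 'a topology \<Rightarrow> ('a \<Rightarrow> complex mat) set" where
  "irreps G T = {U. unitary_rep G T U \<and> irreducible_rep G U}"

definition rep_equiv :: "'a monoid \<Rightarrow> ('a \<Rightarrow> complex mat) \<Rightarrow> ('a \<Rightarrow> complex mat) \<Rightarrow> bool" where
  "rep_equiv G U V \<longleftrightarrow>
     rep_dim G U = rep_dim G V \<and>
     (\<exists>P. unitary_mat (rep_dim G U) P \<and> (\<forall>x\<in>carrier G. P * U x = V x * P))"

definition dual_object :: "'a monoid \<Rightarrow> 'a topology \<Rightarrow> ('a \<Rightarrow> complex mat) set set" where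
  "dual_object G T =
     irreps G T // {(U, V). U \<in> irreps G T \<and> V \<in> irreps G T \<and> rep_equiv G U V}"

section \<open>Fourier transform\<close>

text \<open>
  Below, \<open>rep\<close> is the choice of a representative of each class in the dual object.
\<close>

definition fourier ::
  "'a monoid \<Rightarrow> 'a measure \<Rightarrow> ('a \<Rightarrow> complex mat) \<Rightarrow> ('a \<Rightarrow> complex) \<Rightarrow> complex mat" where
  "fourier G m U f =
     mat (rep_dim G U) (rep_dim G U) (\<lambda>(i, j). LINT x|m. U (inv\<^bsub>G\<^esub> x) $$ (i, j) * f x)"

definition fourier_supp ::
  "'a monoid \<Rightarrow> 'a topology \<Rightarrow> 'a measure \<Rightarrow>
   (('a \<Rightarrow> complex mat) set \<Rightarrow> 'a \<Rightarrow> complex mat) \<Rightarrow> ('a \<Rightarrow> complex) \<Rightarrow>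
   ('a \<Rightarrow> complex mat) set set" where
  "fourier_supp G T m rep f =
     {\<sigma>\<in>dual_object G T.
        fourier G m (rep \<sigma>) f \<noteq> 0\<^sub>m (rep_dim G (rep \<sigma>)) (rep_dim G (rep \<sigma>))}"

text \<open>Meaningful for finite \<open>S\<close> only: a sum over an infinite set is 0 in HOL.\<close>

definition dim_sq_sum ::
  "'a monoid \<Rightarrow> (('a \<Rightarrow> complex mat) set \<Rightarrow> 'a \<Rightarrow> complex mat) \<Rightarrow>
   ('a \<Rightarrow> complex mat) set set \<Rightarrow> nat" where
  "dim_sq_sum G rep S = (\<Sum>\<sigma>\<in>S. (rep_dim G (rep \<sigma>))\<^sup>2)"

section \<open>The measure algebra and central functions\<close>

text \<open>
  A complex measure is a set function; only its values on Borel sets matter.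
\<close>

definition complex_measure :: "'a topology \<Rightarrow> ('a set \<Rightarrow> complex) \<Rightarrow> bool" where
  "complex_measure T \<mu> \<longleftrightarrow>
     (\<forall>A :: nat \<Rightarrow> 'a set. range A \<subseteq> borel_sets T \<and> disjoint_family A \<longrightarrow>
        (\<lambda>n. \<mu> (A n)) sums \<mu> (\<Union>n. A n))"

definition total_variation :: "'a topology \<Rightarrow> ('a set \<Rightarrow> complex) \<Rightarrow> 'a set \<Rightarrow> ennreal" where
  "total_variation T \<mu> E =
     (SUP P\<in>{P. finite P \<and> P \<subseteq> borel_sets T \<and> disjoint P \<and> \<Union>P = E}.
        \<Sum>A\<in>P. ennreal (norm (\<mu> A)))"

definition regular_measures :: "'a topology \<Rightarrow> ('a set \<Rightarrow> complex) set" where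
  "regular_measures T = {\<mu>. complex_measure T \<mu> \<and> regular_on T (total_variation T \<mu>)}"

text \<open>
  The positive part of a real signed measure in the Jordan decomposition. Negative
  values need no special treatment, as \<open>ennreal\<close> truncates them to 0.
\<close>

definition pos_part :: "'a topology \<Rightarrow> ('a set \<Rightarrow> real) \<Rightarrow> 'a measure" where
  "pos_part T \<nu> =
     measure_of (topspace T) (borel_sets T)
       (\<lambda>E. SUP A\<in>{A\<in>borel_sets T. A \<subseteq> E}. ennreal (\<nu> A))"

definition complex_integral ::
  "'a topology \<Rightarrow> ('a set \<Rightarrow> complex) \<Rightarrow> ('a \<Rightarrow> complex) \<Rightarrow> complex" where
  "complex_integral T \<mu> g =
     (LINT x|pos_part T (\<lambda>E. Re (\<mu> E)). g x) - (LINT x|pos_part T (\<lambda>E. - Re (\<mu> E)). g x) +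
     \<i> * ((LINT x|pos_part T (\<lambda>E. Im (\<mu> E)). g x) - (LINT x|pos_part T (\<lambda>E. - Im (\<mu> E)). g x))"

text \<open>\<open>(\<mu> * \<nu>)(E) = \<integral> \<nu>(x\<^sup>-\<^sup>1 E) d\<mu>(x)\<close>\<close>

definition convolution ::
  "'a monoid \<Rightarrow> 'a topology \<Rightarrow> ('a set \<Rightarrow> complex) \<Rightarrow> ('a set \<Rightarrow> complex) \<Rightarrow> 'a set \<Rightarrow> complex" where
  "convolution G T \<mu> \<nu> E =
     complex_integral T \<mu> (\<lambda>x. \<nu> {y\<in>carrier G. x \<otimes>\<^bsub>G\<^esub> y \<in> E})"

definition central_measure :: "'a monoid \<Rightarrow> 'a topology \<Rightarrow> ('a set \<Rightarrow> complex) \<Rightarrow> bool" where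
  "central_measure G T \<mu> \<longleftrightarrow>
     \<mu> \<in> regular_measures T \<and>
     (\<forall>\<nu>\<in>regular_measures T. \<forall>E\<in>borel_sets T. convolution G T \<mu> \<nu> E = convolution G T \<nu> \<mu> E)"

definition central_function ::
  "'a monoid \<Rightarrow> 'a topology \<Rightarrow> 'a measure \<Rightarrow> ('a \<Rightarrow> complex) \<Rightarrow> bool" where
  "central_function G T m f \<longleftrightarrow>
     integrable m f \<and> central_measure G T (\<lambda>E. LINT x:E|m. f x)"

definition L_infinity :: "'a measure \<Rightarrow> ('a \<Rightarrow> complex) set" where
  "L_infinity m = {f\<in>borel_measurable m. \<exists>B. AE x in m. norm (f x) \<le> B}"

end

theory Submission
  imports Defs "Jordan_Normal_Form.Spectral_Radius" "HOL-Library.Function_Algebras"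
begin

text \<open>
  On coordinate vectors indexed by the matrix entries over \<open>R\<close>, let \<open>N\<close> be the norm whose unit
  ball is spanned by the translations \<open>U x\<close>; it is submultiplicative, and \<open>\<nu> x = N (U x - U 1)\<close> is an
  invariant pseudometric. A packing argument in real dimension \<open>2 v(R)\<close> shows that \<open>{\<nu> \<le> \<delta>}\<close> has
  measure at least \<open>(c \<delta>)\<close> to the power \<open>2 v(R)\<close>. A normalized central bump function \<open>h\<close> on \<open>{\<nu> \<le> 2 \<delta>}\<close>
  then has scalar Fourier coefficients \<open>a \<sigma>\<close> with \<open>\<Sum> d\<^sup>2 a\<^sup>2\<close> bounded by the reciprocal of that measure,
  and since \<open>h\<close> is even the second differences of \<open>U\<close> give \<open>N (1 - a) \<le> 2 \<delta>\<^sup>2\<close>: with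
  \<open>\<delta>\<^sup>2 = \<epsilon> / 32\<close> this turns \<open>\<delta>\<close> into \<open>\<surd>\<epsilon>\<close> and yields the exponent \<open>2 v(R)\<close>.
  Convolving \<open>h\<close> four times with itself and discarding the \<open>\<sigma>\<close> with small \<open>a \<sigma>\<close> leaves a finite support
  at a small cost in \<open>L\<^sup>1\<close>. Finally the coefficients \<open>a\<^sup>4\<close> on \<open>R\<close> are corrected to \<open>1\<close> by convolving with a
  finitely supported measure of mass about \<open>1 / (1 - \<epsilon> / 4)\<close>, averaged over conjugates.
\<close>

section \<open>Regular Borel measures\<close>

text \<open>Two obstacles shape the preparation. Multiplication on G need not be measurable for the
  product \<sigma>-algebra, while centrality refers to every regular complex measure; so the order
  of integration is exchanged for open sets and the result is extended to Borel sets. Where only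
  coefficients occur, kernels are instead expanded into finite sums of products. The bump function
  depends on finitely many coefficients, so Stone-Weierstrass on a compact set of coordinate values
  takes the place of the full Peter-Weyl theorem.

  Write v for v(R) and Q for 2304 / \<epsilon>. The exponent 2 v is v + v: the reciprocal of the
  measure is at most Q^v, and the spectrum is cut at a^2 \<ge> Q^-v, so the sum of d^2 over what is
  kept is at most Q^v Q^v. The constant is 2 * 36 * 32, with 32 from the choice of \<delta>, 36 from
  the square of q \<le> 6 / \<delta>, and 2 from the packing bound.\<close>

definition fin_reg :: "'a topology \<Rightarrow> 'a measure \<Rightarrow> bool" where
  "fin_reg T p \<longleftrightarrow> space p = topspace T \<and> sets p = borel_sets T \<and> finite_measure p \<and>
     regular_on T (emeasure p)"

lemma openin_borel_sets: "openin T V \<Longrightarrow> V \<in> borel_sets T"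
  unfolding borel_sets_def by auto

lemma sigma_algebra_borel_sets: "sigma_algebra (topspace T) (borel_sets T)"
  unfolding borel_sets_def by (rule sigma_algebra_sigma_sets) (auto dest: openin_subset)

lemma topspace_borel_sets [simp]: "topspace T \<in> borel_sets T"
  by (rule openin_borel_sets) simp

lemma borel_sets_subset: "E \<in> borel_sets T \<Longrightarrow> E \<subseteq> topspace T"
  using sigma_algebra_borel_sets[of T] by (meson sigma_algebra.sigma_sets_subset' sigma_algebra_iff2 subsetD PowD)

lemma compactin_borel_sets:
  assumes "Hausdorff_space T" "compactin T K" shows "K \<in> borel_sets T"
proof -
  interpret sigma_algebra "topspace T" "borel_sets T" by (rule sigma_algebra_borel_sets)
  have "closedin T K" using assms compactin_imp_closedin by blast
  then have "K = topspace T - (topspace T - K)" "openin T (topspace T - K)"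
    by (auto dest: closedin_subset)
  then show ?thesis using openin_borel_sets compl_sets by metis
qed

lemma fin_regD:
  assumes "fin_reg T p"
  shows "space p = topspace T" "sets p = borel_sets T" "finite_measure p" "regular_on T (emeasure p)"
  using assms unfolding fin_reg_def by auto

lemma regular_onD:
  assumes "regular_on T \<phi>" "E \<in> borel_sets T" "0 < e"
  shows "\<exists>K V. compactin T K \<and> openin T V \<and> K \<subseteq> E \<and> E \<subseteq> V \<and> \<phi> (V - K) < e"
  using assms unfolding regular_on_def by simp

lemma regular_compact_inner:
  assumes "fin_reg T p" "Hausdorff_space T" "E \<in> borel_sets T" "e > 0"
  obtains K where "compactin T K" "K \<subseteq> E" "measure p (E - K) < e" "measure p E < measure p K + e"
proof -
  interpret finite_measure p using fin_regD[OF assms(1)] by simp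
  have "ennreal e > 0" using assms by simp
  then obtain K V where K: "compactin T K" "openin T V" "K \<subseteq> E" "E \<subseteq> V" "emeasure p (V - K) < ennreal e"
    using regular_onD[OF fin_regD(4)[OF assms(1)] assms(3)] by metis
  have s: "K \<in> sets p" "V \<in> sets p" "E \<in> sets p"
    using K assms compactin_borel_sets openin_borel_sets fin_regD(2)[OF assms(1)] by auto
  have "emeasure p (E - K) \<le> emeasure p (V - K)" using K s by (intro emeasure_mono) auto
  then have 1: "measure p (E - K) < e" using K(5) assms(4) unfolding emeasure_eq_measure
    by (metis (mono_tags) assms(4) ennreal_less_iff le_less_trans measure_nonneg)
  have "measure p (E - K) = measure p E - measure p K" using s K by (intro finite_measure_Diff) auto
  then show ?thesis using 1 K that by force
qed

section \<open>Order of integration for open sets\<close>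

lemma openin_Pair_vimage:
  assumes "openin (prod_topology X Y) W" shows "openin Y (Pair x -` W)"
proof (cases "x \<in> topspace X")
  case True
  then have "continuous_map Y (prod_topology X Y) (Pair x)"
    by (simp add: continuous_map_paired)
  then have "openin Y {y \<in> topspace Y. (x, y) \<in> W}" using assms openin_continuous_map_preimage by fastforce
  moreover have "Pair x -` W = {y \<in> topspace Y. (x, y) \<in> W}" using openin_subset[OF assms] by auto
  ultimately show ?thesis by simp
next
  case False
  then have "Pair x -` W = {}" using openin_subset[OF assms] by auto
  then show ?thesis by simp
qed

text \<open>Inner regularity puts a compact set of measure above \<open>t\<close> inside the
  section, and the tube lemma thickens its product with \<open>{x}\<close> to an open rectangle that
  stays in \<open>W\<close>.\<close>

lemma open_rectangle_below_section:
  assumes q: "fin_reg Y q" "Hausdorff_space Y" and W: "openin (prod_topology X Y) W"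
    and x: "x \<in> topspace X" and t: "t < measure q (Pair x -` W)"
  obtains A B where "openin X A" "openin Y B" "x \<in> A" "A \<times> B \<subseteq> W" "t < measure q B"
proof -
  interpret finite_measure q using fin_regD[OF q(1)] by simp
  have "Pair x -` W \<in> borel_sets Y" using openin_Pair_vimage[OF W] openin_borel_sets by blast
  then obtain K where K: "compactin Y K" "K \<subseteq> Pair x -` W"
      "measure q (Pair x -` W) < measure q K + (measure q (Pair x -` W) - t)"
    using regular_compact_inner[OF q, of "Pair x -` W" "measure q (Pair x -` W) - t"] t by (metis diff_gt_0_iff_gt)
  have "{x} \<times> K \<subseteq> W" using K by auto
  then obtain A B where AB: "openin X A" "openin Y B" "x \<in> A" "K \<subseteq> B" "A \<times> B \<subseteq> W"
    using tube_lemma_right[OF W K(1) x] by blast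
  have "measure q K \<le> measure q B" using AB openin_borel_sets fin_regD(2)[OF q(1)]
    by (intro finite_measure_mono) auto
  then show ?thesis using AB K that by force
qed

text \<open>The measure of the section is lower semicontinuous in the base point: the rectangle
  found at one point serves all nearby points, so superlevel sets are open. This takes the place of
  measurability of \<open>W\<close> for the product \<sigma>-algebra.\<close>

lemma section_measurable:
  assumes q: "fin_reg Y q" "Hausdorff_space Y" and W: "openin (prod_topology X Y) W"
    and p: "space p = topspace X" "sets p = borel_sets X"
  shows "(\<lambda>x. measure q (Pair x -` W)) \<in> borel_measurable p"
proof -
  interpret finite_measure q using fin_regD[OF q(1)] by simp
  { fix t
    have "openin X {x \<in> topspace X. t < measure q (Pair x -` W)}"
    proof (subst openin_subopen, safe)
      fix x assume x: "x \<in> topspace X" "t < measure q (Pair x -` W)"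
      obtain A B where AB: "openin X A" "openin Y B" "x \<in> A" "A \<times> B \<subseteq> W" "t < measure q B"
        using open_rectangle_below_section[OF q W x] by blast
      have "t < measure q (Pair x' -` W)" if "x' \<in> A" for x'
      proof -
        have "measure q B \<le> measure q (Pair x' -` W)"
          using AB that openin_Pair_vimage[OF W] openin_borel_sets[of Y] fin_regD(2)[OF q(1)]
          by (intro finite_measure_mono) auto
        then show ?thesis using AB by simp
      qed
      then show "\<exists>T'. openin X T' \<and> x \<in> T' \<and> T' \<subseteq> {x \<in> topspace X. t < measure q (Pair x -` W)}"
        using AB openin_subset[OF AB(1)] by blast
    qed
    then have "{x \<in> space p. t < measure q (Pair x -` W)} \<in> sets p"
      using p openin_borel_sets by auto }
  then show ?thesis by (simp add: borel_measurable_iff_greater)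
qed

text \<open>\<open>W\<close> may lie outside the product \<sigma>-algebra, so it is exhausted from
  inside by a finite union \<open>R\<close> of open rectangles, to which the usual Fubini theorem
  applies. Only the integral over x has to be nearly attained by \<open>R\<close>; over y
  monotonicity suffices. The result is an inequality, whose converse is the same statement with the
  factors exchanged.\<close>

lemma fubini_open_le:
  assumes p: "fin_reg X p" "Hausdorff_space X" and q: "fin_reg Y q" "Hausdorff_space Y"
    and W: "openin (prod_topology X Y) W"
  shows "(LINT x|p. measure q (Pair x -` W)) \<le> (LINT y|q. measure p ((\<lambda>x. (x, y)) -` W))"
proof -
  interpret p: finite_measure p using fin_regD[OF p(1)] by simp
  interpret q: finite_measure q using fin_regD[OF q(1)] by simp
  interpret pq: pair_sigma_finite p q ..
  note sp = fin_regD(1,2)[OF p(1)] and sq = fin_regD(1,2)[OF q(1)]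
  define \<phi> where "\<phi> x = measure q (Pair x -` W)" for x
  have \<phi>m: "\<phi> \<in> borel_measurable p" unfolding \<phi>_def by (rule section_measurable[OF q W sp])
  define c where "c = measure q (space q)"
  have \<phi>c: "0 \<le> \<phi> x" "\<phi> x \<le> c" for x unfolding \<phi>_def c_def by (auto intro: q.bounded_measure)
  define W' where "W' = prod.swap -` W"
  have W'eq: "W' = {z \<in> topspace (prod_topology Y X). prod.swap z \<in> W}"
    using openin_subset[OF W] by (auto simp: W'_def)
  have W': "openin (prod_topology Y X) W'"
    unfolding W'eq by (rule openin_continuous_map_preimage[OF _ W]) (auto simp: prod.swap_def intro!: continuous_map_pairedI continuous_map_fst continuous_map_snd)
  have sec': "(\<lambda>x. (x, y)) -` W = Pair y -` W'" for y by (auto simp: W'_def)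
  have \<psi>m: "(\<lambda>y. measure p ((\<lambda>x. (x, y)) -` W)) \<in> borel_measurable q"
    unfolding sec' by (rule section_measurable[OF p W' sq])
  have \<psi>i: "integrable q (\<lambda>y. measure p ((\<lambda>x. (x, y)) -` W))"
    by (rule q.integrable_const_bound[where B="measure p (space p)"]) (use \<psi>m in \<open>auto intro: p.bounded_measure\<close>)
  have main: "(LINT x|p. \<phi> x) \<le> (LINT y|q. measure p ((\<lambda>x. (x, y)) -` W)) + e * (2 * measure p (space p) + c)"
    if e: "e > 0" for e
  proof -
    \<comment> \<open>Number of slices of height \<open>e\<close> for the values of
      \<open>\<phi>\<close>, which lie between 0 and \<open>c\<close>; the extra 1 covers the value
      \<open>c\<close> itself and keeps \<open>L\<close> positive.\<close>
    define L where "L = nat \<lceil>c / e\<rceil> + 1"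
    define D where "D i = {x \<in> space p. of_nat i * e \<le> \<phi> x \<and> \<phi> x < (of_nat i + 1) * e}" for i :: nat
    have Ds: "D i \<in> sets p" for i unfolding D_def using \<phi>m by measurable
    have cover: "space p = (\<Union>i<L. D i)"
    proof (intro equalityI subsetI)
      fix x assume x: "x \<in> space p"
      define i where "i = nat \<lfloor>\<phi> x / e\<rfloor>"
      have fl: "0 \<le> \<lfloor>\<phi> x / e\<rfloor>" using \<phi>c e by simp
      have "of_int \<lfloor>\<phi> x / e\<rfloor> \<le> \<phi> x / e" "\<phi> x / e < of_int \<lfloor>\<phi> x / e\<rfloor> + 1" by linarith+
      then have "of_nat i \<le> \<phi> x / e" "\<phi> x / e < of_nat i + 1" using fl unfolding i_def by simp_all
      then have "x \<in> D i" using x e unfolding D_def by (auto simp: field_simps)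
      moreover have "i < L"
      proof -
        have "\<phi> x / e \<le> c / e" using \<phi>c e by (simp add: divide_right_mono)
        then have "of_nat i \<le> c / e" using \<open>of_nat i \<le> \<phi> x / e\<close> by linarith
        then have "i \<le> nat \<lceil>c / e\<rceil>" by linarith
        then show ?thesis unfolding L_def by simp
      qed
      ultimately show "x \<in> (\<Union>i<L. D i)" by blast
    qed (auto simp: D_def)
    \<comment> \<open>Each slice may lose \<open>e / L\<close>, so that all of them together lose at
      most \<open>e\<close>.\<close>
    have "\<exists>K. compactin X K \<and> K \<subseteq> D i \<and> measure p (D i - K) < e / L" for i
    proof -
      have "0 < e / L" using e unfolding L_def by simp
      then show ?thesis using regular_compact_inner[OF p, of "D i" "e / L"] Ds sp by metis
    qed
    then obtain K where K: "\<And>i. compactin X (K i)" "\<And>i. K i \<subseteq> D i" "\<And>i. measure p (D i - K i) < e / L" by metis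
    have Ks: "K i \<in> sets p" for i using K(1) compactin_borel_sets p(2) sp by auto
    define KK where "KK = (\<Union>i<L. K i)"
    have KKc: "compactin X KK" unfolding KK_def using K(1) by (intro compactin_Union) auto
    have KKs: "KK \<in> sets p" unfolding KK_def using Ks by auto
    have Krest: "measure p (space p - KK) \<le> e"
    proof -
      have "space p - KK \<subseteq> (\<Union>i<L. D i - K i)" unfolding KK_def cover by auto
      then have "measure p (space p - KK) \<le> measure p (\<Union>i<L. D i - K i)"
        using Ds Ks by (intro p.finite_measure_mono) auto
      also have "\<dots> \<le> (\<Sum>i<L. measure p (D i - K i))"
        using Ds Ks by (intro p.finite_measure_subadditive_finite) auto
      also have "\<dots> \<le> (\<Sum>i<L. e / L)" using K(3) by (intro sum_mono) (simp add: less_imp_le)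
      also have "\<dots> = e" unfolding L_def by simp
      finally show ?thesis .
    qed
    have "\<exists>A B. openin X A \<and> openin Y B \<and> x \<in> A \<and> A \<times> B \<subseteq> W \<and> \<phi> x - e < measure q B" if "x \<in> topspace X" for x
      using open_rectangle_below_section[OF q W that, of "\<phi> x - e"] e unfolding \<phi>_def
      by (metis diff_less_eq less_add_same_cancel1)
    then obtain A B where AB: "\<And>x. x \<in> topspace X \<Longrightarrow> openin X (A x) \<and> openin Y (B x) \<and> x \<in> A x \<and> A x \<times> B x \<subseteq> W \<and> \<phi> x - e < measure q (B x)"
      by metis
    have fincover: "\<exists>F. finite F \<and> F \<subseteq> K i \<and> K i \<subseteq> (\<Union>x\<in>F. A x)" for i
    proof -
      have KX: "K i \<subseteq> topspace X" using compactin_subset_topspace K(1) by blast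
      have "\<exists>\<F>. finite \<F> \<and> \<F> \<subseteq> A ` K i \<and> K i \<subseteq> \<Union>\<F>"
        using K(1)[of i] KX AB unfolding compactin_def by (smt (verit) UN_iff imageE subset_iff)
      then show ?thesis by (metis finite_subset_image)
    qed
    then obtain F where F: "\<And>i. finite (F i)" "\<And>i. F i \<subseteq> K i" "\<And>i. K i \<subseteq> (\<Union>x\<in>F i. A x)" by metis
    define R where "R = (\<Union>i<L. \<Union>x\<in>F i. A x \<times> B x)"
    have FX: "x \<in> topspace X" if "x \<in> F i" for x i using that F(2) K(1) compactin_subset_topspace by blast
    have RW: "R \<subseteq> W" unfolding R_def using AB FX by blast
    have Rs: "R \<in> sets (p \<Otimes>\<^sub>M q)"
    proof -
      have "A x \<times> B x \<in> sets (p \<Otimes>\<^sub>M q)" if "x \<in> F i" for x i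
        using AB[OF FX[OF that]] by (intro pair_measureI) (auto simp: sp sq openin_borel_sets)
      then show ?thesis unfolding R_def using F(1) by (intro sets.finite_UN) auto
    qed
    \<comment> \<open>The rectangle chosen at z loses \<open>e\<close> against
      \<open>\<phi> z\<close>, and z lies in the same slice as x, which costs \<open>e\<close> once
      more.\<close>
    have low: "\<phi> x \<le> measure q (Pair x -` R) + 2 * e" if x: "x \<in> KK" for x
    proof -
      obtain i where i: "i < L" "x \<in> K i" using x unfolding KK_def by blast
      obtain z where z: "z \<in> F i" "x \<in> A z" using F(3) i by blast
      have "B z \<subseteq> Pair x -` R" unfolding R_def using z i by auto
      then have "measure q (B z) \<le> measure q (Pair x -` R)"
        using sets_Pair1[OF Rs] by (intro q.finite_measure_mono) auto
      moreover have "\<phi> z - e < measure q (B z)" using AB FX z by blast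
      moreover have "of_nat i * e \<le> \<phi> z" "\<phi> x < (of_nat i + 1) * e"
        using z i F(2) K(2) unfolding D_def by blast+
      ultimately show ?thesis by (simp add: algebra_simps)
    qed
    have Rm: "(\<lambda>x. measure q (Pair x -` R)) \<in> borel_measurable p"
      using q.measurable_emeasure_Pair[OF Rs] unfolding measure_def by simp
    have Ri: "integrable p (\<lambda>x. measure q (Pair x -` R))"
      by (rule p.integrable_const_bound[where B=c]) (use Rm in \<open>auto simp: c_def intro: q.bounded_measure\<close>)
    have "(LINT x|p. \<phi> x) \<le> (LINT x|p. measure q (Pair x -` R) + 2 * e + c * indicator (space p - KK) x)"
    proof (rule integral_mono)
      show "integrable p \<phi>" by (rule p.integrable_const_bound[where B=c]) (use \<phi>m \<phi>c in auto)
      show "integrable p (\<lambda>x. measure q (Pair x -` R) + 2 * e + c * indicator (space p - KK) x)"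
        using Ri KKs by (auto intro!: integrable_real_indicator simp: p.emeasure_finite less_top[symmetric])
      fix x assume "x \<in> space p"
      then show "\<phi> x \<le> measure q (Pair x -` R) + 2 * e + c * indicator (space p - KK) x"
        using low[of x] \<phi>c[of x] e by (cases "x \<in> KK") (auto simp: add_nonneg_nonneg intro: order_trans)
    qed
    also have "\<dots> = (LINT x|p. measure q (Pair x -` R)) + 2 * e * measure p (space p) + c * measure p (space p - KK)"
      using Ri KKs by (simp add: p.emeasure_finite less_top[symmetric] Int_absorb2 sets.sets_into_space)
    also have "c * measure p (space p - KK) \<le> c * e" using Krest unfolding c_def by (intro mult_left_mono) auto
    also have "(LINT x|p. measure q (Pair x -` R)) = measure (p \<Otimes>\<^sub>M q) R"
    proof -
      interpret pqf: finite_measure "p \<Otimes>\<^sub>M q"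
        by (rule finite_measure_pair_measure) unfold_locales
      have "ennreal (measure (p \<Otimes>\<^sub>M q) R) = (\<integral>\<^sup>+x. emeasure q (Pair x -` R) \<partial>p)"
        using q.emeasure_pair_measure_alt[OF Rs] pqf.emeasure_eq_measure by simp
      also have "\<dots> = ennreal (LINT x|p. measure q (Pair x -` R))"
        using Ri by (simp add: q.emeasure_eq_measure nn_integral_eq_integral)
      finally show ?thesis by (simp add: integral_nonneg)
    qed
    also have "measure (p \<Otimes>\<^sub>M q) R \<le> (LINT y|q. measure p ((\<lambda>x. (x, y)) -` W))"
    proof -
      interpret pqf: finite_measure "p \<Otimes>\<^sub>M q"
        by (rule finite_measure_pair_measure) unfold_locales
      have "ennreal (measure (p \<Otimes>\<^sub>M q) R) = (\<integral>\<^sup>+y. emeasure p ((\<lambda>x. (x, y)) -` R) \<partial>q)"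
        using pq.emeasure_pair_measure_alt2[OF Rs] pqf.emeasure_eq_measure by simp
      also have "\<dots> \<le> (\<integral>\<^sup>+y. emeasure p ((\<lambda>x. (x, y)) -` W) \<partial>q)"
        using RW openin_borel_sets[OF openin_Pair_vimage[OF W']]
        by (intro nn_integral_mono emeasure_mono vimage_mono) (simp_all add: sec' sp)
      also have "\<dots> = ennreal (LINT y|q. measure p ((\<lambda>x. (x, y)) -` W))"
        using \<psi>i by (simp add: p.emeasure_eq_measure nn_integral_eq_integral)
      finally show ?thesis by (simp add: integral_nonneg)
    qed
    finally show ?thesis by (simp add: algebra_simps)
  qed
  have "(LINT x|p. \<phi> x) \<le> (LINT y|q. measure p ((\<lambda>x. (x, y)) -` W))"
  proof (rule field_le_epsilon)
    fix e :: real assume e: "e > 0"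
    \<comment> \<open>The coefficient of \<open>e\<close> in \<open>main\<close>, increased by 1 so
      that it can be divided by.\<close>
    define k where "k = 2 * measure p (space p) + c + 1"
    have k: "k > 0" "2 * measure p (space p) + c \<le> k" unfolding k_def c_def by (auto simp: add_nonneg_pos)
    have "e / k * (2 * measure p (space p) + c) \<le> e / k * k" using k e by (intro mult_left_mono) auto
    then show "(LINT x|p. \<phi> x) \<le> (LINT y|q. measure p ((\<lambda>x. (x, y)) -` W)) + e"
      using main[of "e / k"] k e by simp
  qed
  then show ?thesis unfolding \<phi>_def .
qed

lemma fubini_open:
  assumes p: "fin_reg X p" "Hausdorff_space X" and q: "fin_reg Y q" "Hausdorff_space Y"
    and W: "openin (prod_topology X Y) W"
  shows "(LINT x|p. measure q (Pair x -` W)) = (LINT y|q. measure p ((\<lambda>x. (x, y)) -` W))"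
proof (rule antisym[OF fubini_open_le[OF assms]])
  define W' where "W' = prod.swap -` W"
  have W'eq: "W' = {z \<in> topspace (prod_topology Y X). prod.swap z \<in> W}"
    using openin_subset[OF W] by (auto simp: W'_def)
  have W': "openin (prod_topology Y X) W'"
    unfolding W'eq by (rule openin_continuous_map_preimage[OF _ W]) (auto simp: prod.swap_def intro!: continuous_map_pairedI continuous_map_fst continuous_map_snd)
  have s: "(\<lambda>x. (x, y)) -` W = Pair y -` W'" for y by (auto simp: W'_def)
  have "(\<lambda>y. (y, x)) -` W' = Pair x -` W" for x by (auto simp: W'_def)
  then show "(LINT y|q. measure p ((\<lambda>x. (x, y)) -` W)) \<le> (LINT x|p. measure q (Pair x -` W))"
    using fubini_open_le[OF q p W'] s by simp
qed

section \<open>Jordan decomposition and boundedness of complex measures\<close>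

text \<open>The terms may be negative: truncation at 0 by \<open>ennreal\<close> can only enlarge
  the partial sums.\<close>

lemma ennreal_sums_le_suminf:
  assumes "f sums l" shows "ennreal l \<le> (\<Sum>n. ennreal (f n))"
proof -
  have 1: "(\<lambda>n. ennreal (\<Sum>i<n. f i)) \<longlonglongrightarrow> ennreal l"
    using assms unfolding sums_def by (rule tendsto_ennrealI)
  have fin: "ennreal (\<Sum>i\<in>A. f i) \<le> (\<Sum>i\<in>A. ennreal (f i))" if "finite A" for A
    using that
  proof (induction A rule: finite_induct)
    case (insert x F)
    have "ennreal (f x + sum f F) \<le> ennreal (max 0 (f x) + max 0 (sum f F))" by (intro ennreal_leI) auto
    also have "\<dots> = ennreal (f x) + ennreal (sum f F)"
    proof -
      have "ennreal (max 0 t) = ennreal t" for t by (simp add: max_def ennreal_neg)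
      then show ?thesis by (subst ennreal_plus) auto
    qed
    also have "\<dots> \<le> ennreal (f x) + (\<Sum>i\<in>F. ennreal (f i))" by (rule add_left_mono[OF insert(3)])
    finally show ?case using insert by simp
  qed simp
  have 2: "ennreal (\<Sum>i<n. f i) \<le> (\<Sum>n. ennreal (f n))" for n
    using fin[of "{..<n}"] sum_le_suminf[of "\<lambda>n. ennreal (f n)" "{..<n}"] by (auto intro: order_trans)
  show ?thesis by (rule LIMSEQ_le_const2[OF 1]) (use 2 in blast)
qed

text \<open>\<open>signed_on T \<nu>\<close>: a real Borel measure, finite in the sense that it has bounded range.\<close>

definition signed_on :: "'a topology \<Rightarrow> ('a set \<Rightarrow> real) \<Rightarrow> bool" where
  "signed_on T \<nu> \<longleftrightarrow>
     (\<forall>A :: nat \<Rightarrow> 'a set. range A \<subseteq> borel_sets T \<and> disjoint_family A \<longrightarrow>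
        (\<lambda>n. \<nu> (A n)) sums \<nu> (\<Union>n. A n)) \<and> (\<exists>B. \<forall>E\<in>borel_sets T. \<bar>\<nu> E\<bar> \<le> B)"

text \<open>A convergent series with constant terms has zero terms. The values lie in a normed space
  so that this and the next two facts serve complex measures as well as their real parts.\<close>

lemma countably_additive_empty:
  fixes \<nu> :: "'a set \<Rightarrow> 'b::real_normed_vector"
  assumes "\<forall>A :: nat \<Rightarrow> 'a set. range A \<subseteq> borel_sets T \<and> disjoint_family A \<longrightarrow>
        (\<lambda>n. \<nu> (A n)) sums \<nu> (\<Union>n. A n)"
  shows "\<nu> {} = 0"
proof -
  have "{} \<in> borel_sets T" by (simp add: openin_borel_sets)
  then have "(\<lambda>n::nat. \<nu> {}) sums \<nu> (\<Union>n::nat. {})"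
    using assms[rule_format, of "\<lambda>_. {}"] by (auto simp: disjoint_family_on_def)
  then have "summable (\<lambda>n::nat. \<nu> {})" by (rule sums_summable)
  then show ?thesis using summable_LIMSEQ_zero LIMSEQ_const_iff by blast
qed

lemma countably_additive_Un:
  fixes \<nu> :: "'a set \<Rightarrow> 'b::real_normed_vector"
  assumes ca: "\<forall>A :: nat \<Rightarrow> 'a set. range A \<subseteq> borel_sets T \<and> disjoint_family A \<longrightarrow>
        (\<lambda>n. \<nu> (A n)) sums \<nu> (\<Union>n. A n)"
    and E: "E \<in> borel_sets T" "F \<in> borel_sets T" "E \<inter> F = {}"
  shows "\<nu> (E \<union> F) = \<nu> E + \<nu> F"
proof -
  have z: "\<nu> {} = 0" by (rule countably_additive_empty[OF ca])
  have e: "{} \<in> borel_sets T" by (simp add: openin_borel_sets)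
  have "(\<lambda>n. \<nu> (binaryset E F n)) sums \<nu> (\<Union>n. binaryset E F n)"
    using E e by (intro ca[rule_format]) (auto simp: disjoint_family_on_def binaryset_def)
  then have "(\<lambda>n. \<nu> (binaryset E F n)) sums \<nu> (E \<union> F)" by (simp add: UN_binaryset_eq)
  moreover have "(\<lambda>n. \<nu> (binaryset E F n)) sums (\<nu> E + \<nu> F)" by (rule binaryset_sums) (rule z)
  ultimately show ?thesis by (rule sums_unique2)
qed

lemma countably_additive_split:
  fixes \<nu> :: "'a set \<Rightarrow> 'b::real_normed_vector"
  assumes ca: "\<forall>A :: nat \<Rightarrow> 'a set. range A \<subseteq> borel_sets T \<and> disjoint_family A \<longrightarrow>
        (\<lambda>n. \<nu> (A n)) sums \<nu> (\<Union>n. A n)"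
    and E: "E \<in> borel_sets T" "F \<in> borel_sets T"
  shows "\<nu> E = \<nu> (E \<inter> F) + \<nu> (E - F)"
proof -
  interpret sigma_algebra "topspace T" "borel_sets T" by (rule sigma_algebra_borel_sets)
  have "\<nu> ((E \<inter> F) \<union> (E - F)) = \<nu> (E \<inter> F) + \<nu> (E - F)"
    using E by (intro countably_additive_Un[OF ca]) auto
  then show ?thesis by (simp add: Int_Diff_Un)
qed

text \<open>\<open>measure_of\<close> returns the given set function only if that is a measure, so
  the supremum is shown to be countably additive. Superadditivity on disjoint sets bounds the
  partial sums from above; conversely, any competitor inside a disjoint union splits along its
  pieces.\<close>

lemma emeasure_pos_part:
  assumes \<nu>: "signed_on T \<nu>" and E: "E \<in> borel_sets T"
  shows "emeasure (pos_part T \<nu>) E = (SUP A\<in>{A\<in>borel_sets T. A \<subseteq> E}. ennreal (\<nu> A))"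
proof -
  interpret sigma_algebra "topspace T" "borel_sets T" by (rule sigma_algebra_borel_sets)
  have ca: "\<forall>A :: nat \<Rightarrow> 'a set. range A \<subseteq> borel_sets T \<and> disjoint_family A \<longrightarrow>
        (\<lambda>n. \<nu> (A n)) sums \<nu> (\<Union>n. A n)" using \<nu> unfolding signed_on_def by blast
  note z = countably_additive_empty[OF ca]
  define s where "s E = (SUP A\<in>{A\<in>borel_sets T. A \<subseteq> E}. ennreal (\<nu> A))" for E
  have s_ge: "ennreal (\<nu> A) \<le> s E" if "A \<in> borel_sets T" "A \<subseteq> E" for A E
    unfolding s_def using that by (intro SUP_upper) auto
  have s0: "s {} = 0" unfolding s_def by (auto simp: z ennreal_neg intro!: antisym SUP_least)
  have s_Un: "s E + s F \<le> s (E \<union> F)" if "E \<inter> F = {}" for E F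
  proof -
    have *: "ennreal (\<nu> A) + ennreal (\<nu> B) \<le> s (E \<union> F)"
      if A: "A \<in> borel_sets T" "A \<subseteq> E" and B: "B \<in> borel_sets T" "B \<subseteq> F" for A B
    proof -
      \<comment> \<open>A competitor of negative value counts as 0 after truncation. The empty set
        counts the same, and its value can be added without loss.\<close>
      define A' where "A' = (if \<nu> A \<ge> 0 then A else {})"
      define B' where "B' = (if \<nu> B \<ge> 0 then B else {})"
      have AB: "A' \<in> borel_sets T" "B' \<in> borel_sets T" "A' \<inter> B' = {}" "A' \<union> B' \<subseteq> E \<union> F"
        using A B \<open>E \<inter> F = {}\<close> unfolding A'_def B'_def by auto
      have "ennreal (\<nu> A) + ennreal (\<nu> B) = ennreal (\<nu> A') + ennreal (\<nu> B')"
        unfolding A'_def B'_def by (auto simp: z ennreal_neg)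
      also have "\<dots> = ennreal (\<nu> A' + \<nu> B')"
        unfolding A'_def B'_def by (subst ennreal_plus) (auto simp: z)
      also have "\<nu> A' + \<nu> B' = \<nu> (A' \<union> B')" using countably_additive_Un[OF ca AB(1-3)] by simp
      also have "ennreal \<dots> \<le> s (E \<union> F)" using AB by (intro s_ge) auto
      finally show ?thesis .
    qed
    have ne: "{A\<in>borel_sets T. A \<subseteq> E} \<noteq> {}" for E by auto
    have "ennreal (\<nu> A) + s F \<le> s (E \<union> F)" if "A \<in> borel_sets T" "A \<subseteq> E" for A
    proof -
      have "ennreal (\<nu> A) + s F = (SUP B\<in>{A\<in>borel_sets T. A \<subseteq> F}. ennreal (\<nu> A) + ennreal (\<nu> B))"
        unfolding s_def[of F] using ne[of F] by (intro ennreal_SUP_add_right)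
      then show ?thesis using *[OF that] by (auto intro!: SUP_least)
    qed
    moreover have "s E + s F = (SUP A\<in>{A\<in>borel_sets T. A \<subseteq> E}. ennreal (\<nu> A) + s F)"
      unfolding s_def[of E] using ne[of E] by (intro ennreal_SUP_add_left[symmetric])
    ultimately show ?thesis by (auto intro!: SUP_least)
  qed
  have pos: "positive (borel_sets T) s" unfolding positive_def using s0 by simp
  have add: "countably_additive (borel_sets T) s"
  proof (rule countably_additiveI)
    fix A :: "nat \<Rightarrow> 'a set"
    assume A: "range A \<subseteq> borel_sets T" "disjoint_family A" "(\<Union>i. A i) \<in> borel_sets T"
    show "(\<Sum>i. s (A i)) = s (\<Union>i. A i)"
    proof (rule antisym)
      have smono: "s E \<le> s F" if "E \<subseteq> F" for E F unfolding s_def using that by (intro SUP_subset_mono) auto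
      have "(\<Sum>i<n. s (A i)) \<le> s (\<Union>i<n. A i)" for n
      proof (induction n)
        case (Suc n)
        have "A i \<inter> A n = {}" if "i < n" for i using that disjoint_family_onD[OF A(2), of i n] by auto
        then have "(\<Union>i<n. A i) \<inter> A n = {}" by blast
        then have "s (\<Union>i<n. A i) + s (A n) \<le> s ((\<Union>i<n. A i) \<union> A n)" by (rule s_Un)
        also have "(\<Union>i<n. A i) \<union> A n = (\<Union>i<Suc n. A i)" by (auto simp: less_Suc_eq)
        finally show ?case using order_trans[OF add_right_mono[OF Suc, of "s (A n)"]] by simp
      qed (simp add: s0)
      then have "(\<Sum>i<n. s (A i)) \<le> s (\<Union>i. A i)" for n
        by (rule order_trans) (auto intro: smono)
      then show "(\<Sum>i. s (A i)) \<le> s (\<Union>i. A i)" by (intro suminf_le_const) auto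
    next
      have "ennreal (\<nu> B) \<le> (\<Sum>i. s (A i))" if B: "B \<in> borel_sets T" "B \<subseteq> (\<Union>i. A i)" for B
      proof -
        have "(\<lambda>i. \<nu> (B \<inter> A i)) sums \<nu> (\<Union>i. B \<inter> A i)"
          using A B by (intro ca[rule_format]) (auto simp: disjoint_family_on_def)
        also have "(\<Union>i. B \<inter> A i) = B" using B by auto
        finally have "ennreal (\<nu> B) \<le> (\<Sum>i. ennreal (\<nu> (B \<inter> A i)))" by (rule ennreal_sums_le_suminf)
        also have "\<dots> \<le> (\<Sum>i. s (A i))" using A B by (intro suminf_le s_ge) auto
        finally show ?thesis .
      qed
      then show "s (\<Union>i. A i) \<le> (\<Sum>i. s (A i))" unfolding s_def[of "\<Union>i. A i"] by (intro SUP_least) auto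
    qed
  qed
  show ?thesis unfolding pos_part_def s_def[symmetric]
    by (rule emeasure_measure_of_sigma[OF sigma_algebra_borel_sets pos add E])
qed

lemma space_pos_part [simp]: "space (pos_part T \<nu>) = topspace T"
  and sets_pos_part [simp]: "sets (pos_part T \<nu>) = borel_sets T"
proof -
  interpret sigma_algebra "topspace T" "borel_sets T" by (rule sigma_algebra_borel_sets)
  show "space (pos_part T \<nu>) = topspace T" unfolding pos_part_def by (rule space_measure_of) (rule space_closed)
  show "sets (pos_part T \<nu>) = borel_sets T" unfolding pos_part_def
    by (rule sets_measure_of_eq)
qed

lemma signed_on_uminus: "signed_on T \<nu> \<Longrightarrow> signed_on T (\<lambda>E. - \<nu> E)"
  unfolding signed_on_def by (auto intro: sums_minus)

lemma finite_measure_pos_part: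
  assumes "signed_on T \<nu>" shows "finite_measure (pos_part T \<nu>)"
proof
  obtain B where B: "\<And>E. E \<in> borel_sets T \<Longrightarrow> \<bar>\<nu> E\<bar> \<le> B" using assms unfolding signed_on_def by blast
  have "emeasure (pos_part T \<nu>) (topspace T) \<le> ennreal B"
    unfolding emeasure_pos_part[OF assms topspace_borel_sets] using B
    by (intro SUP_least ennreal_leI) (auto simp: abs_le_iff)
  then show "emeasure (pos_part T \<nu>) (space (pos_part T \<nu>)) \<noteq> \<infinity>"
    by (auto simp: top_unique)
qed

text \<open>For a Borel set A inside E, \<open>\<nu> A = \<nu> E - \<nu> (E - A)\<close>, and
  \<open>- \<nu> (E - A)\<close> is at most the negative part of E. The supremum over A gives one
  inequality, and \<open>- \<nu>\<close> in place of \<open>\<nu>\<close> gives the other. No Hahn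
  set has to be constructed.\<close>

lemma Jordan_decomposition_pos_part:
  assumes \<nu>: "signed_on T \<nu>" and E: "E \<in> borel_sets T"
  shows "\<nu> E = measure (pos_part T \<nu>) E - measure (pos_part T (\<lambda>E. - \<nu> E)) E"
proof -
  interpret sigma_algebra "topspace T" "borel_sets T" by (rule sigma_algebra_borel_sets)
  have key: "measure (pos_part T \<nu>) E \<le> \<nu> E + measure (pos_part T (\<lambda>E. - \<nu> E)) E" if \<nu>: "signed_on T \<nu>" for \<nu>
  proof -
    have ca: "\<forall>A :: nat \<Rightarrow> 'a set. range A \<subseteq> borel_sets T \<and> disjoint_family A \<longrightarrow>
        (\<lambda>n. \<nu> (A n)) sums \<nu> (\<Union>n. A n)" using \<nu> unfolding signed_on_def by blast
    note \<nu>' = signed_on_uminus[OF \<nu>]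
    interpret p: finite_measure "pos_part T \<nu>" by (rule finite_measure_pos_part[OF \<nu>])
    interpret n: finite_measure "pos_part T (\<lambda>E. - \<nu> E)" by (rule finite_measure_pos_part[OF \<nu>'])
    have neg: "- \<nu> B \<le> measure (pos_part T (\<lambda>E. - \<nu> E)) E" if "B \<in> borel_sets T" "B \<subseteq> E" for B
    proof -
      have "ennreal (- \<nu> B) \<le> ennreal (measure (pos_part T (\<lambda>E. - \<nu> E)) E)"
        unfolding n.emeasure_eq_measure[symmetric] emeasure_pos_part[OF \<nu>' E]
        using that by (intro SUP_upper) auto
      then show ?thesis by (simp add: ennreal_le_iff)
    qed
    have "ennreal (\<nu> A) \<le> ennreal (\<nu> E + measure (pos_part T (\<lambda>E. - \<nu> E)) E)"
      if A: "A \<in> borel_sets T" "A \<subseteq> E" for A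
    proof (rule ennreal_leI)
      have "\<nu> E = \<nu> A + \<nu> (E - A)" using countably_additive_split[OF ca E A(1)] A(2) by (simp add: Int_absorb1)
      then show "\<nu> A \<le> \<nu> E + measure (pos_part T (\<lambda>E. - \<nu> E)) E" using neg[of "E - A"] Diff[OF E A(1)] by auto
    qed
    then have "ennreal (measure (pos_part T \<nu>) E) \<le> ennreal (\<nu> E + measure (pos_part T (\<lambda>E. - \<nu> E)) E)"
      unfolding p.emeasure_eq_measure[symmetric] emeasure_pos_part[OF \<nu> E] by (intro SUP_least) auto
    moreover have "0 \<le> \<nu> E + measure (pos_part T (\<lambda>E. - \<nu> E)) E" using neg[of E] E by simp
    ultimately show ?thesis by (simp add: ennreal_le_iff)
  qed
  show ?thesis using key[OF \<nu>] key[OF signed_on_uminus[OF \<nu>]] by simp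
qed

lemma total_variation_ge:
  assumes "A \<in> borel_sets T" "E \<in> borel_sets T" "A \<subseteq> E"
  shows "ennreal (norm (\<mu> A)) \<le> total_variation T \<mu> E"
proof -
  interpret sigma_algebra "topspace T" "borel_sets T" by (rule sigma_algebra_borel_sets)
  have "ennreal (norm (\<mu> A)) \<le> (\<Sum>B\<in>{A, E - A}. ennreal (norm (\<mu> B)))"
    by (rule member_le_sum[of A]) auto
  also have "\<dots> \<le> total_variation T \<mu> E"
    unfolding total_variation_def using assms
    by (intro SUP_upper) (auto simp: disjoint_def)
  finally show ?thesis .
qed

text \<open>
  Regularity of the total variation at single points, together with compactness, already
  forces the range to be bounded.
\<close>

lemma regular_measures_bounded:
  assumes T: "compact_space T" "Hausdorff_space T" and \<mu>: "\<mu> \<in> regular_measures T"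
  shows "\<exists>B. \<forall>E\<in>borel_sets T. norm (\<mu> E) \<le> B"
proof -
  interpret sigma_algebra "topspace T" "borel_sets T" by (rule sigma_algebra_borel_sets)
  have ca: "\<forall>A :: nat \<Rightarrow> 'a set. range A \<subseteq> borel_sets T \<and> disjoint_family A \<longrightarrow>
        (\<lambda>n. \<mu> (A n)) sums \<mu> (\<Union>n. A n)" and reg: "regular_on T (total_variation T \<mu>)"
    using \<mu> unfolding regular_measures_def complex_measure_def by auto
  note z = countably_additive_empty[OF ca]
  define bd where "bd V \<longleftrightarrow> (\<exists>B. \<forall>E\<in>borel_sets T. E \<subseteq> V \<longrightarrow> norm (\<mu> E) \<le> B)" for V
  have loc: "\<exists>V. openin T V \<and> x \<in> V \<and> bd V" if x: "x \<in> topspace T" for x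
  proof -
    have xs: "{x} \<in> borel_sets T" by (rule compactin_borel_sets) (use x T in auto)
    obtain K V where K: "compactin T K" "openin T V" "K \<subseteq> {x}" "{x} \<subseteq> V" "total_variation T \<mu> (V - K) < 1"
      using regular_onD[OF reg xs, of 1] by auto
    have Ks: "K \<in> borel_sets T" "V \<in> borel_sets T" using K T compactin_borel_sets openin_borel_sets by auto
    \<comment> \<open>\<open>K\<close> is empty or equal to \<open>{x}\<close>. So E meets
      \<open>K\<close> in at most the point x, and the rest of E lies in \<open>V - K\<close>, where
      the variation is below 1.\<close>
    have "norm (\<mu> E) \<le> norm (\<mu> {x}) + 1" if E: "E \<in> borel_sets T" "E \<subseteq> V" for E
    proof -
      have "ennreal (norm (\<mu> (E - K))) \<le> total_variation T \<mu> (V - K)"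
        using E Ks by (intro total_variation_ge) auto
      then have "ennreal (norm (\<mu> (E - K))) < 1" using K(5) by (rule le_less_trans)
      then have "norm (\<mu> (E - K)) \<le> 1" by (metis ennreal_1 ennreal_less_iff less_eq_real_def norm_ge_zero)
      moreover have "norm (\<mu> (E \<inter> K)) \<le> norm (\<mu> {x})"
      proof (cases "E \<inter> K = {}")
        case False then have "E \<inter> K = {x}" using K(3) by auto
        then show ?thesis by simp
      qed (simp add: z)
      ultimately show ?thesis using countably_additive_split[OF ca E(1) Ks(1)] norm_triangle_ineq[of "\<mu> (E \<inter> K)" "\<mu> (E - K)"] by simp
    qed
    then show ?thesis using K unfolding bd_def by auto
  qed
  have bdU: "bd (\<Union>\<F>)" if "finite \<F>" "\<And>V. V \<in> \<F> \<Longrightarrow> openin T V \<and> bd V" for \<F>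
    using that
  proof (induction \<F> rule: finite_induct)
    case empty
    then show ?case unfolding bd_def using z by auto
  next
    case (insert V \<F>)
    then obtain B B' where B: "\<And>E. E \<in> borel_sets T \<Longrightarrow> E \<subseteq> V \<Longrightarrow> norm (\<mu> E) \<le> B"
       "\<And>E. E \<in> borel_sets T \<Longrightarrow> E \<subseteq> \<Union>\<F> \<Longrightarrow> norm (\<mu> E) \<le> B'" unfolding bd_def by (metis insertCI)
    have Vs: "V \<in> borel_sets T" using insert openin_borel_sets by blast
    have "norm (\<mu> E) \<le> B + B'" if E: "E \<in> borel_sets T" "E \<subseteq> \<Union>(insert V \<F>)" for E
    proof -
      have "norm (\<mu> (E \<inter> V)) \<le> B" "norm (\<mu> (E - V)) \<le> B'" using E Vs by (auto intro!: B)
      then show ?thesis using countably_additive_split[OF ca E(1) Vs] norm_triangle_ineq[of "\<mu> (E \<inter> V)" "\<mu> (E - V)"] by simp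
    qed
    then show ?case unfolding bd_def by blast
  qed
  have "\<exists>\<F>. finite \<F> \<and> \<F> \<subseteq> {V. openin T V \<and> bd V} \<and> topspace T \<subseteq> \<Union>\<F>"
    using T(1) loc unfolding compact_space_def compactin_def
    by (elim conjE allE[of _ "{V. openin T V \<and> bd V}"]) (auto simp: subset_iff)
  then obtain \<F> where \<F>: "finite \<F>" "\<F> \<subseteq> {V. openin T V \<and> bd V}" "topspace T \<subseteq> \<Union>\<F>" by blast
  have "bd (\<Union>\<F>)" using \<F> by (intro bdU) auto
  then show ?thesis using \<F>(3) borel_sets_subset unfolding bd_def by (meson subset_trans)
qed

text \<open>The total variation of \<open>\<mu>\<close> dominates the positive part of
  \<open>\<nu>\<close>, so the compact and open sets that witness regularity of the former also work
  for the latter.\<close>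

lemma fin_reg_pos_part:
  assumes \<nu>: "signed_on T \<nu>" and reg: "regular_on T (total_variation T \<mu>)"
    and T: "Hausdorff_space T" and le: "\<And>E. \<nu> E \<le> norm (\<mu> E)"
  shows "fin_reg T (pos_part T \<nu>)"
proof -
  interpret sigma_algebra "topspace T" "borel_sets T" by (rule sigma_algebra_borel_sets)
  have tv: "emeasure (pos_part T \<nu>) E \<le> total_variation T \<mu> E" if E: "E \<in> borel_sets T" for E
    unfolding emeasure_pos_part[OF \<nu> E]
  proof (rule SUP_least)
    fix A assume "A \<in> {A \<in> borel_sets T. A \<subseteq> E}"
    then show "ennreal (\<nu> A) \<le> total_variation T \<mu> E"
      using total_variation_ge[of A T E \<mu>] E le[of A] by (auto intro: order_trans ennreal_leI)
  qed
  have "regular_on T (emeasure (pos_part T \<nu>))"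
    unfolding regular_on_def
  proof (intro ballI allI impI)
    fix E and e :: ennreal assume E: "E \<in> borel_sets T" "e > 0"
    obtain K V where K: "compactin T K" "openin T V" "K \<subseteq> E" "E \<subseteq> V" "total_variation T \<mu> (V - K) < e"
      using regular_onD[OF reg E] by auto
    have "V - K \<in> borel_sets T"
      by (rule Diff[OF openin_borel_sets[OF K(2)] compactin_borel_sets[OF T K(1)]])
    from tv[OF this] K show "\<exists>K V. compactin T K \<and> openin T V \<and> K \<subseteq> E \<and> E \<subseteq> V \<and> emeasure (pos_part T \<nu>) (V - K) < e"
      by (meson le_less_trans)
  qed
  then show ?thesis unfolding fin_reg_def using finite_measure_pos_part[OF \<nu>] by simp
qed

text \<open>Integrals are interchanged for finite regular positive measures only. This splits a
  regular complex measure into four of them, the ones over which \<open>complex_integral\<close> is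
  computed.\<close>

lemma regular_measures_parts:
  assumes T: "compact_space T" "Hausdorff_space T" and \<mu>: "\<mu> \<in> regular_measures T"
  shows "fin_reg T (pos_part T (\<lambda>E. Re (\<mu> E)))" "fin_reg T (pos_part T (\<lambda>E. - Re (\<mu> E)))"
    "fin_reg T (pos_part T (\<lambda>E. Im (\<mu> E)))" "fin_reg T (pos_part T (\<lambda>E. - Im (\<mu> E)))"
    "\<And>E. E \<in> borel_sets T \<Longrightarrow> \<mu> E =
       of_real (measure (pos_part T (\<lambda>E. Re (\<mu> E))) E) - of_real (measure (pos_part T (\<lambda>E. - Re (\<mu> E))) E) +
       \<i> * (of_real (measure (pos_part T (\<lambda>E. Im (\<mu> E))) E) - of_real (measure (pos_part T (\<lambda>E. - Im (\<mu> E))) E))"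
proof -
  have ca: "\<forall>A :: nat \<Rightarrow> 'a set. range A \<subseteq> borel_sets T \<and> disjoint_family A \<longrightarrow>
        (\<lambda>n. \<mu> (A n)) sums \<mu> (\<Union>n. A n)" and reg: "regular_on T (total_variation T \<mu>)"
    using \<mu> unfolding regular_measures_def complex_measure_def by auto
  obtain B where B: "\<And>E. E \<in> borel_sets T \<Longrightarrow> norm (\<mu> E) \<le> B" using regular_measures_bounded[OF assms] by blast
  have R: "signed_on T (\<lambda>E. Re (\<mu> E))"
    unfolding signed_on_def using ca B order_trans[OF abs_Re_le_cmod] by (intro conjI allI impI sums_Re exI[of _ B] ballI) auto
  have I: "signed_on T (\<lambda>E. Im (\<mu> E))"
    unfolding signed_on_def using ca B order_trans[OF abs_Im_le_cmod] by (intro conjI allI impI sums_Im exI[of _ B] ballI) auto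
  note R' = signed_on_uminus[OF R] and I' = signed_on_uminus[OF I]
  show "fin_reg T (pos_part T (\<lambda>E. Re (\<mu> E)))" "fin_reg T (pos_part T (\<lambda>E. - Re (\<mu> E)))"
    "fin_reg T (pos_part T (\<lambda>E. Im (\<mu> E)))" "fin_reg T (pos_part T (\<lambda>E. - Im (\<mu> E)))"
    using abs_Re_le_cmod abs_Im_le_cmod
    by (auto intro!: fin_reg_pos_part[OF _ reg T(2)] R I R' I' simp: abs_le_iff)
  show "\<mu> E =
       of_real (measure (pos_part T (\<lambda>E. Re (\<mu> E))) E) - of_real (measure (pos_part T (\<lambda>E. - Re (\<mu> E))) E) +
       \<i> * (of_real (measure (pos_part T (\<lambda>E. Im (\<mu> E))) E) - of_real (measure (pos_part T (\<lambda>E. - Im (\<mu> E))) E))"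
    if "E \<in> borel_sets T" for E
    using Jordan_decomposition_pos_part[OF R that] Jordan_decomposition_pos_part[OF I that]
    by (simp add: complex_eq_iff)
qed

section \<open>Haar measure and convolution\<close>

lemma borel_sets_vimage:
  assumes f: "continuous_map X Y f" and E: "E \<in> borel_sets Y"
  shows "{x \<in> topspace X. f x \<in> E} \<in> borel_sets X"
proof -
  interpret sigma_algebra "topspace X" "borel_sets X" by (rule sigma_algebra_borel_sets)
  show ?thesis using E unfolding borel_sets_def[of Y]
  proof (induction rule: sigma_sets.induct)
    case (Basic V)
    then show ?case using openin_continuous_map_preimage[OF f] openin_borel_sets by auto
  next
    case (Compl E)
    have "{x \<in> topspace X. f x \<in> topspace Y - E} = topspace X - {x \<in> topspace X. f x \<in> E}"
      using continuous_map_image_subset_topspace[OF f] by blast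
    then show ?case using Compl by auto
  next
    case (Union E)
    have "{x \<in> topspace X. f x \<in> \<Union> (range E)} = (\<Union>i. {x \<in> topspace X. f x \<in> E i})" by blast
    then show ?case using Union by auto
  qed auto
qed

lemma continuous_map_measurable:
  assumes f: "continuous_map X Y f"
    and "space p = topspace X" "sets p = borel_sets X" "space q = topspace Y" "sets q = borel_sets Y"
  shows "f \<in> measurable p q"
proof (rule measurableI)
  fix x assume "x \<in> space p" then show "f x \<in> space q"
    using assms continuous_map_image_subset_topspace[OF f] by blast
next
  fix A assume "A \<in> sets q"
  moreover have "f -` A \<inter> space p = {x \<in> topspace X. f x \<in> A}" using assms by auto
  ultimately show "f -` A \<inter> space p \<in> sets p" using borel_sets_vimage[OF f] assms by simp
qed

lemma borel_measurable_continuous_map: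
  fixes f :: "'a \<Rightarrow> 'b::topological_space"
  assumes "continuous_map X euclidean f" "space p = topspace X" "sets p = borel_sets X"
  shows "f \<in> borel_measurable p"
proof (rule borel_measurableI)
  fix S :: "'b set" assume "open S"
  then have "openin X {x \<in> topspace X. f x \<in> S}" using openin_continuous_map_preimage[OF assms(1)] by simp
  moreover have "f -` S \<inter> space p = {x \<in> topspace X. f x \<in> S}" using assms(2) by auto
  ultimately show "f -` S \<inter> space p \<in> sets p" using openin_borel_sets assms(3) by simp
qed

context compact_group
begin

text \<open>The set x^-1 E in the form in which it occurs in \<open>convolution\<close>;
  \<open>right_div y E\<close> is likewise E y^-1.\<close>

definition left_div :: "'a \<Rightarrow> 'a set \<Rightarrow> 'a set" where
  "left_div x E = {y \<in> carrier G. x \<otimes> y \<in> E}"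

definition right_div :: "'a \<Rightarrow> 'a set \<Rightarrow> 'a set" where
  "right_div y E = {x \<in> carrier G. x \<otimes> y \<in> E}"

lemma continuous_left_mult: "x \<in> carrier G \<Longrightarrow> continuous_map T T (\<lambda>y. x \<otimes> y)"
  using continuous_map_compose[OF _ continuous_mult, of T "\<lambda>y. (x, y)"]
  by (simp add: o_def continuous_map_paired topspace_eq)

lemma continuous_right_mult: "y \<in> carrier G \<Longrightarrow> continuous_map T T (\<lambda>x. x \<otimes> y)"
  using continuous_map_compose[OF _ continuous_mult, of T "\<lambda>x. (x, y)"]
  by (simp add: o_def continuous_map_paired topspace_eq)

lemma left_div_borel: "x \<in> carrier G \<Longrightarrow> E \<in> borel_sets T \<Longrightarrow> left_div x E \<in> borel_sets T"
  unfolding left_div_def using borel_sets_vimage[OF continuous_left_mult] topspace_eq by simp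

lemma right_div_borel: "x \<in> carrier G \<Longrightarrow> E \<in> borel_sets T \<Longrightarrow> right_div x E \<in> borel_sets T"
  unfolding right_div_def using borel_sets_vimage[OF continuous_right_mult] topspace_eq by simp

text \<open>
  The map \<open>(x, y) \<mapsto> x \<otimes> y\<close> need not be measurable for the product \<open>\<sigma>\<close>-algebra when the
  group is not second countable, so this is not an instance of the usual Fubini theorem.
\<close>

lemma fubini_mult:
  assumes p: "fin_reg T p" and q: "fin_reg T q" and E: "E \<in> borel_sets T"
  shows "(\<lambda>x. emeasure q (left_div x E)) \<in> borel_measurable p \<and>
     (\<lambda>y. emeasure p (right_div y E)) \<in> borel_measurable q \<and>
     (\<integral>\<^sup>+x. emeasure q (left_div x E) \<partial>p) = (\<integral>\<^sup>+y. emeasure p (right_div y E) \<partial>q)"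
proof -
  interpret p: finite_measure p using fin_regD[OF p] by simp
  interpret q: finite_measure q using fin_regD[OF q] by simp
  note sp = fin_regD(1,2)[OF p] and sq = fin_regD(1,2)[OF q]
  have stable: "Int_stable {V. openin T V}" and sub: "{V. openin T V} \<subseteq> Pow (topspace T)"
    by (auto simp: Int_stable_def dest: openin_subset)
  show ?thesis using E unfolding borel_sets_def
  \<comment> \<open>Open sets are stable under intersection, so it suffices to treat open sets,
    complements and disjoint countable unions. Complements use that both measures are
    finite.\<close>
  proof (induction rule: sigma_sets_induct_disjoint[OF stable sub, consumes 1, case_names basic empty compl union])
    case (basic E)
    then have E: "openin T E" by simp
    \<comment> \<open>The preimage of E under multiplication is open in the product topology, which
      is what \<open>fubini_open\<close> asks for.\<close>
    define W where "W = {z \<in> topspace (prod_topology T T). (case z of (x, y) \<Rightarrow> x \<otimes> y) \<in> E}"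
    have W: "openin (prod_topology T T) W"
      unfolding W_def by (rule openin_continuous_map_preimage[OF continuous_mult E])
    have l: "left_div x E = Pair x -` W" if "x \<in> space p" for x
      using that sp unfolding left_div_def W_def by (auto simp: topspace_eq)
    have r: "right_div y E = (\<lambda>x. (x, y)) -` W" if "y \<in> space q" for y
      using that sq unfolding right_div_def W_def by (auto simp: topspace_eq)
    have lm: "(\<lambda>x. measure q (left_div x E)) \<in> borel_measurable p"
      using section_measurable[OF q Hausdorff W sp] l by (simp cong: measurable_cong)
    define W' where "W' = prod.swap -` W"
    have W'eq: "W' = {z \<in> topspace (prod_topology T T). prod.swap z \<in> W}"
      by (auto simp: W'_def W_def)
    have W': "openin (prod_topology T T) W'"
      unfolding W'eq by (rule openin_continuous_map_preimage[OF _ W]) (auto simp: prod.swap_def intro!: continuous_map_pairedI continuous_map_fst continuous_map_snd)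
    have r': "right_div y E = Pair y -` W'" if "y \<in> space q" for y
      using r[OF that] by (auto simp: W'_def)
    have rm: "(\<lambda>x. measure p (right_div x E)) \<in> borel_measurable q"
      using section_measurable[OF p Hausdorff W' sq] r' by (simp cong: measurable_cong)
    have "(LINT x|p. measure q (left_div x E)) = (LINT y|q. measure p (right_div y E))"
      using fubini_open[OF p Hausdorff q Hausdorff W] l r by (simp cong: Bochner_Integration.integral_cong)
    moreover have "integrable p (\<lambda>x. measure q (left_div x E))"
      by (rule p.integrable_const_bound[where B="measure q (space q)"]) (use lm q.bounded_measure in auto)
    moreover have "integrable q (\<lambda>x. measure p (right_div x E))"
      by (rule q.integrable_const_bound[where B="measure p (space p)"]) (use rm p.bounded_measure in auto)
    ultimately show ?case using lm rm
      by (simp add: p.emeasure_eq_measure q.emeasure_eq_measure nn_integral_eq_integral)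
  next
    case empty
    show ?case by (simp add: left_div_def right_div_def)
  next
    case (compl E)
    then have E: "E \<in> borel_sets T" unfolding borel_sets_def by simp
    have l: "emeasure q (left_div x (topspace T - E)) = emeasure q (space q) - emeasure q (left_div x E)"
      if "x \<in> space p" for x
    proof -
      have x: "x \<in> carrier G" using that sp topspace_eq by simp
      have "left_div x (topspace T - E) = space q - left_div x E"
        using x sq by (auto simp: left_div_def topspace_eq)
      then show ?thesis using emeasure_compl[of "left_div x E" q] left_div_borel[OF x E] sq q.emeasure_finite by simp
    qed
    have r: "emeasure p (right_div y (topspace T - E)) = emeasure p (space p) - emeasure p (right_div y E)"
      if "y \<in> space q" for y
    proof -
      have y: "y \<in> carrier G" using that sq topspace_eq by simp
      have "right_div y (topspace T - E) = space p - right_div y E"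
        using y sp by (auto simp: right_div_def topspace_eq)
      then show ?thesis using emeasure_compl[of "right_div y E" p] right_div_borel[OF y E] sp p.emeasure_finite by simp
    qed
    note IH = compl(2)
    have "(\<integral>\<^sup>+x. emeasure q (space q) - emeasure q (left_div x E) \<partial>p) =
        (\<integral>\<^sup>+x. emeasure q (space q) \<partial>p) - (\<integral>\<^sup>+x. emeasure q (left_div x E) \<partial>p)"
    proof (rule nn_integral_diff)
      have "(\<integral>\<^sup>+x. emeasure q (left_div x E) \<partial>p) \<le> (\<integral>\<^sup>+x. emeasure q (space q) \<partial>p)"
        by (intro nn_integral_mono emeasure_space)
      then show "(\<integral>\<^sup>+x. emeasure q (left_div x E) \<partial>p) \<noteq> \<infinity>"
        by (auto simp: top_unique ennreal_mult_eq_top_iff)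
    qed (use IH emeasure_space in auto)
    moreover have "(\<integral>\<^sup>+y. emeasure p (space p) - emeasure p (right_div y E) \<partial>q) =
        (\<integral>\<^sup>+y. emeasure p (space p) \<partial>q) - (\<integral>\<^sup>+y. emeasure p (right_div y E) \<partial>q)"
    proof (rule nn_integral_diff)
      have "(\<integral>\<^sup>+y. emeasure p (right_div y E) \<partial>q) \<le> (\<integral>\<^sup>+y. emeasure p (space p) \<partial>q)"
        by (intro nn_integral_mono emeasure_space)
      then show "(\<integral>\<^sup>+y. emeasure p (right_div y E) \<partial>q) \<noteq> \<infinity>"
        by (auto simp: top_unique ennreal_mult_eq_top_iff)
    qed (use IH emeasure_space in auto)
    moreover have "(\<lambda>x. emeasure q (space q) - emeasure q (left_div x E)) \<in> borel_measurable p"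
      "(\<lambda>y. emeasure p (space p) - emeasure p (right_div y E)) \<in> borel_measurable q"
      using IH by (auto intro: borel_measurable_minus_ennreal)
    ultimately show ?case using l r IH
      by (simp cong: nn_integral_cong measurable_cong add: mult.commute)
  next
    case (union A)
    have A: "A i \<in> borel_sets T" for i using union unfolding borel_sets_def by auto
    have l: "emeasure q (left_div x (\<Union>i. A i)) = (\<Sum>i. emeasure q (left_div x (A i)))"
      if "x \<in> space p" for x
    proof -
      have x: "x \<in> carrier G" using that sp topspace_eq by simp
      have "left_div x (\<Union>i. A i) = (\<Union>i. left_div x (A i))" by (auto simp: left_div_def)
      moreover have "disjoint_family (\<lambda>i. left_div x (A i))"
        using union(1) unfolding disjoint_family_on_def left_div_def by blast
      ultimately show ?thesis using left_div_borel[OF x A] sq by (simp add: suminf_emeasure image_subset_iff)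
    qed
    have r: "emeasure p (right_div y (\<Union>i. A i)) = (\<Sum>i. emeasure p (right_div y (A i)))"
      if "y \<in> space q" for y
    proof -
      have y: "y \<in> carrier G" using that sq topspace_eq by simp
      have "right_div y (\<Union>i. A i) = (\<Union>i. right_div y (A i))" by (auto simp: right_div_def)
      moreover have "disjoint_family (\<lambda>i. right_div y (A i))"
        using union(1) unfolding disjoint_family_on_def right_div_def by blast
      ultimately show ?thesis using right_div_borel[OF y A] sp by (simp add: suminf_emeasure image_subset_iff)
    qed
    have "(\<lambda>x. \<Sum>i. emeasure q (left_div x (A i))) \<in> borel_measurable p"
      "(\<lambda>y. \<Sum>i. emeasure p (right_div y (A i))) \<in> borel_measurable q"
      using union(3) by (auto intro: borel_measurable_suminf_order)
    then show ?case using l r union(3)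
      by (simp cong: nn_integral_cong measurable_cong add: nn_integral_suminf)
  qed
qed

lemma integrable_measure_left_div:
  assumes p: "fin_reg T p" and q: "fin_reg T q" and E: "E \<in> borel_sets T"
  shows "integrable p (\<lambda>x. measure q (left_div x E))"
proof -
  interpret p: finite_measure p using fin_regD[OF p] by simp
  interpret q: finite_measure q using fin_regD[OF q] by simp
  have "(\<lambda>x. measure q (left_div x E)) \<in> borel_measurable p"
    using fubini_mult[OF assms] unfolding measure_def by (intro borel_measurable_enn2real) blast
  then show ?thesis
    by (intro p.integrable_const_bound[where B="measure q (space q)"]) (use q.bounded_measure in auto)
qed

lemma integrable_measure_right_div:
  assumes p: "fin_reg T p" and q: "fin_reg T q" and E: "E \<in> borel_sets T"
  shows "integrable q (\<lambda>y. measure p (right_div y E))"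
proof -
  interpret p: finite_measure p using fin_regD[OF p] by simp
  interpret q: finite_measure q using fin_regD[OF q] by simp
  have "(\<lambda>y. measure p (right_div y E)) \<in> borel_measurable q"
    using fubini_mult[OF assms] unfolding measure_def by (intro borel_measurable_enn2real) blast
  then show ?thesis
    by (intro q.integrable_const_bound[where B="measure p (space p)"]) (use p.bounded_measure in auto)
qed

lemma integral_measure_left_div:
  assumes p: "fin_reg T p" and q: "fin_reg T q" and E: "E \<in> borel_sets T"
  shows "(LINT x|p. measure q (left_div x E)) = (LINT y|q. measure p (right_div y E))"
proof -
  interpret p: finite_measure p using fin_regD[OF p] by simp
  interpret q: finite_measure q using fin_regD[OF q] by simp
  have "ennreal (LINT x|p. measure q (left_div x E)) = ennreal (LINT y|q. measure p (right_div y E))"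
    using fubini_mult[OF assms] integrable_measure_left_div[OF assms] integrable_measure_right_div[OF assms]
    by (simp add: p.emeasure_eq_measure q.emeasure_eq_measure nn_integral_eq_integral)
  then show ?thesis by (simp add: integral_nonneg)
qed

text \<open>Both measures split into four positive parts with coefficients 1, -1, i, -i, and the
  identity is the bilinear extension of the sixteen cases of
  \<open>integral_measure_left_div\<close>. It turns an integral against \<open>\<mu>\<close> into
  one against \<open>\<nu>\<close>, the form in which the two orders of convolution can be
  compared.\<close>

lemma convolution_swap:
  assumes \<mu>: "\<mu> \<in> regular_measures T" and \<nu>: "\<nu> \<in> regular_measures T" and E: "E \<in> borel_sets T"
  shows "convolution G T \<mu> \<nu> E = complex_integral T \<nu> (\<lambda>y. \<mu> (right_div y E))"
proof -
  note M = regular_measures_parts[OF compact Hausdorff \<mu>] and N = regular_measures_parts[OF compact Hausdorff \<nu>]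
  define p where "p = (\<lambda>i::nat. [pos_part T (\<lambda>E. Re (\<mu> E)), pos_part T (\<lambda>E. - Re (\<mu> E)),
     pos_part T (\<lambda>E. Im (\<mu> E)), pos_part T (\<lambda>E. - Im (\<mu> E))] ! i)"
  define q where "q = (\<lambda>i::nat. [pos_part T (\<lambda>E. Re (\<nu> E)), pos_part T (\<lambda>E. - Re (\<nu> E)),
     pos_part T (\<lambda>E. Im (\<nu> E)), pos_part T (\<lambda>E. - Im (\<nu> E))] ! i)"
  define c where "c = (\<lambda>i::nat. [1, -1, \<i>, -\<i>] ! i)"
  have four: "{..<4::nat} = {0, 1, 2, 3}" by auto
  have p: "fin_reg T (p i)" "fin_reg T (q i)" if "i < 4" for i
    using that M(1-4) N(1-4) unfolding p_def q_def by (auto simp: less_Suc_eq numeral_eq_Suc)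
  have me: "\<mu> F = (\<Sum>i<4. c i * of_real (measure (p i) F))" "\<nu> F = (\<Sum>i<4. c i * of_real (measure (q i) F))"
    if "F \<in> borel_sets T" for F
    using M(5)[OF that] N(5)[OF that] unfolding four c_def p_def q_def by (simp_all add: algebra_simps)
  have cim: "complex_integral T \<mu> g = (\<Sum>i<4. c i * (LINT x|p i. g x))"
    "complex_integral T \<nu> g = (\<Sum>i<4. c i * (LINT x|q i. g x))" for g
    unfolding complex_integral_def four c_def p_def q_def by (simp_all add: algebra_simps)
  have sp: "space (p i) = carrier G" "space (q i) = carrier G" if "i < 4" for i
    using p[OF that] fin_regD(1) topspace_eq by auto
  have "convolution G T \<mu> \<nu> E = (\<Sum>i<4. c i * (LINT x|p i. \<nu> (left_div x E)))"
    unfolding convolution_def cim left_div_def ..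
  also have "\<dots> = (\<Sum>i<4. c i * (LINT x|p i. (\<Sum>j<4. c j * of_real (measure (q j) (left_div x E)))))"
    by (intro sum.cong arg_cong2[where f="(*)"] Bochner_Integration.integral_cong me left_div_borel E) (auto simp: sp)
  also have "\<dots> = (\<Sum>i<4. c i * (\<Sum>j<4. c j * of_real (LINT x|p i. measure (q j) (left_div x E))))"
    using integrable_measure_left_div[OF p(1) p(2) E] by (simp add: integral_sum)
  also have "\<dots> = (\<Sum>i<4. c i * (\<Sum>j<4. c j * of_real (LINT y|q j. measure (p i) (right_div y E))))"
    using integral_measure_left_div[OF p(1) p(2) E] by simp
  also have "\<dots> = (\<Sum>j<4. c j * (\<Sum>i<4. c i * of_real (LINT y|q j. measure (p i) (right_div y E))))"
    by (simp only: sum_distrib_left, subst sum.swap) (simp add: mult.left_commute)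
  also have "\<dots> = (\<Sum>j<4. c j * (LINT y|q j. (\<Sum>i<4. c i * of_real (measure (p i) (right_div y E)))))"
    using integrable_measure_right_div[OF p(1) p(2) E] by (simp add: integral_sum)
  also have "\<dots> = (\<Sum>j<4. c j * (LINT y|q j. \<mu> (right_div y E)))"
    by (intro sum.cong arg_cong2[where f="(*)"] Bochner_Integration.integral_cong me(1)[symmetric] right_div_borel E) (auto simp: sp)
  finally show ?thesis unfolding cim .
qed

end

section \<open>Invariance of Haar measure and centrality of class functions\<close>

lemma compact_space_finite_cover:
  assumes "compact_space X" "\<And>V. V \<in> \<V> \<Longrightarrow> openin X V" "topspace X \<subseteq> \<Union>\<V>"
  shows "\<exists>\<F>. finite \<F> \<and> \<F> \<subseteq> \<V> \<and> topspace X \<subseteq> \<Union>\<F>"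
  using assms unfolding compact_space_alt by auto

locale haar_group = compact_group +
  fixes m :: "'a measure"
  assumes haar: "normalized_haar G T m"

sublocale haar_group \<subseteq> prob_space m
  using haar unfolding normalized_haar_def by blast

context haar_group
begin

lemma space_m: "space m = carrier G" and sets_m: "sets m = borel_sets T" and fin_reg_m: "fin_reg T m"
  using haar finite_measure_axioms unfolding normalized_haar_def fin_reg_def topspace_eq by auto

lemma borel_measurable_m:
  fixes f :: "'a \<Rightarrow> 'b::topological_space"
  shows "continuous_map T euclidean f \<Longrightarrow> f \<in> borel_measurable m"
  by (rule borel_measurable_continuous_map) (auto simp: space_m sets_m topspace_eq)

lemma measurable_m: "continuous_map T T f \<Longrightarrow> f \<in> measurable m m"
  by (rule continuous_map_measurable) (auto simp: space_m sets_m topspace_eq)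

lemma emeasure_left_div:
  assumes x: "x \<in> carrier G" and E: "E \<in> borel_sets T"
  shows "emeasure m (left_div x E) = emeasure m E"
proof -
  have "E \<subseteq> carrier G" using borel_sets_subset[OF E] topspace_eq by simp
  then have "left_div x E = inv x <# E"
    using x unfolding left_div_def l_coset_def
    by (auto simp: m_assoc[symmetric] intro!: bexI[where x="x \<otimes> _"])
  then show ?thesis using haar x E unfolding normalized_haar_def by simp
qed

lemma distr_left_mult: "y \<in> carrier G \<Longrightarrow> distr m m (\<lambda>x. y \<otimes> x) = m"
proof (rule measure_eqI)
  fix E assume y: "y \<in> carrier G" and E: "E \<in> sets (distr m m (\<lambda>x. y \<otimes> x))"
  have "(\<lambda>x. y \<otimes> x) -` E \<inter> space m = left_div y E" by (auto simp: left_div_def space_m)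
  then show "emeasure (distr m m (\<lambda>x. y \<otimes> x)) E = emeasure m E"
    using E emeasure_left_div[OF y] measurable_m[OF continuous_left_mult[OF y]]
    by (simp add: emeasure_distr sets_m)
qed simp

text \<open>
  Comparing the left Haar measure with its image under inversion through the convolution
  of the two gives unimodularity and uniqueness at once.
\<close>

lemma distr_inv: "distr m m (\<lambda>x. inv x) = m"
proof -
  define m' where "m' = distr m m (\<lambda>x. inv x)"
  have im: "(\<lambda>x. inv x) \<in> measurable m m" by (rule measurable_m[OF continuous_inv])
  have em': "emeasure m' E = emeasure m {x \<in> carrier G. inv x \<in> E}" if "E \<in> borel_sets T" for E
    unfolding m'_def using that im by (simp add: emeasure_distr sets_m space_m vimage_def Int_def conj_commute)
  have p': "prob_space m'" unfolding m'_def by (rule prob_space_distr[OF im])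
  interpret p': prob_space m' by (rule p')
  have sm': "space m' = topspace T" "sets m' = borel_sets T" unfolding m'_def by (auto simp: space_m sets_m topspace_eq)
  have iinv: "{x \<in> carrier G. inv x \<in> A} = (\<lambda>x. inv x) ` A" if "A \<subseteq> carrier G" for A
    using that by (force simp: image_iff)
  have iborel: "{x \<in> carrier G. inv x \<in> A} \<in> borel_sets T" if "A \<in> borel_sets T" for A
    using borel_sets_vimage[OF continuous_inv that] topspace_eq by simp
  have "regular_on T (emeasure m')"
    unfolding regular_on_def
  proof (intro ballI allI impI)
    fix E and e :: ennreal assume E: "E \<in> borel_sets T" "e > 0"
    obtain K V where K: "compactin T K" "openin T V" "K \<subseteq> {x \<in> carrier G. inv x \<in> E}"
       "{x \<in> carrier G. inv x \<in> E} \<subseteq> V" "emeasure m (V - K) < e"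
      using regular_onD[OF fin_regD(4)[OF fin_reg_m] iborel[OF E(1)] E(2)] by (elim exE conjE) (rule that)
    define K' V' where "K' = {x \<in> carrier G. inv x \<in> K}" and "V' = {x \<in> carrier G. inv x \<in> V}"
    have sub: "K \<subseteq> carrier G" "V \<subseteq> carrier G" "E \<subseteq> carrier G"
      using K openin_subset[OF K(2)] borel_sets_subset[OF E(1)] topspace_eq by auto
    have 1: "compactin T K'" unfolding K'_def iinv[OF sub(1)] by (rule image_compactin[OF K(1) continuous_inv])
    have 2: "openin T V'" unfolding V'_def
      using openin_continuous_map_preimage[OF continuous_inv K(2)] topspace_eq by simp
    have 3: "K' \<subseteq> E"
    proof
      fix x assume "x \<in> K'"
      then have "x \<in> carrier G" "inv (inv x) \<in> E" using K(3) unfolding K'_def by blast+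
      then show "x \<in> E" by simp
    qed
    have 4: "E \<subseteq> V'"
    proof
      fix x assume x: "x \<in> E"
      then have xc: "x \<in> carrier G" using sub by blast
      then have "inv x \<in> {x \<in> carrier G. inv x \<in> E}" using x by simp
      then show "x \<in> V'" using xc K(4) unfolding V'_def by blast
    qed
    have "V' - K' \<in> borel_sets T"
      using sets.Diff[of V' m K'] openin_borel_sets[OF 2] compactin_borel_sets[OF Hausdorff 1] sets_m by simp
    then have "emeasure m' (V' - K') = emeasure m {x \<in> carrier G. inv x \<in> V' - K'}" by (rule em')
    also have "{x \<in> carrier G. inv x \<in> V' - K'} = V - K" using sub unfolding K'_def V'_def by auto
    finally show "\<exists>K V. compactin T K \<and> openin T V \<and> K \<subseteq> E \<and> E \<subseteq> V \<and> emeasure m' (V - K) < e"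
      using 1 2 3 4 K(5) by metis
  qed
  then have fr: "fin_reg T m'" unfolding fin_reg_def using sm' p'.finite_measure_axioms by simp
  \<comment> \<open>Inversion turns left translates into right translates, so the image measure
    \<open>m'\<close> is right invariant.\<close>
  have rd: "emeasure m' (right_div y E) = emeasure m' E" if y: "y \<in> carrier G" and E: "E \<in> borel_sets T" for y E
  proof -
    have "{x \<in> carrier G. inv x \<in> right_div y E} = left_div (inv y) {x \<in> carrier G. inv x \<in> E}"
    proof -
      have "inv (inv y \<otimes> x) = inv x \<otimes> y" if "x \<in> carrier G" for x
        using that y by (simp add: inv_mult_group)
      then show ?thesis using y unfolding right_div_def left_div_def by auto
    qed
    then show ?thesis using em'[OF right_div_borel[OF y E]] em'[OF E] emeasure_left_div[OF inv_closed[OF y] iborel[OF E]] by simp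
  qed
  \<comment> \<open>Left invariance of \<open>m\<close> makes one integrand constantly m(E), right
    invariance of \<open>m'\<close> makes the other constantly m'(E), and both measures have total
    mass 1.\<close>
  have "emeasure m' E = emeasure m E" if E: "E \<in> borel_sets T" for E
  proof -
    have "(\<integral>\<^sup>+x. emeasure m (left_div x E) \<partial>m') = (\<integral>\<^sup>+y. emeasure m' (right_div y E) \<partial>m)"
      using fubini_mult[OF fr fin_reg_m E] by blast
    moreover have "(\<integral>\<^sup>+x. emeasure m (left_div x E) \<partial>m') = (\<integral>\<^sup>+x. emeasure m E \<partial>m')"
      by (intro nn_integral_cong emeasure_left_div E) (simp add: sm' topspace_eq)
    moreover have "(\<integral>\<^sup>+y. emeasure m' (right_div y E) \<partial>m) = (\<integral>\<^sup>+y. emeasure m' E \<partial>m)"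
      by (intro nn_integral_cong rd E) (simp add: space_m)
    ultimately show ?thesis by (simp add: emeasure_space_1 p'.emeasure_space_1)
  qed
  then show ?thesis unfolding m'_def[symmetric] by (intro measure_eqI) (auto simp: sm' sets_m)
qed

text \<open>As x y is the inverse of y^-1 x^-1, right translation is left translation conjugated by
  inversion, and both of these preserve \<open>m\<close>.\<close>

lemma distr_right_mult:
  assumes y: "y \<in> carrier G" shows "distr m m (\<lambda>x. x \<otimes> y) = m"
proof -
  have mm: "(\<lambda>x. inv x) \<in> measurable m m" "(\<lambda>x. inv y \<otimes> x) \<in> measurable m m"
    using continuous_inv continuous_left_mult y by (auto intro: measurable_m)
  have "distr m m (\<lambda>x. x \<otimes> y) = distr m m ((\<lambda>x. inv x) \<circ> ((\<lambda>x. inv y \<otimes> x) \<circ> (\<lambda>x. inv x)))"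
    using y by (intro distr_cong) (auto simp: space_m inv_mult_group)
  also have "\<dots> = distr (distr (distr m m (\<lambda>x. inv x)) m (\<lambda>x. inv y \<otimes> x)) m (\<lambda>x. inv x)"
    using mm by (simp add: distr_distr measurable_comp)
  also have "\<dots> = m" using y by (simp add: distr_inv distr_left_mult)
  finally show ?thesis .
qed

lemma integral_left_mult:
  fixes f :: "'a \<Rightarrow> 'b::{banach, second_countable_topology}"
  assumes "y \<in> carrier G" "f \<in> borel_measurable m"
  shows "(LINT x|m. f (y \<otimes> x)) = (LINT x|m. f x)"
  using integral_distr[OF measurable_m[OF continuous_left_mult[OF assms(1)]] assms(2)]
  by (simp add: distr_left_mult[OF assms(1)])

lemma integral_right_mult:
  fixes f :: "'a \<Rightarrow> 'b::{banach, second_countable_topology}"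
  assumes "y \<in> carrier G" "f \<in> borel_measurable m"
  shows "(LINT x|m. f (x \<otimes> y)) = (LINT x|m. f x)"
  using integral_distr[OF measurable_m[OF continuous_right_mult[OF assms(1)]] assms(2)]
  by (simp add: distr_right_mult[OF assms(1)])

lemma integral_inv:
  fixes f :: "'a \<Rightarrow> 'b::{banach, second_countable_topology}"
  assumes "f \<in> borel_measurable m"
  shows "(LINT x|m. f (inv x)) = (LINT x|m. f x)"
  using integral_distr[OF measurable_m[OF continuous_inv] assms] by (simp add: distr_inv)

text \<open>By compactness finitely many left translates of V cover the group, so a null V would
  make the whole group null.\<close>

lemma emeasure_open_pos:
  assumes V: "openin T V" "V \<noteq> {}" shows "measure m V > 0"
proof (rule ccontr)
  assume "\<not> measure m V > 0"
  then have z: "emeasure m V = 0" by (simp add: emeasure_eq_measure zero_less_measure_iff)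
  obtain a where a: "a \<in> V" using V by blast
  have VG: "V \<subseteq> carrier G" using openin_subset[OF V(1)] topspace_eq by simp
  define U where "U x = left_div x V" for x
  have Uo: "openin T (U x)" if "x \<in> carrier G" for x
    using openin_continuous_map_preimage[OF continuous_left_mult[OF that] V(1)] unfolding U_def left_div_def topspace_eq by simp
  have "x \<in> U (a \<otimes> inv x)" if "x \<in> carrier G" for x
    using that a VG unfolding U_def left_div_def by (auto simp: m_assoc)
  moreover have "a \<otimes> inv x \<in> carrier G" if "x \<in> carrier G" for x using that a VG by auto
  ultimately have cov: "topspace T \<subseteq> \<Union>(U ` carrier G)" unfolding topspace_eq by blast
  obtain \<F> where \<F>: "finite \<F>" "\<F> \<subseteq> U ` carrier G" "topspace T \<subseteq> \<Union>\<F>"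
    using compact_space_finite_cover[OF compact _ cov] Uo by auto
  have W0: "emeasure m W = 0" if "W \<in> \<F>" for W
    using that \<F>(2) emeasure_left_div[OF _ openin_borel_sets[OF V(1)]] z unfolding U_def by auto
  have Ws: "W \<in> sets m" if "W \<in> \<F>" for W
    using that \<F>(2) Uo openin_borel_sets sets_m by auto
  have "(\<Union>W\<in>\<F>. W) \<in> null_sets m"
    using \<F>(1) W0 Ws by (intro null_sets.finite_UN) auto
  moreover have "space m = (\<Union>W\<in>\<F>. W)"
    using \<F>(3) Ws[THEN sets.sets_into_space] unfolding topspace_eq space_m by blast
  ultimately have "emeasure m (space m) = 0" by auto
  then show False by (simp add: emeasure_space_1)
qed

text \<open>The heart is \<open>sym\<close>: conjugation by y preserves both \<open>m\<close> and
  \<open>f\<close>, so the measure f dm takes equal values on E y^-1 and y^-1 E. With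
  \<open>convolution_swap\<close> the two convolutions become the same integral against
  \<open>\<nu>\<close>. What precedes places f dm among the regular measures, through the bound of
  its variation by \<open>B\<close> times \<open>m\<close>.\<close>

lemma class_function_central:
  assumes f: "f \<in> borel_measurable m" and B: "\<And>x. x \<in> carrier G \<Longrightarrow> norm (f x) \<le> B"
    and cls: "\<And>x y. x \<in> carrier G \<Longrightarrow> y \<in> carrier G \<Longrightarrow> f (x \<otimes> y) = f (y \<otimes> x)"
  shows "central_function G T m f"
proof -
  have fi: "integrable m f" by (rule integrable_const_bound[where B=B]) (use f B in \<open>auto simp: space_m\<close>)
  define \<mu> where "\<mu> E = (LINT x:E|m. f x)" for E
  have B0: "B \<ge> 0" using B[OF one_closed] norm_ge_zero order_trans by blast
  have nB: "norm (\<mu> E) \<le> B * measure m E" if E: "E \<in> borel_sets T" for E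
  proof -
    have "norm (\<mu> E) \<le> (LINT x|m. norm (indicat_real E x *\<^sub>R f x))"
      unfolding \<mu>_def set_lebesgue_integral_def by (rule integral_norm_bound)
    also have "\<dots> \<le> (LINT x|m. B * indicator E x)"
    proof (rule integral_mono)
      show "integrable m (\<lambda>x. norm (indicat_real E x *\<^sub>R f x))"
        using E fi sets_m by (intro integrable_norm integrable_mult_indicator) auto
      show "integrable m (\<lambda>x. B * indicat_real E x)" using E sets_m by (auto intro!: integrable_real_indicator simp: less_top[symmetric])
      fix x assume "x \<in> space m" then show "norm (indicat_real E x *\<^sub>R f x) \<le> B * indicat_real E x"
        using B by (auto simp: indicator_def space_m)
    qed
    also have "\<dots> = B * measure m E" using E sets_m by (simp add: Int_absorb2 sets.sets_into_space)
    finally show ?thesis .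
  qed
  have cm: "complex_measure T \<mu>"
    unfolding complex_measure_def
  proof (intro allI impI)
    fix A :: "nat \<Rightarrow> 'a set" assume A: "range A \<subseteq> borel_sets T \<and> disjoint_family A"
    have si: "set_integrable m (\<Union>n. A n) f"
      unfolding set_integrable_def using A fi sets_m by (intro integrable_mult_indicator) auto
    have "(\<lambda>n. \<mu> (\<Union>i\<in>{..<n}. A i)) \<longlonglongrightarrow> \<mu> (\<Union>n. \<Union>i\<in>{..<n}. A i)"
    proof -
      have "(\<Union>n. \<Union>i\<in>{..<n}. A i) = (\<Union>n. A n)" by auto
      moreover have "(\<Union>i\<in>{..<n}. A i) \<in> sets m" for n using A sets_m by (intro sets.finite_UN) auto
      moreover have "incseq (\<lambda>n. \<Union>i\<in>{..<n}. A i)" unfolding incseq_def by (intro allI impI UN_mono) auto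
      ultimately show ?thesis unfolding \<mu>_def
        using si by (intro set_integral_cont_up) auto
    qed
    also have "(\<Union>n. \<Union>i\<in>{..<n}. A i) = (\<Union>n. A n)" by auto
    also have "(\<lambda>n. \<mu> (\<Union>i\<in>{..<n}. A i)) = (\<lambda>n. \<Sum>i<n. \<mu> (A i))"
    proof
      fix n show "\<mu> (\<Union>i\<in>{..<n}. A i) = (\<Sum>i<n. \<mu> (A i))"
        unfolding \<mu>_def using A sets_m fi
        by (intro set_integral_finite_Union)
          (auto simp: set_integrable_def disjoint_family_on_def intro!: integrable_mult_indicator)
    qed
    finally show "(\<lambda>n. \<mu> (A n)) sums \<mu> (\<Union>n. A n)" unfolding sums_def .
  qed
  have tv: "total_variation T \<mu> E \<le> ennreal B * emeasure m E" if E: "E \<in> borel_sets T" for E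
    unfolding total_variation_def
  proof (rule SUP_least)
    fix P assume "P \<in> {P. finite P \<and> P \<subseteq> borel_sets T \<and> disjoint P \<and> \<Union> P = E}"
    then have P: "finite P" "P \<subseteq> borel_sets T" "disjoint P" "\<Union> P = E" by auto
    have "(\<Sum>A\<in>P. ennreal (norm (\<mu> A))) \<le> (\<Sum>A\<in>P. ennreal B * emeasure m A)"
      using nB P B0 by (intro sum_mono) (auto simp: emeasure_eq_measure ennreal_mult[symmetric] intro!: ennreal_leI)
    also have "\<dots> = ennreal B * (\<Sum>A\<in>P. emeasure m A)" by (simp add: sum_distrib_left)
    also have "(\<Sum>A\<in>P. emeasure m A) = emeasure m (\<Union>A\<in>P. A)"
      using P sets_m by (intro sum_emeasure) (auto simp: disjoint_family_on_def disjoint_def)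
    finally show "(\<Sum>A\<in>P. ennreal (norm (\<mu> A))) \<le> ennreal B * emeasure m E" using P by simp
  qed
  have reg: "regular_on T (total_variation T \<mu>)"
    unfolding regular_on_def
  proof (intro ballI allI impI)
    fix E and e :: ennreal assume E: "E \<in> borel_sets T" "e > 0"
    obtain e' where e': "e' > 0" "ennreal e' < e" using E(2)
      by (metis dense ennreal_cases ennreal_less_zero_iff not_less_iff_gr_or_eq top.not_eq_extremum)
    \<comment> \<open>Dividing by \<open>B + 1\<close> instead of \<open>B\<close> also covers the
      case \<open>B = 0\<close>.\<close>
    obtain K V where K: "compactin T K" "openin T V" "K \<subseteq> E" "E \<subseteq> V" "emeasure m (V - K) < ennreal (e' / (B + 1))"
      using regular_onD[OF fin_regD(4)[OF fin_reg_m] E(1), of "ennreal (e' / (B + 1))"] e' B0 by auto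
    have VK: "V - K \<in> borel_sets T"
      using sets.Diff[of V m K] openin_borel_sets[OF K(2)] compactin_borel_sets[OF Hausdorff K(1)] sets_m by simp
    have "measure m (V - K) < e' / (B + 1)" using K(5) by (simp add: emeasure_eq_measure ennreal_less_iff)
    then have "B * measure m (V - K) \<le> B * (e' / (B + 1))" using B0 by (intro mult_left_mono) auto
    also have "\<dots> \<le> e'" using B0 e' by (simp add: field_simps)
    finally have "ennreal B * emeasure m (V - K) \<le> ennreal e'"
      using B0 by (simp add: emeasure_eq_measure ennreal_mult[symmetric] ennreal_leI)
    then have "total_variation T \<mu> (V - K) < e" using tv[OF VK] e'(2) by (meson le_less_trans order_trans)
    then show "\<exists>K V. compactin T K \<and> openin T V \<and> K \<subseteq> E \<and> E \<subseteq> V \<and> total_variation T \<mu> (V - K) < e"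
      using K by blast
  qed
  have \<mu>: "\<mu> \<in> regular_measures T" unfolding regular_measures_def using cm reg by simp
  have sym: "\<mu> (right_div y E) = \<mu> (left_div y E)" if y: "y \<in> carrier G" and E: "E \<in> borel_sets T" for y E
  proof -
    have mE: "left_div y E \<in> sets m" using left_div_borel[OF y E] sets_m by simp
    have fm: "(\<lambda>x. indicat_real (left_div y E) x *\<^sub>R f x) \<in> borel_measurable m"
      using f mE by measurable
    then have fm': "(\<lambda>x. indicat_real (left_div y E) (inv y \<otimes> x) *\<^sub>R f (inv y \<otimes> x)) \<in> borel_measurable m"
      using measurable_compose[OF measurable_m[OF continuous_left_mult[OF inv_closed[OF y]]] fm] by simp
    \<comment> \<open>The substitution of y^-1 x y for x, carried out as a left translation followed
      by a right translation.\<close>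
    have "\<mu> (left_div y E) = (LINT x|m. indicat_real (left_div y E) (inv y \<otimes> (x \<otimes> y)) *\<^sub>R f (inv y \<otimes> (x \<otimes> y)))"
      unfolding \<mu>_def set_lebesgue_integral_def
      using integral_left_mult[OF inv_closed[OF y] fm] integral_right_mult[OF y fm'] by simp
    also have "\<dots> = \<mu> (right_div y E)"
      unfolding \<mu>_def set_lebesgue_integral_def
    proof (intro Bochner_Integration.integral_cong refl arg_cong2[where f="(*\<^sub>R)"])
      fix x assume "x \<in> space m"
      then have x: "x \<in> carrier G" by (simp add: space_m)
      have "y \<otimes> (inv y \<otimes> (x \<otimes> y)) = x \<otimes> y" using x y by (simp add: m_assoc[symmetric])
      then show "indicat_real (left_div y E) (inv y \<otimes> (x \<otimes> y)) = indicat_real (right_div y E) x"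
        using x y by (simp add: indicator_def left_div_def right_div_def)
      have "f (inv y \<otimes> (x \<otimes> y)) = f ((x \<otimes> y) \<otimes> inv y)" using x y by (intro cls) auto
      then show "f (inv y \<otimes> (x \<otimes> y)) = f x" using x y by (simp add: m_assoc)
    qed
    finally show ?thesis ..
  qed
  have "convolution G T \<mu> \<nu> E = convolution G T \<nu> \<mu> E"
    if \<nu>: "\<nu> \<in> regular_measures T" and E: "E \<in> borel_sets T" for \<nu> E
  proof -
    have "convolution G T \<mu> \<nu> E = complex_integral T \<nu> (\<lambda>y. \<mu> (right_div y E))"
      by (rule convolution_swap[OF \<mu> \<nu> E])
    also have "\<dots> = convolution G T \<nu> \<mu> E"
    proof -
      have "(LINT y|pos_part T \<phi>. \<mu> (right_div y E)) = (LINT y|pos_part T \<phi>. \<mu> (left_div y E))" for \<phi>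
        by (rule Bochner_Integration.integral_cong) (simp_all add: sym E topspace_eq)
      then show ?thesis unfolding convolution_def complex_integral_def left_div_def[symmetric] by simp
    qed
    finally show ?thesis .
  qed
  then show ?thesis unfolding central_function_def central_measure_def \<mu>_def[symmetric] using fi \<mu> by blast
qed

end

section \<open>Schur orthogonality\<close>

lemma subspace_vec_iff:
  "VectorSpace.subspace class_ring W (module_vec TYPE(complex) n) \<longleftrightarrow>
    W \<subseteq> carrier_vec n \<and> 0\<^sub>v n \<in> W \<and> (\<forall>v\<in>W. \<forall>w\<in>W. v + w \<in> W) \<and> (\<forall>c. \<forall>v\<in>W. c \<cdot>\<^sub>v v \<in> W)"
  unfolding subspace_def submodule_def
  using vec_vs[of n, where 'a=complex] vec_module[of n, where 'a=complex]
  by (auto simp: module_vec_simps class_ring_simps)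

lemma dim_mat_adjoint [simp]:
  "dim_row (mat_adjoint A) = dim_col A" "dim_col (mat_adjoint A) = dim_row A"
  unfolding mat_adjoint_def by auto

lemma index_mat_adjoint [simp]:
  fixes A :: "complex mat"
  shows "i < dim_col A \<Longrightarrow> j < dim_row A \<Longrightarrow> mat_adjoint A $$ (i, j) = cnj (A $$ (j, i))"
  unfolding mat_adjoint_def by (simp add: mat_of_rows_index)

lemma mat_adjoint_carrier [simp]:
  "A \<in> carrier_mat n k \<Longrightarrow> mat_adjoint A \<in> carrier_mat k n"
  by (intro carrier_matI) (auto dest: carrier_matD)

lemma index_mult_mat_sum:
  "A \<in> carrier_mat n k \<Longrightarrow> B \<in> carrier_mat k l \<Longrightarrow> i < n \<Longrightarrow> j < l \<Longrightarrow>
   (A * B) $$ (i, j) = (\<Sum>r<k. A $$ (i, r) * B $$ (r, j))"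
  by (auto simp: scalar_prod_def lessThan_atLeast0)

lemma mat_adjoint_mult:
  fixes A B :: "complex mat"
  assumes "A \<in> carrier_mat n k" "B \<in> carrier_mat k l"
  shows "mat_adjoint (A * B) = mat_adjoint B * mat_adjoint A"
proof (rule eq_matI)
  fix i j assume "i < dim_row (mat_adjoint B * mat_adjoint A)" "j < dim_col (mat_adjoint B * mat_adjoint A)"
  then have ij: "i < l" "j < n" using assms by auto
  have "mat_adjoint (A * B) $$ (i, j) = cnj ((A * B) $$ (j, i))" using ij assms by simp
  also have "\<dots> = (\<Sum>r<k. cnj (A $$ (j, r)) * cnj (B $$ (r, i)))"
    by (subst index_mult_mat_sum[OF assms ij(2,1)]) simp
  also have "\<dots> = (\<Sum>r<k. mat_adjoint B $$ (i, r) * mat_adjoint A $$ (r, j))"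
    using assms ij by (intro sum.cong) auto
  also have "\<dots> = (mat_adjoint B * mat_adjoint A) $$ (i, j)"
    by (rule index_mult_mat_sum[symmetric]) (use assms ij in auto)
  finally show "mat_adjoint (A * B) $$ (i, j) = (mat_adjoint B * mat_adjoint A) $$ (i, j)" .
qed (use assms in auto)

lemma cnj_mult_self: "cnj z * z = complex_of_real ((norm z)\<^sup>2)" "z * cnj z = complex_of_real ((norm z)\<^sup>2)"
  by (metis complex_norm_square mult.commute)+

lemma borel_measurable_cnj [measurable (raw)]:
  "f \<in> borel_measurable M \<Longrightarrow> (\<lambda>x. cnj (f x)) \<in> borel_measurable M"
  by (erule measurable_compose) (intro borel_measurable_continuous_onI continuous_intros)

lemma mat_adjoint_adjoint: "mat_adjoint (mat_adjoint A) = (A :: complex mat)"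
  by (rule eq_matI) auto

lemma smult_one_mult_vec: "v \<in> carrier_vec n \<Longrightarrow> (c \<cdot>\<^sub>m 1\<^sub>m n) *\<^sub>v v = c \<cdot>\<^sub>v (v :: complex vec)"
  by (rule eq_vecI) (auto simp: scalar_prod_def if_distrib[of "\<lambda>z. z * _"] if_distrib[of "\<lambda>z. c * z"] sum.delta cong: if_cong)

context compact_group
begin

lemma irrepsD: "U \<in> irreps G T \<Longrightarrow> unitary_rep G T U" "U \<in> irreps G T \<Longrightarrow> irreducible_rep G U"
  "U \<in> irreps G T \<Longrightarrow> rep_dim G U > 0"
  unfolding irreps_def irreducible_rep_def by auto

lemma rep_carrier: "unitary_rep G T U \<Longrightarrow> x \<in> carrier G \<Longrightarrow> U x \<in> carrier_mat (rep_dim G U) (rep_dim G U)"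
  unfolding unitary_rep_def unitary_mat_def by blast

lemma rep_unitary: "unitary_rep G T U \<Longrightarrow> x \<in> carrier G \<Longrightarrow> mat_adjoint (U x) * U x = 1\<^sub>m (rep_dim G U)"
  unfolding unitary_rep_def unitary_mat_def by blast

lemma rep_mult: "unitary_rep G T U \<Longrightarrow> x \<in> carrier G \<Longrightarrow> y \<in> carrier G \<Longrightarrow> U (x \<otimes> y) = U x * U y"
  unfolding unitary_rep_def by blast

lemma rep_continuous: "unitary_rep G T U \<Longrightarrow> i < rep_dim G U \<Longrightarrow> j < rep_dim G U \<Longrightarrow>
  continuous_map T euclidean (\<lambda>x. U x $$ (i, j))"
  unfolding unitary_rep_def by blast

lemma rep_one:
  assumes U: "unitary_rep G T U" shows "U \<one> = 1\<^sub>m (rep_dim G U)"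
proof -
  note c = rep_carrier[OF U one_closed]
  have "U \<one> = (mat_adjoint (U \<one>) * U \<one>) * U \<one>" using rep_unitary[OF U one_closed] c by simp
  also have "\<dots> = mat_adjoint (U \<one>) * (U \<one> * U \<one>)" using c by (intro assoc_mult_mat) auto
  also have "U \<one> * U \<one> = U \<one>" using rep_mult[OF U one_closed one_closed] by simp
  finally show ?thesis using rep_unitary[OF U one_closed] by simp
qed

lemma rep_inv:
  assumes U: "unitary_rep G T U" and x: "x \<in> carrier G" shows "U (inv x) = mat_adjoint (U x)"
proof -
  note c = rep_carrier[OF U x] rep_carrier[OF U inv_closed[OF x]]
  have "U x * U (inv x) = 1\<^sub>m (rep_dim G U)"
    using rep_mult[OF U x inv_closed[OF x]] x rep_one[OF U] by simp
  then have "mat_adjoint (U x) = mat_adjoint (U x) * (U x * U (inv x))" using c by simp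
  also have "\<dots> = (mat_adjoint (U x) * U x) * U (inv x)" using c by (intro assoc_mult_mat[symmetric]) auto
  finally show ?thesis using rep_unitary[OF U x] c by simp
qed

lemma rep_mult_index:
  assumes U: "unitary_rep G T U" and "x \<in> carrier G" "y \<in> carrier G" "i < rep_dim G U" "j < rep_dim G U"
  shows "U (x \<otimes> y) $$ (i, j) = (\<Sum>k<rep_dim G U. U x $$ (i, k) * U y $$ (k, j))"
  unfolding rep_mult[OF assms(1-3)]
  by (rule index_mult_mat_sum[OF rep_carrier rep_carrier]) (use assms in auto)

lemma rep_inv_index:
  assumes "unitary_rep G T U" "x \<in> carrier G" "i < rep_dim G U" "j < rep_dim G U"
  shows "U (inv x) $$ (i, j) = cnj (U x $$ (j, i))"
  unfolding rep_inv[OF assms(1,2)] using rep_carrier[OF assms(1,2)] assms(3,4) by auto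

lemma rep_unitary_index:
  assumes U: "unitary_rep G T U" and "x \<in> carrier G" "i < rep_dim G U" "j < rep_dim G U"
  shows "(\<Sum>k<rep_dim G U. cnj (U x $$ (k, i)) * U x $$ (k, j)) = (if i = j then 1 else 0)"
proof -
  have "(\<Sum>k<rep_dim G U. cnj (U x $$ (k, i)) * U x $$ (k, j)) = (\<Sum>k<rep_dim G U. U (inv x) $$ (i, k) * U x $$ (k, j))"
    using assms by (intro sum.cong) (auto simp: rep_inv_index)
  also have "\<dots> = U (inv x \<otimes> x) $$ (i, j)" using assms by (intro rep_mult_index[symmetric]) auto
  finally show ?thesis using assms by (simp add: rep_one)
qed

lemma rep_norm_le_1:
  assumes U: "unitary_rep G T U" and "x \<in> carrier G" "i < rep_dim G U" "j < rep_dim G U"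
  shows "norm (U x $$ (i, j)) \<le> 1"
proof -
  have "(\<Sum>k<rep_dim G U. complex_of_real ((norm (U x $$ (k, j)))\<^sup>2)) = 1"
    using rep_unitary_index[OF assms(1,2,4,4)] unfolding cnj_mult_self by simp
  then have "(\<Sum>k<rep_dim G U. (norm (U x $$ (k, j)))\<^sup>2) = 1"
    by (metis of_real_eq_1_iff of_real_sum)
  moreover have "(norm (U x $$ (i, j)))\<^sup>2 \<le> (\<Sum>k<rep_dim G U. (norm (U x $$ (k, j)))\<^sup>2)"
    using assms by (intro member_le_sum) auto
  ultimately show ?thesis by (simp add: power_le_one_iff abs_square_le_1)
qed

text \<open>The kernel of an intertwiner is an invariant subspace. Irreducibility leaves only zero
  or everything, and \<open>v\<close> excludes zero.\<close>

lemma intertwiner_kernel: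
  assumes U: "U \<in> irreps G T" and A: "A \<in> carrier_mat n (rep_dim G U)"
    and W: "\<And>x. x \<in> carrier G \<Longrightarrow> W x \<in> carrier_mat n n"
    and AU: "\<And>x. x \<in> carrier G \<Longrightarrow> A * U x = W x * A"
    and v: "v \<in> carrier_vec (rep_dim G U)" "v \<noteq> 0\<^sub>v (rep_dim G U)" "A *\<^sub>v v = 0\<^sub>v n"
  shows "A = 0\<^sub>m n (rep_dim G U)"
proof -
  define d where "d = rep_dim G U"
  note A = A[folded d_def] and v = v[folded d_def]
  define K where "K = {v \<in> carrier_vec d. A *\<^sub>v v = 0\<^sub>v n}"
  have "VectorSpace.subspace class_ring K (module_vec TYPE(complex) d)"
    unfolding subspace_vec_iff K_def using A by (auto simp: mult_add_distrib_mat_vec mult_mat_vec)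
  moreover have "U x *\<^sub>v w \<in> K" if x: "x \<in> carrier G" and w: "w \<in> K" for x w
  proof -
    have Ux: "U x \<in> carrier_mat d d" using rep_carrier[OF irrepsD(1)[OF U] x] unfolding d_def .
    have w': "w \<in> carrier_vec d" "A *\<^sub>v w = 0\<^sub>v n" using w unfolding K_def by auto
    have "A *\<^sub>v (U x *\<^sub>v w) = (A * U x) *\<^sub>v w" using A Ux w' by simp
    also have "\<dots> = W x *\<^sub>v (A *\<^sub>v w)" unfolding AU[OF x] using W[OF x] A w' by simp
    also have "\<dots> = 0\<^sub>v n" using w' W[OF x] by auto
    finally show ?thesis using Ux w' unfolding K_def by auto
  qed
  ultimately have "K = {0\<^sub>v d} \<or> K = carrier_vec d"
    using irrepsD(2)[OF U] unfolding irreducible_rep_def d_def by blast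
  moreover have "v \<in> K" using v unfolding K_def by simp
  ultimately have K: "K = carrier_vec d" using v by auto
  have "A = 0\<^sub>m n d"
  proof (rule eq_matI)
    fix i j assume "i < dim_row (0\<^sub>m n d :: complex mat)" "j < dim_col (0\<^sub>m n d :: complex mat)"
    then have ij: "i < n" "j < d" by auto
    have "unit_vec d j \<in> K" unfolding K by simp
    then have "A *\<^sub>v unit_vec d j = 0\<^sub>v n" unfolding K_def by simp
    then have "(A *\<^sub>v unit_vec d j) $ i = 0" using ij by simp
    then show "A $$ (i, j) = 0\<^sub>m n d $$ (i, j)" using ij A by simp
  qed (use A in auto)
  then show ?thesis unfolding d_def .
qed

text \<open>Over the complex numbers \<open>B\<close> has an eigenvalue c, and \<open>B - c\<close>
  is an intertwiner that kills an eigenvector.\<close>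

lemma schur_scalar:
  assumes U: "U \<in> irreps G T" and B: "B \<in> carrier_mat (rep_dim G U) (rep_dim G U)"
    and BU: "\<And>x. x \<in> carrier G \<Longrightarrow> B * U x = U x * B"
  obtains c where "B = c \<cdot>\<^sub>m 1\<^sub>m (rep_dim G U)"
proof -
  define d where "d = rep_dim G U"
  note B = B[folded d_def]
  have "d > 0" using irrepsD(3)[OF U] unfolding d_def .
  then obtain c where "eigenvalue B c" using spectrum_non_empty[OF B] unfolding spectrum_def by auto
  then obtain v where v: "v \<in> carrier_vec d" "v \<noteq> 0\<^sub>v d" "B *\<^sub>v v = c \<cdot>\<^sub>v v"
    using B unfolding eigenvalue_def eigenvector_def by auto
  define A where "A = B - c \<cdot>\<^sub>m 1\<^sub>m d"
  have A: "A \<in> carrier_mat d d" unfolding A_def using B by auto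
  have "A *\<^sub>v v = 0\<^sub>v d"
    unfolding A_def using B v by (simp add: minus_mult_distrib_mat_vec smult_one_mult_vec)
  moreover have "A * U x = U x * A" if x: "x \<in> carrier G" for x
  proof -
    have Ux: "U x \<in> carrier_mat d d" using rep_carrier[OF irrepsD(1)[OF U] x] unfolding d_def .
    have "A * U x = B * U x - c \<cdot>\<^sub>m U x"
      unfolding A_def using B Ux by (simp add: minus_mult_distrib_mat mult_smult_assoc_mat[OF one_carrier_mat])
    moreover have "U x * A = U x * B - c \<cdot>\<^sub>m U x"
      unfolding A_def using B Ux by (simp add: mult_minus_distrib_mat mult_smult_distrib[OF _ one_carrier_mat])
    ultimately show ?thesis using BU[OF x] by simp
  qed
  ultimately have "A = 0\<^sub>m d d"
    using intertwiner_kernel[OF U A[unfolded d_def] rep_carrier[OF irrepsD(1)[OF U]]] v unfolding d_def by simp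
  then have "B = c \<cdot>\<^sub>m 1\<^sub>m d" using B unfolding A_def
    by (intro eq_matI) (auto simp: mat_eq_iff)
  then show ?thesis using that unfolding d_def by blast
qed

text \<open>\<open>rep_equiv\<close> asks for equal dimensions and a unitary intertwiner, not just a
  nonzero one. Both products of \<open>A\<close> with its adjoint commute with the representations,
  hence are scalar; they share one positive value, and dividing \<open>A\<close> by its square root
  makes the matrix unitary.\<close>

lemma schur_equiv:
  assumes U: "U \<in> irreps G T" and V: "V \<in> irreps G T"
    and A: "A \<in> carrier_mat (rep_dim G V) (rep_dim G U)"
    and AU: "\<And>x. x \<in> carrier G \<Longrightarrow> A * U x = V x * A"
    and A0: "A \<noteq> 0\<^sub>m (rep_dim G V) (rep_dim G U)"
  shows "rep_equiv G U V"
proof -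
  define d where "d = rep_dim G U"
  define e where "e = rep_dim G V"
  note A = A[folded d_def e_def] and A0 = A0[folded d_def e_def]
  note Ux = rep_carrier[OF irrepsD(1)[OF U], folded d_def] and Vx = rep_carrier[OF irrepsD(1)[OF V], folded e_def]
  define A' where "A' = mat_adjoint A"
  have A': "A' \<in> carrier_mat d e" unfolding A'_def using A by simp
  have A'V: "A' * V x = U x * A'" if x: "x \<in> carrier G" for x
  proof -
    have "mat_adjoint (A * U (inv x)) = mat_adjoint (V (inv x) * A)" using AU x by simp
    then have "mat_adjoint (U (inv x)) * A' = A' * mat_adjoint (V (inv x))"
      unfolding A'_def using mat_adjoint_mult[OF A Ux] mat_adjoint_mult[OF Vx A] x by simp
    then show ?thesis
      using rep_inv[OF irrepsD(1)[OF U] inv_closed[OF x]] rep_inv[OF irrepsD(1)[OF V] inv_closed[OF x]] x by simp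
  qed
  have "(A' * A) * U x = U x * (A' * A)" if x: "x \<in> carrier G" for x
  proof -
    have "(A' * A) * U x = A' * (A * U x)" using A A' Ux[OF x] by simp
    also have "\<dots> = (A' * V x) * A" unfolding AU[OF x] using A A' Vx[OF x] by simp
    also have "\<dots> = U x * (A' * A)" unfolding A'V[OF x] using A A' Ux[OF x] by simp
    finally show ?thesis .
  qed
  then obtain c where c: "A' * A = c \<cdot>\<^sub>m 1\<^sub>m d"
    using schur_scalar[OF U, of "A' * A"] A A' unfolding d_def by auto
  have "(A * A') * V x = V x * (A * A')" if x: "x \<in> carrier G" for x
  proof -
    have "(A * A') * V x = A * (A' * V x)" using A A' Vx[OF x] by simp
    also have "\<dots> = (A * U x) * A'" unfolding A'V[OF x] using A A' Ux[OF x] by simp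
    also have "\<dots> = V x * (A * A')" unfolding AU[OF x] using A A' Vx[OF x] by simp
    finally show ?thesis .
  qed
  then obtain c' where c': "A * A' = c' \<cdot>\<^sub>m 1\<^sub>m e"
    using schur_scalar[OF V, of "A * A'"] A A' unfolding e_def by auto
  \<comment> \<open>Associativity of the product A A' A equates the two scalars as soon as some
    entry of \<open>A\<close> is nonzero.\<close>
  obtain i0 j0 where ij0: "i0 < e" "j0 < d" "A $$ (i0, j0) \<noteq> 0"
    using A0 A by (metis carrier_matD eq_matI index_zero_mat(1) index_zero_mat(2) index_zero_mat(3))
  have "c \<cdot>\<^sub>m A = A * (A' * A)" unfolding c using A by (simp add: mult_smult_distrib[OF _ one_carrier_mat])
  also have "\<dots> = (A * A') * A" using A A' by (metis assoc_mult_mat)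
  also have "\<dots> = c' \<cdot>\<^sub>m A" unfolding c' using A by (simp add: mult_smult_assoc_mat[OF one_carrier_mat])
  finally have "(c \<cdot>\<^sub>m A) $$ (i0, j0) = (c' \<cdot>\<^sub>m A) $$ (i0, j0)" by simp
  then have cc': "c = c'" using ij0 A by simp
  have diag: "(\<Sum>k<e. (norm (A $$ (k, j)))\<^sup>2) = c" if j: "j < d" for j
  proof -
    have "c = (A' * A) $$ (j, j)" unfolding c using j by simp
    also have "\<dots> = (\<Sum>k<e. A' $$ (j, k) * A $$ (k, j))" by (rule index_mult_mat_sum[OF A' A j j])
    also have "\<dots> = (\<Sum>k<e. (norm (A $$ (k, j)))\<^sup>2)"
      unfolding of_real_sum cnj_mult_self(1)[symmetric] A'_def using A j by (intro sum.cong) auto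
    finally show ?thesis ..
  qed
  have diag': "(\<Sum>j<d. (norm (A $$ (k, j)))\<^sup>2) = c" if k: "k < e" for k
  proof -
    have "c = (A * A') $$ (k, k)" unfolding c' cc' using k by simp
    also have "\<dots> = (\<Sum>j<d. A $$ (k, j) * A' $$ (j, k))" by (rule index_mult_mat_sum[OF A A' k k])
    also have "\<dots> = (\<Sum>j<d. (norm (A $$ (k, j)))\<^sup>2)"
      unfolding of_real_sum cnj_mult_self(2)[symmetric] A'_def using A k by (intro sum.cong) auto
    finally show ?thesis ..
  qed
  define r where "r = (\<Sum>k<e. (norm (A $$ (k, j0)))\<^sup>2)"
  have cr: "c = of_real r" unfolding r_def using diag[OF ij0(2)] by simp
  have "0 < (norm (A $$ (i0, j0)))\<^sup>2" using ij0 by simp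
  also have "\<dots> \<le> r" unfolding r_def using ij0 by (intro member_le_sum) auto
  finally have r: "r > 0" .
  \<comment> \<open>The squared moduli of all entries of \<open>A\<close> are summed by columns and
    by rows; as c is positive, the dimensions agree.\<close>
  have "of_nat d * c = (\<Sum>j<d. \<Sum>k<e. complex_of_real ((norm (A $$ (k, j)))\<^sup>2))" using diag by simp
  also have "\<dots> = (\<Sum>k<e. \<Sum>j<d. complex_of_real ((norm (A $$ (k, j)))\<^sup>2))" by (rule sum.swap)
  also have "\<dots> = of_nat e * c" using diag' by simp
  finally have de: "d = e" using r cr by simp
  define P where "P = of_real (1 / sqrt r) \<cdot>\<^sub>m A"
  have P: "P \<in> carrier_mat d d" unfolding P_def using A de by simp
  have "mat_adjoint P = of_real (1 / sqrt r) \<cdot>\<^sub>m A'"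
    unfolding P_def A'_def by (rule eq_matI) auto
  then have "mat_adjoint P * P = of_real (1 / sqrt r) \<cdot>\<^sub>m (of_real (1 / sqrt r) \<cdot>\<^sub>m (A' * A))"
    unfolding P_def
    by (simp only: mult_smult_assoc_mat[OF A' smult_carrier_mat[OF A]] mult_smult_distrib[OF A' A])
  also have "\<dots> = 1\<^sub>m d"
  proof -
    have "complex_of_real (1 / sqrt r) * (complex_of_real (1 / sqrt r) * c) = 1"
    proof -
      have "(1 / sqrt r) * ((1 / sqrt r) * r) = 1" using r by (simp add: field_simps)
      then show ?thesis unfolding cr of_real_mult[symmetric] by simp
    qed
    then show ?thesis unfolding c by (intro eq_matI) auto
  qed
  finally have "unitary_mat d P" unfolding unitary_mat_def using P by simp
  moreover have "P * U x = V x * P" if x: "x \<in> carrier G" for x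
    unfolding P_def mult_smult_assoc_mat[OF A Ux[OF x]] mult_smult_distrib[OF Vx[OF x] A] AU[OF x] ..
  ultimately show ?thesis unfolding rep_equiv_def using de d_def e_def by auto
qed

end

context haar_group
begin

lemma coef_measurable: "unitary_rep G T U \<Longrightarrow> i < rep_dim G U \<Longrightarrow> j < rep_dim G U \<Longrightarrow>
   (\<lambda>x. U x $$ (i, j)) \<in> borel_measurable m"
  by (intro borel_measurable_m rep_continuous)

lemma coef_mult_integrable:
  assumes "unitary_rep G T U" "i < rep_dim G U" "a < rep_dim G U"
    and "unitary_rep G T V" "j < rep_dim G V" "b < rep_dim G V"
  shows "integrable m (\<lambda>x. U x $$ (i, a) * cnj (V x $$ (j, b)))"
proof (rule integrable_const_bound[where B=1])
  show "AE x in m. norm (U x $$ (i, a) * cnj (V x $$ (j, b))) \<le> 1"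
    using assms rep_norm_le_1 by (intro AE_I2) (auto simp: space_m norm_mult intro!: mult_le_one)
  show "(\<lambda>x. U x $$ (i, a) * cnj (V x $$ (j, b))) \<in> borel_measurable m"
    using coef_measurable assms by measurable
qed

text \<open>\<open>A\<close> is the average over x of V(x) E U(x)^-1, where E is the matrix unit
  with its 1 at position (a, b). Invariance of \<open>m\<close> under left translation makes any
  such average an intertwiner.\<close>

lemma coef_intertwiner:
  assumes U: "unitary_rep G T U" and V: "unitary_rep G T V"
    and ab: "a < rep_dim G V" "b < rep_dim G U" and y: "y \<in> carrier G"
  defines "A \<equiv> mat (rep_dim G V) (rep_dim G U) (\<lambda>(i, j). LINT x|m. V x $$ (i, a) * cnj (U x $$ (j, b)))"
  shows "A * U y = V y * A"
proof (rule eq_matI)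
  define d where "d = rep_dim G U"
  define e where "e = rep_dim G V"
  have A: "A \<in> carrier_mat e d" unfolding A_def d_def e_def by simp
  have c: "U y \<in> carrier_mat d d" "V y \<in> carrier_mat e e" using rep_carrier U V y unfolding d_def e_def by auto
  fix i l assume "i < dim_row (V y * A)" "l < dim_col (V y * A)"
  then have il: "i < e" "l < d" using A c by auto
  note ab = ab[folded d_def e_def]
  have "(A * U y) $$ (i, l) = (\<Sum>j<d. A $$ (i, j) * U y $$ (j, l))" by (rule index_mult_mat_sum[OF A c(1) il])
  also have "\<dots> = (\<Sum>j<d. LINT x|m. V x $$ (i, a) * cnj (U x $$ (j, b)) * U y $$ (j, l))"
    using il coef_mult_integrable[OF V _ _ U] ab unfolding A_def d_def e_def by (intro sum.cong) auto
  also have "\<dots> = (LINT x|m. (\<Sum>j<d. V x $$ (i, a) * cnj (U x $$ (j, b)) * U y $$ (j, l)))"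
    using il ab coef_mult_integrable[OF V _ _ U] unfolding d_def e_def by (intro Bochner_Integration.integral_sum[symmetric]) auto
  also have "\<dots> = (LINT x|m. V x $$ (i, a) * cnj (U (inv y \<otimes> x) $$ (l, b)))"
  proof (intro Bochner_Integration.integral_cong refl)
    fix x assume "x \<in> space m" then have x: "x \<in> carrier G" by (simp add: space_m)
    have "cnj (U (inv y \<otimes> x) $$ (l, b)) = (\<Sum>j<d. cnj (U (inv y) $$ (l, j)) * cnj (U x $$ (j, b)))"
      using rep_mult_index[OF U inv_closed[OF y] x] il ab unfolding d_def by simp
    also have "\<dots> = (\<Sum>j<d. U y $$ (j, l) * cnj (U x $$ (j, b)))"
      using rep_inv_index[OF U y] il unfolding d_def by (intro sum.cong) auto
    finally show "(\<Sum>j<d. V x $$ (i, a) * cnj (U x $$ (j, b)) * U y $$ (j, l)) = V x $$ (i, a) * cnj (U (inv y \<otimes> x) $$ (l, b))"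
      by (simp add: sum_distrib_left mult_ac)
  qed
  also have "\<dots> = (LINT x|m. V (y \<otimes> x) $$ (i, a) * cnj (U (inv y \<otimes> (y \<otimes> x)) $$ (l, b)))"
  proof (rule integral_left_mult[OF y, symmetric])
    have "(\<lambda>x. U (inv y \<otimes> x) $$ (l, b)) \<in> borel_measurable m"
      using measurable_compose[OF measurable_m[OF continuous_left_mult[OF inv_closed[OF y]]] coef_measurable[OF U]] il ab
      unfolding d_def by auto
    then show "(\<lambda>x. V x $$ (i, a) * cnj (U (inv y \<otimes> x) $$ (l, b))) \<in> borel_measurable m"
      using coef_measurable[OF V, of i a] il ab unfolding e_def by measurable
  qed
  also have "\<dots> = (LINT x|m. (\<Sum>k<e. V y $$ (i, k) * (V x $$ (k, a) * cnj (U x $$ (l, b)))))"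
  proof (intro Bochner_Integration.integral_cong refl)
    fix x assume "x \<in> space m" then have x: "x \<in> carrier G" by (simp add: space_m)
    have "inv y \<otimes> (y \<otimes> x) = x" using x y by (simp add: m_assoc[symmetric])
    then show "V (y \<otimes> x) $$ (i, a) * cnj (U (inv y \<otimes> (y \<otimes> x)) $$ (l, b)) =
       (\<Sum>k<e. V y $$ (i, k) * (V x $$ (k, a) * cnj (U x $$ (l, b))))"
      using rep_mult_index[OF V y x] il ab unfolding e_def by (simp add: sum_distrib_right mult.assoc)
  qed
  also have "\<dots> = (\<Sum>k<e. LINT x|m. V y $$ (i, k) * (V x $$ (k, a) * cnj (U x $$ (l, b))))"
    using il ab coef_mult_integrable[OF V _ _ U] unfolding d_def e_def by (intro Bochner_Integration.integral_sum) auto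
  also have "\<dots> = (\<Sum>k<e. V y $$ (i, k) * A $$ (k, l))"
    using il unfolding A_def d_def e_def by (intro sum.cong) auto
  also have "\<dots> = (V y * A) $$ (i, l)" by (rule index_mult_mat_sum[OF c(2) A il, symmetric])
  finally show "(A * U y) $$ (i, l) = (V y * A) $$ (i, l)" .
next
  show "dim_row (A * U y) = dim_row (V y * A)" "dim_col (A * U y) = dim_col (V y * A)"
    using rep_carrier[OF U y] rep_carrier[OF V y] unfolding A_def by auto
qed

lemma orthogonality_nonequiv:
  assumes U: "U \<in> irreps G T" and V: "V \<in> irreps G T" and ne: "\<not> rep_equiv G U V"
    and "i < rep_dim G V" "a < rep_dim G V" "j < rep_dim G U" "b < rep_dim G U"
  shows "(LINT x|m. V x $$ (i, a) * cnj (U x $$ (j, b))) = 0"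
proof -
  define A where "A = mat (rep_dim G V) (rep_dim G U) (\<lambda>(i, j). LINT x|m. V x $$ (i, a) * cnj (U x $$ (j, b)))"
  have "A = 0\<^sub>m (rep_dim G V) (rep_dim G U)"
  proof (rule ccontr)
    assume "A \<noteq> 0\<^sub>m (rep_dim G V) (rep_dim G U)"
    moreover have "A \<in> carrier_mat (rep_dim G V) (rep_dim G U)" unfolding A_def by simp
    ultimately show False
      using schur_equiv[OF U V, of A] coef_intertwiner[OF irrepsD(1)[OF U] irrepsD(1)[OF V] assms(5,7)] ne
      unfolding A_def by blast
  qed
  then have "A $$ (i, j) = 0" using assms by simp
  then show ?thesis unfolding A_def using assms by simp
qed

text \<open>The average is a scalar matrix by Schur, and its trace is found from unitarity of
  \<open>U x\<close> by summing the diagonal entries under the integral.\<close>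

lemma orthogonality_same:
  assumes U: "U \<in> irreps G T"
    and "i < rep_dim G U" "a < rep_dim G U" "j < rep_dim G U" "b < rep_dim G U"
  shows "(LINT x|m. U x $$ (i, a) * cnj (U x $$ (j, b))) =
    (if i = j \<and> a = b then 1 / of_nat (rep_dim G U) else 0)"
proof -
  define d where "d = rep_dim G U"
  note Ur = irrepsD(1)[OF U]
  define A where "A = mat d d (\<lambda>(i, j). LINT x|m. U x $$ (i, a) * cnj (U x $$ (j, b)))"
  have "A \<in> carrier_mat d d" unfolding A_def by simp
  then obtain c where c: "A = c \<cdot>\<^sub>m 1\<^sub>m d"
    using schur_scalar[OF U, of A] coef_intertwiner[OF Ur Ur assms(3,5)] unfolding A_def d_def by blast
  have e: "(LINT x|m. U x $$ (i, a) * cnj (U x $$ (j, b))) = (if i = j then c else 0)" if "i < d" "j < d" for i j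
  proof -
    have "A $$ (i, j) = (c \<cdot>\<^sub>m 1\<^sub>m d) $$ (i, j)" using c by simp
    then show ?thesis unfolding A_def using that by (simp split: if_splits)
  qed
  have "of_nat d * c = (\<Sum>k<d. LINT x|m. U x $$ (k, a) * cnj (U x $$ (k, b)))" using e by simp
  also have "\<dots> = (LINT x|m. (\<Sum>k<d. U x $$ (k, a) * cnj (U x $$ (k, b))))"
    using assms coef_mult_integrable[OF Ur _ _ Ur] unfolding d_def by (intro Bochner_Integration.integral_sum[symmetric]) auto
  also have "\<dots> = (LINT x|m. (if a = b then 1 else 0))"
    using rep_unitary_index[OF Ur _ assms(5,3)] unfolding d_def
    by (intro Bochner_Integration.integral_cong refl) (auto simp: space_m mult.commute)
  also have "\<dots> = (if a = b then 1 else 0)" by (simp add: prob_space)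
  finally have "c = (if a = b then 1 / of_nat d else 0)" using irrepsD(3)[OF U] unfolding d_def by (auto simp: field_simps)
  then show ?thesis using e[of i j] assms unfolding d_def by auto
qed

end

section \<open>Representative functions\<close>

text \<open>The scalar action is made explicit so that spans, independence and dimension from
  \<open>vector_space\<close> are taken over the complex numbers.\<close>

definition fscale :: "complex \<Rightarrow> ('b \<Rightarrow> complex) \<Rightarrow> 'b \<Rightarrow> complex" where
  "fscale c f = (\<lambda>x. c * f x)"

global_interpretation fs: vector_space fscale
  by unfold_locales (auto simp: fscale_def fun_eq_iff algebra_simps)

lemma fscale_apply [simp]: "fscale c f x = c * f x" by (simp add: fscale_def)

lemma sum_fun_apply: "(\<Sum>i\<in>A. f i) x = (\<Sum>i\<in>A. (f i x :: complex))"
  by (induction A rule: infinite_finite_induct) auto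

text \<open>Used twice: for coordinate vectors on a finite index set and for continuous functions on
  the group with the L2 product. The axioms are restricted to \<open>C\<close> because the product
  need not be definite, or the integral meaningful, on all functions.\<close>

locale inner_space =
  fixes C :: "('b \<Rightarrow> complex) set" and ip :: "('b \<Rightarrow> complex) \<Rightarrow> ('b \<Rightarrow> complex) \<Rightarrow> complex"
  assumes subspace_C: "fs.subspace C"
    and ip_add: "f \<in> C \<Longrightarrow> g \<in> C \<Longrightarrow> h \<in> C \<Longrightarrow> ip (f + g) h = ip f h + ip g h"
    and ip_scale: "f \<in> C \<Longrightarrow> h \<in> C \<Longrightarrow> ip (fscale c f) h = c * ip f h"
    and ip_cnj: "f \<in> C \<Longrightarrow> g \<in> C \<Longrightarrow> ip g f = cnj (ip f g)"
    and ip_nonneg: "f \<in> C \<Longrightarrow> \<exists>r\<ge>0. ip f f = of_real r"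
    and ip_definite: "f \<in> C \<Longrightarrow> ip f f = 0 \<Longrightarrow> f = 0"
begin

definition orthonormal :: "nat \<Rightarrow> (nat \<Rightarrow> 'b \<Rightarrow> complex) \<Rightarrow> bool" where
  "orthonormal n e \<longleftrightarrow> (\<forall>i<n. e i \<in> C) \<and> (\<forall>i<n. \<forall>j<n. ip (e i) (e j) = (if i = j then 1 else 0))"

definition proj :: "nat \<Rightarrow> (nat \<Rightarrow> 'b \<Rightarrow> complex) \<Rightarrow> ('b \<Rightarrow> complex) \<Rightarrow> 'b \<Rightarrow> complex" where
  "proj n e f = (\<Sum>i<n. fscale (ip f (e i)) (e i))"

lemma ip_zero: "h \<in> C \<Longrightarrow> ip 0 h = 0"
  using ip_scale[of h h 0] by (simp add: fscale_def zero_fun_def)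

lemma ip_sum:
  assumes "\<And>i. i \<in> A \<Longrightarrow> f i \<in> C" "h \<in> C"
  shows "ip (\<Sum>i\<in>A. fscale (c i) (f i)) h = (\<Sum>i\<in>A. c i * ip (f i) h)"
  using assms
proof (induction A rule: infinite_finite_induct)
  case (insert i A)
  have "fscale (c i) (f i) \<in> C" "(\<Sum>i\<in>A. fscale (c i) (f i)) \<in> C"
    using insert subspace_C by (auto intro!: fs.subspace_scale fs.subspace_sum)
  then have "ip (fscale (c i) (f i) + (\<Sum>i\<in>A. fscale (c i) (f i))) h = c i * ip (f i) h + (\<Sum>i\<in>A. c i * ip (f i) h)"
    using ip_add[OF _ _ insert(5), of "fscale (c i) (f i)" "\<Sum>i\<in>A. fscale (c i) (f i)"]
      ip_scale[OF insert(4)[of i] insert(5), of "c i"] insert(3)[OF insert(4) insert(5)] by simp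
  then show ?case unfolding sum.insert[OF insert(1,2)] .
qed (auto simp: ip_zero)

lemma ip_sum_right:
  assumes "\<And>i. i \<in> A \<Longrightarrow> f i \<in> C" "h \<in> C"
  shows "ip h (\<Sum>i\<in>A. fscale (c i) (f i)) = (\<Sum>i\<in>A. cnj (c i) * ip h (f i))"
proof -
  have "(\<Sum>i\<in>A. fscale (c i) (f i)) \<in> C"
    using assms subspace_C by (auto intro!: fs.subspace_scale fs.subspace_sum)
  then have "ip h (\<Sum>i\<in>A. fscale (c i) (f i)) = cnj (ip (\<Sum>i\<in>A. fscale (c i) (f i)) h)"
    using assms by (intro ip_cnj) auto
  also have "\<dots> = (\<Sum>i\<in>A. cnj (c i) * cnj (ip (f i) h))" using assms by (simp add: ip_sum)
  also have "\<dots> = (\<Sum>i\<in>A. cnj (c i) * ip h (f i))"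
    using assms by (intro sum.cong refl) (simp add: ip_cnj[of "f _" h])
  finally show ?thesis .
qed

lemma proj_in:
  assumes "orthonormal n e" shows "proj n e f \<in> C"
  unfolding proj_def using assms subspace_C by (auto simp: orthonormal_def intro!: fs.subspace_scale fs.subspace_sum)

lemma proj_in_subspace:
  assumes "fs.subspace S" "\<And>i. i < n \<Longrightarrow> e i \<in> S" shows "proj n e f \<in> S"
  unfolding proj_def using assms by (auto intro!: fs.subspace_scale fs.subspace_sum)

lemma ip_diff:
  assumes "f \<in> C" "g \<in> C" "h \<in> C" shows "ip (f - g) h = ip f h - ip g h"
proof -
  have "f - g \<in> C" using assms subspace_C fs.subspace_diff by blast
  then have "ip ((f - g) + g) h = ip (f - g) h + ip g h" using assms ip_add by blast
  then show ?thesis by simp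
qed

lemma ip_proj:
  assumes "orthonormal n e" "f \<in> C" "j < n" shows "ip (f - proj n e f) (e j) = 0"
proof -
  have e: "\<And>i. i < n \<Longrightarrow> e i \<in> C" using assms unfolding orthonormal_def by auto
  have "ip (proj n e f) (e j) = (\<Sum>i<n. ip f (e i) * ip (e i) (e j))"
    unfolding proj_def using e assms by (intro ip_sum) auto
  also have "\<dots> = (\<Sum>i<n. if i = j then ip f (e i) else 0)"
    using assms unfolding orthonormal_def by (intro sum.cong) auto
  also have "\<dots> = ip f (e j)" using assms by simp
  finally show ?thesis using ip_diff[OF assms(2) proj_in[OF assms(1)] e[OF assms(3)]] by simp
qed

text \<open>One Gram-Schmidt step: subtract the projection and normalise.\<close>

lemma orthonormal_extend:
  assumes on: "orthonormal n e" and S: "fs.subspace S" "S \<subseteq> C" "\<And>i. i < n \<Longrightarrow> e i \<in> S"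
    and f: "f \<in> S" "f \<noteq> proj n e f"
  obtains g where "orthonormal (Suc n) (e(n := g))" "g \<in> S"
proof -
  define h where "h = f - proj n e f"
  have h: "h \<in> S" unfolding h_def using S f proj_in_subspace fs.subspace_diff by blast
  then have hC: "h \<in> C" using S by blast
  obtain r where r: "r \<ge> 0" "ip h h = of_real r" using ip_nonneg[OF hC] by blast
  have "r \<noteq> 0" using ip_definite[OF hC] r f(2) unfolding h_def by auto
  then have r0: "r > 0" using r by simp
  define g where "g = fscale (of_real (1 / sqrt r)) h"
  have g: "g \<in> S" "g \<in> C" unfolding g_def using S h hC subspace_C fs.subspace_scale by blast+
  have e: "\<And>i. i < n \<Longrightarrow> e i \<in> C" using on unfolding orthonormal_def by auto
  have 1: "ip g (e j) = 0" if "j < n" for j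
    unfolding g_def using ip_scale[OF hC e[OF that]] ip_proj[OF on _ that, of f] f S unfolding h_def by auto
  then have 2: "ip (e j) g = 0" if "j < n" for j
    using ip_cnj[OF g(2) e[OF that]] that by simp
  have "ip g h = of_real (1 / sqrt r) * of_real r" unfolding g_def using ip_scale[OF hC hC] r by simp
  then have "ip h g = of_real (1 / sqrt r) * of_real r" using ip_cnj[OF g(2) hC] by simp
  then have "ip g g = of_real (1 / sqrt r) * (of_real (1 / sqrt r) * of_real r)"
    using ip_scale[OF hC g(2)] unfolding g_def by simp
  also have "\<dots> = of_real ((1 / sqrt r) * ((1 / sqrt r) * r))" by (simp only: of_real_mult)
  also have "(1 / sqrt r) * ((1 / sqrt r) * r) = 1" using r0 by (simp add: field_simps)
  finally have 3: "ip g g = 1" by simp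
  have "orthonormal (Suc n) (e(n := g))"
    using on 1 2 3 g unfolding orthonormal_def by (auto simp: less_Suc_eq)
  then show ?thesis using that g by blast
qed

lemma orthonormal_card_le:
  assumes on: "orthonormal n e" and B: "finite B" "\<And>i. i < n \<Longrightarrow> e i \<in> fs.span B"
  shows "n \<le> card B"
proof -
  have e: "\<And>i. i < n \<Longrightarrow> e i \<in> C" using on unfolding orthonormal_def by auto
  have inj: "inj_on e {..<n}"
    using on unfolding orthonormal_def inj_on_def by (metis lessThan_iff zero_neq_one)
  have "fs.independent (e ` {..<n})"
  proof
    assume "fs.dependent (e ` {..<n})"
    then obtain u where u: "\<exists>v\<in>e ` {..<n}. u v \<noteq> 0" "(\<Sum>v\<in>e ` {..<n}. fscale (u v) v) = 0"
      using fs.dependent_finite[of "e ` {..<n}"] by auto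
    then obtain j where j: "j < n" "u (e j) \<noteq> 0" by auto
    have "(\<Sum>i<n. fscale (u (e i)) (e i)) = 0" using u(2) by (simp add: sum.reindex[OF inj])
    then have "ip (\<Sum>i<n. fscale (u (e i)) (e i)) (e j) = 0" using ip_zero e j by simp
    moreover have "ip (\<Sum>i<n. fscale (u (e i)) (e i)) (e j) = (\<Sum>i<n. u (e i) * ip (e i) (e j))"
      using e j by (intro ip_sum) auto
    moreover have "\<dots> = (\<Sum>i<n. if i = j then u (e i) else 0)"
      using on j unfolding orthonormal_def by (intro sum.cong) auto
    ultimately show False using j by simp
  qed
  then have "card (e ` {..<n}) \<le> card B"
    using fs.independent_span_bound[OF B(1)] B(2) by blast
  then show ?thesis by (simp add: card_image[OF inj])
qed

text \<open>Take a longest orthonormal family in S. Its length is bounded by the size of B, and a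
  vector not fixed by the projection would prolong it.\<close>

lemma orthonormal_basis:
  assumes S: "fs.subspace S" "S \<subseteq> C" and B: "finite B" "S \<subseteq> fs.span B"
  obtains n e where "orthonormal n e" "\<And>i. i < n \<Longrightarrow> e i \<in> S" "\<And>f. f \<in> S \<Longrightarrow> proj n e f = f"
proof -
  define P where "P n \<longleftrightarrow> (\<exists>e. orthonormal n e \<and> (\<forall>i<n. e i \<in> S))" for n
  have "P 0" unfolding P_def orthonormal_def by simp
  moreover have bound: "n \<le> card B" if "P n" for n
    using that orthonormal_card_le[OF _ B(1)] B(2) unfolding P_def by blast
  ultimately obtain n where n: "P n" "\<And>k. P k \<Longrightarrow> k \<le> n"
    using Greatest_le_nat[of P _ "card B"] GreatestI_nat[of P 0 "card B"] by blast
  obtain e where e: "orthonormal n e" "\<And>i. i < n \<Longrightarrow> e i \<in> S" using n(1) unfolding P_def by blast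
  have "proj n e f = f" if f: "f \<in> S" for f
  proof (rule ccontr)
    assume "proj n e f \<noteq> f"
    then obtain g where g: "orthonormal (Suc n) (e(n := g))" "g \<in> S"
      using orthonormal_extend[OF e(1) S e(2) f] by metis
    then have "P (Suc n)" unfolding P_def using e(2) by (intro exI[of _ "e(n := g)"]) (auto simp: less_Suc_eq)
    then show False using n(2)[of "Suc n"] by simp
  qed
  then show ?thesis using that e by blast
qed

end

text \<open>
  Functions that are linearly independent on a set are separated by finite combinations of
  point evaluations on that set.
\<close>

lemma independent_functions_dual:
  fixes u :: "'k \<Rightarrow> 'x \<Rightarrow> complex"
  assumes I: "finite I" and ind: "\<And>l. (\<And>x. x \<in> X \<Longrightarrow> (\<Sum>k\<in>I. l k * u k x) = 0) \<Longrightarrow> (\<And>k. k \<in> I \<Longrightarrow> l k = 0)"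
    and i: "i \<in> I"
  shows "\<exists>S a. finite S \<and> S \<subseteq> X \<and> (\<forall>k\<in>I. (\<Sum>x\<in>S. a x * u k x) = (if k = i then 1 else 0))"
proof -
  define C :: "('k \<Rightarrow> complex) set" where "C = {f. \<forall>k. k \<notin> I \<longrightarrow> f k = 0}"
  define ip where "ip f g = (\<Sum>k\<in>I. f k * cnj (g k))" for f g :: "'k \<Rightarrow> complex"
  interpret inner_space C ip
  proof
    show "fs.subspace C" unfolding C_def by (intro fs.subspaceI) auto
    show "ip (f + g) h = ip f h + ip g h" for f g h unfolding ip_def by (simp add: algebra_simps sum.distrib)
    show "ip (fscale c f) h = c * ip f h" for c f h unfolding ip_def by (simp add: sum_distrib_left mult.assoc)
    show "ip g f = cnj (ip f g)" for f g unfolding ip_def by (simp add: mult.commute)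
    have nn: "ip f f = of_real (\<Sum>k\<in>I. (norm (f k))\<^sup>2)" for f unfolding ip_def of_real_sum cnj_mult_self ..
    then show "\<exists>r\<ge>0. ip f f = of_real r" for f by (meson sum_nonneg zero_le_power2)
    show "f = 0" if "f \<in> C" "ip f f = 0" for f
    proof
      fix k
      have "(\<Sum>k\<in>I. (norm (f k))\<^sup>2) = 0" using that(2) unfolding nn[of f] of_real_eq_0_iff .
      then have "\<forall>k\<in>I. (norm (f k))\<^sup>2 = 0" using I by (subst (asm) sum_nonneg_eq_0_iff) auto
      then show "f k = 0 k" using that(1) unfolding C_def by auto
    qed
  qed
  define w where "w x = (\<lambda>k. if k \<in> I then u k x else 0)" for x
  define S where "S = fs.span (w ` X)"
  have SC: "S \<subseteq> C" unfolding S_def by (rule fs.span_minimal) (auto simp: w_def C_def subspace_C[unfolded C_def] fs.subspaceI)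
  define B :: "('k \<Rightarrow> complex) set" where "B = (\<lambda>k j. if j = k then 1 else 0) ` I"
  have "f \<in> fs.span B" if "f \<in> C" for f
  proof -
    have "f = (\<Sum>k\<in>I. fscale (f k) (\<lambda>j. if j = k then 1 else 0))"
      using that I unfolding C_def by (auto simp: fun_eq_iff sum_fun_apply if_distrib sum.delta' cong: if_cong)
    also have "\<dots> \<in> fs.span B" unfolding B_def by (intro fs.span_sum fs.span_scale fs.span_base) auto
    finally show ?thesis .
  qed
  then have "S \<subseteq> fs.span B" "finite B" using SC I unfolding B_def by auto
  then obtain n e where e: "orthonormal n e" "\<And>j. j < n \<Longrightarrow> e j \<in> S" "\<And>f. f \<in> S \<Longrightarrow> proj n e f = f"
    using orthonormal_basis[of S B] SC unfolding S_def by blast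
  define d :: "'k \<Rightarrow> complex" where "d = (\<lambda>k. if k = i then 1 else 0)"
  have dC: "d \<in> C" unfolding d_def C_def using i by auto
  define g where "g = d - proj n e d"
  have gC: "g \<in> C" unfolding g_def using dC proj_in[OF e(1)] subspace_C fs.subspace_diff by blast
  have gS: "ip f g = 0" if "f \<in> S" for f
  proof -
    have eC: "\<And>j. j < n \<Longrightarrow> e j \<in> C" using e(2) SC by blast
    have "ip (e j) g = 0" if "j < n" for j
      using ip_cnj[OF gC eC[OF that]] ip_proj[OF e(1) dC that] unfolding g_def by simp
    then have "ip (proj n e f) g = 0" unfolding proj_def using eC gC by (subst ip_sum) auto
    then show ?thesis using e(3)[OF that] by simp
  qed
  \<comment> \<open>\<open>g\<close> is the part of the delta vector orthogonal to all evaluations.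
    Its conjugate is therefore a linear relation between the functions on \<open>X\<close> and
    vanishes by independence, so the delta vector is a combination of evaluations.\<close>
  have "cnj (g k) = 0" if "k \<in> I" for k
  proof (rule ind[OF _ that])
    fix x assume "x \<in> X"
    then have "w x \<in> S" unfolding S_def by (intro fs.span_base) auto
    then have "ip (w x) g = 0" by (rule gS)
    then show "(\<Sum>k\<in>I. cnj (g k) * u k x) = 0" unfolding ip_def w_def by (simp add: mult.commute cong: sum.cong)
  qed
  then have "g = 0" using gC unfolding C_def by (auto simp: fun_eq_iff)
  then have "d = proj n e d" unfolding g_def by simp
  then have "d \<in> S" using proj_in_subspace[of S n e d] e(2) unfolding S_def by auto
  then obtain S' r where S': "finite S'" "S' \<subseteq> w ` X" "d = (\<Sum>v\<in>S'. fscale (r v) v)"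
    unfolding S_def fs.span_explicit by blast
  \<comment> \<open>The span yields a combination of vectors; one point chosen for each vector turns
    it into a combination of evaluations at distinct points.\<close>
  obtain Y where Y: "Y \<subseteq> X" "finite Y" "S' = w ` Y" "inj_on w Y"
    using S'(1,2) by (metis finite_imageD inj_on_image_eq_iff subset_image_inj finite_imageD)
  have "\<forall>k\<in>I. (\<Sum>x\<in>Y. r (w x) * u k x) = (if k = i then 1 else 0)"
  proof
    fix k assume k: "k \<in> I"
    have "(if k = i then 1 else 0) = d k" unfolding d_def by simp
    also have "\<dots> = (\<Sum>v\<in>S'. r v * v k)" unfolding S'(3) by (simp add: sum_fun_apply)
    also have "\<dots> = (\<Sum>x\<in>Y. r (w x) * w x k)" unfolding Y(3) by (simp add: sum.reindex[OF Y(4)])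
    also have "\<dots> = (\<Sum>x\<in>Y. r (w x) * u k x)" unfolding w_def using k by simp
    finally show "(\<Sum>x\<in>Y. r (w x) * u k x) = (if k = i then 1 else 0)" ..
  qed
  then show ?thesis using Y(1,2) by (intro exI[of _ Y] exI[of _ "\<lambda>x. r (w x)"] conjI)
qed

lemma continuous_map_complex_mult:
  fixes f g :: "'b \<Rightarrow> complex"
  assumes "continuous_map X euclidean f" "continuous_map X euclidean g"
  shows "continuous_map X euclidean (\<lambda>x. f x * g x)"
proof -
  have "continuous_map X (prod_topology euclidean euclidean) (\<lambda>x. (f x, g x))"
    by (intro continuous_map_pairedI assms)
  moreover have "continuous_map (prod_topology euclidean euclidean) euclidean (\<lambda>z :: complex \<times> complex. fst z * snd z)"
    unfolding euclidean_product_topology by (simp add: continuous_on_mult continuous_on_fst continuous_on_snd continuous_on_id)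
  ultimately have "continuous_map X euclidean ((\<lambda>z. fst z * snd z) \<circ> (\<lambda>x. (f x, g x)))"
    by (rule continuous_map_compose)
  then show ?thesis by (simp add: o_def)
qed

context haar_group
begin

text \<open>Extension by 0 off the carrier makes functions that agree on G equal, as definiteness of
  \<open>L2\<close> requires.\<close>

definition CF :: "('a \<Rightarrow> complex) set" where
  "CF = {f. continuous_map T euclidean f \<and> (\<forall>x. x \<notin> carrier G \<longrightarrow> f x = 0)}"

definition L2 :: "('a \<Rightarrow> complex) \<Rightarrow> ('a \<Rightarrow> complex) \<Rightarrow> complex" where
  "L2 f g = (LINT x|m. f x * cnj (g x))"

definition rtrans :: "'a \<Rightarrow> ('a \<Rightarrow> complex) \<Rightarrow> 'a \<Rightarrow> complex" where
  "rtrans x f = (\<lambda>y. if y \<in> carrier G then f (y \<otimes> x) else 0)"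

definition coef :: "('a \<Rightarrow> complex mat) \<Rightarrow> nat \<Rightarrow> nat \<Rightarrow> 'a \<Rightarrow> complex" where
  "coef U i j = (\<lambda>x. if x \<in> carrier G then U x $$ (i, j) else 0)"

definition trig_polys :: "('a \<Rightarrow> complex) set" where
  "trig_polys = fs.span {coef U i j | U i j. U \<in> irreps G T \<and> i < rep_dim G U \<and> j < rep_dim G U}"

definition inv_space :: "('a \<Rightarrow> complex) set \<Rightarrow> bool" where
  "inv_space W \<longleftrightarrow> fs.subspace W \<and> W \<subseteq> CF \<and> (\<exists>B. finite B \<and> W \<subseteq> fs.span B) \<and>
     (\<forall>x\<in>carrier G. \<forall>f\<in>W. rtrans x f \<in> W)"

lemma continuous_map_eq_carrier:
  assumes "continuous_map T X f" "\<And>x. x \<in> carrier G \<Longrightarrow> g x = f x"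
  shows "continuous_map T X g"
  using continuous_map_eq[OF assms(1), of g] assms(2) topspace_eq by simp

lemma CF_I:
  assumes "continuous_map T euclidean f" "\<And>x. x \<in> carrier G \<Longrightarrow> g x = f x" "\<And>x. x \<notin> carrier G \<Longrightarrow> g x = 0"
  shows "g \<in> CF"
  unfolding CF_def using continuous_map_eq_carrier[OF assms(1,2)] assms(3) by blast

lemma CF_continuous: "f \<in> CF \<Longrightarrow> continuous_map T euclidean f" unfolding CF_def by simp

lemma CF_bounded:
  assumes "f \<in> CF" obtains B where "\<And>x. norm (f x) \<le> B"
proof -
  have "compactin T (topspace T)" using compact by (simp add: compact_space_def)
  then have "compact (f ` topspace T)" using image_compactin[OF _ CF_continuous[OF assms]] by simp
  then obtain B where B: "\<And>x. x \<in> carrier G \<Longrightarrow> norm (f x) \<le> B"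
    using compact_imp_bounded[of "f ` topspace T"] unfolding bounded_iff topspace_eq by auto
  have "norm (f x) \<le> max B 0" for x using B[of x] assms unfolding CF_def by (cases "x \<in> carrier G") auto
  then show ?thesis using that by blast
qed

lemma CF_measurable: "f \<in> CF \<Longrightarrow> f \<in> borel_measurable m"
  by (intro borel_measurable_m CF_continuous)

lemma CF_integrable: "f \<in> CF \<Longrightarrow> integrable m f"
  using CF_bounded[of f] CF_measurable[of f] by (metis (mono_tags, lifting) AE_I2 integrable_const_bound)

lemma CF_mult: "f \<in> CF \<Longrightarrow> g \<in> CF \<Longrightarrow> (\<lambda>x. f x * g x) \<in> CF"
  unfolding CF_def by (auto intro!: continuous_map_complex_mult)

lemma CF_cnj: "f \<in> CF \<Longrightarrow> (\<lambda>x. cnj (f x)) \<in> CF"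
proof -
  assume f: "f \<in> CF"
  have "continuous_map euclidean euclidean cnj" by (simp add: continuous_on_cnj continuous_on_id)
  then have "continuous_map T euclidean (cnj \<circ> f)" using continuous_map_compose[OF CF_continuous[OF f]] by blast
  then show ?thesis using f unfolding CF_def by (simp add: o_def)
qed

lemma subspace_CF: "fs.subspace CF"
proof (rule fs.subspaceI)
  show "0 \<in> CF" unfolding CF_def by (simp add: zero_fun_def)
  show "f + g \<in> CF" if "f \<in> CF" "g \<in> CF" for f g
    using that unfolding CF_def plus_fun_def by (auto intro!: continuous_map_add)
  show "fscale c f \<in> CF" if "f \<in> CF" for c f
    using that unfolding CF_def fscale_def by (auto intro!: continuous_map_complex_mult)
qed

lemma L2_integrable: "f \<in> CF \<Longrightarrow> g \<in> CF \<Longrightarrow> integrable m (\<lambda>x. f x * cnj (g x))"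
  by (intro CF_integrable CF_mult CF_cnj)

lemma L2_self: "f \<in> CF \<Longrightarrow> L2 f f = of_real (LINT x|m. (norm (f x))\<^sup>2)"
  unfolding L2_def cnj_mult_self by (rule integral_complex_of_real)

text \<open>Near a point where f is nonzero its modulus stays above half the value there, on an open
  set, and nonempty open sets have positive measure.\<close>

lemma L2_definite:
  assumes f: "f \<in> CF" and z: "L2 f f = 0" shows "f = 0"
proof (rule ccontr)
  assume "f \<noteq> 0"
  then obtain x0 where x0: "f x0 \<noteq> 0" by (auto simp: fun_eq_iff)
  then have x0c: "x0 \<in> carrier G" using f unfolding CF_def by auto
  define V where "V = {x \<in> topspace T. f x \<in> {z. norm z > norm (f x0) / 2}}"
  have "open {z :: complex. norm z > norm (f x0) / 2}" by (intro open_Collect_less continuous_intros)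
  then have V: "openin T V" unfolding V_def by (intro openin_continuous_map_preimage[OF CF_continuous[OF f]]) simp
  have "x0 \<in> V" unfolding V_def using x0 x0c topspace_eq by simp
  then have mV: "measure m V > 0" using emeasure_open_pos[OF V] by blast
  have Vm: "V \<in> sets m" using openin_borel_sets[OF V] sets_m by simp
  have fi: "integrable m (\<lambda>x. (norm (f x))\<^sup>2)"
  proof -
    obtain B where B: "\<And>x. norm (f x) \<le> B" using CF_bounded[OF f] by blast
    show ?thesis
      by (rule integrable_const_bound[where B="B\<^sup>2"])
        (use B CF_measurable[OF f] in \<open>auto intro!: power_mono\<close>)
  qed
  have "(norm (f x0) / 2)\<^sup>2 * measure m V = (LINT x|m. (norm (f x0) / 2)\<^sup>2 * indicator V x)"
    using Vm by (simp add: Int_absorb2 sets.sets_into_space)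
  also have "\<dots> \<le> (LINT x|m. (norm (f x))\<^sup>2)"
  proof (rule integral_mono[OF _ fi])
    show "integrable m (\<lambda>x. (norm (f x0) / 2)\<^sup>2 * indicat_real V x)" using Vm by (auto intro!: integrable_real_indicator simp: less_top[symmetric])
    fix x show "(norm (f x0) / 2)\<^sup>2 * indicat_real V x \<le> (norm (f x))\<^sup>2"
    proof (cases "x \<in> V")
      case True
      then have "norm (f x0) / 2 \<le> norm (f x)" unfolding V_def by simp
      then have "(norm (f x0) / 2)\<^sup>2 \<le> (norm (f x))\<^sup>2" by (intro power_mono) auto
      then show ?thesis using True by simp
    qed simp
  qed
  also have "\<dots> = 0" using z L2_self[OF f] by simp
  finally have "(norm (f x0) / 2)\<^sup>2 * measure m V \<le> 0" .
  moreover have "(norm (f x0) / 2)\<^sup>2 * measure m V > 0" using x0 mV by (intro mult_pos_pos) auto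
  ultimately show False by linarith
qed

end

sublocale haar_group \<subseteq> L2: inner_space CF L2
proof
  show "fs.subspace CF" by (rule subspace_CF)
  show "L2 (f + g) h = L2 f h + L2 g h" if "f \<in> CF" "g \<in> CF" "h \<in> CF" for f g h
    unfolding L2_def plus_fun_def distrib_right using L2_integrable that by simp
  show "L2 (fscale c f) h = c * L2 f h" if "f \<in> CF" "h \<in> CF" for c f h
    unfolding L2_def fscale_def mult.assoc by simp
  show "L2 g f = cnj (L2 f g)" for f g
  proof -
    have "L2 g f = (LINT x|m. cnj (f x * cnj (g x)))" unfolding L2_def by (simp add: mult.commute del: integral_cnj)
    also have "\<dots> = cnj (L2 f g)" unfolding L2_def by (rule Bochner_Integration.integral_cnj)
    finally show ?thesis .
  qed
  show "\<exists>r\<ge>0. L2 f f = of_real r" if "f \<in> CF" for f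
    using L2_self[OF that] by (intro exI[of _ "LINT x|m. (norm (f x))\<^sup>2"]) simp
qed (rule L2_definite)

context haar_group
begin

lemma rtrans_CF:
  assumes "x \<in> carrier G" "f \<in> CF" shows "rtrans x f \<in> CF"
proof (rule CF_I)
  show "continuous_map T euclidean (f \<circ> (\<lambda>y. y \<otimes> x))"
    using continuous_map_compose[OF continuous_right_mult[OF assms(1)] CF_continuous[OF assms(2)]] .
qed (auto simp: rtrans_def)

lemma rtrans_add: "rtrans x (f + g) = rtrans x f + rtrans x g"
  by (auto simp: rtrans_def fun_eq_iff)

lemma rtrans_scale: "rtrans x (fscale c f) = fscale c (rtrans x f)"
  by (auto simp: rtrans_def fun_eq_iff)

lemma rtrans_sum: "rtrans x (\<Sum>i\<in>A. f i) = (\<Sum>i\<in>A. rtrans x (f i))"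
  by (auto simp: rtrans_def fun_eq_iff sum_fun_apply)

lemma rtrans_mult: "x \<in> carrier G \<Longrightarrow> y \<in> carrier G \<Longrightarrow> rtrans x (rtrans y f) = rtrans (x \<otimes> y) f"
  by (auto simp: rtrans_def fun_eq_iff m_assoc)

lemma rtrans_one: "f \<in> CF \<Longrightarrow> rtrans \<one> f = f"
  by (auto simp: rtrans_def fun_eq_iff CF_def)

lemma L2_rtrans:
  assumes "x \<in> carrier G" "f \<in> CF" "g \<in> CF" shows "L2 (rtrans x f) (rtrans x g) = L2 f g"
proof -
  have "L2 (rtrans x f) (rtrans x g) = (LINT y|m. f (y \<otimes> x) * cnj (g (y \<otimes> x)))"
    unfolding L2_def rtrans_def by (intro Bochner_Integration.integral_cong) (auto simp: space_m)
  also have "\<dots> = L2 f g"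
    unfolding L2_def using assms CF_measurable[OF CF_mult[OF assms(2) CF_cnj[OF assms(3)]]]
    by (intro integral_right_mult[where f="\<lambda>y. f y * cnj (g y)"]) auto
  finally show ?thesis .
qed

lemma coef_CF: "unitary_rep G T U \<Longrightarrow> i < rep_dim G U \<Longrightarrow> j < rep_dim G U \<Longrightarrow> coef U i j \<in> CF"
  by (rule CF_I[OF rep_continuous]) (auto simp: coef_def)

lemma trig_polys_CF: "trig_polys \<subseteq> CF"
  unfolding trig_polys_def by (rule fs.span_minimal[OF _ subspace_CF]) (auto intro: coef_CF irrepsD)

lemma rtrans_coef:
  assumes "unitary_rep G T U" "i < rep_dim G U" "j < rep_dim G U" "x \<in> carrier G"
  shows "rtrans x (coef U i j) = (\<Sum>k<rep_dim G U. fscale (U x $$ (k, j)) (coef U i k))"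
  using rep_mult_index[OF assms(1) _ assms(4) assms(2,3)] assms
  by (auto simp: rtrans_def coef_def fun_eq_iff sum_fun_apply mult.commute)

lemma rtrans_span:
  assumes B: "\<And>b. b \<in> B \<Longrightarrow> rtrans x b \<in> fs.span B" and f: "f \<in> fs.span B"
  shows "rtrans x f \<in> fs.span B"
  using f
proof (induction rule: fs.span_induct_alt)
  case base
  have "rtrans x 0 = 0" by (auto simp: rtrans_def fun_eq_iff)
  then show ?case using fs.span_zero by metis
next
  case (step c b y)
  then show ?case unfolding rtrans_add rtrans_scale using B by (intro fs.span_add fs.span_scale)
qed

lemma rtrans_trig_polys: "x \<in> carrier G \<Longrightarrow> f \<in> trig_polys \<Longrightarrow> rtrans x f \<in> trig_polys"
  unfolding trig_polys_def
proof (erule rtrans_span[rotated])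
  fix b assume x: "x \<in> carrier G" and "b \<in> {coef U i j |U i j. U \<in> irreps G T \<and> i < rep_dim G U \<and> j < rep_dim G U}"
  then obtain U i j where b: "b = coef U i j" "U \<in> irreps G T" "i < rep_dim G U" "j < rep_dim G U" by blast
  show "rtrans x b \<in> fs.span {coef U i j |U i j. U \<in> irreps G T \<and> i < rep_dim G U \<and> j < rep_dim G U}"
    unfolding b(1) rtrans_coef[OF irrepsD(1)[OF b(2)] b(3,4) x]
    using b by (intro fs.span_sum fs.span_scale fs.span_base) blast
qed

text \<open>In an orthonormal basis of W, right translation acts by unitary matrices. An invariant
  subspace of coordinate vectors corresponds to an invariant subspace of W, so minimality makes this
  representation irreducible. Evaluating the translated basis at the identity writes the basis in
  its coefficients.\<close>

lemma minimal_inv_space: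
  assumes W: "inv_space W" "W \<noteq> {0}"
    and min: "\<And>V. inv_space V \<Longrightarrow> V \<subseteq> W \<Longrightarrow> V \<noteq> {0} \<Longrightarrow> V = W"
  shows "W \<subseteq> trig_polys"
proof -
  have sub: "fs.subspace W" and WC: "W \<subseteq> CF" and fd: "\<exists>B. finite B \<and> W \<subseteq> fs.span B"
    and inv: "\<And>x f. x \<in> carrier G \<Longrightarrow> f \<in> W \<Longrightarrow> rtrans x f \<in> W"
    using W(1) unfolding inv_space_def by auto
  obtain B where B: "finite B" "W \<subseteq> fs.span B" using fd by blast
  obtain d e where e: "L2.orthonormal d e" "\<And>i. i < d \<Longrightarrow> e i \<in> W" "\<And>f. f \<in> W \<Longrightarrow> L2.proj d e f = f"
    using L2.orthonormal_basis[OF sub WC B] by blast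
  have eC: "e i \<in> CF" if "i < d" for i using e(2) WC that by blast
  have on: "L2 (e i) (e j) = (if i = j then 1 else 0)" if "i < d" "j < d" for i j
    using e(1) that unfolding L2.orthonormal_def by blast
  have d0: "d > 0"
  proof (rule ccontr)
    assume "\<not> d > 0"
    then have "f = 0" if "f \<in> W" for f using e(3)[OF that] unfolding L2.proj_def by simp
    then show False using W(2) fs.subspace_0[OF sub] by blast
  qed
  have uniq: "a i = L2 (\<Sum>j<d. fscale (a j) (e j)) (e i)" if "i < d" for a i
  proof -
    have "L2 (\<Sum>j<d. fscale (a j) (e j)) (e i) = (\<Sum>j<d. a j * L2 (e j) (e i))"
      using eC that by (intro L2.ip_sum) auto
    also have "\<dots> = (\<Sum>j<d. if j = i then a j else 0)" using on that by (intro sum.cong) auto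
    finally show ?thesis using that by simp
  qed
  define u where "u x i j = L2 (rtrans x (e j)) (e i)" for x i j
  define U where "U x = mat d d (\<lambda>(i, j). u x i j)" for x
  have Uc: "U x \<in> carrier_mat d d" for x unfolding U_def by simp
  have Ui: "U x $$ (i, j) = u x i j" if "i < d" "j < d" for x i j unfolding U_def using that by simp
  have Re: "rtrans x (e j) = (\<Sum>i<d. fscale (u x i j) (e i))" if "x \<in> carrier G" "j < d" for x j
    using e(3)[OF inv[OF that(1) e(2)[OF that(2)]]] unfolding L2.proj_def u_def by simp
  have dim: "rep_dim G U = d" unfolding rep_dim_def U_def by simp
  have mult: "u (x \<otimes> y) i j = (\<Sum>k<d. u x i k * u y k j)" if "x \<in> carrier G" "y \<in> carrier G" "i < d" "j < d" for x y i j
  proof -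
    have "rtrans (x \<otimes> y) (e j) = rtrans x (rtrans y (e j))" using rtrans_mult that by simp
    also have "\<dots> = (\<Sum>k<d. fscale (u y k j) (rtrans x (e k)))"
      using Re[OF that(2,4)] by (simp only: rtrans_sum rtrans_scale)
    also have "\<dots> = (\<Sum>k<d. fscale (u y k j) (\<Sum>i<d. fscale (u x i k) (e i)))" using Re[OF that(1)] by simp
    also have "\<dots> = (\<Sum>i<d. fscale (\<Sum>k<d. u x i k * u y k j) (e i))"
      by (auto simp: fun_eq_iff sum_fun_apply sum_distrib_left sum_distrib_right mult_ac intro: sum.swap)
    finally show ?thesis unfolding u_def[of "x \<otimes> y"] using uniq[OF that(3), symmetric] by simp
  qed
  have unit: "(\<Sum>k<d. cnj (u x k i) * u x k j) = (if i = j then 1 else 0)" if "x \<in> carrier G" "i < d" "j < d" for x i j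
  proof -
    have "(if i = j then 1 else 0) = L2 (rtrans x (e j)) (rtrans x (e i))"
      using L2_rtrans[OF that(1) eC eC] that on by auto
    also have "\<dots> = (\<Sum>k<d. cnj (u x k i) * L2 (rtrans x (e j)) (e k))"
      unfolding Re[OF that(1,2)] using eC rtrans_CF[OF that(1)] that by (intro L2.ip_sum_right) auto
    also have "\<dots> = (\<Sum>k<d. cnj (u x k i) * u x k j)" unfolding u_def ..
    finally show ?thesis ..
  qed
  \<comment> \<open>The coefficients were defined by integrals. Rewritten as finite combinations of
    values \<open>e j (y \<otimes> x)\<close> at fixed points y they are visibly continuous in x,
    without an argument by uniform continuity.\<close>
  have cont: "continuous_map T euclidean (\<lambda>x. U x $$ (i, j))" if ij: "i < d" "j < d" for i j
  proof -
    have "\<exists>S a. finite S \<and> S \<subseteq> carrier G \<and> (\<forall>k\<in>{..<d}. (\<Sum>y\<in>S. a y * e k y) = (if k = i then 1 else 0))"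
    proof (rule independent_functions_dual)
      fix l :: "nat \<Rightarrow> complex" and k
      assume l: "\<And>y. y \<in> carrier G \<Longrightarrow> (\<Sum>k<d. l k * e k y) = 0" and k: "k \<in> {..<d}"
      have "(\<Sum>k<d. fscale (l k) (e k)) = 0"
      proof
        fix y show "(\<Sum>k<d. fscale (l k) (e k)) y = 0 y"
          using l eC by (cases "y \<in> carrier G") (auto simp: sum_fun_apply CF_def)
      qed
      then show "l k = 0" using uniq[of k l] k L2.ip_zero[OF eC] by simp
    qed (use ij in auto)
    then obtain S a where S: "finite S" "S \<subseteq> carrier G" "\<And>k. k < d \<Longrightarrow> (\<Sum>y\<in>S. a y * e k y) = (if k = i then 1 else 0)"
      by blast
    have eq: "U x $$ (i, j) = (\<Sum>y\<in>S. a y * e j (y \<otimes> x))" if x: "x \<in> carrier G" for x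
    proof -
      have "(\<Sum>y\<in>S. a y * e j (y \<otimes> x)) = (\<Sum>y\<in>S. a y * rtrans x (e j) y)"
        using S(2) by (intro sum.cong) (auto simp: rtrans_def)
      also have "\<dots> = (\<Sum>y\<in>S. \<Sum>k<d. u x k j * (a y * e k y))"
        unfolding Re[OF x ij(2)] by (simp add: sum_fun_apply sum_distrib_left mult_ac)
      also have "\<dots> = (\<Sum>k<d. u x k j * (\<Sum>y\<in>S. a y * e k y))"
        unfolding sum_distrib_left by (rule sum.swap)
      also have "\<dots> = (\<Sum>k<d. if k = i then u x k j else 0)" using S(3) by (intro sum.cong) auto
      finally show ?thesis using ij Ui by simp
    qed
    have "continuous_map T euclidean (\<lambda>x. \<Sum>y\<in>S. a y * e j (y \<otimes> x))"
    proof (rule continuous_map_sum[OF S(1)])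
      fix y assume "y \<in> S"
      then have y: "y \<in> carrier G" using S by blast
      have "continuous_map T euclidean (e j \<circ> (\<lambda>x. y \<otimes> x))"
        by (rule continuous_map_compose[OF continuous_left_mult[OF y] CF_continuous[OF eC[OF ij(2)]]])
      then show "continuous_map T euclidean (\<lambda>x. a y * e j (y \<otimes> x))"
        by (intro continuous_map_complex_mult) (auto simp: o_def)
    qed
    then show ?thesis by (rule continuous_map_eq_carrier) (rule eq)
  qed
  have rep: "unitary_rep G T U"
    unfolding unitary_rep_def dim unitary_mat_def
  proof (intro conjI ballI allI impI)
    fix x assume x: "x \<in> carrier G"
    show "U x \<in> carrier_mat d d" by (rule Uc)
    show "mat_adjoint (U x) * U x = 1\<^sub>m d"
    proof (rule eq_matI)
      fix i j assume "i < dim_row (1\<^sub>m d :: complex mat)" "j < dim_col (1\<^sub>m d :: complex mat)"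
      then have ij: "i < d" "j < d" by auto
      have "(mat_adjoint (U x) * U x) $$ (i, j) = (\<Sum>k<d. mat_adjoint (U x) $$ (i, k) * U x $$ (k, j))"
        by (rule index_mult_mat_sum[OF _ Uc ij]) (simp add: Uc)
      also have "\<dots> = (\<Sum>k<d. cnj (u x k i) * u x k j)" using ij Uc[of x] by (intro sum.cong) (auto simp: Ui)
      also have "\<dots> = (if i = j then 1 else 0)" by (rule unit[OF x ij])
      finally show "(mat_adjoint (U x) * U x) $$ (i, j) = 1\<^sub>m d $$ (i, j)" using ij by simp
    qed (use Uc[of x] in auto)
    fix y assume y: "y \<in> carrier G"
    show "U (x \<otimes> y) = U x * U y"
    proof (rule eq_matI)
      fix i j assume "i < dim_row (U x * U y)" "j < dim_col (U x * U y)"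
      then have ij: "i < d" "j < d" using Uc[of x] Uc[of y] by auto
      have "(U x * U y) $$ (i, j) = (\<Sum>k<d. U x $$ (i, k) * U y $$ (k, j))" by (rule index_mult_mat_sum[OF Uc Uc ij])
      then show "U (x \<otimes> y) $$ (i, j) = (U x * U y) $$ (i, j)" using mult[OF x y ij] ij by (simp add: Ui)
    qed (use Uc[of x] Uc[of y] Uc[of "x \<otimes> y"] in auto)
  qed (rule cont)
  have irr: "irreducible_rep G U"
    unfolding irreducible_rep_def dim subspace_vec_iff
  proof (intro conjI allI impI)
    fix S assume S: "(S \<subseteq> carrier_vec d \<and> 0\<^sub>v d \<in> S \<and> (\<forall>v\<in>S. \<forall>w\<in>S. v + w \<in> S) \<and> (\<forall>c. \<forall>v\<in>S. c \<cdot>\<^sub>v v \<in> S)) \<and>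
       (\<forall>x\<in>carrier G. \<forall>w\<in>S. U x *\<^sub>v w \<in> S)"
    \<comment> \<open>Passes from coordinate vectors to W and carries subspaces invariant under
      \<open>U\<close> to translation-invariant ones, to which minimality applies.\<close>
    define \<phi> where "\<phi> v = (\<Sum>i<d. fscale (v $ i) (e i))" for v :: "complex vec"
    define V where "V = \<phi> ` S"
    have Sd: "dim_vec v = d" if "v \<in> S" for v using S that by auto
    have \<phi>W: "\<phi> v \<in> W" for v unfolding \<phi>_def using e(2) sub by (intro fs.subspace_sum fs.subspace_scale) auto
    have coord: "v $ i = L2 (\<phi> v) (e i)" if "i < d" for v i
      unfolding \<phi>_def by (rule uniq[OF that])
    have \<phi>inj: "v = w" if "dim_vec v = d" "dim_vec w = d" "\<phi> v = \<phi> w" for v w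
      by (rule eq_vecI) (simp_all add: coord that)
    have "inv_space V"
      unfolding inv_space_def
    proof (intro conjI ballI)
      show "fs.subspace V"
      proof (rule fs.subspaceI)
        have "\<phi> (0\<^sub>v d) = 0" unfolding \<phi>_def by (auto simp: fun_eq_iff sum_fun_apply)
        then show "0 \<in> V" unfolding V_def using S by (metis imageI)
        show "f + g \<in> V" if fg: "f \<in> V" "g \<in> V" for f g
        proof -
          obtain v w where vw: "v \<in> S" "w \<in> S" "f = \<phi> v" "g = \<phi> w" using fg unfolding V_def by blast
          have "f + g = \<phi> (v + w)" unfolding vw \<phi>_def using Sd vw
            by (auto simp: fun_eq_iff sum_fun_apply distrib_right sum.distrib)
          then show ?thesis unfolding V_def using S vw by blast
        qed
        show "fscale c f \<in> V" if fV: "f \<in> V" for c f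
        proof -
          obtain v where v: "v \<in> S" "f = \<phi> v" using fV unfolding V_def by blast
          have "fscale c f = \<phi> (c \<cdot>\<^sub>v v)" unfolding v \<phi>_def using Sd v
            by (auto simp: fun_eq_iff sum_fun_apply sum_distrib_left mult.assoc)
          then show ?thesis unfolding V_def using S v by blast
        qed
      qed
      show "V \<subseteq> CF" using \<phi>W WC unfolding V_def by blast
      show "\<exists>B. finite B \<and> V \<subseteq> fs.span B" using fd \<phi>W unfolding V_def by blast
      fix x f assume x: "x \<in> carrier G" and "f \<in> V"
      then obtain v where v: "v \<in> S" "f = \<phi> v" unfolding V_def by blast
      have "rtrans x f = (\<Sum>j<d. fscale (v $ j) (\<Sum>i<d. fscale (u x i j) (e i)))"
        unfolding v \<phi>_def rtrans_sum rtrans_scale using Re[OF x] by simp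
      also have "\<dots> = (\<Sum>i<d. fscale (\<Sum>j<d. u x i j * v $ j) (e i))"
        by (auto simp: fun_eq_iff sum_fun_apply sum_distrib_left sum_distrib_right mult_ac intro: sum.swap)
      also have "\<dots> = \<phi> (U x *\<^sub>v v)"
        unfolding \<phi>_def using Sd[OF v(1)] Uc[of x]
        by (intro sum.cong refl arg_cong2[where f=fscale]) (auto simp: scalar_prod_def lessThan_atLeast0 Ui)
      finally show "rtrans x f \<in> V" unfolding V_def using S x v by blast
    qed
    moreover have "V \<subseteq> W" using \<phi>W unfolding V_def by blast
    ultimately consider "V = {0}" | "V = W" using min by blast
    then show "S = {0\<^sub>v d} \<or> S = carrier_vec d"
    proof cases
      case 1
      have z: "\<phi> (0\<^sub>v d) = 0" unfolding \<phi>_def by (auto simp: fun_eq_iff sum_fun_apply)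
      have "v = 0\<^sub>v d" if "v \<in> S" for v
        using that 1 Sd[OF that] unfolding V_def by (intro \<phi>inj) (auto simp: z)
      then show ?thesis using S by blast
    next
      case 2
      have "v \<in> S" if v: "v \<in> carrier_vec d" for v
      proof -
        have "\<phi> v \<in> V" using 2 \<phi>W by simp
        then obtain w where w: "w \<in> S" "\<phi> v = \<phi> w" unfolding V_def by blast
        then have "v = w" using v Sd by (intro \<phi>inj) auto
        then show ?thesis using w by simp
      qed
      then show ?thesis using S by blast
    qed
  qed (rule d0)
  have U: "U \<in> irreps G T" unfolding irreps_def using rep irr by simp
  have "e j \<in> trig_polys" if j: "j < d" for j
  proof -
    have "e j = (\<Sum>i<d. fscale (e i \<one>) (coef U i j))"
    proof
      fix x show "e j x = (\<Sum>i<d. fscale (e i \<one>) (coef U i j)) x"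
      proof (cases "x \<in> carrier G")
        case True
        have "e j x = rtrans x (e j) \<one>" using True by (simp add: rtrans_def)
        also have "\<dots> = (\<Sum>i<d. u x i j * e i \<one>)" unfolding Re[OF True j] by (simp add: sum_fun_apply)
        finally show ?thesis using True j by (simp add: sum_fun_apply coef_def Ui mult.commute)
      next
        case False
        then show ?thesis using eC[OF j] by (simp add: sum_fun_apply coef_def CF_def)
      qed
    qed
    also have "\<dots> \<in> trig_polys" unfolding trig_polys_def using U j dim
      by (intro fs.span_sum fs.span_scale fs.span_base) auto
    finally show ?thesis .
  qed
  then have "L2.proj d e f \<in> trig_polys" for f
    by (intro L2.proj_in_subspace) (auto simp: trig_polys_def)
  then show ?thesis using e(3) by (metis subsetI)
qed

text \<open>Otherwise the orthogonal complement of \<open>W \<inter> trig_polys\<close> in W is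
  nonzero. Translations are unitary, so it is invariant and contains a minimal invariant space; that
  one consists of trigonometric polynomials and is thus orthogonal to itself.\<close>

theorem inv_space_trig_polys:
  assumes W: "inv_space W" shows "W \<subseteq> trig_polys"
proof (rule ccontr)
  assume "\<not> W \<subseteq> trig_polys"
  then obtain f where f: "f \<in> W" "f \<notin> trig_polys" by blast
  have sub: "fs.subspace W" and WC: "W \<subseteq> CF" and fd: "\<exists>B. finite B \<and> W \<subseteq> fs.span B"
    and inv: "\<And>x f. x \<in> carrier G \<Longrightarrow> f \<in> W \<Longrightarrow> rtrans x f \<in> W"
    using W(1) unfolding inv_space_def by auto
  define W' where "W' = W \<inter> trig_polys"
  have sub': "fs.subspace W'" unfolding W'_def using sub by (intro fs.subspace_inter) (auto simp: trig_polys_def)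
  have inv': "rtrans x f \<in> W'" if "x \<in> carrier G" "f \<in> W'" for x f
    using that inv rtrans_trig_polys unfolding W'_def by blast
  define W'' where "W'' = {w \<in> W. \<forall>t\<in>W'. L2 w t = 0}"
  obtain B where B: "finite B" "W \<subseteq> fs.span B" using fd by blast
  have sub'': "fs.subspace W''"
  proof (rule fs.subspaceI)
    show "0 \<in> W''" unfolding W''_def using fs.subspace_0[OF sub] WC L2.ip_zero W'_def by auto
    show "f + g \<in> W''" if "f \<in> W''" "g \<in> W''" for f g
    proof -
      have "L2 (f + g) t = L2 f t + L2 g t" if "t \<in> W'" for t
        using that \<open>f \<in> W''\<close> \<open>g \<in> W''\<close> WC unfolding W''_def W'_def by (intro L2.ip_add) auto
      then show ?thesis using that fs.subspace_add[OF sub] unfolding W''_def by auto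
    qed
    show "fscale c f \<in> W''" if "f \<in> W''" for c f
    proof -
      have "L2 (fscale c f) t = c * L2 f t" if "t \<in> W'" for t
        using that \<open>f \<in> W''\<close> WC unfolding W''_def W'_def by (intro L2.ip_scale) auto
      then show ?thesis using that fs.subspace_scale[OF sub] unfolding W''_def by auto
    qed
  qed
  have inv'': "rtrans x w \<in> W''" if x: "x \<in> carrier G" and w: "w \<in> W''" for x w
  proof -
    have "L2 (rtrans x w) t = 0" if t: "t \<in> W'" for t
    proof -
      have tC: "t \<in> CF" "w \<in> CF" using t w WC unfolding W'_def W''_def by auto
      \<comment> \<open>Unitarity moves the translation by x onto t as translation by the inverse,
        which leaves t in \<open>W'\<close>.\<close>
      have "rtrans x (rtrans (inv x) t) = t" using x rtrans_mult[of x "inv x" t] rtrans_one[OF tC(1)] by simp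
      then have "L2 (rtrans x w) t = L2 (rtrans x w) (rtrans x (rtrans (inv x) t))" by simp
      also have "\<dots> = L2 w (rtrans (inv x) t)" using x tC rtrans_CF by (intro L2_rtrans) auto
      also have "\<dots> = 0" using inv'[OF _ t] x w unfolding W''_def by auto
      finally show ?thesis .
    qed
    then show ?thesis using inv[OF x] w unfolding W''_def by auto
  qed
  have ispace: "inv_space W''" unfolding inv_space_def using sub'' inv'' WC fd unfolding W''_def by blast
  have ne: "W'' \<noteq> {0}"
  proof -
    have W'B: "W' \<subseteq> CF" "W' \<subseteq> fs.span B" using WC B unfolding W'_def by auto
    obtain n e where e: "L2.orthonormal n e" "\<And>i. i < n \<Longrightarrow> e i \<in> W'" "\<And>f. f \<in> W' \<Longrightarrow> L2.proj n e f = f"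
      using L2.orthonormal_basis[OF sub' W'B(1) B(1) W'B(2)] by blast
    define g where "g = f - L2.proj n e f"
    have pW: "L2.proj n e f \<in> W'" by (rule L2.proj_in_subspace[OF sub' e(2)])
    have gW: "g \<in> W" unfolding g_def using f pW fs.subspace_diff[OF sub] unfolding W'_def by blast
    have "L2 g t = 0" if t: "t \<in> W'" for t
    proof -
      have gC: "g \<in> CF" using gW WC by blast
      have eC: "e i \<in> CF" if "i < n" for i using e(2)[OF that] W'B by blast
      have "L2 g (e i) = 0" if "i < n" for i
        unfolding g_def using L2.ip_proj[OF e(1) _ that] f WC by blast
      then have "L2 g (L2.proj n e t) = 0" unfolding L2.proj_def using eC gC by (subst L2.ip_sum_right) auto
      then show ?thesis using e(3)[OF t] by simp
    qed
    then have "g \<in> W''" using gW unfolding W''_def by simp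
    moreover have "g \<noteq> 0" using pW f unfolding g_def W'_def by auto
    ultimately show ?thesis by auto
  qed
  \<comment> \<open>A minimal space is found through the least size n of an orthonormal basis: a
    proper nonzero invariant subspace of V would have a basis of size at least n, and that could be
    prolonged inside V beyond its dimension.\<close>
  define P where "P n \<longleftrightarrow> (\<exists>V e. inv_space V \<and> V \<subseteq> W'' \<and> V \<noteq> {0} \<and> L2.orthonormal n e \<and>
    (\<forall>i<n. e i \<in> V) \<and> (\<forall>f\<in>V. L2.proj n e f = f))" for n
  have basis: "\<exists>n e. L2.orthonormal n e \<and> (\<forall>i<n. e i \<in> V) \<and> (\<forall>f\<in>V. L2.proj n e f = f)" if "inv_space V" for V
    using that L2.orthonormal_basis[of V] unfolding inv_space_def by metis
  have "\<exists>n. P n" unfolding P_def using basis[OF ispace] ispace ne by blast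
  then obtain n where n: "P n" "\<And>k. P k \<Longrightarrow> n \<le> k" by (metis LeastI Least_le)
  obtain V e where V: "inv_space V" "V \<subseteq> W''" "V \<noteq> {0}" and e: "L2.orthonormal n e" "\<And>i. i < n \<Longrightarrow> e i \<in> V"
    "\<And>f. f \<in> V \<Longrightarrow> L2.proj n e f = f" using n(1) unfolding P_def by blast
  have Vsub: "fs.subspace V" "V \<subseteq> CF" using V(1) unfolding inv_space_def by auto
  have Vspan: "V \<subseteq> fs.span (e ` {..<n})"
  proof
    fix f assume "f \<in> V"
    moreover have "L2.proj n e f \<in> fs.span (e ` {..<n})"
      by (rule L2.proj_in_subspace) (auto intro: fs.span_base)
    ultimately show "f \<in> fs.span (e ` {..<n})" using e(3) by simp
  qed
  have "V1 = V" if V1: "inv_space V1" "V1 \<subseteq> V" "V1 \<noteq> {0}" for V1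
  proof (rule ccontr)
    assume "V1 \<noteq> V"
    then obtain f where f: "f \<in> V" "f \<notin> V1" using V1 by blast
    obtain k e' where e': "L2.orthonormal k e'" "\<And>i. i < k \<Longrightarrow> e' i \<in> V1" "\<And>f. f \<in> V1 \<Longrightarrow> L2.proj k e' f = f"
      using basis[OF V1(1)] by blast
    have "P k" unfolding P_def using V1 V(2) e' by blast
    then have nk: "n \<le> k" by (rule n(2))
    have s1: "fs.subspace V1" using V1(1) unfolding inv_space_def by blast
    have e'V: "e' i \<in> V" if "i < k" for i using e'(2)[OF that] V1(2) by blast
    have "L2.proj k e' f \<in> V1" by (rule L2.proj_in_subspace[OF s1 e'(2)])
    then have ne: "f \<noteq> L2.proj k e' f" using f(2) by metis
    obtain g where g: "L2.orthonormal (Suc k) (e'(k := g))" "g \<in> V"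
      by (rule L2.orthonormal_extend[OF e'(1) Vsub e'V f(1) ne])
    have "Suc k \<le> card (e ` {..<n})"
      using g e'(2) V1(2) Vspan by (intro L2.orthonormal_card_le[OF g(1)]) (auto simp: less_Suc_eq)
    also have "\<dots> \<le> n" using card_image_le[of "{..<n}" e] by simp
    finally show False using nk by simp
  qed
  then have "V \<subseteq> trig_polys" using minimal_inv_space[OF V(1,3)] by blast
  then have "V \<subseteq> W'" using V(2) unfolding W'_def W''_def by blast
  then have "L2 v v = 0" if "v \<in> V" for v using that V(2) unfolding W''_def by blast
  then have "V \<subseteq> {0}" using L2_definite Vsub(2) by blast
  then show False using V(3) fs.subspace_0[OF Vsub(1)] by blast
qed

end

section \<open>Uniform approximation by trigonometric polynomials\<close>

context haar_group
begin

text \<open>The classical representative functions, whose right translates span a finite-dimensional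
  space. They are described by a finite generating set \<open>B\<close>, since in this form sums,
  conjugates and products reduce to operations on generators.\<close>

definition representative :: "('a \<Rightarrow> complex) \<Rightarrow> bool" where
  "representative f \<longleftrightarrow> (\<exists>B. finite B \<and> B \<subseteq> CF \<and>
     (\<forall>b\<in>B. \<forall>x\<in>carrier G. rtrans x b \<in> fs.span B) \<and> f \<in> fs.span B)"

lemma representative_trig_poly:
  assumes "representative f" shows "f \<in> trig_polys"
proof -
  obtain B where B: "finite B" "B \<subseteq> CF" "\<And>b x. b \<in> B \<Longrightarrow> x \<in> carrier G \<Longrightarrow> rtrans x b \<in> fs.span B" "f \<in> fs.span B"
    using assms unfolding representative_def by blast
  have "inv_space (fs.span B)"
    unfolding inv_space_def using B rtrans_span[of B] fs.span_minimal[OF B(2) subspace_CF] by auto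
  then show ?thesis using inv_space_trig_polys B(4) by blast
qed

lemma representative_CF: "representative f \<Longrightarrow> f \<in> CF"
  using representative_trig_poly trig_polys_CF by blast

lemma representative_scale: "representative f \<Longrightarrow> representative (fscale c f)"
  unfolding representative_def using fs.span_scale by meson

lemma representative_add:
  assumes "representative f" "representative g" shows "representative (f + g)"
proof -
  obtain A B where A: "finite A" "A \<subseteq> CF" "\<And>b x. b \<in> A \<Longrightarrow> x \<in> carrier G \<Longrightarrow> rtrans x b \<in> fs.span A" "f \<in> fs.span A"
    and B: "finite B" "B \<subseteq> CF" "\<And>b x. b \<in> B \<Longrightarrow> x \<in> carrier G \<Longrightarrow> rtrans x b \<in> fs.span B" "g \<in> fs.span B"
    using assms unfolding representative_def by metis
  have "fs.span A \<subseteq> fs.span (A \<union> B)" "fs.span B \<subseteq> fs.span (A \<union> B)" by (auto intro!: fs.span_mono)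
  then show ?thesis unfolding representative_def using A B fs.span_add[of f "A \<union> B" g]
    by (intro exI[of _ "A \<union> B"]) blast
qed

lemma representative_cnj:
  assumes "representative f" shows "representative (\<lambda>x. cnj (f x))"
proof -
  obtain B where B: "finite B" "B \<subseteq> CF" "\<And>b x. b \<in> B \<Longrightarrow> x \<in> carrier G \<Longrightarrow> rtrans x b \<in> fs.span B" "f \<in> fs.span B"
    using assms unfolding representative_def by blast
  define B' where "B' = (\<lambda>b x. cnj (b x)) ` B"
  have sp: "(\<lambda>x. cnj (h x)) \<in> fs.span B'" if "h \<in> fs.span B" for h
    using that
  proof (induction rule: fs.span_induct_alt)
    case base
    have "(\<lambda>x. cnj ((0 :: 'a \<Rightarrow> complex) x)) = 0" by auto
    then show ?case using fs.span_zero by metis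
  next
    case (step c b y)
    have eq: "(\<lambda>x. cnj ((fscale c b + y) x)) = fscale (cnj c) (\<lambda>x. cnj (b x)) + (\<lambda>x. cnj (y x))" by auto
    have "(\<lambda>x. cnj (b x)) \<in> fs.span B'" using step unfolding B'_def by (intro fs.span_base) auto
    then show ?case unfolding eq by (intro fs.span_add fs.span_scale step.IH)
  qed
  have "rtrans x (\<lambda>x. cnj (b x)) = (\<lambda>y. cnj (rtrans x b y))" for x b by (auto simp: rtrans_def)
  then have "\<forall>b\<in>B'. \<forall>x\<in>carrier G. rtrans x b \<in> fs.span B'" using B(3) sp unfolding B'_def by auto
  then show ?thesis unfolding representative_def using B sp CF_cnj by (intro exI[of _ B']) (auto simp: B'_def)
qed

text \<open>The products of generators generate. Together with
  \<open>representative_trig_poly\<close> this stands for the decomposition of tensor products of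
  representations.\<close>

lemma representative_mult:
  assumes "representative f" "representative g" shows "representative (\<lambda>x. f x * g x)"
proof -
  obtain A B where A: "finite A" "A \<subseteq> CF" "\<And>b x. b \<in> A \<Longrightarrow> x \<in> carrier G \<Longrightarrow> rtrans x b \<in> fs.span A" "f \<in> fs.span A"
    and B: "finite B" "B \<subseteq> CF" "\<And>b x. b \<in> B \<Longrightarrow> x \<in> carrier G \<Longrightarrow> rtrans x b \<in> fs.span B" "g \<in> fs.span B"
    using assms unfolding representative_def by metis
  define D where "D = (\<lambda>(a, b) x. a x * b x) ` (A \<times> B)"
  have sp: "(\<lambda>x. h x * k x) \<in> fs.span D" if h: "h \<in> fs.span A" and k: "k \<in> fs.span B" for h k
    using h
  proof (induction rule: fs.span_induct_alt)
    case base
    have "(\<lambda>x. (0 :: 'a \<Rightarrow> complex) x * k x) = 0" by auto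
    then show ?case using fs.span_zero by metis
  next
    case (step c a y)
    have "(\<lambda>x. a x * k x) \<in> fs.span D"
      using k
    proof (induction rule: fs.span_induct_alt)
      case base
      have "(\<lambda>x. a x * (0 :: 'a \<Rightarrow> complex) x) = 0" by auto
      then show ?case using fs.span_zero by metis
    next
      case (step c b y)
      have eq: "(\<lambda>x. a x * (fscale c b + y) x) = fscale c (\<lambda>x. a x * b x) + (\<lambda>x. a x * y x)" by (auto simp: algebra_simps)
      have "(\<lambda>x. a x * b x) \<in> fs.span D"
        using step \<open>a \<in> A\<close> unfolding D_def by (intro fs.span_base) (auto intro!: image_eqI[of _ _ "(a, b)"])
      then show ?case unfolding eq by (intro fs.span_add fs.span_scale step.IH)
    qed
    moreover have eq: "(\<lambda>x. (fscale c a + y) x * k x) = fscale c (\<lambda>x. a x * k x) + (\<lambda>x. y x * k x)" by (auto simp: algebra_simps)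
    ultimately show ?case unfolding eq by (intro fs.span_add fs.span_scale step.IH)
  qed
  have "rtrans x (\<lambda>x. a x * b x) = (\<lambda>y. rtrans x a y * rtrans x b y)" for x a b by (auto simp: rtrans_def)
  then have "\<forall>d\<in>D. \<forall>x\<in>carrier G. rtrans x d \<in> fs.span D" using A(3) B(3) sp unfolding D_def by auto
  moreover have "D \<subseteq> CF" using A(2) B(2) CF_mult unfolding D_def by auto
  ultimately show ?thesis unfolding representative_def using A(1,4) B(1,4) sp by (intro exI[of _ D]) (auto simp: D_def)
qed

lemma representative_const: "representative (\<lambda>x. if x \<in> carrier G then c else 0)"
proof -
  define k where "k = (\<lambda>x. if x \<in> carrier G then c else 0)"
  have "k \<in> CF" unfolding k_def by (rule CF_I[where f="\<lambda>_. c"]) auto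
  moreover have "rtrans x k = k" if "x \<in> carrier G" for x using that unfolding rtrans_def k_def by auto
  ultimately show ?thesis unfolding k_def[symmetric] representative_def
    by (intro exI[of _ "{k}"]) (auto intro: fs.span_base)
qed

lemma representative_coef:
  assumes "unitary_rep G T U" "i < rep_dim G U" "j < rep_dim G U"
  shows "representative (coef U i j)"
proof -
  define B where "B = (\<lambda>(i, j). coef U i j) ` ({..<rep_dim G U} \<times> {..<rep_dim G U})"
  have inB: "coef U i j \<in> B" if "i < rep_dim G U" "j < rep_dim G U" for i j
    using that unfolding B_def by (intro image_eqI[of _ _ "(i, j)"]) auto
  have "rtrans x b \<in> fs.span B" if b: "b \<in> B" and x: "x \<in> carrier G" for x b
  proof -
    obtain i j where ij: "b = coef U i j" "i < rep_dim G U" "j < rep_dim G U" using b unfolding B_def by auto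
    show ?thesis unfolding ij(1) rtrans_coef[OF assms(1) ij(2,3) x]
      using ij inB by (intro fs.span_sum fs.span_scale fs.span_base) auto
  qed
  moreover have "B \<subseteq> CF" unfolding B_def using coef_CF[OF assms(1)] by auto
  moreover have "finite B" unfolding B_def by simp
  ultimately show ?thesis unfolding representative_def
    using fs.span_base[OF inB[OF assms(2,3)]] by (intro exI[of _ B] conjI ballI) simp_all
qed

text \<open>Stone-Weierstrass on the compact image of G under the coordinates \<open>w\<close>. The
  algebra consists of the continuous real functions on the image whose pullbacks to G are
  representative, so the approximant pulls back to a trigonometric polynomial.\<close>

lemma Lipschitz_approx_trig_poly:
  fixes w :: "nat \<Rightarrow> 'a \<Rightarrow> complex" and H :: "(nat \<Rightarrow> complex) \<Rightarrow> real"
  assumes w: "\<And>k. k < n \<Longrightarrow> representative (w k)"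
    and H: "\<And>c c'. \<bar>H c - H c'\<bar> \<le> L * (\<Sum>k<n. norm (c k - c' k))" and e: "e > 0"
  shows "continuous_map T euclidean (\<lambda>x. H (\<lambda>k. w k x))"
    and "\<exists>p\<in>trig_polys. \<forall>x\<in>carrier G. norm (of_real (H (\<lambda>k. w k x)) - p x) < e"
proof -
  \<comment> \<open>Padding by 0 makes the image a compact subset of a space of sequences; the
    Lipschitz bound shows that \<open>H\<close> does not see the padding.\<close>
  define W where "W x = (\<lambda>k. if k < n then w k x else 0)" for x
  define S where "S = W ` carrier G"
  have HW: "H (W x) = H (\<lambda>k. w k x)" for x
    using H[of "W x" "\<lambda>k. w k x"] unfolding W_def by simp
  have contW: "continuous_map T euclidean W"
    unfolding euclidean_product_topology[symmetric] continuous_map_componentwise_UNIV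
  proof
    fix k show "continuous_map T euclidean (\<lambda>x. W x k)"
      using CF_continuous[OF representative_CF[OF w]] unfolding W_def by (cases "k < n") auto
  qed
  have "compactin euclidean (W ` topspace T)"
    using compact contW unfolding compact_space_def by (intro image_compactin)
  then have compS: "compact S" unfolding S_def topspace_eq by simp
  \<comment> \<open>The Lipschitz bound involves finitely many coordinates, each continuous in the
    product topology.\<close>
  have contH: "continuous_on UNIV H"
    unfolding continuous_on_def
  proof
    fix c :: "nat \<Rightarrow> complex"
    have pt: "((\<lambda>c'. c' k) \<longlongrightarrow> c k) (at c within UNIV)" for k
      using continuous_on_product_coordinates[of k] unfolding continuous_on_def by auto
    have lim: "((\<lambda>c'. L * (\<Sum>k<n. norm (c' k - c k))) \<longlongrightarrow> L * (\<Sum>k<n. norm (c k - c k))) (at c within UNIV)"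
      by (intro tendsto_intros pt)
    have "((\<lambda>c'. H c' - H c) \<longlongrightarrow> 0) (at c within UNIV)"
      by (rule Lim_null_comparison[OF _ lim[simplified]]) (use H in auto)
    then show "(H \<longlongrightarrow> H c) (at c within UNIV)" by (simp add: LIM_zero_iff)
  qed
  show "continuous_map T euclidean (\<lambda>x. H (\<lambda>k. w k x))"
    using continuous_map_compose[OF contW, of euclidean H] contH HW by (simp add: o_def)
  define R where "R = {q. continuous_on S q \<and> (\<exists>f. representative f \<and> (\<forall>x\<in>carrier G. complex_of_real (q (W x)) = f x))}"
  interpret function_ring_on R S
  proof
    show "compact S" by (rule compS)
    show "continuous_on S f" if "f \<in> R" for f using that unfolding R_def by blast
    show "(\<lambda>x. f x + g x) \<in> R" if fg: "f \<in> R" "g \<in> R" for f g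
    proof -
      obtain f' g' where "representative f'" "\<forall>x\<in>carrier G. complex_of_real (f (W x)) = f' x"
        "representative g'" "\<forall>x\<in>carrier G. complex_of_real (g (W x)) = g' x" using fg unfolding R_def by blast
      then have "representative (f' + g')" "\<forall>x\<in>carrier G. complex_of_real (f (W x) + g (W x)) = (f' + g') x"
        using representative_add by auto
      then show ?thesis using fg unfolding R_def by (auto intro: continuous_on_add)
    qed
    show "(\<lambda>x. f x * g x) \<in> R" if fg: "f \<in> R" "g \<in> R" for f g
    proof -
      obtain f' g' where "representative f'" "\<forall>x\<in>carrier G. complex_of_real (f (W x)) = f' x"
        "representative g'" "\<forall>x\<in>carrier G. complex_of_real (g (W x)) = g' x" using fg unfolding R_def by blast
      then have "representative (\<lambda>x. f' x * g' x)" "\<forall>x\<in>carrier G. complex_of_real (f (W x) * g (W x)) = f' x * g' x"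
        using representative_mult by auto
      then show ?thesis using fg unfolding R_def by (auto intro!: continuous_on_mult)
    qed
    show "(\<lambda>_. c) \<in> R" for c
      using representative_const[of "complex_of_real c"] unfolding R_def by auto
    show "\<exists>f\<in>R. f x \<noteq> f y" if xy: "x \<in> S" "y \<in> S" "x \<noteq> y" for x y
    proof -
      obtain k where k: "x k \<noteq> y k" using xy(3) by blast
      obtain a b where ab: "x = W a" "y = W b" using xy(1,2) unfolding S_def by blast
      have kn: "k < n" using k unfolding ab W_def by (rule contrapos_np) simp
      have ck: "continuous_on S (\<lambda>c :: nat \<Rightarrow> complex. c k)"
        by (rule continuous_on_subset[OF continuous_on_product_coordinates subset_UNIV])
      have wc: "representative (\<lambda>x. cnj (w k x))" using representative_cnj[OF w[OF kn]] .
      \<comment> \<open>Real and imaginary parts of coordinates separate the points of the image.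
        Their pullbacks are representative because conjugates of representative functions
        are.\<close>
      have "complex_of_real (Re z) = (1/2) * z + (1/2) * cnj z" for z by (simp add: complex_eq_iff)
      then have re: "\<forall>z\<in>carrier G. complex_of_real (Re (W z k)) = (fscale (1/2) (w k) + fscale (1/2) (\<lambda>x. cnj (w k x))) z"
        using kn unfolding W_def by simp
      have ReR: "(\<lambda>c. Re (c k)) \<in> R" unfolding R_def
        using re representative_add[OF representative_scale[OF w[OF kn]] representative_scale[OF wc]] ck
        by (intro CollectI conjI exI[of _ "fscale (1/2) (w k) + fscale (1/2) (\<lambda>x. cnj (w k x))"] continuous_intros) auto
      have "complex_of_real (Im z) = (-\<i>/2) * z + (\<i>/2) * cnj z" for z by (simp add: complex_eq_iff)
      then have im: "\<forall>z\<in>carrier G. complex_of_real (Im (W z k)) = (fscale (-\<i>/2) (w k) + fscale (\<i>/2) (\<lambda>x. cnj (w k x))) z"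
        using kn unfolding W_def by simp
      have ImR: "(\<lambda>c. Im (c k)) \<in> R" unfolding R_def
        using im representative_add[OF representative_scale[OF w[OF kn]] representative_scale[OF wc]] ck
        by (intro CollectI conjI exI[of _ "fscale (-\<i>/2) (w k) + fscale (\<i>/2) (\<lambda>x. cnj (w k x))"] continuous_intros)
      show ?thesis
      proof (cases "Re (x k) = Re (y k)")
        case True
        then have "Im (x k) \<noteq> Im (y k)" using k complex_eqI by blast
        then show ?thesis by (intro bexI[OF _ ImR])
      next
        case False
        then show ?thesis by (intro bexI[OF _ ReR])
      qed
    qed
  qed
  obtain g where g: "g \<in> R" "\<forall>x\<in>S. \<bar>H x - g x\<bar> < e"
    using Stone_Weierstrass_basic[OF continuous_on_subset[OF contH] e] by blast
  obtain f where f: "representative f" "\<forall>x\<in>carrier G. complex_of_real (g (W x)) = f x" using g(1) unfolding R_def by blast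
  have "norm (of_real (H (\<lambda>k. w k x)) - f x) < e" if x: "x \<in> carrier G" for x
  proof -
    have "of_real (H (\<lambda>k. w k x)) - f x = complex_of_real (H (W x) - g (W x))" using f(2) x HW by simp
    then have "norm (of_real (H (\<lambda>k. w k x)) - f x) = \<bar>H (W x) - g (W x)\<bar>" by (simp only: norm_of_real)
    then show ?thesis using g(2) x unfolding S_def by simp
  qed
  then show "\<exists>p\<in>trig_polys. \<forall>x\<in>carrier G. norm (of_real (H (\<lambda>k. w k x)) - p x) < e"
    using representative_trig_poly[OF f(1)] by blast
qed

end

section \<open>Lattice packing in complex vector spaces\<close>

text \<open>
  A volume-free packing bound. The volume comparison is replaced by counting lattice points:
  since the number of lattice points in a ball of radius \<open>L\<close> is \<open>O(L\<^sup>k)\<close>, for suitable arbitrarily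
  large \<open>L\<close> the dilation by \<open>q\<close> multiplies it by at most \<open>2 q\<^sup>k\<close>.
\<close>

lemma polynomial_growth_dilation:
  fixes b :: "nat \<Rightarrow> nat"
  assumes b1: "\<And>L. b L \<ge> 1" and bp: "\<And>L. b L \<le> (2 * L + 1) ^ k" and q: "q \<ge> 1"
  shows "\<exists>L\<ge>L0. b (q * L) \<le> 2 * q ^ k * b L"
proof (rule ccontr)
  assume "\<not> ?thesis"
  then have gr: "b (q * L) > 2 * q ^ k * b L" if "L \<ge> L0" for L using that not_le by blast
  define L1 where "L1 = max L0 1"
  have low: "b (q ^ j * L1) \<ge> 2 ^ j * q ^ (k * j)" for j
  proof (induction j)
    case 0 then show ?case using b1 by simp
  next
    case (Suc j)
    have "1 \<le> q ^ j" using q by simp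
    then have "L0 \<le> q ^ j * L1" unfolding L1_def by (metis le_trans max.cobounded1 mult_le_mono1 nat_mult_1)
    then have 1: "2 * q ^ k * b (q ^ j * L1) \<le> b (q * (q ^ j * L1))" using gr by (simp add: less_imp_le)
    have 2: "2 * q ^ k * (2 ^ j * q ^ (k * j)) \<le> 2 * q ^ k * b (q ^ j * L1)" using Suc by simp
    have 3: "2 ^ Suc j * q ^ (k * Suc j) = 2 * q ^ k * (2 ^ j * q ^ (k * j))"
      by (simp add: power_add mult_ac)
    have 4: "q ^ Suc j * L1 = q * (q ^ j * L1)" by simp
    show ?case unfolding 3 4 by (rule order_trans[OF 2 1])
  qed
  have up: "b (q ^ j * L1) \<le> (3 * L1) ^ k * q ^ (k * j)" for j
  proof -
    have "1 \<le> q ^ j * L1" using q unfolding L1_def by (simp add: Suc_le_eq)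
    then have "2 * (q ^ j * L1) + 1 \<le> 3 * L1 * q ^ j" by simp
    then have "(2 * (q ^ j * L1) + 1) ^ k \<le> (3 * L1 * q ^ j) ^ k" by (rule power_mono) simp
    then show ?thesis using bp[of "q ^ j * L1"] by (simp add: power_mult_distrib power_mult mult.commute[of k])
  qed
  \<comment> \<open>After this many iterations \<open>low\<close> and \<open>up\<close> together say
    \<open>2 ^ j \<le> j\<close>.\<close>
  define j where "j = (3 * L1) ^ k"
  have "2 ^ j * q ^ (k * j) \<le> j * q ^ (k * j)" using low[of j] up[of j] unfolding j_def by linarith
  moreover have "q ^ (k * j) > 0" using q by simp
  ultimately have "2 ^ j \<le> j" by (simp only: mult_le_cancel2)
  then show False using less_exp[of j] by simp
qed

lemma packing_bound:
  fixes N :: "('i \<Rightarrow> complex) \<Rightarrow> real" and u :: "'y \<Rightarrow> 'i \<Rightarrow> complex"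
  assumes I: "finite I"
    and add: "\<And>c c'. N (\<lambda>i. c i + c' i) \<le> N c + N c'"
    and scale: "\<And>t c. N (\<lambda>i. of_real t * c i) \<le> \<bar>t\<bar> * N c"
    and coord: "\<And>c i. i \<in> I \<Longrightarrow> norm (c i) \<le> N c"
    and bound: "\<And>c. N c \<le> C * (\<Sum>i\<in>I. norm (c i))" and C: "C \<ge> 0"
    and Y: "finite Y" "\<And>y. y \<in> Y \<Longrightarrow> N (u y) \<le> 1"
    and sep: "\<And>y z. y \<in> Y \<Longrightarrow> z \<in> Y \<Longrightarrow> y \<noteq> z \<Longrightarrow> N (\<lambda>i. u y i - u z i) \<ge> \<delta>"
    and \<delta>: "0 < \<delta>" "\<delta> \<le> 1" and q: "5 / \<delta> \<le> real q"
  shows "card Y \<le> 2 * q ^ (2 * card I)"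
proof -
  define J where "J = I \<times> (UNIV :: bool set)"
  define w where "w z = (\<lambda>i. Complex (of_int (z (i, True))) (of_int (z (i, False))))" for z :: "'i \<times> bool \<Rightarrow> int"
  have fJ: "finite J" "card J = 2 * card I" unfolding J_def using I by (auto simp: card_cartesian_product)
  have diff0: "N (\<lambda>i. c i - c' i) \<le> C * (\<Sum>i\<in>I. norm (c i - c' i))" for c c' using bound by simp
  have tri: "N c \<le> N c' + N (\<lambda>i. c i - c' i)" for c c' using add[of c' "\<lambda>i. c i - c' i"] by simp
  \<comment> \<open>\<open>bound\<close> makes \<open>N\<close> nonpositive on a difference that
    vanishes on \<open>I\<close>, so \<open>N\<close> depends on the coordinates in \<open>I\<close>
    only.\<close>
  have Ncong: "N c \<le> N c'" if "\<And>i. i \<in> I \<Longrightarrow> c i = c' i" for c c'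
    using tri[of c c'] diff0[of c c'] that by simp
  have Nminus: "N (\<lambda>i. - c i) \<le> N c" for c using scale[of "-1" c] by simp
  have Nsub: "N (\<lambda>i. c i - c' i) \<le> N c + N c'" for c c' using add[of c "\<lambda>i. - c' i"] Nminus[of c'] by simp
  define B where "B L = {z \<in> PiE J (\<lambda>_. UNIV). N (w z) \<le> real L}" for L :: nat
  have Bsub: "B L \<subseteq> PiE J (\<lambda>_. {- int L..int L})" for L
  proof
    fix z assume z: "z \<in> B L"
    have "z (i, b) \<in> {- int L..int L}" if i: "i \<in> I" for i b
    proof -
      have "norm (w z i) \<le> real L" using coord[OF i, of "w z"] z unfolding B_def by simp
      moreover have "\<bar>Re (w z i)\<bar> \<le> norm (w z i)" "\<bar>Im (w z i)\<bar> \<le> norm (w z i)"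
        by (rule abs_Re_le_cmod, rule abs_Im_le_cmod)
      ultimately have "\<bar>real_of_int (z (i, b))\<bar> \<le> real L" unfolding w_def by (cases b) auto
      then show ?thesis by (simp add: abs_le_iff)
    qed
    then show "z \<in> PiE J (\<lambda>_. {- int L..int L})" using z unfolding B_def J_def by (auto simp: PiE_iff)
  qed
  have finB: "finite (B L)" for L by (rule finite_subset[OF Bsub]) (auto intro!: finite_PiE fJ)
  define b where "b L = card (B L)" for L
  have bp: "b L \<le> (2 * L + 1) ^ (2 * card I)" for L
  proof -
    have "b L \<le> card (PiE J (\<lambda>_. {- int L..int L}))" unfolding b_def
      by (intro card_mono Bsub finite_PiE fJ) auto
    also have "\<dots> = (2 * L + 1) ^ (2 * card I)" 
    proof -
      have "card {- int L..int L} = 2 * L + 1" unfolding card_atLeastAtMost_int by linarith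
      then show ?thesis using fJ by (simp add: card_PiE)
    qed
    finally show ?thesis .
  qed
  have b1: "b L \<ge> 1" for L
  proof -
    define z0 where "z0 = (\<lambda>j\<in>J. 0 :: int)"
    have "N (w z0) \<le> C * (\<Sum>i\<in>I. norm (w z0 i))" by (rule bound)
    also have "(\<Sum>i\<in>I. norm (w z0 i)) = 0" unfolding w_def z0_def J_def by (intro sum.neutral) (auto simp: complex_eq_iff Complex_eq_0)
    finally have "N (w z0) \<le> real L" by simp
    moreover have "z0 \<in> PiE J (\<lambda>_. UNIV)" unfolding z0_def by auto
    ultimately have "z0 \<in> B L" unfolding B_def by simp
    then show ?thesis unfolding b_def using finB by (metis One_nat_def Suc_leI card_gt_0_iff empty_iff)
  qed
  have q1: "q \<ge> 1"
  proof -
    have "5 / \<delta> > 0" using \<delta> by simp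
    then show ?thesis using q by linarith
  qed
  \<comment> \<open>Bounds the rounding error measured by \<open>N\<close>, each complex coordinate
    being moved by at most 2.\<close>
  define K where "K = 2 * C * real (card I)"
  have K0: "K \<ge> 0" unfolding K_def using C by simp
  obtain L where L: "L \<ge> nat \<lceil>2 * K + 1\<rceil>" "b (q * L) \<le> 2 * q ^ (2 * card I) * b L"
    using polynomial_growth_dilation[of b "2 * card I" q, OF b1 bp q1] by blast
  have LK: "real L \<ge> 2 * K + 1" using L(1) by linarith
  \<comment> \<open>After scaling by \<open>s\<close> the points are at distance at least
    \<open>s * \<delta> = 2 * L + 2 * K + 1\<close>, more than two radii and two rounding errors, so
    the lattice balls around the rounded points are disjoint.\<close>
  define s where "s = (2 * real L + 2 * K + 1) / \<delta>"
  have s0: "s > 0" unfolding s_def using \<delta> K0 by simp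
  define r where "r y = (\<lambda>(i, b)\<in>J. if b then \<lfloor>s * Re (u y i)\<rfloor> else \<lfloor>s * Im (u y i)\<rfloor>)" for y
  have rd: "N (\<lambda>i. w (r y) i - of_real s * u y i) \<le> K" for y
  proof -
    have "norm (w (r y) i - of_real s * u y i) \<le> 2" if i: "i \<in> I" for i
    proof -
      have "norm (w (r y) i - of_real s * u y i) \<le> \<bar>Re (w (r y) i - of_real s * u y i)\<bar> + \<bar>Im (w (r y) i - of_real s * u y i)\<bar>"
        by (rule cmod_le)
      also have "\<dots> \<le> 1 + 1"
      proof (rule add_mono)
        show "\<bar>Re (w (r y) i - of_real s * u y i)\<bar> \<le> 1" using i unfolding w_def r_def J_def by simp linarith
        show "\<bar>Im (w (r y) i - of_real s * u y i)\<bar> \<le> 1" using i unfolding w_def r_def J_def by simp linarith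
      qed
      finally show ?thesis by simp
    qed
    then have "(\<Sum>i\<in>I. norm (w (r y) i - of_real s * u y i)) \<le> real (card I) * 2"
      by (intro sum_bounded_above[of I _ 2, simplified]) auto
    then have "C * (\<Sum>i\<in>I. norm (w (r y) i - of_real s * u y i)) \<le> K"
      unfolding K_def using C mult_left_mono by fastforce
    then show ?thesis using bound[of "\<lambda>i. w (r y) i - of_real s * u y i"] by linarith
  qed
  \<comment> \<open>Moves the lattice ball to the rounded points. This gives \<open>card Y\<close>
    disjoint copies inside the ball of radius \<open>q * L\<close>, whose number of lattice points
    is controlled by the choice of \<open>L\<close>.\<close>
  define A where "A = (\<lambda>(y, z). \<lambda>j\<in>J. r y j + z j)"
  have wA: "w (A (y, z)) i = w (r y) i + w z i" if "i \<in> I" for y z i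
    using that unfolding w_def A_def J_def by (simp add: complex_eq_iff)
  have inj: "inj_on A (Y \<times> B L)"
  proof (rule inj_onI, clarify)
    fix y z y' z' assume y: "y \<in> Y" "y' \<in> Y" and z: "z \<in> B L" "z' \<in> B L" and eq: "A (y, z) = A (y', z')"
    have "y = y'"
    proof (rule ccontr)
      assume ne: "y \<noteq> y'"
      have e: "u y i - u y' i = of_real (1 / s) * ((w z' i - w z i) + ((w (r y') i - of_real s * u y' i) - (w (r y) i - of_real s * u y i)))"
        if i: "i \<in> I" for i
      proof -
        have "w (r y) i + w z i = w (r y') i + w z' i" using wA[OF i, of y z] wA[OF i, of y' z'] eq by simp
        then have "w z' i - w z i = w (r y) i - w (r y') i" by (simp add: algebra_simps)
        then show ?thesis using s0 by (simp add: field_simps)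
      qed
      have "N (\<lambda>i. u y i - u y' i) \<le> N (\<lambda>i. of_real (1 / s) * ((w z' i - w z i) + ((w (r y') i - of_real s * u y' i) - (w (r y) i - of_real s * u y i))))"
        by (rule Ncong) (rule e)
      also have "\<dots> \<le> \<bar>1 / s\<bar> * N (\<lambda>i. (w z' i - w z i) + ((w (r y') i - of_real s * u y' i) - (w (r y) i - of_real s * u y i)))"
        by (rule scale)
      also have "\<dots> \<le> \<bar>1 / s\<bar> * (2 * real L + 2 * K)"
      proof (rule mult_left_mono)
        have "N (\<lambda>i. w z' i - w z i) \<le> 2 * real L" using Nsub[of "w z'" "w z"] z unfolding B_def by auto
        moreover have "N (\<lambda>i. (w (r y') i - of_real s * u y' i) - (w (r y) i - of_real s * u y i)) \<le> 2 * K"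
          using Nsub[of "\<lambda>i. w (r y') i - of_real s * u y' i" "\<lambda>i. w (r y) i - of_real s * u y i"] rd[of y] rd[of y'] by linarith
        ultimately show "N (\<lambda>i. (w z' i - w z i) + ((w (r y') i - of_real s * u y' i) - (w (r y) i - of_real s * u y i))) \<le> 2 * real L + 2 * K"
          using add[of "\<lambda>i. w z' i - w z i" "\<lambda>i. (w (r y') i - of_real s * u y' i) - (w (r y) i - of_real s * u y i)"] by linarith
      qed simp
      also have "\<dots> < \<delta>"
      proof -
        have "\<bar>1 / s\<bar> * (2 * real L + 2 * K) = \<delta> * (2 * real L + 2 * K) / (2 * real L + 2 * K + 1)"
          using s0 \<delta> K0 unfolding s_def by (simp add: field_simps)
        also have "\<dots> < \<delta>" using \<delta> K0 by (simp add: field_simps)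
        finally show ?thesis .
      qed
      finally show False using sep[OF y ne] by simp
    qed
    moreover have "z = z'"
    proof (rule PiE_ext[of z J "\<lambda>_. UNIV" z'])
      fix j assume j: "j \<in> J"
      then show "z j = z' j" using fun_cong[OF eq, of j] \<open>y = y'\<close> unfolding A_def by simp
    qed (use z in \<open>auto simp: B_def\<close>)
    ultimately show "y = y' \<and> z = z'" by simp
  qed
  have "A ` (Y \<times> B L) \<subseteq> B (q * L)"
  proof (clarify)
    fix y z assume y: "y \<in> Y" and z: "z \<in> B L"
    have "N (w (A (y, z))) \<le> N (\<lambda>i. w (r y) i + w z i)" by (rule Ncong) (rule wA)
    also have "\<dots> \<le> N (w (r y)) + N (w z)" by (rule add)
    also have "N (w (r y)) \<le> N (\<lambda>i. of_real s * u y i) + K"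
      using tri[of "w (r y)" "\<lambda>i. of_real s * u y i"] rd[of y] by linarith
    also have "N (\<lambda>i. of_real s * u y i) \<le> s"
    proof -
      have "s * N (u y) \<le> s * 1" using Y(2)[OF y] s0 by (intro mult_left_mono) auto
      moreover have "N (\<lambda>i. of_real s * u y i) \<le> s * N (u y)" using scale[of s "u y"] s0 by simp
      ultimately show ?thesis by linarith
    qed
    also have "N (w z) \<le> real L" using z unfolding B_def by simp
    \<comment> \<open>From \<open>2 * K + 1 \<le> L\<close> come
      \<open>s \<le> 3 * L / \<delta>\<close> and \<open>K + L \<le> 2 * L / \<delta>\<close>: this
      is the origin of the 5 in the choice of \<open>q\<close>.\<close>
    also have "s + K + real L \<le> (5 / \<delta>) * real L"
    proof -
      have "s \<le> 3 * real L / \<delta>" unfolding s_def using \<delta> LK K0 by (intro divide_right_mono) auto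
      moreover have "K + real L \<le> 2 * real L / \<delta>"
      proof -
        have "2 * real L * \<delta> \<le> 2 * real L" using \<delta> by (intro mult_left_le) auto
        then have "2 * real L \<le> 2 * real L / \<delta>" using \<delta> by (simp add: field_simps)
        then show ?thesis using LK K0 by linarith
      qed
      moreover have "(5 / \<delta>) * real L = 3 * real L / \<delta> + 2 * real L / \<delta>"
        by (simp add: add_divide_distrib[symmetric])
      ultimately show ?thesis by linarith
    qed
    also have "\<dots> \<le> real q * real L" using q by (intro mult_right_mono) auto
    finally show "A (y, z) \<in> B (q * L)" unfolding B_def A_def by auto
  qed
  then have "card (A ` (Y \<times> B L)) \<le> b (q * L)" unfolding b_def by (intro card_mono finB)
  then have "card Y * b L \<le> 2 * q ^ (2 * card I) * b L"
    using L(2) unfolding card_image[OF inj] card_cartesian_product b_def by linarith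
  then show ?thesis using b1[of L] by simp
qed

section \<open>Central trigonometric polynomials\<close>

context compact_group
begin

lemma unitary_mat_adjoint:
  assumes "unitary_mat n P" shows "P \<in> carrier_mat n n" "mat_adjoint P * P = 1\<^sub>m n" "P * mat_adjoint P = 1\<^sub>m n"
    "unitary_mat n (mat_adjoint P)"
proof -
  show P: "P \<in> carrier_mat n n" "mat_adjoint P * P = 1\<^sub>m n" using assms unfolding unitary_mat_def by auto
  show PP: "P * mat_adjoint P = 1\<^sub>m n"
    by (rule mat_mult_left_right_inverse[OF _ P(1) P(2)]) (simp add: P(1))
  then show "unitary_mat n (mat_adjoint P)" unfolding unitary_mat_def using P(1) by (simp add: mat_adjoint_adjoint)
qed

lemma rep_equiv_refl: "U \<in> irreps G T \<Longrightarrow> rep_equiv G U U"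
proof -
  assume U: "U \<in> irreps G T"
  have "mat_adjoint (1\<^sub>m (rep_dim G U)) = (1\<^sub>m (rep_dim G U) :: complex mat)" by (rule eq_matI) auto
  moreover have "1\<^sub>m (rep_dim G U) * U x = U x * 1\<^sub>m (rep_dim G U)" if "x \<in> carrier G" for x
    using left_mult_one_mat[OF rep_carrier[OF irrepsD(1)[OF U] that]]
      right_mult_one_mat[OF rep_carrier[OF irrepsD(1)[OF U] that]] by simp
  ultimately show ?thesis
    unfolding rep_equiv_def unitary_mat_def
    by (intro conjI refl exI[of _ "1\<^sub>m (rep_dim G U)"] ballI) simp_all
qed

lemma rep_equiv_sym:
  assumes U: "U \<in> irreps G T" and V: "V \<in> irreps G T" and e: "rep_equiv G U V" shows "rep_equiv G V U"
proof -
  define d where "d = rep_dim G U"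
  obtain P where dim: "rep_dim G V = d" and P: "unitary_mat d P" "\<And>x. x \<in> carrier G \<Longrightarrow> P * U x = V x * P"
    using e unfolding rep_equiv_def d_def by auto
  note P' = unitary_mat_adjoint[OF P(1)]
  have Q: "mat_adjoint P \<in> carrier_mat d d" using P'(1) by simp
  have "mat_adjoint P * V x = U x * mat_adjoint P" if x: "x \<in> carrier G" for x
  proof -
    have c: "U x \<in> carrier_mat d d" "V x \<in> carrier_mat d d"
      using rep_carrier[OF irrepsD(1)[OF U] x] rep_carrier[OF irrepsD(1)[OF V] x] dim d_def by auto
    have "mat_adjoint P * V x = mat_adjoint P * (V x * (P * mat_adjoint P))" using P' c by simp
    also have "V x * (P * mat_adjoint P) = (P * U x) * mat_adjoint P" unfolding P(2)[OF x] by (rule assoc_mult_mat[OF c(2) P'(1) Q, symmetric])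
    also have "mat_adjoint P * ((P * U x) * mat_adjoint P) = (mat_adjoint P * P) * (U x * mat_adjoint P)"
      using P'(1) Q c by (simp add: assoc_mult_mat[of _ d d _ d _ d])
    finally show ?thesis using P'(2) Q c by simp
  qed
  then show ?thesis unfolding rep_equiv_def using P'(4) dim d_def by auto
qed

lemma rep_equiv_trans:
  assumes U: "U \<in> irreps G T" and V: "V \<in> irreps G T" and W: "W \<in> irreps G T"
    and "rep_equiv G U V" "rep_equiv G V W" shows "rep_equiv G U W"
proof -
  define d where "d = rep_dim G U"
  have dim: "rep_dim G V = d" "rep_dim G W = d" using assms(4,5) unfolding rep_equiv_def d_def by simp_all
  obtain P where P: "unitary_mat d P" "\<And>x. x \<in> carrier G \<Longrightarrow> P * U x = V x * P"
    using assms(4) unfolding rep_equiv_def d_def[symmetric] by blast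
  obtain Q where Q: "unitary_mat d Q" "\<And>x. x \<in> carrier G \<Longrightarrow> Q * V x = W x * Q"
    using assms(5) unfolding rep_equiv_def dim by blast
  note P' = unitary_mat_adjoint[OF P(1)] and Q' = unitary_mat_adjoint[OF Q(1)]
  have ad: "mat_adjoint P \<in> carrier_mat d d" "mat_adjoint Q \<in> carrier_mat d d" using P'(1) Q'(1) by auto
  have "mat_adjoint (Q * P) * (Q * P) = mat_adjoint P * ((mat_adjoint Q * Q) * P)"
    unfolding mat_adjoint_mult[OF Q'(1) P'(1)] using P'(1) Q'(1) ad by (simp add: assoc_mult_mat[of _ d d _ d _ d])
  also have "\<dots> = 1\<^sub>m d" unfolding Q'(2) using P' by simp
  finally have "unitary_mat d (Q * P)" unfolding unitary_mat_def using P'(1) Q'(1) by simp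
  moreover have "(Q * P) * U x = W x * (Q * P)" if x: "x \<in> carrier G" for x
  proof -
    have c: "U x \<in> carrier_mat d d" "V x \<in> carrier_mat d d" "W x \<in> carrier_mat d d"
      using rep_carrier[OF irrepsD(1)[OF U] x] rep_carrier[OF irrepsD(1)[OF V] x] rep_carrier[OF irrepsD(1)[OF W] x] dim d_def by auto
    have "(Q * P) * U x = Q * (P * U x)" using P'(1) Q'(1) c by simp
    also have "\<dots> = (Q * V x) * P" unfolding P(2)[OF x] using P'(1) Q'(1) c by simp
    also have "\<dots> = W x * (Q * P)" unfolding Q(2)[OF x] using P'(1) Q'(1) c by simp
    finally show ?thesis .
  qed
  ultimately show ?thesis unfolding rep_equiv_def using dim d_def by auto
qed

lemma equiv_rep_equiv: "equiv (irreps G T) {(U, V). U \<in> irreps G T \<and> V \<in> irreps G T \<and> rep_equiv G U V}"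
  by (rule equivI) (auto simp: refl_on_def sym_def trans_def intro: rep_equiv_refl rep_equiv_sym rep_equiv_trans)

end

locale dual_group = haar_group +
  fixes rep :: "('a \<Rightarrow> complex mat) set \<Rightarrow> 'a \<Rightarrow> complex mat"
  assumes rep: "\<And>\<sigma>. \<sigma> \<in> dual_object G T \<Longrightarrow> rep \<sigma> \<in> \<sigma>"
begin

abbreviation \<Sigma> where "\<Sigma> \<equiv> dual_object G T"

abbreviation d where "d \<sigma> \<equiv> rep_dim G (rep \<sigma>)"

abbreviation u where "u \<sigma> i j \<equiv> coef (rep \<sigma>) i j"

definition \<chi> where "\<chi> \<sigma> x = (\<Sum>i<d \<sigma>. u \<sigma> i i x)"

lemma rep_irreps: "\<sigma> \<in> \<Sigma> \<Longrightarrow> rep \<sigma> \<in> irreps G T"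
  unfolding dual_object_def
  by (rule subsetD[OF in_quotient_imp_subset[OF equiv_rep_equiv] rep]) (simp_all add: dual_object_def)

lemma rep_unitary_rep: "\<sigma> \<in> \<Sigma> \<Longrightarrow> unitary_rep G T (rep \<sigma>)"
  by (intro irrepsD rep_irreps)

lemma d_pos: "\<sigma> \<in> \<Sigma> \<Longrightarrow> d \<sigma> > 0"
  by (intro irrepsD rep_irreps)

lemma rep_nonequiv: "\<sigma> \<in> \<Sigma> \<Longrightarrow> \<tau> \<in> \<Sigma> \<Longrightarrow> \<sigma> \<noteq> \<tau> \<Longrightarrow> \<not> rep_equiv G (rep \<sigma>) (rep \<tau>)"
  using quotient_eq_iff[OF equiv_rep_equiv, folded dual_object_def, of \<sigma> \<tau> "rep \<sigma>" "rep \<tau>"]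
    rep[of \<sigma>] rep[of \<tau>] rep_irreps[of \<sigma>] rep_irreps[of \<tau>] by simp

lemma u_CF: "\<sigma> \<in> \<Sigma> \<Longrightarrow> i < d \<sigma> \<Longrightarrow> j < d \<sigma> \<Longrightarrow> u \<sigma> i j \<in> CF"
  by (intro coef_CF rep_unitary_rep)

lemma u_mult:
  "\<sigma> \<in> \<Sigma> \<Longrightarrow> i < d \<sigma> \<Longrightarrow> j < d \<sigma> \<Longrightarrow> x \<in> carrier G \<Longrightarrow> y \<in> carrier G \<Longrightarrow>
   u \<sigma> i j (x \<otimes> y) = (\<Sum>k<d \<sigma>. u \<sigma> i k x * u \<sigma> k j y)"
  using rep_mult_index[OF rep_unitary_rep] by (simp add: coef_def)

lemma u_inv:
  "\<sigma> \<in> \<Sigma> \<Longrightarrow> i < d \<sigma> \<Longrightarrow> j < d \<sigma> \<Longrightarrow> x \<in> carrier G \<Longrightarrow> u \<sigma> i j (inv x) = cnj (u \<sigma> j i x)"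
  using rep_inv_index[OF rep_unitary_rep] by (simp add: coef_def)

lemma u_one: "\<sigma> \<in> \<Sigma> \<Longrightarrow> i < d \<sigma> \<Longrightarrow> j < d \<sigma> \<Longrightarrow> u \<sigma> i j \<one> = (if i = j then 1 else 0)"
  using rep_one[OF rep_unitary_rep] by (simp add: coef_def)

lemma u_norm: "\<sigma> \<in> \<Sigma> \<Longrightarrow> i < d \<sigma> \<Longrightarrow> j < d \<sigma> \<Longrightarrow> norm (u \<sigma> i j x) \<le> 1"
  using rep_norm_le_1[OF rep_unitary_rep] by (simp add: coef_def)

lemma u_orthogonal:
  assumes "\<sigma> \<in> \<Sigma>" "i < d \<sigma>" "a < d \<sigma>" "\<tau> \<in> \<Sigma>" "j < d \<tau>" "b < d \<tau>"
  shows "L2 (u \<sigma> i a) (u \<tau> j b) = (if \<sigma> = \<tau> \<and> i = j \<and> a = b then 1 / of_nat (d \<sigma>) else 0)"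
proof -
  have "L2 (u \<sigma> i a) (u \<tau> j b) = (LINT x|m. rep \<sigma> x $$ (i, a) * cnj (rep \<tau> x $$ (j, b)))"
    unfolding L2_def coef_def by (intro Bochner_Integration.integral_cong) (auto simp: space_m)
  also have "\<dots> = (if \<sigma> = \<tau> \<and> i = j \<and> a = b then 1 / of_nat (d \<sigma>) else 0)"
  proof (cases "\<sigma> = \<tau>")
    case True
    then show ?thesis using orthogonality_same[OF rep_irreps[OF assms(1)] assms(2,3)] assms by simp
  next
    case False
    then show ?thesis using orthogonality_nonequiv[OF rep_irreps[OF assms(4)] rep_irreps[OF assms(1)] rep_nonequiv[OF assms(4,1)]] assms by simp
  qed
  finally show ?thesis .
qed

text \<open>The representative of the class of U is P U P^-1 for a unitary P, so every coefficient
  of U is a combination of coefficients of that representative.\<close>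

lemma coef_in_class_span:
  assumes U: "U \<in> irreps G T" and ij: "i < rep_dim G U" "j < rep_dim G U"
  shows "\<exists>\<sigma>\<in>\<Sigma>. coef U i j \<in> fs.span {u \<sigma> a b | a b. a < d \<sigma> \<and> b < d \<sigma>}"
proof -
  define r where "r = {(U, V). U \<in> irreps G T \<and> V \<in> irreps G T \<and> rep_equiv G U V}"
  define \<sigma> where "\<sigma> = r `` {U}"
  have \<sigma>: "\<sigma> \<in> \<Sigma>" unfolding \<sigma>_def r_def dual_object_def using U by (rule quotientI)
  have "rep \<sigma> \<in> r `` {U}" using rep[OF \<sigma>] by (simp only: \<sigma>_def[symmetric])
  then have "(U, rep \<sigma>) \<in> r" by (rule Image_singleton_iff[THEN iffD1])
  then have "case (U, rep \<sigma>) of (U, V) \<Rightarrow> U \<in> irreps G T \<and> V \<in> irreps G T \<and> rep_equiv G U V"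
    unfolding r_def by (rule CollectD)
  then have "rep_equiv G U (rep \<sigma>)" unfolding prod.case by (elim conjE)
  then obtain P where dim: "rep_dim G U = d \<sigma>" and P: "unitary_mat (d \<sigma>) P" "\<And>x. x \<in> carrier G \<Longrightarrow> P * U x = rep \<sigma> x * P"
    unfolding rep_equiv_def by auto
  define n where "n = d \<sigma>"
  note P' = unitary_mat_adjoint[OF P(1), folded n_def]
  have Q: "mat_adjoint P \<in> carrier_mat n n" using P'(1) by simp
  have "coef U i j = (\<Sum>a<n. \<Sum>b<n. fscale (cnj (P $$ (a, i)) * P $$ (b, j)) (u \<sigma> a b))"
  proof
    fix x show "coef U i j x = (\<Sum>a<n. \<Sum>b<n. fscale (cnj (P $$ (a, i)) * P $$ (b, j)) (u \<sigma> a b)) x"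
    proof (cases "x \<in> carrier G")
      case True
      have c: "U x \<in> carrier_mat n n" "rep \<sigma> x \<in> carrier_mat n n"
        using rep_carrier[OF irrepsD(1)[OF U] True] rep_carrier[OF rep_unitary_rep[OF \<sigma>] True] dim n_def by auto
      have "U x = mat_adjoint P * (P * U x)" using P' Q c assoc_mult_mat[OF Q P'(1) c(1)] by simp
      also have "\<dots> = mat_adjoint P * (rep \<sigma> x * P)" using P(2)[OF True] by simp
      finally have "U x $$ (i, j) = (mat_adjoint P * (rep \<sigma> x * P)) $$ (i, j)" by simp
      also have "\<dots> = (\<Sum>a<n. mat_adjoint P $$ (i, a) * (rep \<sigma> x * P) $$ (a, j))"
        by (rule index_mult_mat_sum[OF Q]) (use c P'(1) ij dim n_def in auto)
      also have "\<dots> = (\<Sum>a<n. \<Sum>b<n. cnj (P $$ (a, i)) * P $$ (b, j) * rep \<sigma> x $$ (a, b))"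
      proof (intro sum.cong refl)
        fix a assume a: "a \<in> {..<n}"
        have "(rep \<sigma> x * P) $$ (a, j) = (\<Sum>b<n. rep \<sigma> x $$ (a, b) * P $$ (b, j))"
          by (rule index_mult_mat_sum[OF c(2) P'(1)]) (use a ij dim n_def in auto)
        then show "mat_adjoint P $$ (i, a) * (rep \<sigma> x * P) $$ (a, j) = (\<Sum>b<n. cnj (P $$ (a, i)) * P $$ (b, j) * rep \<sigma> x $$ (a, b))"
          using a P'(1) ij dim n_def by (simp add: sum_distrib_left mult_ac)
      qed
      finally show ?thesis using True by (simp add: sum_fun_apply coef_def)
    qed (simp add: sum_fun_apply coef_def)
  qed
  also have "\<dots> \<in> fs.span {u \<sigma> a b | a b. a < d \<sigma> \<and> b < d \<sigma>}"
    unfolding n_def by (intro fs.span_sum fs.span_scale fs.span_base) auto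
  finally show ?thesis using \<sigma> by blast
qed

definition coef_space where "coef_space S = fs.span {u \<sigma> a b | \<sigma> a b. \<sigma> \<in> S \<and> a < d \<sigma> \<and> b < d \<sigma>}"

lemma coef_space_mono: "S \<subseteq> S' \<Longrightarrow> coef_space S \<subseteq> coef_space S'"
  unfolding coef_space_def by (intro fs.span_mono) auto

lemma trig_poly_finite_support:
  assumes "p \<in> trig_polys" shows "\<exists>S. finite S \<and> S \<subseteq> \<Sigma> \<and> p \<in> coef_space S"
  using assms unfolding trig_polys_def
proof (induction rule: fs.span_induct_alt)
  case base
  show ?case unfolding coef_space_def by (intro exI[of _ "{}"]) (simp add: fs.span_zero del: zero_fun_apply)
next
  case (step c b y)
  then obtain S where S: "finite S" "S \<subseteq> \<Sigma>" "y \<in> coef_space S" by blast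
  obtain U i j where b: "b = coef U i j" "U \<in> irreps G T" "i < rep_dim G U" "j < rep_dim G U" using step by blast
  then obtain \<sigma> where \<sigma>: "\<sigma> \<in> \<Sigma>" "b \<in> fs.span {u \<sigma> a b | a b. a < d \<sigma> \<and> b < d \<sigma>}"
    using coef_in_class_span by blast
  have "fs.span {u \<sigma> a b | a b. a < d \<sigma> \<and> b < d \<sigma>} \<subseteq> coef_space (insert \<sigma> S)"
    unfolding coef_space_def by (intro fs.span_mono) auto
  then have "b \<in> coef_space (insert \<sigma> S)" "y \<in> coef_space (insert \<sigma> S)"
    using \<sigma> S(3) coef_space_mono[of S "insert \<sigma> S"] by auto
  then have "fscale c b + y \<in> coef_space (insert \<sigma> S)"
    unfolding coef_space_def by (intro fs.span_add fs.span_scale)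
  moreover have "finite (insert \<sigma> S)" "insert \<sigma> S \<subseteq> \<Sigma>" using S \<sigma>(1) by auto
  ultimately show ?case by blast
qed

lemma \<chi>_CF: "\<sigma> \<in> \<Sigma> \<Longrightarrow> \<chi> \<sigma> \<in> CF"
proof -
  assume \<sigma>: "\<sigma> \<in> \<Sigma>"
  have "\<chi> \<sigma> = (\<Sum>i<d \<sigma>. u \<sigma> i i)" by (auto simp: \<chi>_def fun_eq_iff sum_fun_apply)
  also have "\<dots> \<in> CF" using \<sigma> u_CF by (intro fs.subspace_sum[OF subspace_CF]) auto
  finally show ?thesis .
qed

lemma \<chi>_comm:
  assumes \<sigma>: "\<sigma> \<in> \<Sigma>" and x: "x \<in> carrier G" "y \<in> carrier G" shows "\<chi> \<sigma> (x \<otimes> y) = \<chi> \<sigma> (y \<otimes> x)"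
proof -
  have "\<chi> \<sigma> (x \<otimes> y) = (\<Sum>i<d \<sigma>. \<Sum>k<d \<sigma>. u \<sigma> i k x * u \<sigma> k i y)"
    unfolding \<chi>_def using u_mult[OF \<sigma> _ _ x] by simp
  also have "\<dots> = (\<Sum>k<d \<sigma>. \<Sum>i<d \<sigma>. u \<sigma> k i y * u \<sigma> i k x)" by (subst sum.swap) (simp add: mult.commute)
  also have "\<dots> = \<chi> \<sigma> (y \<otimes> x)" unfolding \<chi>_def using u_mult[OF \<sigma> _ _ x(2,1)] by simp
  finally show ?thesis .
qed

text \<open>The central trigonometric polynomial with Fourier transform \<open>\<beta> \<sigma> I\<close> on \<open>S\<close>.\<close>

definition cpoly where "cpoly S \<beta> x = (\<Sum>\<sigma>\<in>S. of_nat (d \<sigma>) * \<beta> \<sigma> * \<chi> \<sigma> x)"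

lemma cpoly_eq: "cpoly S \<beta> = (\<Sum>\<sigma>\<in>S. fscale (of_nat (d \<sigma>) * \<beta> \<sigma>) (\<chi> \<sigma>))"
  by (auto simp: cpoly_def fun_eq_iff sum_fun_apply)

lemma cpoly_CF: "S \<subseteq> \<Sigma> \<Longrightarrow> cpoly S \<beta> \<in> CF"
  unfolding cpoly_eq using \<chi>_CF by (intro fs.subspace_sum[OF subspace_CF] fs.subspace_scale[OF subspace_CF]) auto

lemma L2_\<chi>_u:
  assumes "\<sigma> \<in> \<Sigma>" "\<tau> \<in> \<Sigma>" "i < d \<tau>" "j < d \<tau>"
  shows "L2 (\<chi> \<sigma>) (u \<tau> i j) = (if \<sigma> = \<tau> \<and> i = j then 1 / of_nat (d \<tau>) else 0)"
proof -
  have "\<chi> \<sigma> = (\<Sum>k<d \<sigma>. fscale 1 (u \<sigma> k k))" by (auto simp: \<chi>_def fun_eq_iff sum_fun_apply)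
  then have "L2 (\<chi> \<sigma>) (u \<tau> i j) = (\<Sum>k<d \<sigma>. 1 * L2 (u \<sigma> k k) (u \<tau> i j))"
    using assms u_CF by (simp only:) (intro L2.ip_sum, auto)
  also have "\<dots> = (\<Sum>k<d \<sigma>. if k = i then (if \<sigma> = \<tau> \<and> i = j then 1 / of_nat (d \<tau>) else 0) else 0)"
    using assms by (intro sum.cong) (auto simp: u_orthogonal)
  also have "\<dots> = (if \<sigma> = \<tau> \<and> i = j then 1 / of_nat (d \<tau>) else 0)" using assms by auto
  finally show ?thesis .
qed

lemma L2_cpoly_u:
  assumes S: "finite S" "S \<subseteq> \<Sigma>" and \<tau>: "\<tau> \<in> \<Sigma>" "i < d \<tau>" "j < d \<tau>"
  shows "L2 (cpoly S \<beta>) (u \<tau> i j) = (if \<tau> \<in> S \<and> i = j then \<beta> \<tau> else 0)"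
proof -
  have "L2 (cpoly S \<beta>) (u \<tau> i j) = (\<Sum>\<sigma>\<in>S. (of_nat (d \<sigma>) * \<beta> \<sigma>) * L2 (\<chi> \<sigma>) (u \<tau> i j))"
    unfolding cpoly_eq using S \<tau> \<chi>_CF u_CF by (intro L2.ip_sum) auto
  also have "\<dots> = (\<Sum>\<sigma>\<in>S. if \<sigma> = \<tau> then (if i = j then \<beta> \<tau> else 0) else 0)"
  proof (intro sum.cong refl)
    fix \<sigma> assume "\<sigma> \<in> S"
    then have "L2 (\<chi> \<sigma>) (u \<tau> i j) = (if \<sigma> = \<tau> \<and> i = j then 1 / of_nat (d \<tau>) else 0)"
      using S(2) \<tau> by (intro L2_\<chi>_u) auto
    then show "of_nat (d \<sigma>) * \<beta> \<sigma> * L2 (\<chi> \<sigma>) (u \<tau> i j) = (if \<sigma> = \<tau> then (if i = j then \<beta> \<tau> else 0) else 0)"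
      using d_pos[OF \<tau>(1)] by simp
  qed
  also have "\<dots> = (if \<tau> \<in> S \<and> i = j then \<beta> \<tau> else 0)" using S by simp
  finally show ?thesis .
qed

lemma L2_cpoly_\<chi>:
  assumes S: "finite S" "S \<subseteq> \<Sigma>" and \<tau>: "\<tau> \<in> \<Sigma>"
  shows "L2 (cpoly S \<beta>) (\<chi> \<tau>) = (if \<tau> \<in> S then of_nat (d \<tau>) * \<beta> \<tau> else 0)"
proof -
  have "\<chi> \<tau> = (\<Sum>k<d \<tau>. fscale 1 (u \<tau> k k))" by (auto simp: \<chi>_def fun_eq_iff sum_fun_apply)
  then have "L2 (cpoly S \<beta>) (\<chi> \<tau>) = (\<Sum>k<d \<tau>. cnj 1 * L2 (cpoly S \<beta>) (u \<tau> k k))"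
    using S \<tau> u_CF cpoly_CF by (simp only:) (intro L2.ip_sum_right, auto)
  also have "\<dots> = (\<Sum>k<d \<tau>. if \<tau> \<in> S then \<beta> \<tau> else 0)" using S \<tau> by (simp add: L2_cpoly_u)
  finally show ?thesis by simp
qed

lemma L2_cpoly_cpoly:
  assumes S: "finite S" "S \<subseteq> \<Sigma>"
  shows "L2 (cpoly S \<beta>) (cpoly S \<beta>) = of_real (\<Sum>\<sigma>\<in>S. (real (d \<sigma>))\<^sup>2 * (norm (\<beta> \<sigma>))\<^sup>2)"
proof -
  have "L2 (cpoly S \<beta>) (cpoly S \<beta>) = (\<Sum>\<sigma>\<in>S. cnj (of_nat (d \<sigma>) * \<beta> \<sigma>) * L2 (cpoly S \<beta>) (\<chi> \<sigma>))"
    using S \<chi>_CF cpoly_CF by (subst (2) cpoly_eq) (intro L2.ip_sum_right, auto)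
  also have "\<dots> = (\<Sum>\<sigma>\<in>S. cnj (of_nat (d \<sigma>) * \<beta> \<sigma>) * (of_nat (d \<sigma>) * \<beta> \<sigma>))"
  proof (intro sum.cong refl)
    fix \<sigma> assume "\<sigma> \<in> S"
    then have "L2 (cpoly S \<beta>) (\<chi> \<sigma>) = of_nat (d \<sigma>) * \<beta> \<sigma>" using L2_cpoly_\<chi>[OF S, of \<sigma>] S(2) by auto
    then show "cnj (of_nat (d \<sigma>) * \<beta> \<sigma>) * L2 (cpoly S \<beta>) (\<chi> \<sigma>) =
        cnj (of_nat (d \<sigma>) * \<beta> \<sigma>) * (of_nat (d \<sigma>) * \<beta> \<sigma>)" by (rule arg_cong)
  qed
  also have "\<dots> = of_real (\<Sum>\<sigma>\<in>S. (real (d \<sigma>))\<^sup>2 * (norm (\<beta> \<sigma>))\<^sup>2)"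
    unfolding cnj_mult_self of_real_sum by (simp add: norm_mult power_mult_distrib)
  finally show ?thesis .
qed

text \<open>Inversion transposes and conjugates coefficients, so entry (i, j) of the transform is
  the L2 product with the coefficient (j, i), which orthogonality determines.\<close>

lemma fourier_cpoly:
  assumes S: "finite S" "S \<subseteq> \<Sigma>" and \<tau>: "\<tau> \<in> \<Sigma>"
  shows "fourier G m (rep \<tau>) (cpoly S \<beta>) = (if \<tau> \<in> S then \<beta> \<tau> else 0) \<cdot>\<^sub>m 1\<^sub>m (d \<tau>)"
proof (rule eq_matI)
  fix i j assume "i < dim_row ((if \<tau> \<in> S then \<beta> \<tau> else 0) \<cdot>\<^sub>m 1\<^sub>m (d \<tau>))" "j < dim_col ((if \<tau> \<in> S then \<beta> \<tau> else 0) \<cdot>\<^sub>m 1\<^sub>m (d \<tau>))"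
  then have ij: "i < d \<tau>" "j < d \<tau>" by auto
  have "fourier G m (rep \<tau>) (cpoly S \<beta>) $$ (i, j) = (LINT x|m. rep \<tau> (inv x) $$ (i, j) * cpoly S \<beta> x)"
    unfolding fourier_def using ij by simp
  also have "\<dots> = L2 (cpoly S \<beta>) (u \<tau> j i)"
    unfolding L2_def using rep_inv_index[OF rep_unitary_rep[OF \<tau>] _ ij]
    by (intro Bochner_Integration.integral_cong) (auto simp: space_m coef_def mult.commute)
  also have "\<dots> = (if \<tau> \<in> S \<and> j = i then \<beta> \<tau> else 0)" by (rule L2_cpoly_u[OF S \<tau> ij(2,1)])
  finally show "fourier G m (rep \<tau>) (cpoly S \<beta>) $$ (i, j) = ((if \<tau> \<in> S then \<beta> \<tau> else 0) \<cdot>\<^sub>m 1\<^sub>m (d \<tau>)) $$ (i, j)"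
    using ij by auto
qed (auto simp: fourier_def)

lemma fourier_supp_cpoly:
  assumes S: "finite S" "S \<subseteq> \<Sigma>" shows "fourier_supp G T m rep (cpoly S \<beta>) \<subseteq> S"
proof (rule subsetI, rule ccontr)
  fix \<tau> assume \<tau>: "\<tau> \<in> fourier_supp G T m rep (cpoly S \<beta>)" "\<tau> \<notin> S"
  then have "\<tau> \<in> \<Sigma>" unfolding fourier_supp_def by simp
  then have "fourier G m (rep \<tau>) (cpoly S \<beta>) = 0 \<cdot>\<^sub>m 1\<^sub>m (d \<tau>)" using fourier_cpoly[OF S] \<tau>(2) by simp
  also have "\<dots> = 0\<^sub>m (d \<tau>) (d \<tau>)" by (rule eq_matI) auto
  finally show False using \<tau>(1) unfolding fourier_supp_def by simp
qed

lemma cpoly_central: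
  assumes "finite S" "S \<subseteq> \<Sigma>"
  shows "central_function G T m (cpoly S \<beta>)" "cpoly S \<beta> \<in> L_infinity m"
proof -
  have C: "cpoly S \<beta> \<in> CF" using cpoly_CF assms by blast
  obtain B where B: "\<And>x. norm (cpoly S \<beta> x) \<le> B" using CF_bounded[OF C] by blast
  show "central_function G T m (cpoly S \<beta>)"
    using assms \<chi>_comm by (intro class_function_central[OF CF_measurable[OF C] B]) (auto simp: cpoly_def intro!: sum.cong)
  show "cpoly S \<beta> \<in> L_infinity m" unfolding L_infinity_def using CF_measurable[OF C] B by auto
qed

end

section \<open>The atomic norm on the spectrum\<close>

locale spectral_set = dual_group +
  fixes R :: "('a \<Rightarrow> complex mat) set set"
  assumes finite_R: "finite R" and R_dual: "R \<subseteq> \<Sigma>"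
begin

type_synonym 'x coords = "('x \<Rightarrow> complex mat) set \<times> nat \<times> nat \<Rightarrow> complex"

definition I where "I = {(\<sigma>, i, j). \<sigma> \<in> R \<and> i < d \<sigma> \<and> j < d \<sigma>}"

definition U :: "'a \<Rightarrow> 'a coords" where "U x = (\<lambda>(\<sigma>, i, j). u \<sigma> i j x)"

text \<open>Matrix multiplication block by block. With \<open>U x\<close> as transform of the point
  mass at x, it is convolution of measures.\<close>

definition conv :: "'a coords \<Rightarrow> 'a coords \<Rightarrow> 'a coords" where
  "conv c c' = (\<lambda>(\<sigma>, i, j). \<Sum>k<d \<sigma>. c (\<sigma>, i, k) * c' (\<sigma>, k, j))"

text \<open>
  \<open>atom r c\<close>: on \<open>R\<close>, \<open>c\<close> is the Fourier-Stieltjes transform of a finitely supported measure of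
  mass at most \<open>r\<close>; \<open>N\<close> is the corresponding quotient norm.
\<close>

definition atom :: "real \<Rightarrow> 'a coords \<Rightarrow> bool" where
  "atom r c \<longleftrightarrow> (\<exists>S a. finite S \<and> S \<subseteq> carrier G \<and> (\<Sum>x\<in>S. norm (a x)) \<le> r \<and>
     (\<forall>k\<in>I. c k = (\<Sum>x\<in>S. a x * U x k)))"

definition N :: "'a coords \<Rightarrow> real" where "N c = Inf {r. atom r c}"

lemma I_Sigma: "I = (SIGMA \<sigma>:R. {..<d \<sigma>} \<times> {..<d \<sigma>})"
  unfolding I_def by auto

lemma finite_I: "finite I"
  unfolding I_Sigma using finite_R by auto

lemma card_I: "card I = dim_sq_sum G rep R"
  unfolding I_Sigma dim_sq_sum_def using finite_R by (simp add: card_SigmaI power2_eq_square)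

lemma I_dual: "(\<sigma>, i, j) \<in> I \<Longrightarrow> \<sigma> \<in> \<Sigma>" "(\<sigma>, i, j) \<in> I \<Longrightarrow> i < d \<sigma>" "(\<sigma>, i, j) \<in> I \<Longrightarrow> j < d \<sigma>"
  unfolding I_def using R_dual by auto

lemma U_norm: "k \<in> I \<Longrightarrow> norm (U x k) \<le> 1"
  unfolding U_def using u_norm I_dual by (cases k) auto

lemma U_CF: "k \<in> I \<Longrightarrow> (\<lambda>x. U x k) \<in> CF"
  unfolding U_def using u_CF I_dual by (cases k) auto

lemma U_representative: "k \<in> I \<Longrightarrow> representative (\<lambda>x. U x k)"
  unfolding U_def using representative_coef[OF rep_unitary_rep] I_dual by (cases k) auto

lemma conv_U:
  assumes "k \<in> I" "x \<in> carrier G" "y \<in> carrier G" shows "conv (U x) (U y) k = U (x \<otimes> y) k"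
  using assms I_dual unfolding conv_def U_def by (cases k) (auto simp: u_mult)

lemma atom_mono: "atom r c \<Longrightarrow> r \<le> s \<Longrightarrow> atom s c"
  unfolding atom_def by (meson order_trans)

lemma atom_cong: "atom r c \<Longrightarrow> (\<And>k. k \<in> I \<Longrightarrow> c' k = c k) \<Longrightarrow> atom r c'"
  unfolding atom_def by auto

lemma atom_coord:
  assumes "atom r c" "k \<in> I" shows "norm (c k) \<le> r"
proof -
  obtain S a where S: "finite S" "(\<Sum>x\<in>S. norm (a x)) \<le> r" "\<forall>k\<in>I. c k = (\<Sum>x\<in>S. a x * U x k)"
    using assms(1) unfolding atom_def by blast
  have "norm (c k) \<le> (\<Sum>x\<in>S. norm (a x * U x k))" using S(3) assms(2) by (simp add: norm_sum)
  also have "\<dots> \<le> (\<Sum>x\<in>S. norm (a x) * 1)" unfolding norm_mult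
    using U_norm[OF assms(2)] by (intro sum_mono mult_left_mono) auto
  finally show ?thesis using S(2) by simp
qed

lemma atom_nonneg: "atom r c \<Longrightarrow> 0 \<le> r"
  unfolding atom_def by (meson norm_ge_zero order_trans sum_nonneg)

lemma atom_zero: "atom 0 (\<lambda>k. 0)"
  unfolding atom_def by (intro exI[of _ "{}"]) auto

lemma atom_U: "x \<in> carrier G \<Longrightarrow> atom 1 (U x)"
  unfolding atom_def by (intro exI[of _ "{x}"] exI[of _ "\<lambda>_. 1"]) auto

lemma atom_scale:
  assumes "atom r c" shows "atom (norm t * r) (\<lambda>k. t * c k)"
proof -
  obtain S a where S: "finite S" "S \<subseteq> carrier G" "(\<Sum>x\<in>S. norm (a x)) \<le> r" "\<forall>k\<in>I. c k = (\<Sum>x\<in>S. a x * U x k)"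
    using assms(1) unfolding atom_def by blast
  have "(\<Sum>x\<in>S. norm (t * a x)) \<le> norm t * r"
    unfolding norm_mult sum_distrib_left[symmetric] using S(3) by (intro mult_left_mono) auto
  moreover have "\<forall>k\<in>I. t * c k = (\<Sum>x\<in>S. (t * a x) * U x k)" using S(4) by (simp add: sum_distrib_left mult.assoc)
  ultimately show ?thesis unfolding atom_def using S by (intro exI[of _ S] exI[of _ "\<lambda>x. t * a x"]) simp
qed

lemma atom_add:
  assumes "atom r c" "atom r' c'" shows "atom (r + r') (\<lambda>k. c k + c' k)"
proof -
  obtain S a where S: "finite S" "S \<subseteq> carrier G" "(\<Sum>x\<in>S. norm (a x)) \<le> r" "\<forall>k\<in>I. c k = (\<Sum>x\<in>S. a x * U x k)"
    using assms(1) unfolding atom_def by blast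
  obtain S' a' where S': "finite S'" "S' \<subseteq> carrier G" "(\<Sum>x\<in>S'. norm (a' x)) \<le> r'" "\<forall>k\<in>I. c' k = (\<Sum>x\<in>S'. a' x * U x k)"
    using assms(2) unfolding atom_def by blast
  define W where "W = S \<union> S'"
  define b where "b x = (if x \<in> S then a x else 0)" for x
  define b' where "b' x = (if x \<in> S' then a' x else 0)" for x
  have W: "finite W" "S \<subseteq> W" "S' \<subseteq> W" unfolding W_def using S S' by auto
  have e: "(\<Sum>x\<in>W. norm (b x)) = (\<Sum>x\<in>S. norm (a x))" "(\<Sum>x\<in>W. norm (b' x)) = (\<Sum>x\<in>S'. norm (a' x))"
    "(\<Sum>x\<in>W. b x * U x k) = (\<Sum>x\<in>S. a x * U x k)" "(\<Sum>x\<in>W. b' x * U x k) = (\<Sum>x\<in>S'. a' x * U x k)" for k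
    using W by (auto intro!: sum.mono_neutral_cong_right simp: b_def b'_def)
  have "(\<Sum>x\<in>W. norm (b x + b' x)) \<le> (\<Sum>x\<in>W. norm (b x) + norm (b' x))"
    by (intro sum_mono norm_triangle_ineq)
  also have "\<dots> \<le> r + r'" unfolding sum.distrib e using S S' by simp
  finally have "(\<Sum>x\<in>W. norm (b x + b' x)) \<le> r + r'" .
  moreover have "\<forall>k\<in>I. c k + c' k = (\<Sum>x\<in>W. (b x + b' x) * U x k)"
    unfolding distrib_right sum.distrib e using S S' by simp
  moreover have "W \<subseteq> carrier G" unfolding W_def using S S' by simp
  ultimately show ?thesis unfolding atom_def using W(1) by (intro exI[of _ W] exI[of _ "\<lambda>x. b x + b' x"]) simp
qed

lemma atom_sum:
  assumes "finite A" "\<And>i. i \<in> A \<Longrightarrow> atom (r i) (v i)"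
  shows "atom (\<Sum>i\<in>A. r i) (\<lambda>k. \<Sum>i\<in>A. v i k)"
  using assms by (induction A rule: finite_induct) (auto intro: atom_zero atom_add)

text \<open>By the orthogonality relations the translations \<open>U x\<close> span all coordinate vectors.\<close>

lemma atom_bound: "\<exists>C\<ge>0. \<forall>c. atom (C * (\<Sum>k\<in>I. norm (c k))) c"
proof -
  have "\<exists>r. atom r (\<lambda>k. if k = i then 1 else 0)" if i: "i \<in> I" for i
  proof -
    have "\<exists>S a. finite S \<and> S \<subseteq> carrier G \<and> (\<forall>k\<in>I. (\<Sum>x\<in>S. a x * U x k) = (if k = i then 1 else 0))"
    proof (rule independent_functions_dual[where u="\<lambda>k x. U x k", OF finite_I _ i])
      fix l :: "'a coords" and k assume l: "\<And>x. x \<in> carrier G \<Longrightarrow> (\<Sum>k\<in>I. l k * U x k) = 0" and k: "k \<in> I"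
      obtain \<tau> i' j' where k': "k = (\<tau>, i', j')" by (cases k)
      note kI = I_dual[OF k[unfolded k']]
      have z: "(\<Sum>k\<in>I. fscale (l k) (\<lambda>x. U x k)) = 0"
      proof
        fix x show "(\<Sum>k\<in>I. fscale (l k) (\<lambda>x. U x k)) x = 0 x"
          using l U_CF by (cases "x \<in> carrier G") (auto simp: sum_fun_apply CF_def)
      qed
      \<comment> \<open>Pairing the linear relation with the coefficient of index k isolates
        \<open>l k\<close> divided by the dimension.\<close>
      have "0 = L2 (\<Sum>k\<in>I. fscale (l k) (\<lambda>x. U x k)) (u \<tau> i' j')" unfolding z using L2.ip_zero u_CF[OF kI] by simp
      also have "\<dots> = (\<Sum>k\<in>I. l k * L2 (\<lambda>x. U x k) (u \<tau> i' j'))" using U_CF u_CF[OF kI] by (intro L2.ip_sum)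
      also have "\<dots> = (\<Sum>k''\<in>I. if k'' = k then l k / of_nat (d \<tau>) else 0)"
      proof (intro sum.cong refl)
        fix k'' assume k2: "k'' \<in> I"
        obtain \<sigma> a b where k3: "k'' = (\<sigma>, a, b)" by (cases k'')
        note k2I = I_dual[OF k2[unfolded k3]]
        have "L2 (\<lambda>x. U x k'') (u \<tau> i' j') = L2 (u \<sigma> a b) (u \<tau> i' j')" unfolding U_def k3 by simp
        also have "\<dots> = (if \<sigma> = \<tau> \<and> a = i' \<and> b = j' then 1 / of_nat (d \<sigma>) else 0)"
          by (rule u_orthogonal[OF k2I kI])
        finally show "l k'' * L2 (\<lambda>x. U x k'') (u \<tau> i' j') = (if k'' = k then l k / of_nat (d \<tau>) else 0)"
          unfolding k3 k' by auto
      qed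
      also have "\<dots> = l k / of_nat (d \<tau>)" using k finite_I by simp
      finally show "l k = 0" using d_pos[OF kI(1)] by simp
    qed
    then obtain S a where S: "finite S" "S \<subseteq> carrier G" "\<forall>k\<in>I. (\<Sum>x\<in>S. a x * U x k) = (if k = i then 1 else 0)" by blast
    then show ?thesis unfolding atom_def
      by (intro exI[of _ "\<Sum>x\<in>S. norm (a x)"] exI[of _ S] exI[of _ a]) simp
  qed
  then obtain r where r: "\<And>i. i \<in> I \<Longrightarrow> atom (r i) (\<lambda>k. if k = i then 1 else 0)" by metis
  define C where "C = (\<Sum>i\<in>I. r i)"
  have r0: "0 \<le> r i" if "i \<in> I" for i using atom_nonneg[OF r[OF that]] .
  have rC: "r i \<le> C" if "i \<in> I" for i unfolding C_def using that r0 finite_I by (intro member_le_sum) auto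
  have "atom (C * (\<Sum>k\<in>I. norm (c k))) c" for c
  proof -
    have "atom (\<Sum>i\<in>I. norm (c i) * r i) (\<lambda>k. \<Sum>i\<in>I. c i * (if k = i then 1 else 0))"
      using r by (intro atom_sum finite_I atom_scale) auto
    then have "atom (\<Sum>i\<in>I. norm (c i) * r i) c"
      by (rule atom_cong) (use finite_I in \<open>simp add: if_distrib sum.delta cong: if_cong\<close>)
    moreover have "(\<Sum>i\<in>I. norm (c i) * r i) \<le> C * (\<Sum>k\<in>I. norm (c k))"
      unfolding sum_distrib_left using rC by (intro sum_mono) (simp add: mult.commute[of "norm _"] mult_right_mono)
    ultimately show ?thesis by (rule atom_mono)
  qed
  moreover have "C \<ge> 0" unfolding C_def using r0 by (intro sum_nonneg)
  ultimately show ?thesis by blast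
qed

lemma atom_exists: "\<exists>r. atom r c" using atom_bound by blast

lemma N_le: "atom r c \<Longrightarrow> N c \<le> r"
  unfolding N_def by (rule cInf_lower) (auto intro: bdd_belowI[of _ 0] atom_nonneg)

text \<open>The infimum need not be attained, hence the strict inequality and the small slack that
  later estimates of \<open>N\<close> grant themselves.\<close>

lemma atom_N: "N c < s \<Longrightarrow> atom s c"
proof -
  assume "N c < s"
  moreover have ne: "{r. atom r c} \<noteq> {}" using atom_exists[of c] by auto
  ultimately obtain r where "atom r c" "r < s" using cInf_lessD[OF ne, of s] unfolding N_def by auto
  then show ?thesis using atom_mono by simp
qed

lemma N_leI: "(\<And>s. r < s \<Longrightarrow> atom s c) \<Longrightarrow> N c \<le> r"
  by (rule dense_ge) (rule N_le)

lemma N_nonneg: "0 \<le> N c"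
  unfolding N_def using atom_exists atom_nonneg by (intro cInf_greatest) auto

lemma N_add: "N (\<lambda>k. c k + c' k) \<le> N c + N c'"
proof (rule N_leI)
  fix s assume s: "N c + N c' < s"
  define e where "e = (s - N c - N c') / 2"
  have "atom (N c + e) c" "atom (N c' + e) c'" unfolding e_def using s by (auto intro: atom_N)
  from atom_add[OF this] show "atom s (\<lambda>k. c k + c' k)" unfolding e_def by (rule atom_mono) (simp add: field_simps)
qed

lemma N_scale: "N (\<lambda>k. t * c k) \<le> norm t * N c"
proof (rule field_le_epsilon)
  fix e :: real assume e: "e > 0"
  have n: "norm t + 1 > 0" by (simp add: add_nonneg_pos)
  have "atom (N c + e / (norm t + 1)) c" using e n by (intro atom_N) simp
  then have "N (\<lambda>k. t * c k) \<le> norm t * (N c + e / (norm t + 1))" by (intro N_le atom_scale)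
  also have "\<dots> \<le> norm t * N c + e"
  proof -
    have "norm t * (e / (norm t + 1)) \<le> (norm t + 1) * (e / (norm t + 1))" using e n by (intro mult_right_mono) auto
    then show ?thesis using n by (simp add: distrib_left)
  qed
  finally show "N (\<lambda>k. t * c k) \<le> norm t * N c + e" .
qed

lemma N_cong: "(\<And>k. k \<in> I \<Longrightarrow> c k = c' k) \<Longrightarrow> N c = N c'"
  unfolding N_def by (intro arg_cong[where f=Inf] Collect_cong iffI) (auto elim: atom_cong)

lemma N_coord: "k \<in> I \<Longrightarrow> norm (c k) \<le> N c"
  by (rule dense_ge) (rule atom_coord[OF atom_N])

lemma N_U: "x \<in> carrier G \<Longrightarrow> N (U x) \<le> 1"
  by (intro N_le atom_U)

lemma N_zero: "N (\<lambda>k. 0) = 0"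
  using N_le[OF atom_zero] N_nonneg[of "\<lambda>k. 0"] by simp

lemma N_minus: "N (\<lambda>k. - c k) \<le> N c"
  using N_scale[of "-1" c] by simp

lemma N_diff_commute: "N (\<lambda>k. c k - c' k) = N (\<lambda>k. c' k - c k)"
  using N_minus[of "\<lambda>k. c k - c' k"] N_minus[of "\<lambda>k. c' k - c k"] by simp

lemma N_sum:
  "N (\<lambda>k. \<Sum>i\<in>A. a i * v i k) \<le> (\<Sum>i\<in>A. norm (a i) * N (v i))"
proof (induction A rule: infinite_finite_induct)
  case (insert i A)
  have "N (\<lambda>k. \<Sum>i\<in>insert i A. a i * v i k) = N (\<lambda>k. a i * v i k + (\<Sum>i\<in>A. a i * v i k))" using insert by simp
  also have "\<dots> \<le> N (\<lambda>k. a i * v i k) + N (\<lambda>k. \<Sum>i\<in>A. a i * v i k)" by (rule N_add)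
  also have "\<dots> \<le> norm (a i) * N (v i) + (\<Sum>i\<in>A. norm (a i) * N (v i))" using insert N_scale by (intro add_mono) auto
  finally show ?case using insert by simp
qed (auto simp: N_zero)

text \<open>Convolution on the left with the point mass at y moves each atom from x to y x and keeps
  the total mass.\<close>

lemma atom_left_mult:
  assumes y: "y \<in> carrier G" and "atom r c" shows "atom r (conv (U y) c)"
proof -
  obtain S a where S: "finite S" "S \<subseteq> carrier G" "(\<Sum>x\<in>S. norm (a x)) \<le> r" "\<forall>k\<in>I. c k = (\<Sum>x\<in>S. a x * U x k)"
    using assms(2) unfolding atom_def by blast
  have inj: "inj_on (\<lambda>x. y \<otimes> x) S" using S(2) y
    by (intro inj_on_inverseI[where g="\<lambda>z. inv y \<otimes> z"]) (auto simp: m_assoc[symmetric] subset_iff)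
  have shift: "a (inv y \<otimes> (y \<otimes> x)) = a x" if "x \<in> S" for x
    using that S(2) y by (auto simp: m_assoc[symmetric] subset_iff)
  have "(\<Sum>z\<in>(\<lambda>x. y \<otimes> x) ` S. norm (a (inv y \<otimes> z))) \<le> r" using S(3) shift by (simp add: sum.reindex[OF inj])
  moreover have "conv (U y) c k = (\<Sum>z\<in>(\<lambda>x. y \<otimes> x) ` S. a (inv y \<otimes> z) * U z k)" if k: "k \<in> I" for k
  proof -
    obtain \<sigma> i j where k': "k = (\<sigma>, i, j)" by (cases k)
    have ks: "(\<sigma>, l, j) \<in> I" if "l < d \<sigma>" for l using k that unfolding k' I_def by auto
    have "conv (U y) c k = (\<Sum>l<d \<sigma>. U y (\<sigma>, i, l) * (\<Sum>x\<in>S. a x * U x (\<sigma>, l, j)))"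
      unfolding conv_def k' using S(4) ks by simp
    also have "\<dots> = (\<Sum>l<d \<sigma>. \<Sum>x\<in>S. a x * (U y (\<sigma>, i, l) * U x (\<sigma>, l, j)))"
      by (simp add: sum_distrib_left mult_ac)
    also have "\<dots> = (\<Sum>x\<in>S. a x * conv (U y) (U x) k)"
      unfolding conv_def k' by (subst sum.swap) (simp add: sum_distrib_left)
    also have "\<dots> = (\<Sum>x\<in>S. a (inv y \<otimes> (y \<otimes> x)) * U (y \<otimes> x) k)"
      using S(2) y shift by (intro sum.cong) (auto simp: conv_U[OF k])
    finally show ?thesis by (simp add: sum.reindex[OF inj])
  qed
  moreover have "(\<lambda>x. y \<otimes> x) ` S \<subseteq> carrier G" using S(2) y by auto
  ultimately show ?thesis unfolding atom_def using S(1)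
    by (intro exI[of _ "(\<lambda>x. y \<otimes> x) ` S"] exI[of _ "\<lambda>z. a (inv y \<otimes> z)"]) simp
qed

lemma N_left_mult: "y \<in> carrier G \<Longrightarrow> N (conv (U y) c) \<le> N c"
  by (rule N_leI) (intro atom_left_mult atom_N)

text \<open>The first factor is expanded into translations \<open>U x\<close> with nearly optimal
  mass, and each of these acts on the second factor without increasing \<open>N\<close>.\<close>

lemma N_conv: "N (conv c c') \<le> N c * N c'"
proof -
  have "N (conv c c') \<le> r * N c'" if "atom r c" for r
  proof -
    obtain S a where S: "finite S" "S \<subseteq> carrier G" "(\<Sum>x\<in>S. norm (a x)) \<le> r" "\<forall>k\<in>I. c k = (\<Sum>x\<in>S. a x * U x k)"
      using \<open>atom r c\<close> unfolding atom_def by blast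
    have "N (conv c c') = N (\<lambda>k. \<Sum>x\<in>S. a x * conv (U x) c' k)"
    proof (rule N_cong)
      fix k assume k: "k \<in> I"
      obtain \<sigma> i j where k': "k = (\<sigma>, i, j)" by (cases k)
      have ks: "(\<sigma>, i, l) \<in> I" if "l < d \<sigma>" for l using k that unfolding k' I_def by auto
      have "conv c c' k = (\<Sum>l<d \<sigma>. (\<Sum>x\<in>S. a x * U x (\<sigma>, i, l)) * c' (\<sigma>, l, j))"
        unfolding conv_def k' using S(4) ks by simp
      also have "\<dots> = (\<Sum>l<d \<sigma>. \<Sum>x\<in>S. a x * (U x (\<sigma>, i, l) * c' (\<sigma>, l, j)))"
        by (simp only: sum_distrib_right mult.assoc)
      also have "\<dots> = (\<Sum>x\<in>S. a x * conv (U x) c' k)"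
        unfolding conv_def k' by (subst sum.swap) (simp add: sum_distrib_left)
      finally show "conv c c' k = (\<Sum>x\<in>S. a x * conv (U x) c' k)" .
    qed
    also have "\<dots> \<le> (\<Sum>x\<in>S. norm (a x) * N (conv (U x) c'))" by (rule N_sum)
    also have "\<dots> \<le> (\<Sum>x\<in>S. norm (a x) * N c')"
      using S(2) N_left_mult by (intro sum_mono mult_left_mono) auto
    also have "\<dots> \<le> r * N c'" unfolding sum_distrib_right[symmetric] using S(3) N_nonneg by (intro mult_right_mono) auto
    finally show ?thesis .
  qed
  then have *: "N (conv c c') \<le> s * N c'" if "N c < s" for s using atom_N[OF that] by blast
  show ?thesis
  proof (rule field_le_epsilon)
    fix e :: real assume e: "e > 0"
    have n: "N c' + 1 > 0" using N_nonneg by (simp add: add_nonneg_pos)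
    have "N (conv c c') \<le> (N c + e / (N c' + 1)) * N c'" using e n by (intro *) simp
    also have "\<dots> \<le> N c * N c' + e"
    proof -
      have "(e / (N c' + 1)) * N c' \<le> (e / (N c' + 1)) * (N c' + 1)" using e n by (intro mult_left_mono) auto
      then show ?thesis using n by (simp add: distrib_right)
    qed
    finally show "N (conv c c') \<le> N c * N c' + e" .
  qed
qed

definition \<nu> where "\<nu> x = N (\<lambda>k. U x k - U \<one> k)"

lemma \<nu>_left: 
  assumes "x \<in> carrier G" "y \<in> carrier G" shows "\<nu> (inv x \<otimes> y) \<le> N (\<lambda>k. U y k - U x k)"
proof -
  have "\<nu> (inv x \<otimes> y) = N (conv (U (inv x)) (\<lambda>k. U y k - U x k))"
    unfolding \<nu>_def
  proof (rule N_cong)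
    fix k assume k: "k \<in> I"
    have "conv (U (inv x)) (\<lambda>k. U y k - U x k) k = conv (U (inv x)) (U y) k - conv (U (inv x)) (U x) k"
      unfolding conv_def by (cases k) (simp add: right_diff_distrib sum_subtractf)
    then show "U (inv x \<otimes> y) k - U \<one> k = conv (U (inv x)) (\<lambda>k. U y k - U x k) k"
      using assms by (simp add: conv_U[OF k])
  qed
  also have "\<dots> \<le> N (\<lambda>k. U y k - U x k)" using assms by (intro N_left_mult) auto
  finally show ?thesis .
qed

lemma \<nu>_inv: assumes "x \<in> carrier G" shows "\<nu> (inv x) = \<nu> x"
proof -
  have "\<nu> (inv x) \<le> \<nu> x" if "x \<in> carrier G" for x
    using \<nu>_left[OF that one_closed] that N_diff_commute[of "U \<one>" "U x"] unfolding \<nu>_def by simp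
  from this[OF assms] this[of "inv x"] show ?thesis using assms by simp
qed

text \<open>Conjugation by y is a left factor \<open>U y\<close> and a right factor
  \<open>U (inv y)\<close>, neither of which increases \<open>N\<close>. This is what makes
  functions of \<open>\<nu>\<close> class functions.\<close>

lemma \<nu>_conj: 
  assumes "x \<in> carrier G" "y \<in> carrier G" shows "\<nu> (y \<otimes> x \<otimes> inv y) \<le> \<nu> x"
proof -
  have "\<nu> (y \<otimes> x \<otimes> inv y) = N (conv (conv (U y) (\<lambda>k. U x k - U \<one> k)) (U (inv y)))"
    unfolding \<nu>_def
  proof (rule N_cong)
    fix k assume k: "k \<in> I"
    obtain \<sigma> i j where k': "k = (\<sigma>, i, j)" by (cases k)
    have ks: "(\<sigma>, i, l) \<in> I" if "l < d \<sigma>" for l using k that unfolding k' I_def by auto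
    have "conv (U y) (\<lambda>k. U x k - U \<one> k) (\<sigma>, i, l) = U (y \<otimes> x) (\<sigma>, i, l) - U y (\<sigma>, i, l)" if "l < d \<sigma>" for l
    proof -
      have "conv (U y) (\<lambda>k. U x k - U \<one> k) (\<sigma>, i, l) = conv (U y) (U x) (\<sigma>, i, l) - conv (U y) (U \<one>) (\<sigma>, i, l)"
        unfolding conv_def by (simp add: right_diff_distrib sum_subtractf)
      then show ?thesis using assms by (simp add: conv_U[OF ks[OF that]])
    qed
    then have "conv (conv (U y) (\<lambda>k. U x k - U \<one> k)) (U (inv y)) k = conv (U (y \<otimes> x)) (U (inv y)) k - conv (U y) (U (inv y)) k"
      unfolding k' conv_def[of _ "U (inv y)"] by (simp add: left_diff_distrib sum_subtractf)
    then show "U (y \<otimes> x \<otimes> inv y) k - U \<one> k = conv (conv (U y) (\<lambda>k. U x k - U \<one> k)) (U (inv y)) k"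
      using assms by (simp add: conv_U[OF k])
  qed
  also have "\<dots> \<le> N (conv (U y) (\<lambda>k. U x k - U \<one> k)) * N (U (inv y))" by (rule N_conv)
  also have "\<dots> \<le> N (\<lambda>k. U x k - U \<one> k) * 1"
    using assms N_nonneg by (intro mult_mono N_left_mult N_U) auto
  finally show ?thesis unfolding \<nu>_def by simp
qed

lemma \<nu>_commute:
  assumes "x \<in> carrier G" "y \<in> carrier G" shows "\<nu> (x \<otimes> y) = \<nu> (y \<otimes> x)"
proof -
  have "\<nu> (x \<otimes> y) \<le> \<nu> (y \<otimes> x)" if "x \<in> carrier G" "y \<in> carrier G" for x y
  proof -
    have "x \<otimes> (y \<otimes> x) \<otimes> inv x = x \<otimes> y" using that by (simp add: m_assoc)
    then show ?thesis using \<nu>_conj[of "y \<otimes> x" x] that by simp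
  qed
  from this[OF assms] this[OF assms(2,1)] show ?thesis by simp
qed

text \<open>\<open>2 - u - u\<^sup>-\<^sup>1 = - (u - 1) (u\<^sup>-\<^sup>1 - 1)\<close>: the source of the quadratic gain.\<close>

lemma N_second_difference:
  assumes x: "x \<in> carrier G" shows "N (\<lambda>k. U \<one> k - (U x k + U (inv x) k) / 2) \<le> (\<nu> x)\<^sup>2 / 2"
proof -
  have "N (\<lambda>k. U \<one> k - (U x k + U (inv x) k) / 2) =
     N (\<lambda>k. (1/2) * conv (\<lambda>k. U x k - U \<one> k) (\<lambda>k. U (inv x) k - U \<one> k) k)"
  proof (rule N_cong)
    fix k assume k: "k \<in> I"
    have "conv (\<lambda>k. U x k - U \<one> k) (\<lambda>k. U (inv x) k - U \<one> k) k =
       conv (U x) (U (inv x)) k - conv (U x) (U \<one>) k - conv (U \<one>) (U (inv x)) k + conv (U \<one>) (U \<one>) k"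
      unfolding conv_def by (cases k) (simp add: algebra_simps sum_subtractf sum.distrib)
    also have "\<dots> = U \<one> k - U x k - U (inv x) k + U \<one> k" using x by (simp add: conv_U[OF k])
    finally have q: "conv (\<lambda>k. U x k - U \<one> k) (\<lambda>k. U (inv x) k - U \<one> k) k = U \<one> k - U x k - U (inv x) k + U \<one> k" .
    show "U \<one> k - (U x k + U (inv x) k) / 2 = (1/2) * conv (\<lambda>k. U x k - U \<one> k) (\<lambda>k. U (inv x) k - U \<one> k) k"
      unfolding q by (simp add: field_simps)
  qed
  also have "\<dots> \<le> norm (1/2 :: complex) * N (conv (\<lambda>k. U x k - U \<one> k) (\<lambda>k. U (inv x) k - U \<one> k))" by (rule N_scale)
  also have "\<dots> \<le> (1/2) * (\<nu> x * \<nu> (inv x))"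
    using N_conv[of "\<lambda>k. U x k - U \<one> k" "\<lambda>k. U (inv x) k - U \<one> k"] unfolding \<nu>_def by simp
  finally show ?thesis using \<nu>_inv[OF x] by (simp add: power2_eq_square)
qed

lemma N_Lipschitz: "\<exists>C\<ge>0. \<forall>c. N c \<le> C * (\<Sum>k\<in>I. norm (c k))"
  using atom_bound N_le by blast

lemma N_abs_diff: "\<bar>N c - N c'\<bar> \<le> N (\<lambda>k. c k - c' k)"
  using N_add[of c' "\<lambda>k. c k - c' k"] N_add[of c "\<lambda>k. c' k - c k"] N_diff_commute[of c c'] by simp

text \<open>An average of vectors inside a ball of \<open>N\<close> stays in the ball. Integrals are
  taken coordinate by coordinate, so this is reduced to finite sums: G is cut into cells on which
  real and imaginary parts of the coordinates of \<open>w\<close> vary by at most \<open>e\<close>,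
  and the integral is compared with a weighted sum over sample points.\<close>

lemma N_integral:
  fixes w :: "'a \<Rightarrow> 'a coords" and h :: "'a \<Rightarrow> real"
  assumes w: "\<And>k. k \<in> I \<Longrightarrow> (\<lambda>x. w x k) \<in> borel_measurable m" "\<And>k x. k \<in> I \<Longrightarrow> norm (w x k) \<le> B"
    and h: "integrable m h" "\<And>x. 0 \<le> h x"
    and r: "\<And>x. x \<in> carrier G \<Longrightarrow> h x \<noteq> 0 \<Longrightarrow> N (w x) \<le> r"
  shows "N (\<lambda>k. LINT x|m. of_real (h x) * w x k) \<le> r * (LINT x|m. h x)"
proof -
  obtain C where C0: "C \<ge> 0" "\<forall>c. N c \<le> C * (\<Sum>k\<in>I. norm (c k))"
    using N_Lipschitz by (elim exE conjE) (rule that)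
  note C = C0(1) spec[OF C0(2)]
  define H where "H = (LINT x|m. h x)"
  have H0: "H \<ge> 0" unfolding H_def by (intro integral_nonneg_AE AE_I2 h(2))
  have main: "N (\<lambda>k. LINT x|m. of_real (h x) * w x k) \<le> r * H + C * (real (card I) * (2 * e * H))" if e: "e > 0" for e
  proof -
    \<comment> \<open>Records the coordinates of \<open>w x\<close> rounded to multiples of
      \<open>e\<close>; boundedness of \<open>w\<close> leaves finitely many cells.\<close>
    define cell where "cell x = (\<lambda>k\<in>I. (\<lfloor>Re (w x k) / e\<rfloor>, \<lfloor>Im (w x k) / e\<rfloor>))" for x
    define M where "M = \<lceil>\<bar>B\<bar> / e\<rceil> + 1"
    define Z where "Z = cell ` space m"
    have fl: "\<lfloor>t / e\<rfloor> \<in> {-M..M}" if "\<bar>t\<bar> \<le> B" for t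
    proof -
      have "\<bar>t / e\<bar> \<le> \<bar>B\<bar> / e" using that e by (simp add: divide_right_mono)
      then have c: "t / e \<le> of_int (M - 1)" "of_int (- (M - 1)) \<le> t / e" unfolding M_def by linarith+
      from floor_mono[OF c(1)] floor_mono[OF c(2)] show ?thesis unfolding floor_of_int by simp
    qed
    have "Z \<subseteq> PiE I (\<lambda>_. {-M..M} \<times> {-M..M})"
    proof
      fix z assume "z \<in> Z"
      then obtain x where z: "z = cell x" unfolding Z_def by blast
      have "(\<lfloor>Re (w x k) / e\<rfloor>, \<lfloor>Im (w x k) / e\<rfloor>) \<in> {-M..M} \<times> {-M..M}" if "k \<in> I" for k
        by (intro SigmaI fl order_trans[OF abs_Re_le_cmod w(2)[OF that]] order_trans[OF abs_Im_le_cmod w(2)[OF that]])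
      then show "z \<in> PiE I (\<lambda>_. {-M..M} \<times> {-M..M})" unfolding z cell_def by (intro restrict_PiE_iff[THEN iffD2]) blast
    qed
    moreover have "finite (PiE I (\<lambda>_. {-M..M} \<times> {-M..M}))" by (intro finite_PiE finite_I) auto
    ultimately have fZ: "finite Z" by (rule finite_subset)
    define A where "A z = {x \<in> space m. cell x = z}" for z
    have A: "A z \<in> sets m" if z: "z \<in> Z" for z
    proof -
      have "A z = {x \<in> space m. \<forall>k\<in>I. \<lfloor>Re (w x k) / e\<rfloor> = fst (z k) \<and> \<lfloor>Im (w x k) / e\<rfloor> = snd (z k)}"
      proof -
        obtain x0 where x0: "z = cell x0" using z unfolding Z_def by blast
        have "cell x = z \<longleftrightarrow> (\<forall>k\<in>I. \<lfloor>Re (w x k) / e\<rfloor> = fst (z k) \<and> \<lfloor>Im (w x k) / e\<rfloor> = snd (z k))" for x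
        proof
          assume "cell x = z"
          then show "\<forall>k\<in>I. \<lfloor>Re (w x k) / e\<rfloor> = fst (z k) \<and> \<lfloor>Im (w x k) / e\<rfloor> = snd (z k)"
            unfolding cell_def by auto
        next
          assume *: "\<forall>k\<in>I. \<lfloor>Re (w x k) / e\<rfloor> = fst (z k) \<and> \<lfloor>Im (w x k) / e\<rfloor> = snd (z k)"
          show "cell x = z"
          proof (rule extensionalityI[of _ I])
            show "cell x \<in> extensional I" "z \<in> extensional I" unfolding x0 cell_def by simp_all
            show "cell x k = z k" if "k \<in> I" for k
              using * that unfolding cell_def by (simp add: prod_eq_iff)
          qed
        qed
        then show ?thesis unfolding A_def by simp
      qed
      also have "\<dots> \<in> sets m"
      proof (rule sets.sets_Collect_finite_All[OF _ finite_I])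
        fix k assume k: "k \<in> I"
        note [measurable] = w(1)[OF k]
        show "{x \<in> space m. \<lfloor>Re (w x k) / e\<rfloor> = fst (z k) \<and> \<lfloor>Im (w x k) / e\<rfloor> = snd (z k)} \<in> sets m" by measurable
      qed
      finally show ?thesis .
    qed
    \<comment> \<open>A sample point at which \<open>h\<close> is nonzero, so that the bound
      \<open>r\<close> applies. A cell without such a point has weight 0, and the choice there is
      immaterial.\<close>
    define p where "p z = (SOME x. x \<in> A z \<and> h x \<noteq> 0)" for z
    have p: "p z \<in> A z \<and> h (p z) \<noteq> 0" if "x \<in> A z" "h x \<noteq> 0" for x z
      unfolding p_def by (rule someI[of _ x]) (use that in auto)
    define g where "g z = (LINT x|m. indicator (A z) x * h x)" for z
    have gi: "integrable m (\<lambda>x. indicat_real (A z) x * h x)" if "z \<in> Z" for z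
      using integrable_mult_indicator[OF A[OF that] h(1)] by simp
    have g0: "g z \<ge> 0" for z unfolding g_def using h(2) by (intro integral_nonneg_AE AE_I2) auto
    have gz: "g z = 0" if "\<not> (\<exists>x\<in>A z. h x \<noteq> 0)" for z
    proof -
      have "(\<lambda>x. indicator (A z) x * h x) = (\<lambda>x. 0)" using that by (auto simp: indicator_def)
      then show ?thesis unfolding g_def by simp
    qed
    have part: "(\<Sum>z\<in>Z. indicat_real (A z) x) = 1" if "x \<in> space m" for x
    proof -
      have "(\<Sum>z\<in>Z. indicat_real (A z) x) = (\<Sum>z\<in>Z. if z = cell x then 1 else 0)"
        using that by (intro sum.cong) (auto simp: A_def indicator_def)
      then show ?thesis using fZ that by (simp add: Z_def)
    qed
    have gsum: "(\<Sum>z\<in>Z. g z) = H"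
    proof -
      have "(\<Sum>z\<in>Z. g z) = (LINT x|m. (\<Sum>z\<in>Z. indicat_real (A z) x * h x))"
        unfolding g_def using gi by (intro Bochner_Integration.integral_sum[symmetric]) auto
      also have "\<dots> = H" unfolding H_def
        by (intro Bochner_Integration.integral_cong refl) (simp add: sum_distrib_right[symmetric] part)
      finally show ?thesis .
    qed
    define v where "v k = (\<Sum>z\<in>Z. of_real (g z) * w (p z) k)" for k
    have Nv: "N v \<le> r * H"
    proof -
      have "N v \<le> (\<Sum>z\<in>Z. norm (complex_of_real (g z)) * N (w (p z)))" unfolding v_def by (rule N_sum)
      also have "\<dots> \<le> (\<Sum>z\<in>Z. g z * r)"
      proof (rule sum_mono)
        fix z show "norm (complex_of_real (g z)) * N (w (p z)) \<le> g z * r"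
        proof (cases "\<exists>x\<in>A z. h x \<noteq> 0")
          case True
          then have "p z \<in> A z" "h (p z) \<noteq> 0" using p by blast+
          then have "N (w (p z)) \<le> r" using r unfolding A_def space_m by blast
          then show ?thesis using g0[of z] by (simp add: mult_left_mono)
        qed (simp add: gz)
      qed
      also have "\<dots> = r * H" unfolding sum_distrib_right[symmetric] gsum by (rule mult.commute)
      finally show ?thesis .
    qed
    \<comment> \<open>Within a cell real and imaginary parts each change by at most
      \<open>e\<close>, which makes \<open>2 * e\<close> for each coordinate.\<close>
    have err: "norm ((LINT x|m. of_real (h x) * w x k) - v k) \<le> 2 * e * H" if k: "k \<in> I" for k
    proof -
      have wi: "integrable m (\<lambda>x. of_real (h x) * w x k)"
      proof (rule Bochner_Integration.integrable_bound[OF integrable_mult_right[OF h(1), of "\<bar>B\<bar>"]])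
        show "(\<lambda>x. of_real (h x) * w x k) \<in> borel_measurable m" using w(1)[OF k] h(1) by measurable
        have "norm (of_real (h x) * w x k) \<le> norm (\<bar>B\<bar> * h x)" for x
          using mult_left_mono[OF order_trans[OF w(2)[OF k] abs_ge_self], of "h x" x] h(2)[of x] by (simp add: norm_mult mult.commute)
        then show "AE x in m. norm (of_real (h x) * w x k) \<le> norm (\<bar>B\<bar> * h x)" by simp
      qed
      have vk: "v k = (LINT x|m. (\<Sum>z\<in>Z. of_real (indicator (A z) x * h x) * w (p z) k))"
      proof -
        have gw: "of_real (g z) * w (p z) k = (LINT x|m. of_real (indicator (A z) x * h x) * w (p z) k)" for z
          unfolding g_def by (simp only: integral_mult_left_zero integral_complex_of_real)
        have "v k = (\<Sum>z\<in>Z. LINT x|m. of_real (indicator (A z) x * h x) * w (p z) k)"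
          unfolding v_def by (intro sum.cong refl gw)
        also have "\<dots> = (LINT x|m. (\<Sum>z\<in>Z. of_real (indicator (A z) x * h x) * w (p z) k))"
          using gi by (intro Bochner_Integration.integral_sum[symmetric] integrable_mult_left integrable_of_real)
        finally show ?thesis .
      qed
      have vi: "integrable m (\<lambda>x. \<Sum>z\<in>Z. of_real (indicat_real (A z) x * h x) * w (p z) k)"
        using gi by (intro Bochner_Integration.integrable_sum integrable_mult_left integrable_of_real) auto
      have "norm ((LINT x|m. of_real (h x) * w x k) - v k) =
         norm (LINT x|m. of_real (h x) * w x k - (\<Sum>z\<in>Z. of_real (indicator (A z) x * h x) * w (p z) k))"
        unfolding vk using wi vi by (subst Bochner_Integration.integral_diff) auto
      also have "\<dots> \<le> (LINT x|m. norm (of_real (h x) * w x k - (\<Sum>z\<in>Z. of_real (indicator (A z) x * h x) * w (p z) k)))"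
        by (rule integral_norm_bound)
      also have "\<dots> \<le> (LINT x|m. 2 * e * h x)"
      proof (rule integral_mono)
        show "integrable m (\<lambda>x. norm (of_real (h x) * w x k - (\<Sum>z\<in>Z. of_real (indicator (A z) x * h x) * w (p z) k)))"
          using wi vi by (intro integrable_norm Bochner_Integration.integrable_diff)
        show "integrable m (\<lambda>x. 2 * e * h x)" using h(1) by simp
        fix x assume x: "x \<in> space m"
        have "(\<Sum>z\<in>Z. of_real (indicator (A z) x * h x) * w (p z) k) = (\<Sum>z\<in>Z. if z = cell x then of_real (h x) * w (p z) k else 0)"
          using x by (intro sum.cong) (auto simp: A_def indicator_def)
        also have "\<dots> = of_real (h x) * w (p (cell x)) k" using fZ x by (simp add: Z_def)
        finally have eq: "of_real (h x) * w x k - (\<Sum>z\<in>Z. of_real (indicator (A z) x * h x) * w (p z) k) =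
           of_real (h x) * (w x k - w (p (cell x)) k)" by (simp add: right_diff_distrib)
        show "norm (of_real (h x) * w x k - (\<Sum>z\<in>Z. of_real (indicator (A z) x * h x) * w (p z) k)) \<le> 2 * e * h x"
        proof (cases "h x = 0")
          case False
          have "x \<in> A (cell x)" using x unfolding A_def by simp
          then have "p (cell x) \<in> A (cell x)" using p False by blast
          then have "cell (p (cell x)) k = cell x k" unfolding A_def by simp
          then have "\<lfloor>Re (w (p (cell x)) k) / e\<rfloor> = \<lfloor>Re (w x k) / e\<rfloor>" "\<lfloor>Im (w (p (cell x)) k) / e\<rfloor> = \<lfloor>Im (w x k) / e\<rfloor>"
            using k unfolding cell_def by auto
          then have "\<bar>Re (w x k) / e - Re (w (p (cell x)) k) / e\<bar> \<le> 1" "\<bar>Im (w x k) / e - Im (w (p (cell x)) k) / e\<bar> \<le> 1"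
            by linarith+
          then have "\<bar>Re (w x k - w (p (cell x)) k)\<bar> \<le> e" "\<bar>Im (w x k - w (p (cell x)) k)\<bar> \<le> e"
            using e by (simp_all add: diff_divide_distrib[symmetric] abs_divide)
          then have "norm (w x k - w (p (cell x)) k) \<le> 2 * e" using cmod_le[of "w x k - w (p (cell x)) k"] by linarith
          then show ?thesis unfolding eq using h(2)[of x] mult_left_mono[of "norm (w x k - w (p (cell x)) k)" "2 * e" "h x"]
            by (simp add: norm_mult mult_ac)
        qed (simp add: eq)
      qed
      also have "\<dots> = 2 * e * H" unfolding H_def by simp
      finally show ?thesis .
    qed
    have "N (\<lambda>k. LINT x|m. of_real (h x) * w x k) \<le> N v + N (\<lambda>k. (LINT x|m. of_real (h x) * w x k) - v k)"
      using N_add[of v "\<lambda>k. (LINT x|m. of_real (h x) * w x k) - v k"] by simp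
    also have "N (\<lambda>k. (LINT x|m. of_real (h x) * w x k) - v k) \<le> C * (\<Sum>k\<in>I. norm ((LINT x|m. of_real (h x) * w x k) - v k))"
      by (rule C)
    also have "\<dots> \<le> C * (real (card I) * (2 * e * H))"
      using C(1) err by (intro mult_left_mono sum_bounded_above) auto
    finally show ?thesis using Nv by simp
  qed
  have "N (\<lambda>k. LINT x|m. of_real (h x) * w x k) \<le> r * H"
  proof (rule field_le_epsilon)
    fix e :: real assume e: "e > 0"
    define D where "D = C * (real (card I) * (2 * H)) + 1"
    have D: "D > 0" unfolding D_def using C(1) H0 by (simp add: add_nonneg_pos)
    have "C * (real (card I) * (2 * (e / D) * H)) = (e / D) * (D - 1)" unfolding D_def by simp
    also have "\<dots> \<le> (e / D) * D" using e D by (intro mult_left_mono) auto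
    finally have "C * (real (card I) * (2 * (e / D) * H)) \<le> e" using D by simp
    then show "N (\<lambda>k. LINT x|m. of_real (h x) * w x k) \<le> r * H + e" using main[of "e / D"] e D by simp
  qed
  then show ?thesis unfolding H_def .
qed

end

section \<open>Norm inequalities and coefficient multipliers\<close>

context haar_group
begin

definition L1 :: "('a \<Rightarrow> complex) \<Rightarrow> real" where "L1 f = (LINT x|m. norm (f x))"

definition n2 :: "('a \<Rightarrow> complex) \<Rightarrow> real" where "n2 f = (LINT x|m. (norm (f x))\<^sup>2)"

lemma L2_n2: "f \<in> CF \<Longrightarrow> L2 f f = of_real (n2 f)"
  unfolding n2_def by (rule L2_self)

lemma n2_nonneg: "0 \<le> n2 f"
  unfolding n2_def by simp

lemma n2_Pythagoras:
  assumes "f \<in> CF" "g \<in> CF" "L2 f g = 0" shows "n2 (f + g) = n2 f + n2 g"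
proof -
  have fg: "f + g \<in> CF" using assms subspace_CF fs.subspace_add by blast
  have gf: "L2 g f = 0" using L2.ip_cnj[OF assms(1,2)] assms(3) by simp
  have "L2 (f + g) (f + g) = L2 f (f + g) + L2 g (f + g)" by (rule L2.ip_add[OF assms(1,2) fg])
  also have "L2 f (f + g) = cnj (L2 (f + g) f)" by (rule L2.ip_cnj[OF fg assms(1)])
  also have "L2 (f + g) f = L2 f f + L2 g f" by (rule L2.ip_add[OF assms(1,2,1)])
  also have "L2 g (f + g) = cnj (L2 (f + g) g)" by (rule L2.ip_cnj[OF fg assms(2)])
  also have "L2 (f + g) g = L2 f g + L2 g g" by (rule L2.ip_add[OF assms(1,2,2)])
  finally have "complex_of_real (n2 (f + g)) = of_real (n2 f + n2 g)"
    using assms gf L2_n2 fg by (simp only:) simp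
  then show ?thesis by (simp only: of_real_eq_iff)
qed

lemma CF_norm_power_integrable: "f \<in> CF \<Longrightarrow> integrable m (\<lambda>x. norm (f x) ^ k)"
proof -
  assume f: "f \<in> CF"
  obtain B where B: "\<And>x. norm (f x) \<le> B" using CF_bounded[OF f] by blast
  show ?thesis
    by (rule integrable_const_bound[where B="B ^ k"])
      (use B CF_measurable[OF f] in \<open>auto intro!: power_mono\<close>)
qed

text \<open>The variance of the modulus of f under the probability measure \<open>m\<close> is
  nonnegative.\<close>

lemma L1_le_n2: assumes f: "f \<in> CF" shows "L1 f \<le> sqrt (n2 f)"
proof -
  have i1: "integrable m (\<lambda>x. norm (f x))" using CF_norm_power_integrable[OF f, of 1] by simp
  have i2: "integrable m (\<lambda>x. (norm (f x))\<^sup>2)" by (rule CF_norm_power_integrable[OF f])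
  have "0 \<le> variance (\<lambda>x. norm (f x))" by (rule variance_positive)
  also have "\<dots> = n2 f - (L1 f)\<^sup>2" unfolding n2_def L1_def by (rule variance_eq[OF i1 i2])
  finally show ?thesis by (intro real_le_rsqrt) simp
qed

lemma L1_triangle: "f \<in> CF \<Longrightarrow> g \<in> CF \<Longrightarrow> L1 (f + g) \<le> L1 f + L1 g"
proof -
  assume fg: "f \<in> CF" "g \<in> CF"
  have fg': "f + g \<in> CF" using fg subspace_CF fs.subspace_add by blast
  note i = CF_norm_power_integrable[of _ 1, simplified]
  have "L1 (f + g) \<le> (LINT x|m. norm (f x) + norm (g x))"
    unfolding L1_def using i[OF fg(1)] i[OF fg(2)] i[OF fg']
    by (intro integral_mono) (auto intro: norm_triangle_ineq)
  also have "\<dots> = L1 f + L1 g" unfolding L1_def using i[OF fg(1)] i[OF fg(2)] by simp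
  finally show ?thesis .
qed

text \<open>Minkowski's inequality for integrals. Measurability is asked for the product
  \<sigma>-algebra, where ordinary Fubini holds; it is met later by writing the kernel as a finite
  sum of products of coefficients.\<close>

lemma L1_average:
  fixes K :: "'a \<Rightarrow> 'a \<Rightarrow> complex" and w :: "'a \<Rightarrow> real"
  assumes K: "(\<lambda>(y, x). K y x) \<in> borel_measurable (m \<Otimes>\<^sub>M m)"
    and B: "\<And>y x. y \<in> carrier G \<Longrightarrow> x \<in> carrier G \<Longrightarrow> norm (K y x) \<le> B"
    and w: "w \<in> borel_measurable m" "\<And>y. 0 \<le> w y" "\<And>y. w y \<le> W" "(LINT y|m. w y) = 1"
    and L: "\<And>y. y \<in> carrier G \<Longrightarrow> (LINT x|m. norm (K y x)) = L"
  shows "(LINT x|m. norm (LINT y|m. of_real (w y) * K y x)) \<le> L"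
proof -
  interpret P: pair_prob_space m m ..
  define F where "F y x = of_real (w y) * K y x" for y x
  have Fm: "case_prod F \<in> borel_measurable (m \<Otimes>\<^sub>M m)"
    unfolding F_def using K w(1) by (simp add: split_beta') 
  have FB: "norm (F y x) \<le> W * B" if "y \<in> carrier G" "x \<in> carrier G" for y x
    unfolding F_def norm_mult using B[OF that] w(2)[of y] w(3)[of y]
    by (intro mult_mono) (auto intro: order_trans[OF norm_ge_zero])
  have Fi: "integrable (m \<Otimes>\<^sub>M m) (case_prod F)"
    by (rule P.P.integrable_const_bound[where B="W * B", OF _ Fm])
      (use FB in \<open>auto simp: space_pair_measure space_m\<close>)
  have Ni: "integrable (m \<Otimes>\<^sub>M m) (\<lambda>(y, x). norm (F y x))"
    using integrable_norm[OF Fi] by (simp add: split_beta')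
  have "(LINT x|m. norm (LINT y|m. F y x)) \<le> (LINT x|m. (LINT y|m. norm (F y x)))"
  proof (rule integral_mono)
    show "integrable m (\<lambda>x. norm (LINT y|m. F y x))" using P.integrable_snd[OF Fi] by (rule integrable_norm)
    show "integrable m (\<lambda>x. LINT y|m. norm (F y x))" using P.integrable_snd[OF Ni] .
  qed (rule integral_norm_bound)
  also have "\<dots> = (LINT y|m. (LINT x|m. norm (F y x)))" by (rule P.Fubini_integral[OF Ni])
  also have "\<dots> = (LINT y|m. w y * L)"
  proof (intro Bochner_Integration.integral_cong refl)
    fix y assume "y \<in> space m"
    then have "(LINT x|m. norm (K y x)) = L" using L space_m by simp
    then show "(LINT x|m. norm (F y x)) = w y * L" unfolding F_def norm_mult using w(2)[of y] by simp
  qed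
  also have "\<dots> = L" using w(4) by simp
  finally show ?thesis unfolding F_def .
qed

end

context dual_group
begin

lemma u_measurable [measurable]: "\<sigma> \<in> \<Sigma> \<Longrightarrow> i < d \<sigma> \<Longrightarrow> j < d \<sigma> \<Longrightarrow> u \<sigma> i j \<in> borel_measurable m"
  by (intro CF_measurable u_CF)

text \<open>The matrix of integrals commutes with the representation, since \<open>m\<close> and
  \<open>h\<close> are invariant under conjugation, and Schur makes it scalar. Evenness of the real
  function \<open>h\<close> makes the scalar real.\<close>

lemma class_function_fourier:
  fixes h :: "'a \<Rightarrow> real"
  assumes h: "(\<lambda>x. complex_of_real (h x)) \<in> CF"
    and comm: "\<And>x y. x \<in> carrier G \<Longrightarrow> y \<in> carrier G \<Longrightarrow> h (x \<otimes> y) = h (y \<otimes> x)"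
    and sym: "\<And>x. x \<in> carrier G \<Longrightarrow> h (inv x) = h x"
    and \<sigma>: "\<sigma> \<in> \<Sigma>"
  shows "\<exists>a::real. \<forall>i<d \<sigma>. \<forall>j<d \<sigma>. (LINT x|m. of_real (h x) * u \<sigma> i j x) = (if i = j then of_real a else 0)"
proof -
  define n where "n = d \<sigma>"
  define h' where "h' = (\<lambda>x. complex_of_real (h x))"
  have hC: "h' \<in> CF" using h unfolding h'_def .
  define b where "b i j = (LINT x|m. h' x * u \<sigma> i j x)" for i j
  define B where "B = mat n n (\<lambda>(i, j). b i j)"
  have B: "B \<in> carrier_mat n n" unfolding B_def by simp
  have hu: "(\<lambda>x. h' x * u \<sigma> i j x) \<in> CF" if "i < n" "j < n" for i j
    using that CF_mult[OF hC u_CF[OF \<sigma>]] unfolding n_def by blast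
  have c: "rep \<sigma> y \<in> carrier_mat n n" if "y \<in> carrier G" for y
    using rep_carrier[OF rep_unitary_rep[OF \<sigma>] that] unfolding n_def .
  have ri: "rep \<sigma> y $$ (i, j) = u \<sigma> i j y" if "y \<in> carrier G" for y i j using that unfolding coef_def by simp
  have comB: "B * rep \<sigma> y = rep \<sigma> y * B" if y: "y \<in> carrier G" for y
  proof (rule eq_matI)
    fix i l assume "i < dim_row (rep \<sigma> y * B)" "l < dim_col (rep \<sigma> y * B)"
    then have il: "i < n" "l < n" using c[OF y] B by auto
    have hm: "h' \<in> borel_measurable m" "u \<sigma> i l \<in> borel_measurable m"
      using CF_measurable[OF hC] u_measurable[OF \<sigma>] il unfolding n_def by auto
    have m1: "(\<lambda>x. h' (x \<otimes> inv y) * u \<sigma> i l x) \<in> borel_measurable m"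
      using measurable_compose[OF measurable_m[OF continuous_right_mult[OF inv_closed[OF y]]] hm(1)] hm(2) by measurable
    have m2: "(\<lambda>x. h' (inv y \<otimes> x) * u \<sigma> i l x) \<in> borel_measurable m"
      using measurable_compose[OF measurable_m[OF continuous_left_mult[OF inv_closed[OF y]]] hm(1)] hm(2) by measurable
    have "(B * rep \<sigma> y) $$ (i, l) = (\<Sum>j<n. B $$ (i, j) * rep \<sigma> y $$ (j, l))"
      by (rule index_mult_mat_sum[OF B c[OF y] il])
    also have "\<dots> = (\<Sum>j<n. LINT x|m. h' x * u \<sigma> i j x * u \<sigma> j l y)"
      using il unfolding B_def by (intro sum.cong) (auto simp: b_def ri[OF y])
    also have "\<dots> = (LINT x|m. (\<Sum>j<n. h' x * u \<sigma> i j x * u \<sigma> j l y))"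
      using CF_integrable[OF hu] il by (intro Bochner_Integration.integral_sum[symmetric]) auto
    also have "\<dots> = (LINT x|m. h' ((x \<otimes> y) \<otimes> inv y) * u \<sigma> i l (x \<otimes> y))"
    proof (intro Bochner_Integration.integral_cong refl)
      fix x assume "x \<in> space m" then have x: "x \<in> carrier G" by (simp add: space_m)
      then have "(x \<otimes> y) \<otimes> inv y = x" using y by (simp add: m_assoc)
      then show "(\<Sum>j<n. h' x * u \<sigma> i j x * u \<sigma> j l y) = h' ((x \<otimes> y) \<otimes> inv y) * u \<sigma> i l (x \<otimes> y)"
        using u_mult[OF \<sigma> _ _ x y] il unfolding n_def by (simp add: sum_distrib_left mult.assoc)
    qed
    also have "\<dots> = (LINT x|m. h' (x \<otimes> inv y) * u \<sigma> i l x)" by (rule integral_right_mult[OF y m1])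
    also have "\<dots> = (LINT x|m. h' (inv y \<otimes> x) * u \<sigma> i l x)"
      using y comm by (intro Bochner_Integration.integral_cong refl) (simp add: space_m h'_def)
    also have "\<dots> = (LINT x|m. h' (inv y \<otimes> (y \<otimes> x)) * u \<sigma> i l (y \<otimes> x))" by (rule integral_left_mult[OF y m2, symmetric])
    also have "\<dots> = (LINT x|m. (\<Sum>j<n. u \<sigma> i j y * (h' x * u \<sigma> j l x)))"
    proof (intro Bochner_Integration.integral_cong refl)
      fix x assume "x \<in> space m" then have x: "x \<in> carrier G" by (simp add: space_m)
      then have "inv y \<otimes> (y \<otimes> x) = x" using y by (simp add: m_assoc[symmetric])
      then show "h' (inv y \<otimes> (y \<otimes> x)) * u \<sigma> i l (y \<otimes> x) = (\<Sum>j<n. u \<sigma> i j y * (h' x * u \<sigma> j l x))"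
        using u_mult[OF \<sigma> _ _ y x] il unfolding n_def by (simp add: sum_distrib_left mult.left_commute)
    qed
    also have "\<dots> = (\<Sum>j<n. LINT x|m. u \<sigma> i j y * (h' x * u \<sigma> j l x))"
      using CF_integrable[OF hu] il by (intro Bochner_Integration.integral_sum) auto
    also have "\<dots> = (\<Sum>j<n. rep \<sigma> y $$ (i, j) * B $$ (j, l))"
      using il unfolding B_def by (intro sum.cong) (auto simp: b_def ri[OF y])
    also have "\<dots> = (rep \<sigma> y * B) $$ (i, l)" by (rule index_mult_mat_sum[OF c[OF y] B il, symmetric])
    finally show "(B * rep \<sigma> y) $$ (i, l) = (rep \<sigma> y * B) $$ (i, l)" .
  next
    show "dim_row (B * rep \<sigma> y) = dim_row (rep \<sigma> y * B)" "dim_col (B * rep \<sigma> y) = dim_col (rep \<sigma> y * B)"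
      using B c[OF y] by auto
  qed
  obtain z where z: "B = z \<cdot>\<^sub>m 1\<^sub>m n"
    using schur_scalar[OF rep_irreps[OF \<sigma>], of B] B comB unfolding n_def by blast
  have bz: "b i j = (if i = j then z else 0)" if "i < n" "j < n" for i j
  proof -
    have "B $$ (i, j) = (z \<cdot>\<^sub>m 1\<^sub>m n) $$ (i, j)" using z by simp
    then show ?thesis unfolding B_def using that by (simp split: if_splits)
  qed
  have n0: "0 < n" using d_pos[OF \<sigma>] unfolding n_def .
  have "b 0 0 = (LINT x|m. h' (inv x) * u \<sigma> 0 0 (inv x))"
    unfolding b_def using CF_measurable[OF hu[OF n0 n0]] by (rule integral_inv[symmetric])
  also have "\<dots> = (LINT x|m. cnj (h' x * u \<sigma> 0 0 x))"
    using sym u_inv[OF \<sigma>, of 0 0] n0 unfolding n_def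
    by (intro Bochner_Integration.integral_cong refl) (simp add: space_m h'_def)
  also have "\<dots> = cnj (b 0 0)" unfolding b_def by (rule Bochner_Integration.integral_cnj)
  finally have "z = cnj z" using bz[OF n0 n0] by simp
  then have "z = of_real (Re z)" by (simp add: complex_eq_iff)
  then show ?thesis using bz unfolding b_def h'_def n_def by (intro exI[of _ "Re z"]) auto
qed

text \<open>Multiplying the coefficients by \<open>a\<close> is convolution with the probability
  density \<open>h\<close>. This is an average of translates of the polynomial, so the L1 norm does
  not grow.\<close>

lemma L1_cpoly_convolution:
  fixes h :: "'a \<Rightarrow> real"
  assumes h: "(\<lambda>x. complex_of_real (h x)) \<in> CF" "\<And>x. 0 \<le> h x" "(LINT x|m. h x) = 1"
    and a: "\<And>\<sigma> i j. \<sigma> \<in> S \<Longrightarrow> i < d \<sigma> \<Longrightarrow> j < d \<sigma> \<Longrightarrow>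
       (LINT x|m. of_real (h x) * u \<sigma> i j x) = (if i = j then of_real (a \<sigma>) else 0)"
    and S: "finite S" "S \<subseteq> \<Sigma>"
  shows "L1 (cpoly S (\<lambda>\<sigma>. of_real (a \<sigma>) * \<beta> \<sigma>)) \<le> L1 (cpoly S \<beta>)"
proof -
  \<comment> \<open>On the group this is \<open>cpoly S \<beta>\<close> at y^-1 x, expanded by
    multiplicativity so that joint measurability in y and x is evident.\<close>
  define K where "K y x = (\<Sum>\<sigma>\<in>S. of_nat (d \<sigma>) * \<beta> \<sigma> * (\<Sum>i<d \<sigma>. \<Sum>k<d \<sigma>. cnj (u \<sigma> k i y) * u \<sigma> k i x))" for y x
  have Ke: "K y x = cpoly S \<beta> (inv y \<otimes> x)" if "y \<in> carrier G" "x \<in> carrier G" for y x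
    unfolding K_def cpoly_def \<chi>_def using that S(2)
    by (intro sum.cong refl arg_cong2[where f="(*)"]) (auto simp: u_mult u_inv)
  have C: "cpoly S \<beta> \<in> CF" by (rule cpoly_CF[OF S(2)])
  obtain B where B: "\<And>x. norm (cpoly S \<beta> x) \<le> B" using CF_bounded[OF C] by blast
  obtain W where W: "\<And>x. norm (complex_of_real (h x)) \<le> W" using CF_bounded[OF h(1)] by blast
  have hm: "h \<in> borel_measurable m"
  proof -
    have "(\<lambda>x. Re (complex_of_real (h x))) \<in> borel_measurable m" using CF_measurable[OF h(1)] by measurable
    then show ?thesis by simp
  qed
  have Km: "(\<lambda>(y, x). K y x) \<in> borel_measurable (m \<Otimes>\<^sub>M m)"
  proof -
    have [measurable]: "u \<sigma> k i \<in> borel_measurable m" if "\<sigma> \<in> S" "k \<in> {..<d \<sigma>}" "i \<in> {..<d \<sigma>}" for \<sigma> k i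
      using that S(2) u_measurable by auto
    show ?thesis unfolding K_def by (simp only: split_beta') measurable
  qed
  have "(LINT x|m. norm (LINT y|m. of_real (h y) * K y x)) \<le> L1 (cpoly S \<beta>)"
  proof (rule L1_average[OF Km _ hm h(2) _ h(3)])
    show "norm (K y x) \<le> B" if "y \<in> carrier G" "x \<in> carrier G" for y x using Ke[OF that] B by simp
    show "h y \<le> W" for y using W[of y] by simp
    show "(LINT x|m. norm (K y x)) = L1 (cpoly S \<beta>)" if y: "y \<in> carrier G" for y
    proof -
      have "(LINT x|m. norm (K y x)) = (LINT x|m. norm (cpoly S \<beta> (inv y \<otimes> x)))"
        using Ke[OF y] by (intro Bochner_Integration.integral_cong) (auto simp: space_m)
      also have "\<dots> = L1 (cpoly S \<beta>)" unfolding L1_def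
        using y CF_measurable[OF C] by (intro integral_left_mult[where f="\<lambda>x. norm (cpoly S \<beta> x)"]) auto
      finally show ?thesis .
    qed
  qed
  also have "(LINT x|m. norm (LINT y|m. of_real (h y) * K y x)) = L1 (cpoly S (\<lambda>\<sigma>. of_real (a \<sigma>) * \<beta> \<sigma>))"
    unfolding L1_def
  proof (intro Bochner_Integration.integral_cong refl arg_cong[where f=norm])
    fix x assume "x \<in> space m"
    have hu: "integrable m (\<lambda>y. of_real (h y) * cnj (u \<sigma> k i y))" if "\<sigma> \<in> S" "k < d \<sigma>" "i < d \<sigma>" for \<sigma> k i
      using that S(2) CF_integrable[OF CF_mult[OF h(1) CF_cnj[OF u_CF]]] by blast
    have ac: "(LINT y|m. of_real (h y) * cnj (u \<sigma> k i y)) = (if k = i then of_real (a \<sigma>) else 0)" if "\<sigma> \<in> S" "k < d \<sigma>" "i < d \<sigma>" for \<sigma> k i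
    proof -
      have "(LINT y|m. of_real (h y) * cnj (u \<sigma> k i y)) = (LINT y|m. cnj (of_real (h y) * u \<sigma> k i y))" by simp
      also have "\<dots> = cnj (LINT y|m. of_real (h y) * u \<sigma> k i y)" by (rule Bochner_Integration.integral_cnj)
      finally show ?thesis using a[OF that] by simp
    qed
    have "(LINT y|m. of_real (h y) * K y x) = (LINT y|m. (\<Sum>\<sigma>\<in>S. \<Sum>i<d \<sigma>. \<Sum>k<d \<sigma>.
        of_real (h y) * cnj (u \<sigma> k i y) * (of_nat (d \<sigma>) * \<beta> \<sigma> * u \<sigma> k i x)))"
      unfolding K_def by (simp add: sum_distrib_left mult_ac)
    also have "\<dots> = (\<Sum>\<sigma>\<in>S. LINT y|m. (\<Sum>i<d \<sigma>. \<Sum>k<d \<sigma>.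
        of_real (h y) * cnj (u \<sigma> k i y) * (of_nat (d \<sigma>) * \<beta> \<sigma> * u \<sigma> k i x)))"
      using hu by (intro Bochner_Integration.integral_sum Bochner_Integration.integrable_sum integrable_mult_left) auto
    also have "\<dots> = (\<Sum>\<sigma>\<in>S. \<Sum>i<d \<sigma>. LINT y|m. (\<Sum>k<d \<sigma>.
        of_real (h y) * cnj (u \<sigma> k i y) * (of_nat (d \<sigma>) * \<beta> \<sigma> * u \<sigma> k i x)))"
      using hu by (intro sum.cong refl Bochner_Integration.integral_sum Bochner_Integration.integrable_sum integrable_mult_left) auto
    also have "\<dots> = (\<Sum>\<sigma>\<in>S. \<Sum>i<d \<sigma>. \<Sum>k<d \<sigma>. LINT y|m.
        of_real (h y) * cnj (u \<sigma> k i y) * (of_nat (d \<sigma>) * \<beta> \<sigma> * u \<sigma> k i x))"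
      using hu by (intro sum.cong refl Bochner_Integration.integral_sum integrable_mult_left) auto
    also have "\<dots> = (\<Sum>\<sigma>\<in>S. \<Sum>i<d \<sigma>. \<Sum>k<d \<sigma>. if k = i then of_real (a \<sigma>) * (of_nat (d \<sigma>) * \<beta> \<sigma> * u \<sigma> i i x) else 0)"
      using ac by (intro sum.cong refl) auto
    also have "\<dots> = cpoly S (\<lambda>\<sigma>. of_real (a \<sigma>) * \<beta> \<sigma>) x"
      unfolding cpoly_def \<chi>_def by (simp add: sum_distrib_left mult_ac)
    finally show "(LINT y|m. of_real (h y) * K y x) = cpoly S (\<lambda>\<sigma>. of_real (a \<sigma>) * \<beta> \<sigma>) x" .
  qed
  finally show ?thesis .
qed

text \<open>\<open>\<chi>(t) \<chi>(x) / d\<close> is the average of \<open>\<chi>(y t y\<^sup>-\<^sup>1 x)\<close> over \<open>y\<close>.\<close>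

lemma L1_cpoly_character:
  assumes S: "finite S" "S \<subseteq> \<Sigma>" and t: "t \<in> carrier G"
  shows "L1 (cpoly S (\<lambda>\<sigma>. \<chi> \<sigma> t / of_nat (d \<sigma>) * \<beta> \<sigma>)) \<le> L1 (cpoly S \<beta>)"
proof -
  \<comment> \<open>Again an expanded form, here of \<open>cpoly S \<beta>\<close> at y t y^-1
    x.\<close>
  define K where "K y x = (\<Sum>\<sigma>\<in>S. of_nat (d \<sigma>) * \<beta> \<sigma> *
     (\<Sum>i<d \<sigma>. \<Sum>j<d \<sigma>. \<Sum>k<d \<sigma>. \<Sum>l<d \<sigma>. u \<sigma> i j y * cnj (u \<sigma> l k y) * (u \<sigma> j k t * u \<sigma> l i x)))" for y x
  have Ke: "K y x = cpoly S \<beta> (y \<otimes> (t \<otimes> (inv y \<otimes> x)))" if "y \<in> carrier G" "x \<in> carrier G" for y x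
    unfolding K_def cpoly_def \<chi>_def
  proof (intro sum.cong refl arg_cong2[where f="(*)"])
    fix \<sigma> i assume "\<sigma> \<in> S" "i \<in> {..<d \<sigma>}"
    then have \<sigma>: "\<sigma> \<in> \<Sigma>" and i: "i < d \<sigma>" using S(2) by auto
    have "u \<sigma> i i (y \<otimes> (t \<otimes> (inv y \<otimes> x))) = (\<Sum>j<d \<sigma>. u \<sigma> i j y * (\<Sum>k<d \<sigma>. u \<sigma> j k t * (\<Sum>l<d \<sigma>. cnj (u \<sigma> l k y) * u \<sigma> l i x)))"
      using that t \<sigma> i by (simp add: u_mult u_inv)
    then show "(\<Sum>j<d \<sigma>. \<Sum>k<d \<sigma>. \<Sum>l<d \<sigma>. u \<sigma> i j y * cnj (u \<sigma> l k y) * (u \<sigma> j k t * u \<sigma> l i x)) =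
       u \<sigma> i i (y \<otimes> (t \<otimes> (inv y \<otimes> x)))"
      by (simp add: sum_distrib_left mult_ac)
  qed
  have C: "cpoly S \<beta> \<in> CF" by (rule cpoly_CF[OF S(2)])
  obtain B where B: "\<And>x. norm (cpoly S \<beta> x) \<le> B" using CF_bounded[OF C] by blast
  have Km: "(\<lambda>(y, x). K y x) \<in> borel_measurable (m \<Otimes>\<^sub>M m)"
  proof -
    have [measurable]: "u \<sigma> k i \<in> borel_measurable m" if "\<sigma> \<in> S" "k \<in> {..<d \<sigma>}" "i \<in> {..<d \<sigma>}" for \<sigma> k i
      using that S(2) u_measurable by auto
    show ?thesis unfolding K_def by (simp only: split_beta') measurable
  qed
  have "(LINT x|m. norm (LINT y|m. of_real 1 * K y x)) \<le> L1 (cpoly S \<beta>)"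
  proof (rule L1_average[OF Km, where W=1])
    show "norm (K y x) \<le> B" if "y \<in> carrier G" "x \<in> carrier G" for y x using Ke[OF that] B by simp
    show "(LINT x|m. norm (K y x)) = L1 (cpoly S \<beta>)" if y: "y \<in> carrier G" for y
    proof -
      have "(LINT x|m. norm (K y x)) = (LINT x|m. norm (cpoly S \<beta> ((y \<otimes> (t \<otimes> inv y)) \<otimes> x)))"
        using Ke[OF y] y t by (intro Bochner_Integration.integral_cong) (auto simp: space_m m_assoc)
      also have "\<dots> = L1 (cpoly S \<beta>)" unfolding L1_def
        using y t CF_measurable[OF C] by (intro integral_left_mult[where f="\<lambda>x. norm (cpoly S \<beta> x)"]) auto
      finally show ?thesis .
    qed
  qed (auto simp: prob_space)
  also have "(LINT x|m. norm (LINT y|m. of_real 1 * K y x)) = L1 (cpoly S (\<lambda>\<sigma>. \<chi> \<sigma> t / of_nat (d \<sigma>) * \<beta> \<sigma>))"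
    unfolding L1_def
  proof (intro Bochner_Integration.integral_cong refl arg_cong[where f=norm])
    fix x assume "x \<in> space m"
    have ii: "integrable m (\<lambda>y. u \<sigma> i j y * cnj (u \<sigma> l k y) * z)"
      if "\<sigma> \<in> S" "i < d \<sigma>" "j < d \<sigma>" "l < d \<sigma>" "k < d \<sigma>" for \<sigma> i j k l z
      using that S(2) L2_integrable[OF u_CF u_CF] by (intro integrable_mult_left) blast
    \<comment> \<open>Orthogonality keeps only the terms with i = l and j = k; what survives are
      diagonal entries at t and at x, which sum up to the two characters.\<close>
    have iv: "(LINT y|m. u \<sigma> i j y * cnj (u \<sigma> l k y) * z) = (if i = l \<and> j = k then z / of_nat (d \<sigma>) else 0)"
      if "\<sigma> \<in> S" "i < d \<sigma>" "j < d \<sigma>" "l < d \<sigma>" "k < d \<sigma>" for \<sigma> i j k l z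
    proof -
      have "(LINT y|m. u \<sigma> i j y * cnj (u \<sigma> l k y) * z) = L2 (u \<sigma> i j) (u \<sigma> l k) * z" unfolding L2_def by simp
      also have "L2 (u \<sigma> i j) (u \<sigma> l k) = (if \<sigma> = \<sigma> \<and> i = l \<and> j = k then 1 / of_nat (d \<sigma>) else 0)"
        using that S(2) by (intro u_orthogonal) auto
      finally have e: "(LINT y|m. u \<sigma> i j y * cnj (u \<sigma> l k y) * z) =
         (if \<sigma> = \<sigma> \<and> i = l \<and> j = k then 1 / of_nat (d \<sigma>) else 0) * z" .
      show ?thesis unfolding e by simp
    qed
    define z where "z \<sigma> i j k l = of_nat (d \<sigma>) * \<beta> \<sigma> * (u \<sigma> j k t * u \<sigma> l i x)" for \<sigma> i j k l
    have "(LINT y|m. of_real 1 * K y x) = (LINT y|m. (\<Sum>\<sigma>\<in>S. \<Sum>i<d \<sigma>. \<Sum>j<d \<sigma>. \<Sum>k<d \<sigma>. \<Sum>l<d \<sigma>.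
        u \<sigma> i j y * cnj (u \<sigma> l k y) * z \<sigma> i j k l))"
      unfolding K_def z_def by (simp add: sum_distrib_left mult_ac)
    also have "\<dots> = (\<Sum>\<sigma>\<in>S. LINT y|m. (\<Sum>i<d \<sigma>. \<Sum>j<d \<sigma>. \<Sum>k<d \<sigma>. \<Sum>l<d \<sigma>.
        u \<sigma> i j y * cnj (u \<sigma> l k y) * z \<sigma> i j k l))"
      using ii by (intro Bochner_Integration.integral_sum Bochner_Integration.integrable_sum) auto
    also have "\<dots> = (\<Sum>\<sigma>\<in>S. \<Sum>i<d \<sigma>. LINT y|m. (\<Sum>j<d \<sigma>. \<Sum>k<d \<sigma>. \<Sum>l<d \<sigma>.
        u \<sigma> i j y * cnj (u \<sigma> l k y) * z \<sigma> i j k l))"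
      using ii by (intro sum.cong refl Bochner_Integration.integral_sum Bochner_Integration.integrable_sum) auto
    also have "\<dots> = (\<Sum>\<sigma>\<in>S. \<Sum>i<d \<sigma>. \<Sum>j<d \<sigma>. LINT y|m. (\<Sum>k<d \<sigma>. \<Sum>l<d \<sigma>.
        u \<sigma> i j y * cnj (u \<sigma> l k y) * z \<sigma> i j k l))"
      using ii by (intro sum.cong refl Bochner_Integration.integral_sum Bochner_Integration.integrable_sum) auto
    also have "\<dots> = (\<Sum>\<sigma>\<in>S. \<Sum>i<d \<sigma>. \<Sum>j<d \<sigma>. \<Sum>k<d \<sigma>. LINT y|m. (\<Sum>l<d \<sigma>.
        u \<sigma> i j y * cnj (u \<sigma> l k y) * z \<sigma> i j k l))"
      using ii by (intro sum.cong refl Bochner_Integration.integral_sum Bochner_Integration.integrable_sum) auto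
    also have "\<dots> = (\<Sum>\<sigma>\<in>S. \<Sum>i<d \<sigma>. \<Sum>j<d \<sigma>. \<Sum>k<d \<sigma>. \<Sum>l<d \<sigma>. LINT y|m.
        u \<sigma> i j y * cnj (u \<sigma> l k y) * z \<sigma> i j k l)"
      using ii by (intro sum.cong refl Bochner_Integration.integral_sum) auto
    also have "\<dots> = (\<Sum>\<sigma>\<in>S. \<Sum>i<d \<sigma>. \<Sum>j<d \<sigma>. \<Sum>k<d \<sigma>. \<Sum>l<d \<sigma>.
        if l = i then (if k = j then z \<sigma> i j j i / of_nat (d \<sigma>) else 0) else 0)"
      using iv by (intro sum.cong refl) auto
    also have "\<dots> = (\<Sum>\<sigma>\<in>S. \<Sum>i<d \<sigma>. \<Sum>j<d \<sigma>. z \<sigma> i j j i / of_nat (d \<sigma>))" by simp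
    also have "\<dots> = (\<Sum>\<sigma>\<in>S. \<Sum>j<d \<sigma>. \<Sum>i<d \<sigma>. z \<sigma> i j j i / of_nat (d \<sigma>))"
      by (intro sum.cong refl sum.swap)
    also have "\<dots> = cpoly S (\<lambda>\<sigma>. \<chi> \<sigma> t / of_nat (d \<sigma>) * \<beta> \<sigma>) x"
      unfolding cpoly_def \<chi>_def z_def
      by (simp add: sum_distrib_left sum_distrib_right sum_divide_distrib mult_ac)
    finally show "(LINT y|m. of_real 1 * K y x) = cpoly S (\<lambda>\<sigma>. \<chi> \<sigma> t / of_nat (d \<sigma>) * \<beta> \<sigma>) x" .
  qed
  finally show ?thesis .
qed

end

section \<open>A bump function near the identity\<close>

context spectral_set
begin

text \<open>The packing bound limits the size of a \<delta>-separated set of points. For a largest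
  one the translates of \<open>{\<nu> \<le> \<delta>}\<close> by its points cover the group, and
  invariance of \<open>m\<close> turns the covering into a lower bound for the measure.\<close>

lemma measure_near_identity:
  assumes \<delta>: "0 < \<delta>" "\<delta> \<le> 1" and q: "5 / \<delta> \<le> real q"
    and V: "{x \<in> carrier G. \<nu> x \<le> \<delta>} \<in> sets m"
  shows "1 \<le> real (2 * q ^ (2 * card I)) * measure m {x \<in> carrier G. \<nu> x \<le> \<delta>}"
proof -
  define M where "M = 2 * q ^ (2 * card I)"
  define V where "V = {x \<in> carrier G. \<nu> x \<le> \<delta>}"
  obtain C where C: "C \<ge> 0" "\<forall>c. N c \<le> C * (\<Sum>k\<in>I. norm (c k))"
    using N_Lipschitz by (elim exE conjE) (rule that)
  define P where "P Y \<longleftrightarrow> finite Y \<and> Y \<subseteq> carrier G \<and>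
     (\<forall>y\<in>Y. \<forall>z\<in>Y. y \<noteq> z \<longrightarrow> N (\<lambda>k. U y k - U z k) \<ge> \<delta>)" for Y
  have bound: "card Y \<le> M" if Y: "P Y" for Y
    unfolding M_def
  proof (rule packing_bound[where N=N and u=U and C=C and \<delta>=\<delta>, OF finite_I])
    show "N (\<lambda>i. complex_of_real t * c i) \<le> \<bar>t\<bar> * N c" for t c using N_scale[of "of_real t" c] by simp
    show "N (U y) \<le> 1" if "y \<in> Y" for y using that Y N_U unfolding P_def by blast
    show "\<delta> \<le> N (\<lambda>i. U y i - U z i)" if "y \<in> Y" "z \<in> Y" "y \<noteq> z" for y z using that Y unfolding P_def by blast
    show "finite Y" using Y unfolding P_def by blast
  qed (use N_add N_coord C \<delta> q in simp_all)
  have P0: "P {}" unfolding P_def by simp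
  obtain Y where Y: "P Y" "\<And>Y'. P Y' \<Longrightarrow> card Y' \<le> card Y"
    using ex_has_greatest_nat[of P "{}" card "Suc M"] P0 bound by (auto simp: less_Suc_eq_le)
  have Y': "finite Y" "Y \<subseteq> carrier G" using Y(1) unfolding P_def by auto
  \<comment> \<open>A point at distance at least \<delta> from all of \<open>Y\<close> could be
    added to \<open>Y\<close>, against the choice of \<open>Y\<close> as largest.\<close>
  have near: "\<exists>y\<in>Y. N (\<lambda>k. U x k - U y k) < \<delta>" if x: "x \<in> carrier G" for x
  proof (rule ccontr)
    assume "\<not> ?thesis"
    then have far: "N (\<lambda>k. U x k - U y k) \<ge> \<delta>" if "y \<in> Y" for y using that by (simp add: not_less)
    then have far': "N (\<lambda>k. U y k - U x k) \<ge> \<delta>" if "y \<in> Y" for y using that by (subst N_diff_commute)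
    have "x \<notin> Y"
    proof
      assume "x \<in> Y"
      from far[OF this] have "\<delta> \<le> 0" using N_zero by simp
      then show False using \<delta> by simp
    qed
    moreover have "P (insert x Y)" using Y(1) far far' x unfolding P_def by auto
    ultimately show False using Y(2)[of "insert x Y"] Y' by simp
  qed
  have VY: "left_div (inv y) V \<in> sets m" "measure m (left_div (inv y) V) = measure m V" if "y \<in> Y" for y
  proof -
    have y: "inv y \<in> carrier G" and Vb: "V \<in> borel_sets T" using that Y' V sets_m unfolding V_def by auto
    show "left_div (inv y) V \<in> sets m" using left_div_borel[OF y Vb] sets_m by simp
    show "measure m (left_div (inv y) V) = measure m V" using emeasure_left_div[OF y Vb] by (simp add: measure_def)
  qed
  have "space m \<subseteq> (\<Union>y\<in>Y. left_div (inv y) V)"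
  proof
    fix x assume "x \<in> space m"
    then have x: "x \<in> carrier G" using space_m by simp
    then obtain y where y: "y \<in> Y" "N (\<lambda>k. U x k - U y k) < \<delta>" using near by blast
    then have "y \<in> carrier G" using Y' by blast
    then have "\<nu> (inv y \<otimes> x) \<le> \<delta>" using \<nu>_left[of y x] x y(2) by simp
    then have "x \<in> left_div (inv y) V" using x \<open>y \<in> carrier G\<close> unfolding left_div_def V_def by simp
    then show "x \<in> (\<Union>y\<in>Y. left_div (inv y) V)" using y(1) by blast
  qed
  then have "measure m (space m) \<le> measure m (\<Union>y\<in>Y. left_div (inv y) V)"
    using VY Y' by (intro finite_measure_mono) auto
  also have "\<dots> \<le> (\<Sum>y\<in>Y. measure m (left_div (inv y) V))"
    using VY Y' by (intro finite_measure_subadditive_finite) auto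
  also have "\<dots> = real (card Y) * measure m V" using VY by simp
  also have "\<dots> \<le> real M * measure m V" using bound[OF Y(1)] by (intro mult_right_mono) auto
  finally show ?thesis unfolding M_def V_def prob_space .
qed

text \<open>On the group \<open>h\<close> is a function of \<open>\<nu>\<close> alone and inherits
  invariance and evenness from it. For the bound on \<open>n2\<close>: values in [0, 1] have squares
  below themselves, so after division by the integral Z the square integral is at most 1 / Z, and Z
  is at least the measure of \<open>{\<nu> \<le> \<delta>}\<close>. The last conclusion gives for
  this one function what Peter-Weyl gives in general.\<close>

lemma bump_function:
  assumes \<delta>: "0 < \<delta>" "\<delta> \<le> 1" and q: "5 / \<delta> \<le> real q"
  shows "\<exists>h. (\<lambda>x. complex_of_real (h x)) \<in> CF \<and> (\<forall>x. 0 \<le> h x) \<and> (LINT x|m. h x) = 1 \<and>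
      (\<forall>x\<in>carrier G. h x \<noteq> 0 \<longrightarrow> \<nu> x \<le> 2 * \<delta>) \<and>
      (\<forall>x\<in>carrier G. \<forall>y\<in>carrier G. h (x \<otimes> y) = h (y \<otimes> x)) \<and>
      (\<forall>x\<in>carrier G. h (inv x) = h x) \<and> n2 (\<lambda>x. complex_of_real (h x)) \<le> real (2 * q ^ (2 * card I)) \<and>
      (\<forall>e>0. \<exists>p\<in>trig_polys. \<forall>x\<in>carrier G. norm (complex_of_real (h x) - p x) < e)"
proof -
  \<comment> \<open>A plateau on the ball whose measure is known, support in the ball of twice the
    radius, and a Lipschitz slope as the approximation lemma demands.\<close>
  define \<phi> where "\<phi> t = max 0 (min 1 (2 - t / \<delta>))" for t :: real
  have \<phi>lip: "\<bar>\<phi> s - \<phi> t\<bar> \<le> (1 / \<delta>) * \<bar>s - t\<bar>" for s t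
  proof -
    have "\<bar>\<phi> s - \<phi> t\<bar> \<le> \<bar>s / \<delta> - t / \<delta>\<bar>" unfolding \<phi>_def by linarith
    also have "\<dots> = (1 / \<delta>) * \<bar>s - t\<bar>" using \<delta> by (simp add: diff_divide_distrib[symmetric])
    finally show ?thesis .
  qed
  \<comment> \<open>The approximation lemma takes coordinates numbered by natural numbers, so
    \<open>I\<close> is enumerated, by \<open>f\<close> with inverse \<open>g\<close>.\<close>
  define n where "n = card I"
  obtain f where f: "bij_betw f {..<n} I"
    using ex_bij_betw_nat_finite[OF finite_I] unfolding n_def lessThan_atLeast0 by blast
  define g where "g = inv_into {..<n} f"
  have fg: "f (g k) = k" if "k \<in> I" for k
    unfolding g_def using f that by (intro f_inv_into_f) (auto simp: bij_betw_def)
  have gb: "bij_betw g I {..<n}" unfolding g_def by (rule bij_betw_inv_into[OF f])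
  obtain C where C: "C \<ge> 0" "\<forall>c. N c \<le> C * (\<Sum>k\<in>I. norm (c k))"
    using N_Lipschitz by (elim exE conjE) (rule that)
  define H where "H c = \<phi> (N (\<lambda>k. c (g k) - U \<one> k))" for c :: "nat \<Rightarrow> complex"
  define w where "w i x = U x (f i)" for i x
  have Hw: "H (\<lambda>i. w i x) = \<phi> (\<nu> x)" for x
  proof -
    have "N (\<lambda>k. w (g k) x - U \<one> k) = \<nu> x" unfolding \<nu>_def w_def by (rule N_cong) (simp add: fg)
    then show ?thesis unfolding H_def by simp
  qed
  have Hlip: "\<bar>H c - H c'\<bar> \<le> (C / \<delta>) * (\<Sum>k<n. norm (c k - c' k))" for c c'
  proof -
    have "\<bar>H c - H c'\<bar> \<le> (1 / \<delta>) * \<bar>N (\<lambda>k. c (g k) - U \<one> k) - N (\<lambda>k. c' (g k) - U \<one> k)\<bar>"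
      unfolding H_def by (rule \<phi>lip)
    also have "\<dots> \<le> (1 / \<delta>) * (C * (\<Sum>k\<in>I. norm (c (g k) - c' (g k))))"
    proof (rule mult_left_mono)
      have "\<bar>N (\<lambda>k. c (g k) - U \<one> k) - N (\<lambda>k. c' (g k) - U \<one> k)\<bar> \<le> N (\<lambda>k. c (g k) - c' (g k))"
        using N_abs_diff[of "\<lambda>k. c (g k) - U \<one> k" "\<lambda>k. c' (g k) - U \<one> k"] by simp
      also have "\<dots> \<le> C * (\<Sum>k\<in>I. norm (c (g k) - c' (g k)))" by (rule spec[OF C(2)])
      finally show "\<bar>N (\<lambda>k. c (g k) - U \<one> k) - N (\<lambda>k. c' (g k) - U \<one> k)\<bar> \<le> C * (\<Sum>k\<in>I. norm (c (g k) - c' (g k)))" .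
    qed (use \<delta> in simp)
    also have "(\<Sum>k\<in>I. norm (c (g k) - c' (g k))) = (\<Sum>k<n. norm (c k - c' k))"
      by (rule sum.reindex_bij_betw[OF gb])
    finally show ?thesis by simp
  qed
  have wr: "representative (w i)" if "i < n" for i
  proof -
    have "f i \<in> I" using f that by (auto simp: bij_betw_def)
    then show ?thesis unfolding w_def by (rule U_representative)
  qed
  have contH: "continuous_map T euclidean (\<lambda>x. \<phi> (\<nu> x))"
  proof -
    have "continuous_map T euclidean (\<lambda>x. H (\<lambda>k. w k x))"
      by (rule Lipschitz_approx_trig_poly(1)[where e=1, OF _ Hlip]) (use wr in simp_all)
    then show ?thesis unfolding Hw .
  qed
  have approxH: "\<exists>p\<in>trig_polys. \<forall>x\<in>carrier G. norm (complex_of_real (\<phi> (\<nu> x)) - p x) < e" if "e > 0" for e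
    using Lipschitz_approx_trig_poly(2)[of n w H "C / \<delta>", OF wr Hlip that] unfolding Hw .
  define h0 where "h0 x = (if x \<in> carrier G then \<phi> (\<nu> x) else 0)" for x
  have h01: "0 \<le> h0 x" "h0 x \<le> 1" for x unfolding h0_def \<phi>_def by auto
  have "continuous_map T euclidean (complex_of_real \<circ> (\<lambda>x. \<phi> (\<nu> x)))"
    by (rule continuous_map_compose[OF contH]) (simp add: continuous_on_of_real continuous_on_id)
  then have h0C: "(\<lambda>x. complex_of_real (h0 x)) \<in> CF"
    by (rule CF_I) (auto simp: h0_def)
  have h0m: "h0 \<in> borel_measurable m"
  proof -
    have "(\<lambda>x. Re (complex_of_real (h0 x))) \<in> borel_measurable m" using CF_measurable[OF h0C] by measurable
    then show ?thesis by simp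
  qed
  have h0i: "integrable m h0" by (rule integrable_const_bound[where B=1]) (use h01 h0m in auto)
  define V where "V = {x \<in> carrier G. \<nu> x \<le> \<delta>}"
  have Veq: "V = {x \<in> space m. h0 x = 1}"
    unfolding V_def space_m h0_def \<phi>_def using \<delta> by (auto simp: max_def min_def field_simps)
  have Vm: "V \<in> sets m" unfolding Veq using h0m by measurable
  define Z where "Z = (LINT x|m. h0 x)"
  define M where "M = real (2 * q ^ (2 * card I))"
  have VZ: "measure m V \<le> Z"
  proof -
    have "measure m V = (LINT x|m. indicator V x)" using Vm by simp
    also have "\<dots> \<le> Z" unfolding Z_def
    proof (rule integral_mono)
      show "integrable m (indicator V :: 'a \<Rightarrow> real)"
        using Vm by (intro integrable_real_indicator) (simp_all add: less_top[symmetric])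
      show "indicator V x \<le> h0 x" if "x \<in> space m" for x
        using h01 that by (simp add: indicator_def Veq)
    qed (rule h0i)
    finally show ?thesis .
  qed
  have MV: "1 \<le> M * measure m V" unfolding M_def V_def
    by (rule measure_near_identity[OF \<delta> q]) (use Vm in \<open>simp add: V_def\<close>)
  have M0: "0 \<le> M" unfolding M_def by simp
  have MZ: "1 \<le> M * Z" using MV mult_left_mono[OF VZ M0] by linarith
  have Z0: "Z > 0"
  proof (rule ccontr)
    assume "\<not> Z > 0"
    then have "M * Z \<le> 0" using M0 by (simp add: mult_nonneg_nonpos)
    then show False using MZ by linarith
  qed
  define h where "h x = h0 x / Z" for x
  have hscale: "(\<lambda>x. complex_of_real (h x)) = fscale (of_real (1 / Z)) (\<lambda>x. complex_of_real (h0 x))"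
    unfolding h_def fscale_def by auto
  show ?thesis
  proof (intro exI[of _ h] conjI allI ballI impI)
    show "(\<lambda>x. complex_of_real (h x)) \<in> CF"
      unfolding hscale by (rule fs.subspace_scale[OF subspace_CF h0C])
    show "0 \<le> h x" for x unfolding h_def using h01 Z0 by simp
    show "(LINT x|m. h x) = 1" unfolding h_def using Z0 by (simp add: Z_def)
    show "\<nu> x \<le> 2 * \<delta>" if "x \<in> carrier G" "h x \<noteq> 0" for x
    proof -
      have "\<phi> (\<nu> x) \<noteq> 0" using that unfolding h_def h0_def by auto
      then have "\<nu> x / \<delta> \<le> 2" unfolding \<phi>_def by (auto simp: max_def min_def split: if_splits)
      then show ?thesis using \<delta> by (simp add: field_simps)
    qed
    show "h (x \<otimes> y) = h (y \<otimes> x)" if "x \<in> carrier G" "y \<in> carrier G" for x y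
      unfolding h_def h0_def using that \<nu>_commute[OF that] by simp
    show "h (inv x) = h x" if "x \<in> carrier G" for x
      unfolding h_def h0_def using that \<nu>_inv[OF that] by simp
    show "n2 (\<lambda>x. complex_of_real (h x)) \<le> real (2 * q ^ (2 * card I))"
    proof -
      have h2i: "integrable m (\<lambda>x. (h0 x)\<^sup>2)"
        by (rule integrable_const_bound[where B=1]) (use h01 h0m in \<open>auto simp: power_le_one\<close>)
      have "n2 (\<lambda>x. complex_of_real (h x)) = (LINT x|m. (h0 x)\<^sup>2 / Z\<^sup>2)"
        unfolding n2_def h_def norm_of_real power2_abs power_divide ..
      also have "\<dots> = (LINT x|m. (h0 x)\<^sup>2) / Z\<^sup>2" by simp
      also have "(LINT x|m. (h0 x)\<^sup>2) \<le> Z" unfolding Z_def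
      proof (rule integral_mono[OF h2i h0i])
        show "(h0 x)\<^sup>2 \<le> h0 x" for x unfolding power2_eq_square using h01[of x] by (simp add: mult_left_le)
      qed
      then have "(LINT x|m. (h0 x)\<^sup>2) / Z\<^sup>2 \<le> Z / Z\<^sup>2" by (intro divide_right_mono) auto
      also have "Z / Z\<^sup>2 = 1 / Z" using Z0 by (simp add: power2_eq_square)
      also have "\<dots> \<le> M" using MZ Z0 by (simp add: field_simps)
      finally show ?thesis unfolding M_def .
    qed
    show "\<exists>p\<in>trig_polys. \<forall>x\<in>carrier G. norm (complex_of_real (h x) - p x) < e" if e: "e > 0" for e
    proof -
      obtain p where p: "p \<in> trig_polys" "\<forall>x\<in>carrier G. norm (complex_of_real (\<phi> (\<nu> x)) - p x) < e * Z"
        using approxH[of "e * Z"] e Z0 by auto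
      have "norm (complex_of_real (h x) - fscale (of_real (1 / Z)) p x) < e" if x: "x \<in> carrier G" for x
      proof -
        have "complex_of_real (h x) - fscale (of_real (1 / Z)) p x = of_real (1 / Z) * (complex_of_real (\<phi> (\<nu> x)) - p x)"
          unfolding h_def h0_def using x by (simp add: diff_divide_distrib)
        then have "norm (complex_of_real (h x) - fscale (of_real (1 / Z)) p x) = (1 / Z) * norm (complex_of_real (\<phi> (\<nu> x)) - p x)"
          using Z0 by (simp only: norm_mult norm_of_real) simp
        also have "\<dots> < (1 / Z) * (e * Z)" using p(2) x Z0 by (intro mult_strict_left_mono) auto
        also have "\<dots> = e" using Z0 by simp
        finally show ?thesis .
      qed
      moreover have "fscale (of_real (1 / Z)) p \<in> trig_polys" using p(1) unfolding trig_polys_def by (rule fs.span_scale)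
      ultimately show ?thesis by blast
    qed
  qed
qed

text \<open>Scalar blocks, the shape of transforms of central functions on \<open>R\<close>. The
  scalars are real because those of an even real class function are.\<close>

definition diag :: "(('a \<Rightarrow> complex mat) set \<Rightarrow> real) \<Rightarrow> 'a coords" where
  "diag g = (\<lambda>(\<sigma>, i, j). if i = j then of_real (g \<sigma>) else 0)"

lemma diag_one: "k \<in> I \<Longrightarrow> U \<one> k = diag (\<lambda>_. 1) k"
  using I_dual unfolding diag_def U_def by (cases k) (auto simp: u_one)

lemma N_diag_mult: "N (diag (\<lambda>\<sigma>. g \<sigma> * g' \<sigma>)) \<le> N (diag g) * N (diag g')"
proof -
  have "N (diag (\<lambda>\<sigma>. g \<sigma> * g' \<sigma>)) = N (conv (diag g) (diag g'))"
  proof (rule N_cong)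
    fix k assume k: "k \<in> I"
    obtain \<sigma> i j where k': "k = (\<sigma>, i, j)" by (cases k)
    have i: "i < d \<sigma>" using k unfolding k' I_def by simp
    have "conv (diag g) (diag g') k = (\<Sum>l<d \<sigma>. if l = i then of_real (g \<sigma>) * (if i = j then of_real (g' \<sigma>) else 0) else 0)"
      unfolding conv_def diag_def k' prod.case by (intro sum.cong) auto
    also have "\<dots> = diag (\<lambda>\<sigma>. g \<sigma> * g' \<sigma>) k" using i unfolding diag_def k' by simp
    finally show "diag (\<lambda>\<sigma>. g \<sigma> * g' \<sigma>) k = conv (diag g) (diag g') k" ..
  qed
  then show ?thesis using N_conv[of "diag g" "diag g'"] by simp
qed

lemma N_diag_add: "N (diag (\<lambda>\<sigma>. g \<sigma> + g' \<sigma>)) \<le> N (diag g) + N (diag g')"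
proof -
  have "diag (\<lambda>\<sigma>. g \<sigma> + g' \<sigma>) = (\<lambda>k. diag g k + diag g' k)" unfolding diag_def by (auto simp: fun_eq_iff)
  then show ?thesis using N_add by simp
qed

lemma N_diag_one: "N (diag (\<lambda>_. 1)) \<le> 1"
  using N_cong[OF diag_one] N_U[OF one_closed] by simp

lemma N_diag_abs: "\<sigma> \<in> R \<Longrightarrow> \<bar>g \<sigma>\<bar> \<le> N (diag g)"
  using N_coord[of "(\<sigma>, 0, 0)" "diag g"] d_pos R_dual unfolding I_def diag_def by (auto simp: subset_iff)

text \<open>1 - a^4 = (1 + a + a^2 + a^3) (1 - a), and by submultiplicativity each of the four terms
  costs at most s.\<close>

lemma N_diag_one_minus_power4:
  assumes a: "N (diag a) \<le> 1" and s: "N (diag (\<lambda>\<sigma>. 1 - a \<sigma>)) \<le> s"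
  shows "N (diag (\<lambda>\<sigma>. 1 - (a \<sigma>) ^ 4)) \<le> 4 * s"
proof -
  define b where "b = (\<lambda>\<sigma>. 1 - a \<sigma>)"
  have step: "N (diag (\<lambda>\<sigma>. a \<sigma> * g \<sigma>)) \<le> s" if "N (diag g) \<le> s" for g
  proof -
    have "N (diag (\<lambda>\<sigma>. a \<sigma> * g \<sigma>)) \<le> N (diag a) * N (diag g)" by (rule N_diag_mult)
    also have "\<dots> \<le> 1 * s" using a that N_nonneg by (intro mult_mono) auto
    finally show ?thesis by simp
  qed
  have b: "N (diag b) \<le> s" using s unfolding b_def .
  have 1: "N (diag (\<lambda>\<sigma>. a \<sigma> * b \<sigma>)) \<le> s" by (rule step[OF b])
  have 2: "N (diag (\<lambda>\<sigma>. a \<sigma> * (a \<sigma> * b \<sigma>))) \<le> s" by (rule step[OF 1])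
  have 3: "N (diag (\<lambda>\<sigma>. a \<sigma> * (a \<sigma> * (a \<sigma> * b \<sigma>)))) \<le> s" by (rule step[OF 2])
  have "(\<lambda>\<sigma>. 1 - (a \<sigma>) ^ 4) = (\<lambda>\<sigma>. (b \<sigma> + a \<sigma> * b \<sigma>) + (a \<sigma> * (a \<sigma> * b \<sigma>) + a \<sigma> * (a \<sigma> * (a \<sigma> * b \<sigma>))))"
    unfolding b_def by (auto simp: fun_eq_iff power4_eq_xxxx algebra_simps)
  then have "N (diag (\<lambda>\<sigma>. 1 - (a \<sigma>) ^ 4)) \<le> N (diag (\<lambda>\<sigma>. b \<sigma> + a \<sigma> * b \<sigma>)) +
      N (diag (\<lambda>\<sigma>. a \<sigma> * (a \<sigma> * b \<sigma>) + a \<sigma> * (a \<sigma> * (a \<sigma> * b \<sigma>))))"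
    using N_diag_add[of "\<lambda>\<sigma>. b \<sigma> + a \<sigma> * b \<sigma>" "\<lambda>\<sigma>. a \<sigma> * (a \<sigma> * b \<sigma>) + a \<sigma> * (a \<sigma> * (a \<sigma> * b \<sigma>))"] by simp
  also have "\<dots> \<le> (s + s) + (s + s)"
    using N_diag_add[of b "\<lambda>\<sigma>. a \<sigma> * b \<sigma>"] N_diag_add[of "\<lambda>\<sigma>. a \<sigma> * (a \<sigma> * b \<sigma>)" "\<lambda>\<sigma>. a \<sigma> * (a \<sigma> * (a \<sigma> * b \<sigma>))"] b 1 2 3
    by linarith
  finally show ?thesis by simp
qed

text \<open>
  If \<open>t b = 1\<close> and \<open>1 - b\<close> is small then \<open>t = 1 + (1 - b) t\<close> bounds the norm of \<open>t\<close>.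
\<close>

lemma N_diag_inverse:
  assumes tb: "\<And>\<sigma>. \<sigma> \<in> R \<Longrightarrow> t \<sigma> * b \<sigma> = 1" and s: "N (diag (\<lambda>\<sigma>. 1 - b \<sigma>)) \<le> s" "s < 1"
  shows "N (diag t) \<le> 1 / (1 - s)"
proof -
  have "N (diag t) = N (diag (\<lambda>\<sigma>. 1 + (1 - b \<sigma>) * t \<sigma>))"
  proof (rule N_cong)
    fix k assume k: "k \<in> I"
    obtain \<sigma> i j where k': "k = (\<sigma>, i, j)" by (cases k)
    have "\<sigma> \<in> R" using k unfolding k' I_def by simp
    then have "t \<sigma> = 1 + (1 - b \<sigma>) * t \<sigma>" using tb[of \<sigma>] by (simp add: algebra_simps)
    then show "diag t k = diag (\<lambda>\<sigma>. 1 + (1 - b \<sigma>) * t \<sigma>) k" unfolding k' diag_def prod.case by (metis)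
  qed
  also have "\<dots> \<le> N (diag (\<lambda>_. 1)) + N (diag (\<lambda>\<sigma>. (1 - b \<sigma>) * t \<sigma>))" by (rule N_diag_add)
  also have "\<dots> \<le> 1 + N (diag (\<lambda>\<sigma>. 1 - b \<sigma>)) * N (diag t)" by (intro add_mono N_diag_one N_diag_mult)
  also have "\<dots> \<le> 1 + s * N (diag t)" using s N_nonneg by (intro add_left_mono mult_right_mono) auto
  finally have "N (diag t) * (1 - s) \<le> 1" by (simp add: algebra_simps)
  then show ?thesis using s by (simp add: field_simps)
qed

text \<open>The measure behind \<open>atom\<close>, averaged over conjugates, acts on central
  polynomials by the multiplier \<open>\<gamma>\<close>, a sum of normalised characters weighted by
  the masses, and enlarges the L1 norm at most by the factor r. On R, taking traces identifies
  \<open>\<gamma>\<close> with \<open>t\<close>; off R nothing is claimed about it.\<close>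

lemma atom_cpoly:
  assumes t: "atom r (diag t)" and S: "finite S" "S \<subseteq> \<Sigma>"
  obtains \<gamma> where "\<And>\<sigma>. \<sigma> \<in> R \<Longrightarrow> \<gamma> \<sigma> = of_real (t \<sigma>)" "L1 (cpoly S (\<lambda>\<sigma>. \<gamma> \<sigma> * \<beta> \<sigma>)) \<le> r * L1 (cpoly S \<beta>)"
proof -
  obtain X c where X: "finite X" "X \<subseteq> carrier G" "(\<Sum>x\<in>X. norm (c x)) \<le> r" "\<forall>k\<in>I. diag t k = (\<Sum>x\<in>X. c x * U x k)"
    using t unfolding atom_def by blast
  define \<gamma> where "\<gamma> \<sigma> = (\<Sum>x\<in>X. c x * (\<chi> \<sigma> x / of_nat (d \<sigma>)))" for \<sigma>
  have 1: "\<gamma> \<sigma> = of_real (t \<sigma>)" if \<sigma>: "\<sigma> \<in> R" for \<sigma>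
  proof -
    have d0: "d \<sigma> > 0" using \<sigma> R_dual d_pos by blast
    have "\<gamma> \<sigma> * of_nat (d \<sigma>) = (\<Sum>x\<in>X. c x * \<chi> \<sigma> x)" unfolding \<gamma>_def using d0 by (simp add: sum_distrib_right)
    also have "\<dots> = (\<Sum>i<d \<sigma>. \<Sum>x\<in>X. c x * U x (\<sigma>, i, i))"
      unfolding \<chi>_def U_def sum_distrib_left prod.case by (rule sum.swap)
    also have "\<dots> = (\<Sum>i<d \<sigma>. diag t (\<sigma>, i, i))"
      using X(4) \<sigma> by (intro sum.cong refl) (simp add: I_def)
    also have "\<dots> = of_nat (d \<sigma>) * of_real (t \<sigma>)" unfolding diag_def by simp
    finally show ?thesis using d0 by simp
  qed
  define F where "F x = cpoly S (\<lambda>\<sigma>. \<chi> \<sigma> x / of_nat (d \<sigma>) * \<beta> \<sigma>)" for x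
  have FC: "F x \<in> CF" for x unfolding F_def by (rule cpoly_CF[OF S(2)])
  have FL: "L1 (F x) \<le> L1 (cpoly S \<beta>)" if "x \<in> X" for x
    unfolding F_def using that X(2) by (intro L1_cpoly_character[OF S]) auto
  have Fi: "integrable m (\<lambda>y. norm (F x y))" for x using CF_integrable[OF FC] by (rule integrable_norm)
  have e: "cpoly S (\<lambda>\<sigma>. \<gamma> \<sigma> * \<beta> \<sigma>) y = (\<Sum>x\<in>X. c x * F x y)" for y
  proof -
    have "(\<Sum>x\<in>X. c x * F x y) = (\<Sum>x\<in>X. \<Sum>\<sigma>\<in>S. c x * (of_nat (d \<sigma>) * (\<chi> \<sigma> x / of_nat (d \<sigma>) * \<beta> \<sigma>) * \<chi> \<sigma> y))"
      unfolding F_def cpoly_def by (simp only: sum_distrib_left)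
    also have "\<dots> = (\<Sum>\<sigma>\<in>S. \<Sum>x\<in>X. c x * (of_nat (d \<sigma>) * (\<chi> \<sigma> x / of_nat (d \<sigma>) * \<beta> \<sigma>) * \<chi> \<sigma> y))" by (rule sum.swap)
    also have "\<dots> = cpoly S (\<lambda>\<sigma>. \<gamma> \<sigma> * \<beta> \<sigma>) y"
      unfolding cpoly_def \<gamma>_def sum_distrib_left sum_distrib_right by (intro sum.cong refl) (simp add: mult_ac)
    finally show ?thesis ..
  qed
  have "L1 (cpoly S (\<lambda>\<sigma>. \<gamma> \<sigma> * \<beta> \<sigma>)) \<le> (LINT y|m. (\<Sum>x\<in>X. norm (c x) * norm (F x y)))"
    unfolding L1_def
  proof (rule integral_mono)
    show "integrable m (\<lambda>y. norm (cpoly S (\<lambda>\<sigma>. \<gamma> \<sigma> * \<beta> \<sigma>) y))"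
      by (rule integrable_norm[OF CF_integrable[OF cpoly_CF[OF S(2)]]])
    show "integrable m (\<lambda>y. \<Sum>x\<in>X. norm (c x) * norm (F x y))" using Fi by simp
    fix y show "norm (cpoly S (\<lambda>\<sigma>. \<gamma> \<sigma> * \<beta> \<sigma>) y) \<le> (\<Sum>x\<in>X. norm (c x) * norm (F x y))"
      unfolding e by (rule order_trans[OF norm_sum]) (simp add: norm_mult)
  qed
  also have "\<dots> = (\<Sum>x\<in>X. norm (c x) * L1 (F x))" unfolding L1_def using Fi by simp
  also have "\<dots> \<le> (\<Sum>x\<in>X. norm (c x) * L1 (cpoly S \<beta>))" using FL by (intro sum_mono mult_left_mono) auto
  also have "\<dots> \<le> r * L1 (cpoly S \<beta>)"
    unfolding sum_distrib_right[symmetric] using X(3) by (intro mult_right_mono) (auto simp: L1_def)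
  finally show ?thesis using that 1 by blast
qed

end

section \<open>The central approximate unit\<close>

context spectral_set
begin

lemma exists_central_function:
  assumes R: "R \<noteq> {}" and \<epsilon>: "0 < \<epsilon>" "\<epsilon> \<le> 1"
  shows "\<exists>f. f \<in> L_infinity m \<and> central_function G T m f \<and>
     (\<forall>\<sigma>\<in>R. fourier G m (rep \<sigma>) f = 1\<^sub>m (d \<sigma>)) \<and> (LINT x|m. norm (f x)) \<le> 1 + \<epsilon> \<and>
     finite (fourier_supp G T m rep f) \<and>
     real (dim_sq_sum G rep (fourier_supp G T m rep f)) \<le> (2304 / \<epsilon>) ^ (2 * dim_sq_sum G rep R)"
proof -
  define v where "v = card I"
  obtain \<sigma>0 where \<sigma>0: "\<sigma>0 \<in> R" using R by blast
  then have "(\<sigma>0, 0, 0) \<in> I" unfolding I_def using d_pos R_dual by auto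
  then have v1: "1 \<le> v" unfolding v_def using finite_I by (metis One_nat_def Suc_leI card_gt_0_iff empty_iff)
  \<comment> \<open>The bump lives where \<open>\<nu> \<le> 2 * \<delta>\<close>, so second
    differences are at most 2 \<delta>^2 = \<epsilon> / 16, and passing to fourth powers makes this
    \<epsilon> / 4.\<close>
  define \<delta> where "\<delta> = sqrt (\<epsilon> / 32)"
  have \<delta>2: "\<delta>\<^sup>2 = \<epsilon> / 32" unfolding \<delta>_def using \<epsilon> by simp
  have \<delta>: "0 < \<delta>" "\<delta> \<le> 1" unfolding \<delta>_def using \<epsilon> by auto
  define q where "q = nat \<lceil>5 / \<delta>\<rceil>"
  have q5: "5 / \<delta> \<le> real q" unfolding q_def by linarith
  have q6: "real q \<le> 6 / \<delta>"
  proof -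
    have "0 \<le> 5 / \<delta>" using \<delta> by simp
    then have "real q \<le> 5 / \<delta> + 1" unfolding q_def by linarith
    moreover have "1 \<le> 1 / \<delta>" using \<delta> by simp
    moreover have "5 / \<delta> + 1 / \<delta> = 6 / \<delta>" by (simp add: add_divide_distrib[symmetric])
    ultimately show ?thesis by linarith
  qed
  define Q where "Q = 2304 / \<epsilon>"
  have Q: "2304 \<le> Q" unfolding Q_def using \<epsilon> by (simp add: field_simps)
  have Qv: "Q \<le> Q ^ v" using power_increasing[of 1 v Q] v1 Q by simp
  define M where "M = real (2 * q ^ (2 * card I))"
  \<comment> \<open>q^2 \<le> 36 * 32 / \<epsilon> = 1152 / \<epsilon>. As v is at least 1, the
    factor 2 of the packing bound is at most 2^v, which doubles 1152 to 2304.\<close>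
  have MQ: "M \<le> Q ^ v"
  proof -
    have "(real q)\<^sup>2 \<le> (6 / \<delta>)\<^sup>2" using q6 by (intro power_mono) auto
    also have "\<dots> = 1152 / \<epsilon>" unfolding power_divide \<delta>2 using \<epsilon> by (simp add: field_simps)
    finally have "((real q)\<^sup>2) ^ v \<le> (1152 / \<epsilon>) ^ v" by (intro power_mono) auto
    moreover have "(2::real) \<le> 2 ^ v" using power_increasing[of 1 v "2::real"] v1 by simp
    ultimately have "2 * ((real q)\<^sup>2) ^ v \<le> 2 ^ v * (1152 / \<epsilon>) ^ v" using \<epsilon> by (intro mult_mono) auto
    also have "\<dots> = Q ^ v" unfolding Q_def power_mult_distrib[symmetric] by simp
    finally show ?thesis unfolding M_def v_def by (simp add: power_mult)
  qed
  obtain h where h0: "(\<lambda>x. complex_of_real (h x)) \<in> CF" "\<forall>x. 0 \<le> h x" "(LINT x|m. h x) = 1"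
    "\<forall>x\<in>carrier G. h x \<noteq> 0 \<longrightarrow> \<nu> x \<le> 2 * \<delta>"
    "\<forall>x\<in>carrier G. \<forall>y\<in>carrier G. h (x \<otimes> y) = h (y \<otimes> x)"
    "\<forall>x\<in>carrier G. h (inv x) = h x" "n2 (\<lambda>x. complex_of_real (h x)) \<le> M"
    "\<forall>e>0. \<exists>p\<in>trig_polys. \<forall>x\<in>carrier G. norm (complex_of_real (h x) - p x) < e"
    using bump_function[OF \<delta> q5, folded M_def] by (elim exE conjE) (rule that)
  have h: "(\<lambda>x. complex_of_real (h x)) \<in> CF" "\<And>x. 0 \<le> h x" "(LINT x|m. h x) = 1"
    "\<And>x. x \<in> carrier G \<Longrightarrow> h x \<noteq> 0 \<Longrightarrow> \<nu> x \<le> 2 * \<delta>"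
    "\<And>x y. x \<in> carrier G \<Longrightarrow> y \<in> carrier G \<Longrightarrow> h (x \<otimes> y) = h (y \<otimes> x)"
    "\<And>x. x \<in> carrier G \<Longrightarrow> h (inv x) = h x"
    "n2 (\<lambda>x. complex_of_real (h x)) \<le> M"
    "\<And>e. e > 0 \<Longrightarrow> \<exists>p\<in>trig_polys. \<forall>x\<in>carrier G. norm (complex_of_real (h x) - p x) < e"
    using h0 by auto
  define h' where "h' = (\<lambda>x. complex_of_real (h x))"
  have h'C: "h' \<in> CF" using h(1) unfolding h'_def .
  have hi: "integrable m h"
  proof -
    have "integrable m (\<lambda>x. Re (h' x))" by (rule integrable_Re[OF CF_integrable[OF h'C]])
    then show ?thesis unfolding h'_def by simp
  qed
  have "\<forall>\<sigma>\<in>\<Sigma>. \<exists>a::real. \<forall>i<d \<sigma>. \<forall>j<d \<sigma>. (LINT x|m. of_real (h x) * u \<sigma> i j x) = (if i = j then of_real a else 0)"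
    using class_function_fourier[OF h(1) h(5) h(6)] by blast
  then obtain a :: "('a \<Rightarrow> complex mat) set \<Rightarrow> real" where a: "\<And>\<sigma> i j. \<sigma> \<in> \<Sigma> \<Longrightarrow> i < d \<sigma> \<Longrightarrow> j < d \<sigma> \<Longrightarrow>
      (LINT x|m. of_real (h x) * u \<sigma> i j x) = (if i = j then of_real (a \<sigma>) else 0)"
    using bchoice[of \<Sigma>] by metis
  have hu: "L2 h' (u \<sigma> i j) = (if i = j then of_real (a \<sigma>) else 0)" if "\<sigma> \<in> \<Sigma>" "i < d \<sigma>" "j < d \<sigma>" for \<sigma> i j
  proof -
    have "L2 h' (u \<sigma> i j) = (LINT x|m. cnj (of_real (h x) * u \<sigma> i j x))" unfolding L2_def h'_def by simp
    also have "\<dots> = cnj (LINT x|m. of_real (h x) * u \<sigma> i j x)" by (rule Bochner_Integration.integral_cnj)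
    finally show ?thesis using a[OF that] by simp
  qed
  \<comment> \<open>Serves to find a finite spectrum. The approximant itself is later replaced by
    the L2 projection of the bump, which has the coefficients \<open>a\<close> and is at least as
    close in L2.\<close>
  obtain f0 where f0: "f0 \<in> trig_polys" "\<And>x. x \<in> carrier G \<Longrightarrow> norm (h' x - f0 x) < 1 / Q"
    using h(8)[of "1 / Q"] Q unfolding h'_def by auto
  obtain S0 where S0: "finite S0" "S0 \<subseteq> \<Sigma>" "f0 \<in> coef_space S0" using trig_poly_finite_support[OF f0(1)] by blast
  define S where "S = S0 \<union> R"
  have S: "finite S" "S \<subseteq> \<Sigma>" "R \<subseteq> S" unfolding S_def using S0 finite_R R_dual by auto
  have f0S: "f0 \<in> coef_space S" using S0(3) coef_space_mono[of S0 S] unfolding S_def by blast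
  have f0C: "f0 \<in> CF" using f0(1) trig_polys_CF by blast
  define \<alpha> where "\<alpha> \<sigma> = complex_of_real (a \<sigma>)" for \<sigma>
  define p where "p = cpoly S \<alpha>"
  have pC: "p \<in> CF" unfolding p_def by (rule cpoly_CF[OF S(2)])
  have pS: "p \<in> coef_space S"
  proof -
    have "\<chi> \<sigma> \<in> coef_space S" if "\<sigma> \<in> S" for \<sigma>
    proof -
      have "\<chi> \<sigma> = (\<Sum>i<d \<sigma>. u \<sigma> i i)" by (auto simp: \<chi>_def fun_eq_iff sum_fun_apply)
      also have "\<dots> \<in> coef_space S" unfolding coef_space_def using that by (intro fs.span_sum fs.span_base) auto
      finally show ?thesis .
    qed
    then show ?thesis unfolding p_def cpoly_eq coef_space_def by (intro fs.span_sum fs.span_scale) 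
  qed
  define D where "D = h' - p"
  have DC: "D \<in> CF" unfolding D_def by (rule fs.subspace_diff[OF subspace_CF h'C pC])
  \<comment> \<open>So \<open>p\<close> is the orthogonal projection of the bump onto the
    coefficients over \<open>S\<close>, and Pythagoras gives both \<open>n2p\<close> and
    \<open>n2D\<close>.\<close>
  have orth: "L2 D g = 0 \<and> g \<in> CF" if g: "g \<in> coef_space S" for g
  proof -
    have "coef_space S \<subseteq> {g \<in> CF. L2 g D = 0}"
      unfolding coef_space_def
    proof (rule fs.span_minimal)
      show "{u \<sigma> a b |\<sigma> a b. \<sigma> \<in> S \<and> a < d \<sigma> \<and> b < d \<sigma>} \<subseteq> {g \<in> CF. L2 g D = 0}"
      proof
        fix g assume "g \<in> {u \<sigma> a b |\<sigma> a b. \<sigma> \<in> S \<and> a < d \<sigma> \<and> b < d \<sigma>}"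
        then obtain \<sigma> i j where g: "g = u \<sigma> i j" "\<sigma> \<in> S" "i < d \<sigma>" "j < d \<sigma>" by blast
        have \<sigma>: "\<sigma> \<in> \<Sigma>" using g(2) S(2) by blast
        have uC: "u \<sigma> i j \<in> CF" by (rule u_CF[OF \<sigma> g(3,4)])
        have "L2 D (u \<sigma> i j) = L2 h' (u \<sigma> i j) - L2 p (u \<sigma> i j)" unfolding D_def by (rule L2.ip_diff[OF h'C pC uC])
        also have "\<dots> = 0" unfolding p_def hu[OF \<sigma> g(3,4)] L2_cpoly_u[OF S(1,2) \<sigma> g(3,4)] using g(2) by (simp add: \<alpha>_def)
        finally show "g \<in> {g \<in> CF. L2 g D = 0}" unfolding g(1) using uC L2.ip_cnj[OF DC uC] by simp
      qed
      show "fs.subspace {g \<in> CF. L2 g D = 0}"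
      proof (rule fs.subspaceI)
        show "0 \<in> {g \<in> CF. L2 g D = 0}" using fs.subspace_0[OF subspace_CF] L2.ip_zero[OF DC] by blast
        show "f + g \<in> {g \<in> CF. L2 g D = 0}" if "f \<in> {g \<in> CF. L2 g D = 0}" "g \<in> {g \<in> CF. L2 g D = 0}" for f g
        proof -
          have fg: "f \<in> CF" "g \<in> CF" "L2 f D = 0" "L2 g D = 0" using that by blast+
          then have "L2 (f + g) D = 0" using L2.ip_add[OF fg(1,2) DC] by (simp only:) simp
          then show ?thesis using fs.subspace_add[OF subspace_CF fg(1,2)] by blast
        qed
        show "fscale c f \<in> {g \<in> CF. L2 g D = 0}" if "f \<in> {g \<in> CF. L2 g D = 0}" for c f
        proof -
          have f: "f \<in> CF" "L2 f D = 0" using that by blast+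
          then have "L2 (fscale c f) D = 0" using L2.ip_scale[OF f(1) DC, of c] by (simp only:) simp
          then show ?thesis using fs.subspace_scale[OF subspace_CF f(1)] by blast
        qed
      qed
    qed
    then have gD: "g \<in> CF" "L2 g D = 0" using g by blast+
    then show ?thesis using L2.ip_cnj[OF gD(1) DC] by simp
  qed
  have n2p: "n2 p \<le> M"
  proof -
    have "n2 h' = n2 (D + p)" unfolding D_def by (rule arg_cong[where f=n2]) auto
    also have "\<dots> = n2 D + n2 p" by (rule n2_Pythagoras[OF DC pC]) (use orth[OF pS] in blast)
    finally show ?thesis using n2_nonneg[of D] h(7) unfolding h'_def by linarith
  qed
  have n2D: "n2 D \<le> (1 / Q)\<^sup>2"
  proof -
    have pf: "p - f0 \<in> coef_space S" using pS f0S unfolding coef_space_def by (rule fs.span_diff)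
    have hf: "h' - f0 \<in> CF" by (rule fs.subspace_diff[OF subspace_CF h'C f0C])
    have "n2 (h' - f0) = n2 (D + (p - f0))" unfolding D_def by (rule arg_cong[where f=n2]) auto
    also have "\<dots> = n2 D + n2 (p - f0)" by (rule n2_Pythagoras[OF DC]) (use orth[OF pf] in blast)+
    finally have "n2 D \<le> n2 (h' - f0)" using n2_nonneg[of "p - f0"] by linarith
    also have "\<dots> \<le> (LINT x|m. (1 / Q)\<^sup>2)"
      unfolding n2_def
    proof (rule integral_mono)
      show "integrable m (\<lambda>x. (norm ((h' - f0) x))\<^sup>2)" by (rule CF_norm_power_integrable[OF hf])
      show "(norm ((h' - f0) x))\<^sup>2 \<le> (1 / Q)\<^sup>2" if "x \<in> space m" for x
        using f0(2)[of x] that by (intro power_mono) (auto simp: space_m)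
    qed simp
    also have "\<dots> = (1 / Q)\<^sup>2" by (simp add: prob_space)
    finally show ?thesis .
  qed
  \<comment> \<open>The bump has L1 norm 1, and on a probability space the L2 norm of the error
    bounds its L1 norm.\<close>
  have L1p: "L1 p \<le> 1 + 1 / Q"
  proof -
    have "p = h' + (p - h')" by auto
    then have "L1 p \<le> L1 h' + L1 (p - h')"
      using L1_triangle[OF h'C fs.subspace_diff[OF subspace_CF pC h'C]] by simp
    also have "L1 (p - h') = L1 D" unfolding L1_def D_def by (simp add: norm_minus_commute)
    also have "L1 D \<le> sqrt (n2 D)" by (rule L1_le_n2[OF DC])
    also have "\<dots> \<le> sqrt ((1 / Q)\<^sup>2)" using n2D by (rule real_sqrt_le_mono)
    also have "\<dots> = 1 / Q" using Q by simp
    also have "L1 h' = 1" unfolding L1_def h'_def using h(2,3) by simp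
    finally show ?thesis by simp
  qed
  \<comment> \<open>Bessel's inequality for the bump, whose square integral is at most
    \<open>M\<close>.\<close>
  have weight: "(\<Sum>\<sigma>\<in>S. (real (d \<sigma>))\<^sup>2 * (a \<sigma>)\<^sup>2) \<le> M"
  proof -
    have "complex_of_real (n2 p) = of_real (\<Sum>\<sigma>\<in>S. (real (d \<sigma>))\<^sup>2 * (norm (\<alpha> \<sigma>))\<^sup>2)"
      using L2_cpoly_cpoly[OF S(1,2)] L2_n2[OF pC] unfolding p_def by simp
    then have "n2 p = (\<Sum>\<sigma>\<in>S. (real (d \<sigma>))\<^sup>2 * (a \<sigma>)\<^sup>2)" unfolding of_real_eq_iff \<alpha>_def by simp
    then show ?thesis using n2p by simp
  qed
  \<comment> \<open>Bracketed as successive multiplications by \<open>\<alpha>\<close>, the form in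
    which \<open>step\<close> is applied three times starting from \<open>p\<close>.\<close>
  define b where "b \<sigma> = \<alpha> \<sigma> * (\<alpha> \<sigma> * (\<alpha> \<sigma> * \<alpha> \<sigma>))" for \<sigma>
  have ba: "b \<sigma> = of_real ((a \<sigma>) ^ 4)" for \<sigma> unfolding b_def \<alpha>_def by (simp add: power4_eq_xxxx mult.assoc)
  have step: "L1 (cpoly S (\<lambda>\<sigma>. \<alpha> \<sigma> * \<beta> \<sigma>)) \<le> L1 (cpoly S \<beta>)" for \<beta>
    unfolding \<alpha>_def using S a by (intro L1_cpoly_convolution[OF h(1,2,3) _ S(1,2)]) auto
  have L1b: "L1 (cpoly S b) \<le> 1 + 1 / Q"
    using step[of "\<lambda>\<sigma>. \<alpha> \<sigma> * (\<alpha> \<sigma> * \<alpha> \<sigma>)"] step[of "\<lambda>\<sigma>. \<alpha> \<sigma> * \<alpha> \<sigma>"] step[of \<alpha>] L1p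
    unfolding p_def b_def by linarith
  \<comment> \<open>The threshold is the reciprocal of the bound \<open>Q ^ v\<close> on the
    weighted sum, so the kept classes have total d^2 at most Q^v times that sum.\<close>
  define \<Lambda> where "\<Lambda> = {\<sigma> \<in> S. 1 / Q ^ v \<le> (a \<sigma>)\<^sup>2}"
  have \<Lambda>: "finite \<Lambda>" "\<Lambda> \<subseteq> \<Sigma>" "\<Lambda> \<subseteq> S" unfolding \<Lambda>_def using S by auto
  have Qv0: "Q ^ v > 0" using Q by simp
  \<comment> \<open>The square of \<open>b\<close> has eight factors a: six are bounded by the
    threshold and give Q^(-3 v), two are left to \<open>weight\<close> and give Q^v. The L2 norm is
    thus at most Q^-v; a product of three factors in place of four would leave only Q^(-v/2), too
    large when v = 1.\<close>
  have tail: "L1 (cpoly (S - \<Lambda>) (\<lambda>\<sigma>. - b \<sigma>)) \<le> 1 / Q"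
  proof -
    have SL: "finite (S - \<Lambda>)" "S - \<Lambda> \<subseteq> \<Sigma>" using S by auto
    have C: "cpoly (S - \<Lambda>) (\<lambda>\<sigma>. - b \<sigma>) \<in> CF" by (rule cpoly_CF[OF SL(2)])
    have "complex_of_real (n2 (cpoly (S - \<Lambda>) (\<lambda>\<sigma>. - b \<sigma>))) = of_real (\<Sum>\<sigma>\<in>S - \<Lambda>. (real (d \<sigma>))\<^sup>2 * (norm (- b \<sigma>))\<^sup>2)"
      using L2_cpoly_cpoly[OF SL] L2_n2[OF C] by simp
    then have "n2 (cpoly (S - \<Lambda>) (\<lambda>\<sigma>. - b \<sigma>)) = (\<Sum>\<sigma>\<in>S - \<Lambda>. (real (d \<sigma>))\<^sup>2 * (norm (- b \<sigma>))\<^sup>2)"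
      by (simp only: of_real_eq_iff)
    also have "\<dots> \<le> (\<Sum>\<sigma>\<in>S - \<Lambda>. (1 / Q ^ v) ^ 3 * ((real (d \<sigma>))\<^sup>2 * (a \<sigma>)\<^sup>2))"
    proof (rule sum_mono)
      fix \<sigma> assume "\<sigma> \<in> S - \<Lambda>"
      then have "(a \<sigma>)\<^sup>2 \<le> 1 / Q ^ v" unfolding \<Lambda>_def by auto
      then have "((a \<sigma>)\<^sup>2) ^ 3 * (a \<sigma>)\<^sup>2 \<le> (1 / Q ^ v) ^ 3 * (a \<sigma>)\<^sup>2" by (intro mult_right_mono power_mono) auto
      moreover have "(norm (- b \<sigma>))\<^sup>2 = ((a \<sigma>)\<^sup>2) ^ 3 * (a \<sigma>)\<^sup>2"
        unfolding ba norm_minus_cancel norm_of_real power2_abs power_mult[symmetric] power_add[symmetric] by simp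
      ultimately have "(real (d \<sigma>))\<^sup>2 * (norm (- b \<sigma>))\<^sup>2 \<le> (real (d \<sigma>))\<^sup>2 * ((1 / Q ^ v) ^ 3 * (a \<sigma>)\<^sup>2)"
        by (intro mult_left_mono) auto
      then show "(real (d \<sigma>))\<^sup>2 * (norm (- b \<sigma>))\<^sup>2 \<le> (1 / Q ^ v) ^ 3 * ((real (d \<sigma>))\<^sup>2 * (a \<sigma>)\<^sup>2)"
        by (simp add: mult.left_commute)
    qed
    also have "\<dots> = (1 / Q ^ v) ^ 3 * (\<Sum>\<sigma>\<in>S - \<Lambda>. (real (d \<sigma>))\<^sup>2 * (a \<sigma>)\<^sup>2)" by (simp only: sum_distrib_left)
    also have "\<dots> \<le> (1 / Q ^ v) ^ 3 * Q ^ v"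
    proof (rule mult_left_mono)
      have "(\<Sum>\<sigma>\<in>S - \<Lambda>. (real (d \<sigma>))\<^sup>2 * (a \<sigma>)\<^sup>2) \<le> (\<Sum>\<sigma>\<in>S. (real (d \<sigma>))\<^sup>2 * (a \<sigma>)\<^sup>2)"
        using S by (intro sum_mono2) auto
      then show "(\<Sum>\<sigma>\<in>S - \<Lambda>. (real (d \<sigma>))\<^sup>2 * (a \<sigma>)\<^sup>2) \<le> Q ^ v" using weight MQ by linarith
    qed (use Qv0 in simp)
    also have "\<dots> = (1 / Q ^ v)\<^sup>2" using Qv0 by (simp add: power2_eq_square power3_eq_cube)
    finally have "sqrt (n2 (cpoly (S - \<Lambda>) (\<lambda>\<sigma>. - b \<sigma>))) \<le> 1 / Q ^ v"
      using Qv0 by (intro real_le_lsqrt n2_nonneg) auto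
    moreover have "1 / Q ^ v \<le> 1 / Q" using Qv Q by (intro divide_left_mono) auto
    ultimately show ?thesis using L1_le_n2[OF C] by linarith
  qed
  have L1\<Lambda>: "L1 (cpoly \<Lambda> b) \<le> 1 + 2 / Q"
  proof -
    have "cpoly \<Lambda> b = cpoly S b + cpoly (S - \<Lambda>) (\<lambda>\<sigma>. - b \<sigma>)"
    proof
      fix x
      have "cpoly S b x = cpoly (S - \<Lambda>) b x + cpoly \<Lambda> b x"
        unfolding cpoly_def by (rule sum.subset_diff[OF \<Lambda>(3) S(1)])
      moreover have "cpoly (S - \<Lambda>) (\<lambda>\<sigma>. - b \<sigma>) x = - cpoly (S - \<Lambda>) b x"
        unfolding cpoly_def by (simp add: sum_negf)
      ultimately show "cpoly \<Lambda> b x = (cpoly S b + cpoly (S - \<Lambda>) (\<lambda>\<sigma>. - b \<sigma>)) x" by simp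
    qed
    moreover have "cpoly S b \<in> CF" "cpoly (S - \<Lambda>) (\<lambda>\<sigma>. - b \<sigma>) \<in> CF" using S by (auto intro!: cpoly_CF)
    ultimately have "L1 (cpoly \<Lambda> b) \<le> L1 (cpoly S b) + L1 (cpoly (S - \<Lambda>) (\<lambda>\<sigma>. - b \<sigma>))"
      using L1_triangle by simp
    then show ?thesis using L1b tail by simp
  qed
  have aU: "(LINT x|m. of_real (h x) * U x k) = diag a k" if k: "k \<in> I" for k
    using a I_dual k unfolding U_def diag_def by (cases k) auto
  have Um: "(\<lambda>x. U x k) \<in> borel_measurable m" if "k \<in> I" for k by (rule CF_measurable[OF U_CF[OF that]])
  have Uim: "(\<lambda>x. U (inv x) k) \<in> borel_measurable m" if "k \<in> I" for k
    using measurable_compose[OF measurable_m[OF continuous_inv] Um[OF that]] .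
  have Na: "N (diag a) \<le> 1"
  proof -
    have "N (\<lambda>k. LINT x|m. of_real (h x) * U x k) \<le> 1 * (LINT x|m. h x)"
      by (rule N_integral[where B=1]) (use Um U_norm hi h(2) N_U in auto)
    then show ?thesis using N_cong[OF aU] h(3) by simp
  qed
  \<comment> \<open>Evenness of \<open>h\<close> allows \<open>U x\<close> to be replaced under the
    integral by the mean of \<open>U x\<close> and \<open>U (inv x)\<close>, so the quadratic
    estimate applies instead of the linear one by \<open>\<nu>\<close>.\<close>
  have N1a: "N (diag (\<lambda>\<sigma>. 1 - a \<sigma>)) \<le> \<epsilon> / 16"
  proof -
    define W where "W x k = U \<one> k - (U x k + U (inv x) k) / 2" for x k
    have Wm: "(\<lambda>x. W x k) \<in> borel_measurable m" if "k \<in> I" for k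
      unfolding W_def using Um[OF that] Uim[OF that] by measurable
    have WB: "norm (W x k) \<le> 2" if k: "k \<in> I" for k x
    proof -
      have "norm (W x k) \<le> norm (U \<one> k) + norm ((U x k + U (inv x) k) / 2)" unfolding W_def by (rule norm_triangle_ineq4)
      also have "norm ((U x k + U (inv x) k) / 2) \<le> 1"
        using norm_triangle_ineq[of "U x k" "U (inv x) k"] U_norm[OF k, of x] U_norm[OF k, of "inv x"] by (simp add: norm_divide)
      finally show ?thesis using U_norm[OF k, of \<one>] by simp
    qed
    have NW: "N (\<lambda>k. LINT x|m. of_real (h x) * W x k) \<le> (2 * \<delta>\<^sup>2) * (LINT x|m. h x)"
    proof (rule N_integral[OF Wm WB hi h(2)])
      show "N (W x) \<le> 2 * \<delta>\<^sup>2" if x: "x \<in> carrier G" "h x \<noteq> 0" for x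
      proof -
        have "N (W x) \<le> (\<nu> x)\<^sup>2 / 2" unfolding W_def by (rule N_second_difference[OF x(1)])
        also have "(\<nu> x)\<^sup>2 \<le> (2 * \<delta>)\<^sup>2" using h(4)[OF x] N_nonneg unfolding \<nu>_def by (intro power_mono)
        finally show ?thesis by (simp add: power2_eq_square)
      qed
    qed
    have eq: "(LINT x|m. of_real (h x) * W x k) = diag (\<lambda>\<sigma>. 1 - a \<sigma>) k" if k: "k \<in> I" for k
    proof -
      have hUC: "(\<lambda>x. of_real (h x) * U x k) \<in> CF" using CF_mult[OF h(1) U_CF[OF k]] .
      have i1: "integrable m (\<lambda>x. of_real (h x) * U x k)" by (rule CF_integrable[OF hUC])
      have eqi: "(LINT x|m. of_real (h x) * U (inv x) k) = (LINT x|m. of_real (h (inv x)) * U (inv x) k)"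
        using h(6) by (intro Bochner_Integration.integral_cong) (auto simp: space_m)
      also have "\<dots> = (LINT x|m. of_real (h x) * U x k)"
        by (rule integral_inv[OF CF_measurable[OF hUC]])
      finally have e2: "(LINT x|m. of_real (h x) * U (inv x) k) = diag a k" using aU[OF k] by simp
      have i2: "integrable m (\<lambda>x. of_real (h x) * U (inv x) k)"
      proof (rule Bochner_Integration.integrable_bound[OF hi])
        show "(\<lambda>x. of_real (h x) * U (inv x) k) \<in> borel_measurable m" using Uim[OF k] hi by measurable
        show "AE x in m. norm (of_real (h x) * U (inv x) k) \<le> norm (h x)"
          using U_norm[OF k] by (intro AE_I2) (simp add: norm_mult mult_left_le)
      qed
      have i0: "integrable m (\<lambda>x. of_real (h x) * U \<one> k)" using CF_integrable[OF h(1)] by (rule integrable_mult_left)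
      have "(LINT x|m. of_real (h x) * W x k) =
          (LINT x|m. of_real (h x) * U \<one> k - (of_real (h x) * U x k + of_real (h x) * U (inv x) k) / 2)"
        unfolding W_def by (simp only: right_diff_distrib distrib_left times_divide_eq_right)
      also have "\<dots> = (LINT x|m. of_real (h x) * U \<one> k) - ((LINT x|m. of_real (h x) * U x k) + (LINT x|m. of_real (h x) * U (inv x) k)) / 2"
        unfolding Bochner_Integration.integral_diff[OF i0 integrable_divide_zero[OF Bochner_Integration.integrable_add[OF i1 i2]]]
          integral_divide_zero Bochner_Integration.integral_add[OF i1 i2] ..
      also have "\<dots> = U \<one> k - diag a k" unfolding e2 aU[OF k] integral_mult_left_zero integral_complex_of_real h(3) by simp
      also have "\<dots> = diag (\<lambda>\<sigma>. 1 - a \<sigma>) k" unfolding diag_one[OF k] by (cases k) (simp add: diag_def)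
      finally show ?thesis .
    qed
    have "N (\<lambda>k. LINT x|m. of_real (h x) * W x k) = N (diag (\<lambda>\<sigma>. 1 - a \<sigma>))" by (rule N_cong[OF eq])
    then have "N (diag (\<lambda>\<sigma>. 1 - a \<sigma>)) \<le> 2 * \<delta>\<^sup>2" using NW unfolding h(3) by linarith
    then show ?thesis unfolding \<delta>2 by simp
  qed
  have N4: "N (diag (\<lambda>\<sigma>. 1 - (a \<sigma>) ^ 4)) \<le> \<epsilon> / 4"
    using N_diag_one_minus_power4[OF Na N1a] by simp
  \<comment> \<open>\<open>N\<close> dominates every coordinate, so \<open>a\<close> stays within 1
    / 16 of 1 on \<open>R\<close>: the classes in \<open>R\<close> survive the cut, and division by
    the fourth power is possible.\<close>
  have aR: "15 / 16 \<le> a \<sigma>" if "\<sigma> \<in> R" for \<sigma>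
    using N_diag_abs[OF that, of "\<lambda>\<sigma>. 1 - a \<sigma>"] N1a \<epsilon> by linarith
  have R\<Lambda>: "R \<subseteq> \<Lambda>"
  proof
    fix \<sigma> assume \<sigma>: "\<sigma> \<in> R"
    have "(15 / 16)\<^sup>2 \<le> (a \<sigma>)\<^sup>2" using aR[OF \<sigma>] by (intro power_mono) auto
    moreover have "1 / Q ^ v \<le> 1 / 2304" using Qv Q by (intro divide_left_mono) auto
    ultimately have "1 / Q ^ v \<le> (a \<sigma>)\<^sup>2" by (simp add: power2_eq_square)
    then show "\<sigma> \<in> \<Lambda>" unfolding \<Lambda>_def using \<sigma> S(3) by auto
  qed
  define t where "t \<sigma> = 1 / (a \<sigma>) ^ 4" for \<sigma>
  \<comment> \<open>The infimum in \<open>N\<close> need not be attained; the slack \<epsilon> / 100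
    secures a measure of mass \<open>r\<close>. With 1 / (1 - \<epsilon> / 4) \<le> 1 + \<epsilon> /
    3 it accounts for 103 / 300 = 1 / 3 + 1 / 100 below.\<close>
  define r where "r = 1 / (1 - \<epsilon> / 4) + \<epsilon> / 100"
  have "N (diag t) \<le> 1 / (1 - \<epsilon> / 4)"
    by (rule N_diag_inverse[OF _ N4]) (use aR \<epsilon> in \<open>force simp: t_def\<close>)+
  then have "N (diag t) < r" unfolding r_def using \<epsilon> by simp
  then have at: "atom r (diag t)" by (rule atom_N)
  obtain \<gamma> where \<gamma>: "\<And>\<sigma>. \<sigma> \<in> R \<Longrightarrow> \<gamma> \<sigma> = of_real (t \<sigma>)"
      "L1 (cpoly \<Lambda> (\<lambda>\<sigma>. \<gamma> \<sigma> * b \<sigma>)) \<le> r * L1 (cpoly \<Lambda> b)"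
    using atom_cpoly[OF at \<Lambda>(1,2), of b] by blast
  define f where "f = cpoly \<Lambda> (\<lambda>\<sigma>. \<gamma> \<sigma> * b \<sigma>)"
  have supp: "fourier_supp G T m rep f \<subseteq> \<Lambda>" unfolding f_def by (rule fourier_supp_cpoly[OF \<Lambda>(1,2)])
  have r1: "r \<le> 1 + 103 / 300 * \<epsilon>"
  proof -
    have "1 \<le> (1 + \<epsilon> / 3) * (1 - \<epsilon> / 4)" using \<epsilon> mult_left_mono[OF \<epsilon>(2), of \<epsilon>] by (simp add: algebra_simps)
    then have "1 / (1 - \<epsilon> / 4) \<le> 1 + \<epsilon> / 3" using \<epsilon> by (simp add: divide_le_eq)
    then show ?thesis unfolding r_def by simp
  qed
  \<comment> \<open>The mass \<open>r\<close> times the L1 norm after the cut. Of the excess 2 / Q,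
    one half comes from replacing the bump by its projection and the other from the discarded
    tail.\<close>
  have norm_f: "(LINT x|m. norm (f x)) \<le> 1 + \<epsilon>"
  proof -
    have "(LINT x|m. norm (f x)) \<le> r * L1 (cpoly \<Lambda> b)" using \<gamma>(2) unfolding f_def L1_def .
    also have "\<dots> \<le> (1 + 103 / 300 * \<epsilon>) * (1 + 2 / Q)"
    proof (rule mult_mono[OF r1 L1\<Lambda>])
      show "0 \<le> L1 (cpoly \<Lambda> b)" unfolding L1_def by simp
    qed (use \<epsilon> in simp)
    also have "2 / Q = \<epsilon> / 1152" unfolding Q_def by simp
    also have "(1 + 103 / 300 * \<epsilon>) * (1 + \<epsilon> / 1152) \<le> 1 + \<epsilon>"
    proof -
      have "(1 + 103 / 300 * \<epsilon>) * (1 + \<epsilon> / 1152) = 1 + 103 / 300 * \<epsilon> + \<epsilon> / 1152 + 103 / 345600 * (\<epsilon> * \<epsilon>)"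
        by (simp add: field_simps)
      moreover have "\<epsilon> * \<epsilon> \<le> \<epsilon>" using \<epsilon> by (simp add: mult_left_le)
      ultimately show ?thesis using \<epsilon> by linarith
    qed
    finally show ?thesis .
  qed
  have four: "fourier G m (rep \<sigma>) f = 1\<^sub>m (d \<sigma>)" if \<sigma>: "\<sigma> \<in> R" for \<sigma>
  proof -
    have "\<gamma> \<sigma> * b \<sigma> = of_real (t \<sigma> * (a \<sigma>) ^ 4)" unfolding \<gamma>(1)[OF \<sigma>] ba by simp
    also have "t \<sigma> * (a \<sigma>) ^ 4 = 1" unfolding t_def using aR[OF \<sigma>] by simp
    finally have one: "\<gamma> \<sigma> * b \<sigma> = 1" by simp
    have "fourier G m (rep \<sigma>) f = 1 \<cdot>\<^sub>m 1\<^sub>m (d \<sigma>)"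
      unfolding f_def using fourier_cpoly[OF \<Lambda>(1,2), of \<sigma>] R\<Lambda> R_dual \<sigma> one by (auto simp: subset_iff)
    also have "\<dots> = 1\<^sub>m (d \<sigma>)" by (rule eq_matI) auto
    finally show ?thesis .
  qed
  have count: "real (dim_sq_sum G rep (fourier_supp G T m rep f)) \<le> Q ^ (2 * v)"
  proof -
    have "dim_sq_sum G rep (fourier_supp G T m rep f) \<le> (\<Sum>\<sigma>\<in>\<Lambda>. (d \<sigma>)\<^sup>2)"
      unfolding dim_sq_sum_def using supp \<Lambda>(1) by (intro sum_mono2) auto
    then have "real (dim_sq_sum G rep (fourier_supp G T m rep f)) \<le> (\<Sum>\<sigma>\<in>\<Lambda>. (real (d \<sigma>))\<^sup>2)"
      by (metis (no_types, lifting) of_nat_le_iff of_nat_power of_nat_sum sum.cong)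
    also have "\<dots> \<le> (\<Sum>\<sigma>\<in>\<Lambda>. Q ^ v * ((real (d \<sigma>))\<^sup>2 * (a \<sigma>)\<^sup>2))"
    proof (rule sum_mono)
      fix \<sigma> assume "\<sigma> \<in> \<Lambda>"
      then have "1 \<le> Q ^ v * (a \<sigma>)\<^sup>2" unfolding \<Lambda>_def using Qv0 by (simp add: field_simps)
      then have "(real (d \<sigma>))\<^sup>2 * 1 \<le> (real (d \<sigma>))\<^sup>2 * (Q ^ v * (a \<sigma>)\<^sup>2)" by (intro mult_left_mono) auto
      then show "(real (d \<sigma>))\<^sup>2 \<le> Q ^ v * ((real (d \<sigma>))\<^sup>2 * (a \<sigma>)\<^sup>2)" by (simp add: mult.left_commute)
    qed
    also have "\<dots> = Q ^ v * (\<Sum>\<sigma>\<in>\<Lambda>. (real (d \<sigma>))\<^sup>2 * (a \<sigma>)\<^sup>2)" by (simp only: sum_distrib_left)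
    also have "\<dots> \<le> Q ^ v * Q ^ v"
    proof (rule mult_left_mono)
      have "(\<Sum>\<sigma>\<in>\<Lambda>. (real (d \<sigma>))\<^sup>2 * (a \<sigma>)\<^sup>2) \<le> (\<Sum>\<sigma>\<in>S. (real (d \<sigma>))\<^sup>2 * (a \<sigma>)\<^sup>2)"
        using S \<Lambda> by (intro sum_mono2) auto
      then show "(\<Sum>\<sigma>\<in>\<Lambda>. (real (d \<sigma>))\<^sup>2 * (a \<sigma>)\<^sup>2) \<le> Q ^ v" using weight MQ by linarith
    qed (use Qv0 in simp)
    also have "\<dots> = Q ^ (2 * v)" by (simp add: power_add[symmetric] mult_2)
    finally show ?thesis .
  qed
  show ?thesis
  proof (intro exI[of _ f] conjI ballI)
    show "f \<in> L_infinity m" "central_function G T m f" unfolding f_def by (rule cpoly_central[OF \<Lambda>(1,2)])+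
    show "finite (fourier_supp G T m rep f)" using supp \<Lambda>(1) by (rule finite_subset)
    show "real (dim_sq_sum G rep (fourier_supp G T m rep f)) \<le> (2304 / \<epsilon>) ^ (2 * dim_sq_sum G rep R)"
      using count unfolding Q_def v_def card_I .
  qed (use four norm_f in auto)
qed

end

text \<open>The support contains R, so for nonempty R its v is at least 1 and no power of c /
  \<epsilon> with positive exponent bounds it once \<epsilon> exceeds c;
  \<open>min \<epsilon> 1\<close> keeps the stated bound for \<epsilon> \<le> 1 and continues it by
  its value at 1. Finiteness of the support is asserted separately because \<open>dim_sq_sum\<close>
  of an infinite set is 0.\<close>

theorem theorem2:
  shows "\<exists>c::real. c > 0 \<and>
    (\<forall>(G :: 'a monoid) T m rep R \<epsilon>.
       compact_group G T \<and> normalized_haar G T m \<and>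
       (\<forall>\<sigma>\<in>dual_object G T. rep \<sigma> \<in> \<sigma>) \<and>
       finite R \<and> R \<subseteq> dual_object G T \<and> \<epsilon> > 0 \<longrightarrow>
       (\<exists>f. f \<in> L_infinity m \<and> central_function G T m f \<and>
          (\<forall>\<sigma>\<in>R. fourier G m (rep \<sigma>) f = 1\<^sub>m (rep_dim G (rep \<sigma>))) \<and>
          (LINT x|m. norm (f x)) \<le> 1 + \<epsilon> \<and>
          finite (fourier_supp G T m rep f) \<and>
          real (dim_sq_sum G rep (fourier_supp G T m rep f)) \<le> (c / min \<epsilon> 1) ^ (2 * dim_sq_sum G rep R)))"
proof (intro exI[of _ "2304::real"] conjI allI impI)
  fix G :: "'a monoid" and T m rep R and \<epsilon> :: real
  assume *: "compact_group G T \<and> normalized_haar G T m \<and> (\<forall>\<sigma>\<in>dual_object G T. rep \<sigma> \<in> \<sigma>) \<and>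
       finite R \<and> R \<subseteq> dual_object G T \<and> \<epsilon> > 0"
  then interpret compact_group G T by blast
  interpret spectral_set G T m rep R
    by unfold_locales (use * in auto)
  show "\<exists>f. f \<in> L_infinity m \<and> central_function G T m f \<and>
          (\<forall>\<sigma>\<in>R. fourier G m (rep \<sigma>) f = 1\<^sub>m (rep_dim G (rep \<sigma>))) \<and>
          (LINT x|m. norm (f x)) \<le> 1 + \<epsilon> \<and>
          finite (fourier_supp G T m rep f) \<and>
          real (dim_sq_sum G rep (fourier_supp G T m rep f)) \<le> (2304 / min \<epsilon> 1) ^ (2 * dim_sq_sum G rep R)"
  proof (cases "R = {}")
    case True
    \<comment> \<open>The zero function; the exponent is 0 here and the bound equals 1.\<close>
    define f where "f = cpoly {} (\<lambda>_. 0)"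
    have "fourier_supp G T m rep f = {}" unfolding f_def using fourier_supp_cpoly[of "{}"] by simp
    moreover have "(LINT x|m. norm (f x)) \<le> 1 + \<epsilon>" unfolding f_def cpoly_def using * by simp
    moreover have "f \<in> L_infinity m" "central_function G T m f" unfolding f_def by (rule cpoly_central; simp)+
    ultimately show ?thesis using True by (intro exI[of _ f]) (simp add: dim_sq_sum_def)
  next
    case False
    have "0 < min \<epsilon> 1" "min \<epsilon> 1 \<le> 1" using * by auto
    from exists_central_function[OF False this] obtain f where f: "f \<in> L_infinity m" "central_function G T m f"
      "\<forall>\<sigma>\<in>R. fourier G m (rep \<sigma>) f = 1\<^sub>m (rep_dim G (rep \<sigma>))" "(LINT x|m. norm (f x)) \<le> 1 + min \<epsilon> 1"
      "finite (fourier_supp G T m rep f)"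
      "real (dim_sq_sum G rep (fourier_supp G T m rep f)) \<le> (2304 / min \<epsilon> 1) ^ (2 * dim_sq_sum G rep R)"
      by (elim exE conjE) (rule that)
    have "(LINT x|m. norm (f x)) \<le> 1 + \<epsilon>" using f(4) by linarith
    then show ?thesis using f by blast
  qed
qed simp

end
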